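(* Let $\beta>0$, $\beta'=\beta/2$, and let $\mathrm d\in\mathbb C$ with $\Re\,\mathrm d\ge0$. For each $n$ let $U_n$ be a random matrix with law $\mathrm{CJ}^{(n)}_{\delta(n),\beta}$ where $\delta(n)=\beta'n\,\mathrm d$, and let $\mu^{(n)}_{\mathtt{sp}}=\sum_{k=1}^n\pi^{(n)}_k\delta_{e^{\mathrm i\theta^{(n)}_k}}$ be the spectral measure of $(U_n,e_1)$. Then, as $n\to\infty$, $$\lim\mu^{(n)}_{\mathtt{sp}}=\mu_{\mathrm d}\quad\text{(in probability)},$$ for the weak topology on probability measures on $\mathbb T$.
   Context: $\mathbb D=\{|z|<1\}$, $\mathbb T=\{|z|=1\}$. Weak convergence in probability of random probability measures $\nu_n$ on $\mathbb T$ to a deterministic $\nu$ means: for a distance $d$ metrizing weak convergence (e.g. the Lévy distance), $d(\nu_n,\nu)\to0$ in probability. The measure $\mu_{\mathrm d}$: put $\alpha_{\mathrm d}=-\frac{\bar{\mathrm d}}{1+\bar{\mathrm d}}$, let $\theta_{\mathrm d}\in[0,\pi)$ and $\xi_{\mathrm d}\in[-\theta_{\mathrm d},\theta_{\mathrm d}]$ be such that $\sin\frac{\theta_{\mathrm d}}2=\left|\frac{\mathrm d}{1+\mathrm d}\right|$ and $e^{\mathrm i\xi_{\mathrm d}}=\frac{1+\mathrm d}{1+\bar{\mathrm d}}$. If $\mathrm d\ne0$, $d\mu_{\mathrm d}(\zeta)=w_{\mathrm d}(\theta)\frac{d\theta}{2\pi}$ ($\zeta=e^{\mathrm i\theta}$),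 with $$w_{\mathrm d}(\theta)=\frac{\sqrt{\sin^2((\theta-\xi_{\mathrm d})/2)-\sin^2(\theta_{\mathrm d}/2)}}{|1+\alpha_{\mathrm d}|\sin(\theta/2)}\quad\text{if }\theta\in(\theta_{\mathrm d}+\xi_{\mathrm d},\,2\pi-\theta_{\mathrm d}+\xi_{\mathrm d}),$$ and $w_{\mathrm d}(\theta)=0$ otherwise; $\mu_0$ is the normalized Haar measure on $\mathbb T$. The law $\mathrm{CJ}^{(n)}_{\delta,\beta}$ ($\Re\,\delta>-1/2$): for a probability measure $\mu$ on $\mathbb T$ supported at $n$ points $e^{\mathrm i\theta_j}$, let $\Phi_0,\dots,\Phi_{n-1}$ be its monic orthogonal polynomials, $\Phi_n(z)=\prod_j(z-e^{\mathrm i\theta_j})$, $\Phi_j^*(z)=z^j\overline{\Phi_j(1/\bar z)}$; its Verblunsky coefficients $(\alpha_0,\dots,\alpha_{n-1})\in\mathbb D^{n-1}\times\mathbb T$ are given by $\Phi_{j+1}(z)=z\Phi_j(z)-\bar\alpha_j\Phi_j^*(z)$, and this is a bijection. The GGT matrix $\mathcal G(\alpha_0,\dots,\alpha_{n-1})$ is the matrix of $f(z)\mapsto zf(z)$ on $L^2(\mathbb T,\mu)$ in the basis of orthonormal polynomials $\Phi_j/\|\Phi_j\|$, $0\le j\le n-1$. For $s>1$, $\nu_s$ is the probability measure on $\mathbb D$ with density $\frac{s-1}{2\pi}(1-|z|^2)^{(s-3)/2}$, and $\nu_1$ is uniform on $\mathbb T$. $\mathrm{CJ}^{(n)}_{0,\beta}$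 is the law of $\mathcal G(\alpha_0,\dots,\alpha_{n-1})$ when the $\alpha_k$ are independent with $\alpha_k\sim\nu_{\beta(n-k-1)+1}$. $\mathrm{CJ}^{(n)}_{\delta,\beta}$ is the probability measure whose density with respect to $\mathrm{CJ}^{(n)}_{0,\beta}$ is proportional to $\det_\delta(U)=\det(\mathrm{Id}-U)^{\bar\delta}\det(\mathrm{Id}-\overline U)^{\delta}$, i.e. the product over the eigenvalues $\zeta$ of $U$ of $(1-\zeta)^{\bar\delta}(1-\bar\zeta)^{\delta}$ (principal logarithm). The spectral measure of $(U,e_1)$ is the probability measure $\mu$ on $\mathbb T$ with $\langle e_1,U^ke_1\rangle=\int z^kd\mu$ for all $k\in\mathbb Z$. *)

theory Defs
  imports
    "HOL-Probability.Probability"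
    "HOL-Complex_Analysis.Complex_Analysis"
    "Jordan_Normal_Form.Char_Poly"
    "Jordan_Normal_Form.Schur_Decomposition"
begin

section \<open>Probability measures on the unit circle\<close>

abbreviation circle :: "complex measure" where
  "circle \<equiv> restrict_space borel (sphere 0 1)"

definition haar_circle :: "complex measure" where
  "haar_circle = distr (uniform_measure lborel {0..<2*pi}) circle cis"

definition weak_conv_circle :: "(nat \<Rightarrow> complex measure) \<Rightarrow> complex measure \<Rightarrow> bool" where
  "weak_conv_circle \<nu>s \<nu> \<longleftrightarrow>
     (\<forall>f :: complex \<Rightarrow> real. continuous_on (sphere 0 1) f \<longrightarrow>
        (\<lambda>j. integral\<^sup>L (\<nu>s j) f) \<longlonglongrightarrow> integral\<^sup>L \<nu> f)"

definition metrizes_weak :: "(complex measure \<Rightarrow> complex measure \<Rightarrow> real) \<Rightarrow> bool" where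
  "metrizes_weak dst \<longleftrightarrow>
     Metric_space (space (prob_algebra circle)) dst \<and>
     (\<forall>\<nu>s \<nu>. range \<nu>s \<subseteq> space (prob_algebra circle) \<longrightarrow> \<nu> \<in> space (prob_algebra circle) \<longrightarrow>
        ((\<lambda>j. dst (\<nu>s j) \<nu>) \<longlonglongrightarrow> 0) = weak_conv_circle \<nu>s \<nu>)"

text \<open>
  Weak convergence in probability of random probability measures on the circle to a deterministic
  one. It does not depend on which metrizing distance is used, and is required for all of them;
  lemma \<open>ex_metrizes_weak\<close> below shows that one exists. Sequences are indexed by \<open>n \<ge> 1\<close>, and the
  \<open>n\<close>-th random measure may live on its own probability space \<open>M n\<close>.
\<close>
definition weak_conv_in_prob ::
  "(nat \<Rightarrow> 'a measure) \<Rightarrow> (nat \<Rightarrow> 'a \<Rightarrow> complex measure) \<Rightarrow> complex measure \<Rightarrow> bool" where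
  "weak_conv_in_prob M X \<nu> \<longleftrightarrow>
     (\<forall>dst. metrizes_weak dst \<longrightarrow>
        (\<forall>n\<ge>1. (\<lambda>\<omega>. dst (X n \<omega>) \<nu>) \<in> borel_measurable (M n)) \<and>
        (\<forall>\<epsilon>>0. (\<lambda>n. measure (M n) {\<omega> \<in> space (M n). dst (X n \<omega>) \<nu> > \<epsilon>}) \<longlonglongrightarrow> 0))"

lemma integrable_circle:
  fixes f :: "complex \<Rightarrow> real"
  assumes "\<mu> \<in> space (prob_algebra circle)" "continuous_on (sphere 0 1) f"
  shows "integrable \<mu> f"
proof -
  have s: "sets \<mu> = sets circle" and "prob_space \<mu>"
    using assms(1) by (auto simp: space_prob_algebra)
  interpret prob_space \<mu> by fact
  have sp: "space \<mu> = sphere 0 1"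
    using sets_eq_imp_space_eq[OF s] by (simp add: space_restrict_space)
  have "compact (f ` sphere 0 1)"
    using assms(2) by (intro compact_continuous_image) auto
  then obtain B where B: "\<forall>x\<in>f ` sphere 0 1. norm x \<le> B"
    using compact_imp_bounded bounded_iff by metis
  have "f \<in> borel_measurable circle"
    using assms(2) by (rule borel_measurable_continuous_on_restrict)
  then have "f \<in> borel_measurable \<mu>"
    using measurable_cong_sets[OF s refl] by blast
  then show ?thesis
    using B by (intro integrable_const_bound[of _ B]) (auto simp: sp)
qed

lemma circle_measure_eqI:
  assumes \<mu>: "\<mu> \<in> space (prob_algebra circle)" and \<nu>: "\<nu> \<in> space (prob_algebra circle)"
    and eq: "\<And>f :: complex \<Rightarrow> real. continuous_on (sphere 0 1) f \<Longrightarrow> integral\<^sup>L \<mu> f = integral\<^sup>L \<nu> f"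
  shows "\<mu> = \<nu>"
proof -
  have closed_eq: "integral\<^sup>L \<mu> (indicat_real C) = integral\<^sup>L \<nu> (indicat_real C)"
    if C: "closed C" for C :: "complex set"
  proof (cases "C = {}")
    case False
    define f :: "nat \<Rightarrow> complex \<Rightarrow> real" where "f j z = max 0 (1 - real j * infdist z C)" for j z
    have cont: "continuous_on A (f j)" for A j
      unfolding f_def by (intro continuous_intros)
    have bnd: "norm (f j z) \<le> 1" for j z
      by (auto simp: f_def infdist_nonneg)
    have pt: "(\<lambda>j. f j z) \<longlonglongrightarrow> indicat_real C z" for z
    proof (cases "z \<in> C")
      case True
      then show ?thesis by (simp add: f_def)
    next
      case z: False
      have pos: "infdist z C > 0"
        using z C False in_closed_iff_infdist_zero[of C z] infdist_nonneg[of z C] by fastforce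
      obtain N :: nat where N: "real N > 1 / infdist z C"
        using reals_Archimedean2 by blast
      have "f j z = 0" if "j \<ge> N" for j
      proof -
        have "real j > 1 / infdist z C" using N that by linarith
        then have "real j * infdist z C > 1" using pos by (simp add: field_simps)
        then show ?thesis by (simp add: f_def)
      qed
      then have "eventually (\<lambda>j. f j z = indicat_real C z) sequentially"
        using z by (auto simp: eventually_sequentially)
      then show ?thesis by (rule tendsto_eventually)
    qed
    have lim: "(\<lambda>j. integral\<^sup>L m (f j)) \<longlonglongrightarrow> integral\<^sup>L m (indicat_real C)"
      if m: "m \<in> space (prob_algebra circle)" for m
    proof -
      have s: "sets m = sets circle" and "prob_space m"
        using m by (auto simp: space_prob_algebra)
      interpret prob_space m by fact
      have meas: "g \<in> borel_measurable m" if "g \<in> borel_measurable borel" for g :: "complex \<Rightarrow> real"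
        using measurable_restrict_space1[OF that, of "sphere 0 1"] measurable_cong_sets[OF s refl] by blast
      show ?thesis
      proof (rule integral_dominated_convergence[where w="\<lambda>_. 1"])
        show "f j \<in> borel_measurable m" for j
          by (intro meas borel_measurable_continuous_onI cont)
        show "indicat_real C \<in> borel_measurable m"
          using C by (intro meas) auto
        show "AE z in m. norm (f j z) \<le> 1" for j
          by (intro AE_I2 bnd)
        show "AE z in m. (\<lambda>j. f j z) \<longlonglongrightarrow> indicat_real C z"
          by (intro AE_I2 pt)
      qed simp
    qed
    have "integral\<^sup>L \<mu> (f j) = integral\<^sup>L \<nu> (f j)" for j
      by (rule eq) (rule cont)
    then show ?thesis
      using LIMSEQ_unique[OF lim[OF \<mu>]] lim[OF \<nu>] by simp
  qed auto
  have s: "sets \<mu> = sets circle" "sets \<nu> = sets circle" and p: "prob_space \<mu>" "prob_space \<nu>"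
    using \<mu> \<nu> by (auto simp: space_prob_algebra)
  interpret \<mu>: prob_space \<mu> by fact
  interpret \<nu>: prob_space \<nu> by fact
  have sp: "space \<mu> = sphere 0 1" "space \<nu> = sphere 0 1"
    using sets_eq_imp_space_eq[OF s(1)] sets_eq_imp_space_eq[OF s(2)] by (simp_all add: space_restrict_space)
  have "(\<lambda>x. x) \<in> measurable circle (borel :: complex measure)"
    by (rule measurable_restrict_space1) simp
  then have id: "(\<lambda>x. x) \<in> measurable \<mu> borel" "(\<lambda>x. x) \<in> measurable \<nu> borel"
    using measurable_cong_sets[OF s(1) refl] measurable_cong_sets[OF s(2) refl] by blast+
  have "distr \<mu> borel (\<lambda>x. x) = distr \<nu> borel (\<lambda>x. x)"
  proof (rule measure_eqI_generator_eq[where E="{C. closed C}" and \<Omega>=UNIV and A="\<lambda>_. UNIV"])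
    show "emeasure (distr \<mu> borel (\<lambda>x. x)) X = emeasure (distr \<nu> borel (\<lambda>x. x)) X"
      if "X \<in> {C. closed C}" for X
    proof -
      have X: "closed X" "X \<in> sets borel" using that by auto
      have "X \<inter> sphere 0 1 \<in> sets circle"
        using X(2) by (auto simp: sets_restrict_space)
      then show ?thesis
        using closed_eq[OF X(1)] X(2) id
        by (simp add: emeasure_distr sp \<mu>.emeasure_eq_measure \<nu>.emeasure_eq_measure)
    qed
    show "emeasure (distr \<mu> borel (\<lambda>x. x)) UNIV \<noteq> \<infinity>" for i :: nat
      using id by (simp add: emeasure_distr sp)
  qed (auto simp: Int_stable_def borel_eq_closed)
  note d = this
  show ?thesis
  proof (rule measure_eqI)
    fix A assume A: "A \<in> sets \<mu>"
    then have A': "A \<in> sets borel" "A \<subseteq> sphere 0 1"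
      using s by (auto simp: sets_restrict_space)
    have "emeasure (distr \<mu> borel (\<lambda>x. x)) A = emeasure (distr \<nu> borel (\<lambda>x. x)) A"
      by (simp add: d)
    then show "emeasure \<mu> A = emeasure \<nu> A"
      using A' id by (simp add: emeasure_distr sp Int_absorb2)
  qed (simp add: s)
qed

lemma weak_conv_circle_if_moments:
  assumes \<nu>s: "\<And>j. \<nu>s j \<in> space (prob_algebra circle)" and \<nu>: "\<nu> \<in> space (prob_algebra circle)"
    and mom: "\<And>a b. (\<lambda>j. \<integral>z. Re z ^ a * Im z ^ b \<partial>\<nu>s j) \<longlonglongrightarrow> (\<integral>z. Re z ^ a * Im z ^ b \<partial>\<nu>)"
  shows "weak_conv_circle \<nu>s \<nu>"
proof -
  define S where "S = sphere (0::complex) 1"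
  define L where "L f \<longleftrightarrow> continuous_on S f \<and> (\<lambda>j. integral\<^sup>L (\<nu>s j) f) \<longlonglongrightarrow> integral\<^sup>L \<nu> f"
    for f :: "complex \<Rightarrow> real"
  define G where "G f \<longleftrightarrow> (\<forall>a b. L (\<lambda>z. f z * (Re z ^ a * Im z ^ b)))" for f
  have int: "integrable (\<nu>s j) f" "integrable \<nu> f" if "continuous_on S f"
    for f :: "complex \<Rightarrow> real" and j
    using integrable_circle[OF \<nu>s, of f j] integrable_circle[OF \<nu>, of f] that by (auto simp: S_def)
  have L_add: "L (\<lambda>z. f z + g z)" if "L f" "L g" for f g
    using that int[of f] int[of g]
    by (auto simp: L_def intro!: continuous_intros tendsto_intros)
  have L_cmult: "L (\<lambda>z. c * f z)" if "L f" for f c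
    using that by (auto simp: L_def intro!: continuous_intros tendsto_intros)
  have step: "\<forall>f. G f \<longrightarrow> G (\<lambda>z. f z * p z)" if "real_polynomial_function p" for p
    using that
  proof (induction rule: real_polynomial_function.induct)
    case (linear h)
    have h: "h z = Re z * h 1 + Im z * h \<i>" for z
    proof -
      have "z = Re z *\<^sub>R 1 + Im z *\<^sub>R \<i>"
        by (simp add: complex_eq_iff)
      then have "h z = h (Re z *\<^sub>R 1 + Im z *\<^sub>R \<i>)"
        by (rule arg_cong)
      also have "\<dots> = Re z * h 1 + Im z * h \<i>"
        using linear by (simp only: linear_simps real_scaleR_def)
      finally show ?thesis .
    qed
    show ?case
    proof (intro allI impI)
      fix f assume f: "G f"
      show "G (\<lambda>z. f z * h z)" unfolding G_def
      proof (intro allI)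
        fix a b
        have "L (\<lambda>z. h 1 * (f z * (Re z ^ Suc a * Im z ^ b)) + h \<i> * (f z * (Re z ^ a * Im z ^ Suc b)))"
          using f unfolding G_def by (intro L_add L_cmult) blast+
        also have "(\<lambda>z. h 1 * (f z * (Re z ^ Suc a * Im z ^ b)) + h \<i> * (f z * (Re z ^ a * Im z ^ Suc b)))
            = (\<lambda>z. f z * h z * (Re z ^ a * Im z ^ b))"
          by (rule ext, subst (2) h) (simp add: algebra_simps)
        finally show "L (\<lambda>z. f z * h z * (Re z ^ a * Im z ^ b))" .
      qed
    qed
  next
    case (const c)
    then show ?case
      unfolding G_def using L_cmult[of _ c] by (simp add: mult_ac)
  next
    case (add p q)
    show ?case
    proof (intro allI impI)
      fix f assume "G f"
      then have "G (\<lambda>z. f z * p z)" "G (\<lambda>z. f z * q z)" using add by auto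
      then show "G (\<lambda>z. f z * (p z + q z))"
        unfolding G_def using L_add by (simp add: algebra_simps)
    qed
  next
    case (mult p q)
    then show ?case
      by (metis (no_types, lifting) mult.assoc ext)
  qed
  have "G (\<lambda>_. 1)"
    using mom by (auto simp: G_def L_def intro!: continuous_intros)
  then have pol: "L p" if "real_polynomial_function p" for p
    using step[OF that] unfolding G_def by (metis (no_types, lifting) ext mult_1 mult_1_right power_0)
  show ?thesis
    unfolding weak_conv_circle_def S_def[symmetric]
  proof (intro allI impI LIMSEQ_I)
    fix f :: "complex \<Rightarrow> real" and e :: real
    assume f: "continuous_on S f" and e: "e > 0"
    obtain g where g: "real_polynomial_function g" "\<And>x. x \<in> S \<Longrightarrow> \<bar>f x - g x\<bar> < e / 3"
      using Stone_Weierstrass_real_polynomial_function[of S f "e / 3"] f e by (auto simp: S_def)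
    have gc: "continuous_on S g" and "(\<lambda>j. integral\<^sup>L (\<nu>s j) g) \<longlonglongrightarrow> integral\<^sup>L \<nu> g"
      using pol[OF g(1)] by (auto simp: L_def)
    then obtain N where N: "\<And>j. j \<ge> N \<Longrightarrow> \<bar>integral\<^sup>L (\<nu>s j) g - integral\<^sup>L \<nu> g\<bar> < e / 3"
      using e LIMSEQ_D[of _ _ "e / 3"] by (metis divide_pos_pos real_norm_def zero_less_numeral)
    have close: "\<bar>integral\<^sup>L m f - integral\<^sup>L m g\<bar> \<le> e / 3" if m: "m \<in> space (prob_algebra circle)" for m
    proof -
      have s: "sets m = sets circle" and "prob_space m"
        using m by (auto simp: space_prob_algebra)
      interpret prob_space m by fact
      have sp: "space m = S"
        using sets_eq_imp_space_eq[OF s] by (simp add: space_restrict_space S_def)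
      have i: "integrable m f" "integrable m g"
        using integrable_circle[OF m] f gc by (auto simp: S_def)
      have "\<bar>integral\<^sup>L m f - integral\<^sup>L m g\<bar> = \<bar>\<integral>z. f z - g z \<partial>m\<bar>"
        using i by simp
      also have "\<dots> \<le> (\<integral>z. \<bar>f z - g z\<bar> \<partial>m)"
        by (rule integral_abs_bound)
      also have "\<dots> \<le> (\<integral>z. e / 3 \<partial>m)"
        using i g(2) by (intro integral_mono) (auto simp: sp less_imp_le)
      finally show ?thesis by (simp add: prob_space)
    qed
    have "\<bar>integral\<^sup>L (\<nu>s j) f - integral\<^sup>L \<nu> f\<bar> < e" if "j \<ge> N" for j
      using N[OF that] close[OF \<nu>s, of j] close[OF \<nu>] by linarith
    then show "\<exists>N. \<forall>j\<ge>N. norm (integral\<^sup>L (\<nu>s j) f - integral\<^sup>L \<nu> f) < e"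
      by auto
  qed
qed

lemma ex_metrizes_weak: "\<exists>dst. metrizes_weak dst"
proof -
  define emb :: "complex measure \<Rightarrow> nat \<times> nat \<Rightarrow> real"
    where "emb \<mu> = (\<lambda>(a, b). \<integral>z. Re z ^ a * Im z ^ b \<partial>\<mu>)" for \<mu>
  define P where "P = space (prob_algebra circle)"
  have lim: "(\<lambda>j. dist (emb (\<nu>s j)) (emb \<nu>)) \<longlonglongrightarrow> 0 \<longleftrightarrow> (\<forall>k. (\<lambda>j. emb (\<nu>s j) k) \<longlonglongrightarrow> emb \<nu> k)"
    for \<nu>s \<nu>
  proof -
    have "(\<lambda>j. dist (emb (\<nu>s j)) (emb \<nu>)) \<longlonglongrightarrow> 0 \<longleftrightarrow> (\<lambda>j. emb (\<nu>s j)) \<longlonglongrightarrow> emb \<nu>"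
      by (rule tendsto_dist_iff[symmetric])
    also have "\<dots> \<longleftrightarrow> limitin (product_topology (\<lambda>_. euclidean) UNIV) (\<lambda>j. emb (\<nu>s j)) (emb \<nu>) sequentially"
      by (simp add: euclidean_product_topology)
    finally show ?thesis by (simp add: limitin_componentwise)
  qed
  have weak: "(\<lambda>j. dist (emb (\<nu>s j)) (emb \<nu>)) \<longlonglongrightarrow> 0 \<longleftrightarrow> weak_conv_circle \<nu>s \<nu>"
    if "\<And>j. \<nu>s j \<in> P" "\<nu> \<in> P" for \<nu>s \<nu>
  proof
    assume "(\<lambda>j. dist (emb (\<nu>s j)) (emb \<nu>)) \<longlonglongrightarrow> 0"
    then show "weak_conv_circle \<nu>s \<nu>"
      using that unfolding lim by (intro weak_conv_circle_if_moments) (auto simp: emb_def P_def)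
  next
    assume w: "weak_conv_circle \<nu>s \<nu>"
    have "(\<lambda>j. \<integral>z. Re z ^ a * Im z ^ b \<partial>\<nu>s j) \<longlonglongrightarrow> (\<integral>z. Re z ^ a * Im z ^ b \<partial>\<nu>)" for a b
      by (rule w[unfolded weak_conv_circle_def, rule_format]) (intro continuous_intros)
    then show "(\<lambda>j. dist (emb (\<nu>s j)) (emb \<nu>)) \<longlonglongrightarrow> 0"
      unfolding lim by (auto simp: emb_def)
  qed
  have inj: "\<mu> = \<nu>" if "\<mu> \<in> P" "\<nu> \<in> P" "emb \<mu> = emb \<nu>" for \<mu> \<nu>
  proof -
    have "weak_conv_circle (\<lambda>_. \<mu>) \<nu>"
      using that weak[of "\<lambda>_. \<mu>" \<nu>] by simp
    then have "integral\<^sup>L \<mu> f = integral\<^sup>L \<nu> f" if "continuous_on (sphere 0 1) f" for f :: "complex \<Rightarrow> real"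
      using that LIMSEQ_const_iff unfolding weak_conv_circle_def by blast
    then show ?thesis
      using that by (intro circle_measure_eqI) (auto simp: P_def)
  qed
  have "Metric_space P (\<lambda>\<mu> \<nu>. dist (emb \<mu>) (emb \<nu>))"
    by unfold_locales (auto simp: dist_commute dist_triangle intro: inj)
  then show ?thesis
    using weak unfolding metrizes_weak_def P_def[symmetric]
    by (intro exI[of _ "\<lambda>\<mu> \<nu>. dist (emb \<mu>) (emb \<nu>)"]) (auto simp: subset_iff)
qed


section \<open>Orthogonal polynomials and Verblunsky coefficients\<close>

definition atoms :: "complex measure \<Rightarrow> complex set" where
  "atoms \<mu> = {\<zeta> \<in> sphere 0 1. measure \<mu> {\<zeta>} > 0}"

definition n_point_measures :: "nat \<Rightarrow> complex measure set" where
  "n_point_measures n =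
     {\<mu> \<in> space (prob_algebra circle).
        finite (atoms \<mu>) \<and> card (atoms \<mu>) = n \<and> measure \<mu> (atoms \<mu>) = 1}"

definition monic_OP :: "complex measure \<Rightarrow> nat \<Rightarrow> complex poly" where
  "monic_OP \<mu> j =
     (if j = card (atoms \<mu>) then \<Prod>\<zeta>\<in>atoms \<mu>. [:- \<zeta>, 1:]
      else (THE p. degree p = j \<and> lead_coeff p = 1 \<and>
              (\<forall>q. degree q < j \<longrightarrow> (\<integral>z. cnj (poly q z) * poly p z \<partial>\<mu>) = 0)))"

definition has_verblunsky :: "complex measure \<Rightarrow> nat \<Rightarrow> (nat \<Rightarrow> complex) \<Rightarrow> bool" where
  "has_verblunsky \<mu> n \<alpha> \<longleftrightarrow>
     (\<forall>k<n. \<forall>z. z \<noteq> 0 \<longrightarrow>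
        poly (monic_OP \<mu> (Suc k)) z =
          z * poly (monic_OP \<mu> k) z
          - cnj (\<alpha> k) * (z ^ k * cnj (poly (monic_OP \<mu> k) (1 / cnj z))))"

text \<open>
  \<open>\<mu> \<mapsto> (\<alpha>\<^sub>0, \<dots>, \<alpha>\<^bsub>n-1\<^esub>)\<close> is a bijection from the \<open>n\<close>-point measures onto
  \<open>\<D>\<^bsup>n-1\<^esup> \<times> \<T>\<close>; the following is its inverse.
\<close>
definition measure_of_verblunsky :: "nat \<Rightarrow> (nat \<Rightarrow> complex) \<Rightarrow> complex measure" where
  "measure_of_verblunsky n \<alpha> = (THE \<mu>. \<mu> \<in> n_point_measures n \<and> has_verblunsky \<mu> n \<alpha>)"

definition orthonormal_poly :: "complex measure \<Rightarrow> nat \<Rightarrow> complex \<Rightarrow> complex" where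
  "orthonormal_poly \<mu> j z =
     poly (monic_OP \<mu> j) z / of_real (sqrt (\<integral>w. (cmod (poly (monic_OP \<mu> j) w))\<^sup>2 \<partial>\<mu>))"

definition GGT :: "nat \<Rightarrow> (nat \<Rightarrow> complex) \<Rightarrow> complex mat" where
  "GGT n \<alpha> =
     (let \<mu> = measure_of_verblunsky n \<alpha> in
      mat n n (\<lambda>(i, j). \<integral>z. cnj (orthonormal_poly \<mu> i z) * (z * orthonormal_poly \<mu> j z) \<partial>\<mu>))"


section \<open>The circular Jacobi ensemble\<close>

definition mat_borel :: "nat \<Rightarrow> complex mat measure" where
  "mat_borel n =
     vimage_algebra (carrier_mat n n)
       (\<lambda>A. \<lambda>ij \<in> {..<n} \<times> {..<n}. A $$ ij)
       (Pi\<^sub>M ({..<n} \<times> {..<n}) (\<lambda>_. borel))"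

definition nu_law :: "real \<Rightarrow> complex measure" where
  "nu_law s =
     (if s = 1 then distr (uniform_measure lborel {0..<2*pi}) borel cis
      else density lborel
        (\<lambda>z. ennreal (indicator (ball 0 1) z * ((s - 1) / (2*pi) * (1 - (cmod z)\<^sup>2) powr ((s - 3) / 2)))))"

definition CJ0 :: "nat \<Rightarrow> real \<Rightarrow> complex mat measure" where
  "CJ0 n \<beta> = distr (Pi\<^sub>M {..<n} (\<lambda>k. nu_law (\<beta> * real (n - k - 1) + 1))) (mat_borel n) (GGT n)"

text \<open>
  The product runs over the eigenvalues with algebraic multiplicity. For a unitary matrix it is a
  nonnegative real, each factor being \<open>exp (2 Re (cnj \<delta> * Ln (1 - \<zeta>)))\<close>.
\<close>
definition det_delta :: "complex \<Rightarrow> complex mat \<Rightarrow> complex" where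
  "det_delta \<delta> A = (\<Prod>\<zeta>\<in>#proots (char_poly A). (1 - \<zeta>) powr cnj \<delta> * (1 - cnj \<zeta>) powr \<delta>)"

definition CJ :: "nat \<Rightarrow> complex \<Rightarrow> real \<Rightarrow> complex mat measure" where
  "CJ n \<delta> \<beta> =
     density (CJ0 n \<beta>)
       (\<lambda>A. ennreal (Re (det_delta \<delta> A)) / (\<integral>\<^sup>+B. ennreal (Re (det_delta \<delta> B)) \<partial>CJ0 n \<beta>))"


section \<open>Spectral measures\<close>

text \<open>
  \<open>u \<bullet>c v\<close> is linear in \<open>u\<close> and antilinear in \<open>v\<close>. Negative powers of a unitary matrix are the
  powers of its adjoint.
\<close>
definition spectral_measure :: "complex mat \<Rightarrow> complex vec \<Rightarrow> complex measure" where
  "spectral_measure A v =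
     (if mat_adjoint A * A = 1\<^sub>m (dim_row A) \<and> A * mat_adjoint A = 1\<^sub>m (dim_row A) then
        (THE \<mu>. \<mu> \<in> space (prob_algebra circle) \<and>
           (\<forall>k::int. (\<integral>z. z powi k \<partial>\<mu>) =
              (((if k \<ge> 0 then A ^\<^sub>m nat k else mat_adjoint A ^\<^sub>m nat (- k)) *\<^sub>v v) \<bullet>c v)))
      else undefined)"


section \<open>The limit measure\<close>

definition alpha_d :: "complex \<Rightarrow> complex" where
  "alpha_d d = - (cnj d / (1 + cnj d))"

definition theta_d :: "complex \<Rightarrow> real" where
  "theta_d d = (THE \<theta>. 0 \<le> \<theta> \<and> \<theta> < pi \<and> sin (\<theta> / 2) = cmod (d / (1 + d)))"

definition xi_d :: "complex \<Rightarrow> real" where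
  "xi_d d = (THE \<xi>. - theta_d d \<le> \<xi> \<and> \<xi> \<le> theta_d d \<and> cis \<xi> = (1 + d) / (1 + cnj d))"

definition w_d :: "complex \<Rightarrow> real \<Rightarrow> real" where
  "w_d d \<theta> =
     (if theta_d d + xi_d d < \<theta> \<and> \<theta> < 2*pi - theta_d d + xi_d d
      then sqrt ((sin ((\<theta> - xi_d d) / 2))\<^sup>2 - (sin (theta_d d / 2))\<^sup>2)
             / (cmod (1 + alpha_d d) * sin (\<theta> / 2))
      else 0)"

definition mu_d :: "complex \<Rightarrow> complex measure" where
  "mu_d d =
     (if d = 0 then haar_circle
      else distr (density lborel (\<lambda>\<theta>. indicator {0..<2*pi} \<theta> * ennreal (w_d d \<theta> / (2*pi)))) circle cis)"

end

theory Submission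
  imports Defs
begin

text \<open>
  Weak convergence on the circle is convergence of the power moments
  (\<open>weak_conv_circle_if_power_moments\<close>), and the first \<open>K\<close> moments of a measure are polynomials in
  its first \<open>K\<close> Verblunsky coefficients and their conjugates (\<open>moment_eq_mom\<close>). So it is enough to
  find the limits in probability of finitely many coefficients of the random spectral measure, and
  to recognize \<open>mu_d d\<close> as the measure that has the limits as its coefficients.

  \<^emph>\<open>Limits of the coefficients.\<close> Under \<open>CJ0\<close> the coefficients \<open>\<alpha> k\<close> are independent, but the weight
  \<open>det_delta\<close> couples them. The deformed coefficients
  \<open>gam \<alpha> k = cnj (\<alpha> k) * \<Phi>\<^sub>k\<^sup>*(1) / \<Phi>\<^sub>k(1)\<close> decouple it: \<open>\<Phi>\<^sub>k\<^sub>+\<^sub>1(1) = (1 - gam \<alpha> k) * \<Phi>\<^sub>k(1)\<close>, so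
  \<open>\<Phi>\<^sub>n(1)\<close>, the characteristic polynomial at \<open>1\<close>, is the product of the \<open>1 - gam \<alpha> k\<close>, and
  the principal logarithms of its factors add up without a multiple of \<open>2\<pi>i\<close> (\<open>sum_Ln_zeros\<close>, \<open>det_delta_GGT\<close>). Conversely
  \<open>\<alpha> k\<close> is the conjugate of the \<open>k\<close>-th deformed coefficient times a unimodular function of the
  earlier ones. The laws \<open>nu_law s\<close> are invariant under rotations and reflections, so this change of
  coordinates preserves their product, and under \<open>CJ\<close> the deformed coefficients are independent with
  explicit densities (\<open>emeasure_CJ\<close>). For \<open>\<delta> = \<beta>/2 * n * d\<close> the density of the \<open>k\<close>-th one, for fixed
  \<open>k\<close> and large \<open>n\<close>, is the power \<open>\<beta>/2 * n\<close> of the function \<open>rate d\<close>, up to normalization and a factor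
  that is the same for all \<open>n\<close>; since \<open>rate d\<close> has its strict maximum over the disk at \<open>gamma_d d = - d / (1 + cnj d)\<close> (\<open>rate_max\<close>),
  Laplace's method shows that the \<open>k\<close>-th deformed coefficient tends to \<open>gamma_d d\<close> (\<open>concentration\<close>).

  \<^emph>\<open>The limit measure.\<close> It remains to see that \<open>mu_d d\<close> has constant deformed coefficients
  \<open>gamma_d d\<close>, that is, that its integrals over the corresponding polynomials \<open>\<Phi>\<^sub>k\<close>, \<open>k \<ge> 1\<close>, vanish.
  These polynomials satisfy a three-term recursion with constant coefficients, so that their
  generating function is a quotient (\<open>opuc_const_generating\<close>). The substitution
  \<open>cot ((\<theta> - xi_d d) / 2) = cot (theta_d d / 2) * cos \<psi>\<close> turns the density of \<open>mu_d d\<close> into a rational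
  function of \<open>cos \<psi>\<close> times \<open>sin\<^sup>2 \<psi>\<close> (\<open>mu_d_eq\<close>), and the integral of the generating function into an
  integral of \<open>sin\<^sup>2\<close> over three factors \<open>1 - 2 w cos \<psi> + w\<^sup>2\<close>, which has a closed form
  (\<open>hbi_kern3\<close>). The integral turns out to be constant in the variable of the generating
  function (\<open>integral_opuc_mu_d\<close>).

  The statement about random measures also asks for measurability. The spectral measure depends
  continuously on the entries of a unitary matrix, again by moments
  (\<open>dist_spectral_measure_measurable\<close>).
\<close>

section \<open>The Szego recursion\<close>

text \<open>
  The pair \<open>(\<Phi>\<^sub>k, \<Phi>\<^sub>k\<^sup>*)\<close>. Carrying the reversed polynomial along as a second component avoids
  reversal of coefficient lists; \<open>szego_reversal\<close> shows that it is the reversal.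
\<close>
primrec szego :: "(nat \<Rightarrow> complex) \<Rightarrow> nat \<Rightarrow> complex poly \<times> complex poly" where
  "szego \<alpha> 0 = (1, 1)"
| "szego \<alpha> (Suc k) = (let (p, q) = szego \<alpha> k in
      (pCons 0 p - Polynomial.smult (cnj (\<alpha> k)) q, q - Polynomial.smult (\<alpha> k) (pCons 0 p)))"

definition opuc :: "(nat \<Rightarrow> complex) \<Rightarrow> nat \<Rightarrow> complex poly" where
  "opuc \<alpha> k = fst (szego \<alpha> k)"

definition ropuc :: "(nat \<Rightarrow> complex) \<Rightarrow> nat \<Rightarrow> complex poly" where
  "ropuc \<alpha> k = snd (szego \<alpha> k)"

lemma opuc_0 [simp]: "opuc \<alpha> 0 = 1" "ropuc \<alpha> 0 = 1"
  by (simp_all add: opuc_def ropuc_def)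

lemma opuc_Suc: "opuc \<alpha> (Suc k) = pCons 0 (opuc \<alpha> k) - Polynomial.smult (cnj (\<alpha> k)) (ropuc \<alpha> k)"
  by (simp add: opuc_def ropuc_def case_prod_unfold Let_def)

lemma ropuc_Suc: "ropuc \<alpha> (Suc k) = ropuc \<alpha> k - Polynomial.smult (\<alpha> k) (pCons 0 (opuc \<alpha> k))"
  by (simp add: opuc_def ropuc_def case_prod_unfold Let_def)

lemma poly_opuc_Suc:
  "poly (opuc \<alpha> (Suc k)) z = z * poly (opuc \<alpha> k) z - cnj (\<alpha> k) * poly (ropuc \<alpha> k) z"
  "poly (ropuc \<alpha> (Suc k)) z = poly (ropuc \<alpha> k) z - \<alpha> k * z * poly (opuc \<alpha> k) z"
  by (simp_all add: opuc_Suc ropuc_Suc algebra_simps)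

lemma degree_opuc_le: "degree (opuc \<alpha> k) \<le> k \<and> degree (ropuc \<alpha> k) \<le> k"
proof (induction k)
  case (Suc k)
  have "degree (pCons 0 (opuc \<alpha> k)) \<le> Suc k"
    using Suc degree_pCons_le[of 0 "opuc \<alpha> k"] by linarith
  moreover have "degree (ropuc \<alpha> k) \<le> Suc k" using Suc by simp
  ultimately show ?case
    unfolding opuc_Suc ropuc_Suc
    by (auto intro!: degree_diff_le order.trans[OF degree_smult_le])
qed auto

lemma coeff_opuc_self: "coeff (opuc \<alpha> k) k = 1"
proof (induction k)
  case (Suc k)
  have "coeff (ropuc \<alpha> k) (Suc k) = 0"
    using degree_opuc_le[of \<alpha> k] by (intro coeff_eq_0) auto
  then show ?case using Suc by (simp add: opuc_Suc)
qed auto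

lemma degree_opuc [simp]: "degree (opuc \<alpha> k) = k"
  using degree_opuc_le[of \<alpha> k] coeff_opuc_self[of \<alpha> k]
  by (metis antisym_conv le_degree zero_neq_one)

lemma lead_coeff_opuc [simp]: "lead_coeff (opuc \<alpha> k) = 1"
  by (simp add: coeff_opuc_self)

lemma opuc_nonzero [simp]: "opuc \<alpha> k \<noteq> 0"
  using lead_coeff_opuc[of \<alpha> k] by fastforce

lemma szego_reversal:
  assumes "z \<noteq> 0"
  shows "poly (ropuc \<alpha> k) z = z ^ k * cnj (poly (opuc \<alpha> k) (1 / cnj z))
       \<and> poly (opuc \<alpha> k) z = z ^ k * cnj (poly (ropuc \<alpha> k) (1 / cnj z))"
proof (induction k)
  case (Suc k)
  have 1: "z ^ Suc k * cnj (poly (opuc \<alpha> (Suc k)) (1 / cnj z))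
      = z ^ k * cnj (poly (opuc \<alpha> k) (1 / cnj z))
        - \<alpha> k * z * (z ^ k * cnj (poly (ropuc \<alpha> k) (1 / cnj z)))"
    using assms by (simp add: poly_opuc_Suc field_simps)
  have 2: "z ^ Suc k * cnj (poly (ropuc \<alpha> (Suc k)) (1 / cnj z))
      = z * (z ^ k * cnj (poly (ropuc \<alpha> k) (1 / cnj z)))
        - cnj (\<alpha> k) * (z ^ k * cnj (poly (opuc \<alpha> k) (1 / cnj z)))"
    using assms by (simp add: poly_opuc_Suc field_simps)
  show ?case
    unfolding 1 2 using Suc by (simp add: poly_opuc_Suc)
qed auto

lemma unimodular_mult_cnj: "cmod z = 1 \<Longrightarrow> z * cnj z = 1"
  using complex_norm_square[of z] by simp

lemma unimodular_inverse_cnj: "cmod z = 1 \<Longrightarrow> 1 / cnj z = z"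
  using unimodular_mult_cnj[of z] by (metis mult_zero_right nonzero_eq_divide_eq zero_neq_one)

lemma ropuc_circle:
  assumes "cmod z = 1"
  shows "poly (ropuc \<alpha> k) z = z ^ k * cnj (poly (opuc \<alpha> k) z)"
proof -
  have "z \<noteq> 0" using assms by auto
  from conjunct1[OF szego_reversal[OF this]] show ?thesis
    unfolding unimodular_inverse_cnj[OF assms] .
qed

lemma cmod_ropuc_circle: "cmod z = 1 \<Longrightarrow> cmod (poly (ropuc \<alpha> k) z) = cmod (poly (opuc \<alpha> k) z)"
  by (simp add: ropuc_circle norm_mult norm_power)

lemma szego_cong:
  "(\<And>i. i < k \<Longrightarrow> \<alpha> i = \<alpha>' i) \<Longrightarrow> szego \<alpha> k = szego \<alpha>' k"
  by (induction k) auto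

lemma opuc_cong: "(\<And>i. i < k \<Longrightarrow> \<alpha> i = \<alpha>' i) \<Longrightarrow> opuc \<alpha> k = opuc \<alpha>' k"
  and ropuc_cong: "(\<And>i. i < k \<Longrightarrow> \<alpha> i = \<alpha>' i) \<Longrightarrow> ropuc \<alpha> k = ropuc \<alpha>' k"
  by (simp_all add: opuc_def ropuc_def cong: szego_cong)

text \<open>
  The Christoffel-Darboux formula. The weights \<open>\<Prod>i\<in>{j..<k}. 1 - (cmod (\<alpha> i))\<^sup>2\<close> are the quotients
  \<open>\<parallel>\<Phi>\<^sub>k\<parallel>\<^sup>2 / \<parallel>\<Phi>\<^sub>j\<parallel>\<^sup>2\<close>, written without division so that the identity holds for arbitrary \<open>\<alpha>\<close>.
\<close>
lemma christoffel_darboux: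
  "poly (ropuc \<alpha> k) z * cnj (poly (ropuc \<alpha> k) w) - poly (opuc \<alpha> k) z * cnj (poly (opuc \<alpha> k) w)
   = (1 - z * cnj w) * (\<Sum>j<k. of_real (\<Prod>i\<in>{j..<k}. 1 - (cmod (\<alpha> i))\<^sup>2)
        * (poly (opuc \<alpha> j) z * cnj (poly (opuc \<alpha> j) w)))"
proof (induction k)
  case (Suc k)
  define P Q P' Q' where "P = poly (opuc \<alpha> k) z" and "Q = poly (ropuc \<alpha> k) z"
    and "P' = cnj (poly (opuc \<alpha> k) w)" and "Q' = cnj (poly (ropuc \<alpha> k) w)"
  define S where "S = (\<Sum>j<k. of_real (\<Prod>i\<in>{j..<k}. 1 - (cmod (\<alpha> i))\<^sup>2)
        * (poly (opuc \<alpha> j) z * cnj (poly (opuc \<alpha> j) w)))"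
  define r where "r = complex_of_real (1 - (cmod (\<alpha> k))\<^sup>2)"
  have r: "r = 1 - \<alpha> k * cnj (\<alpha> k)"
    by (simp only: r_def of_real_diff complex_norm_square) simp
  have "(\<Sum>j<Suc k. of_real (\<Prod>i\<in>{j..<Suc k}. 1 - (cmod (\<alpha> i))\<^sup>2)
        * (poly (opuc \<alpha> j) z * cnj (poly (opuc \<alpha> j) w)))
     = (\<Sum>j<k. r * (of_real (\<Prod>i\<in>{j..<k}. 1 - (cmod (\<alpha> i))\<^sup>2)
        * (poly (opuc \<alpha> j) z * cnj (poly (opuc \<alpha> j) w)))) + r * (P * P')"
    unfolding sum.lessThan_Suc
    by (intro arg_cong2[where f="(+)"] sum.cong)
       (auto simp: prod.atLeastLessThan_Suc r_def P_def P'_def mult_ac)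
  also have "\<dots> = r * (S + P * P')"
    by (simp add: S_def sum_distrib_left distrib_left)
  finally have *: "(\<Sum>j<Suc k. of_real (\<Prod>i\<in>{j..<Suc k}. 1 - (cmod (\<alpha> i))\<^sup>2)
        * (poly (opuc \<alpha> j) z * cnj (poly (opuc \<alpha> j) w))) = r * (S + P * P')" .
  have IH: "Q * Q' - P * P' = (1 - z * cnj w) * S"
    using Suc by (simp add: P_def Q_def P'_def Q'_def S_def)
  have "(Q - \<alpha> k * z * P) * (Q' - cnj (\<alpha> k) * cnj w * P')
      - (z * P - cnj (\<alpha> k) * Q) * (cnj w * P' - \<alpha> k * Q')
      = r * ((Q * Q' - P * P') + (1 - z * cnj w) * (P * P'))"
    unfolding r by (simp add: algebra_simps)
  also have "\<dots> = (1 - z * cnj w) * (r * (S + P * P'))"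
    unfolding IH by (simp add: algebra_simps)
  finally show ?case
    unfolding * by (simp add: poly_opuc_Suc P_def Q_def P'_def Q'_def)
qed simp

text \<open>
  The squared norm of \<open>\<Phi>\<^sub>k\<close> in the measure with Verblunsky coefficients \<open>\<alpha>\<close>.
\<close>
definition kappa :: "(nat \<Rightarrow> complex) \<Rightarrow> nat \<Rightarrow> real" where
  "kappa \<alpha> k = (\<Prod>i<k. 1 - (cmod (\<alpha> i))\<^sup>2)"

lemma kappa_0 [simp]: "kappa \<alpha> 0 = 1"
  and kappa_Suc: "kappa \<alpha> (Suc k) = kappa \<alpha> k * (1 - (cmod (\<alpha> k))\<^sup>2)"
  by (simp_all add: kappa_def)

lemma kappa_pos: "(\<And>i. i < k \<Longrightarrow> cmod (\<alpha> i) < 1) \<Longrightarrow> kappa \<alpha> k > 0"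
  unfolding kappa_def by (intro prod_pos) (auto simp: abs_square_less_1)

definition CD_kernel :: "(nat \<Rightarrow> complex) \<Rightarrow> nat \<Rightarrow> complex \<Rightarrow> complex \<Rightarrow> complex" where
  "CD_kernel \<alpha> n z w = (\<Sum>j<n. poly (opuc \<alpha> j) z * cnj (poly (opuc \<alpha> j) w) / of_real (kappa \<alpha> j))"

lemma CD_kernel_eq:
  assumes "\<And>i. i < m \<Longrightarrow> cmod (\<alpha> i) < 1"
  shows "poly (ropuc \<alpha> m) z * cnj (poly (ropuc \<alpha> m) w)
       - (z * poly (opuc \<alpha> m) z) * cnj (w * poly (opuc \<alpha> m) w)
     = (1 - z * cnj w) * of_real (kappa \<alpha> m) * CD_kernel \<alpha> (Suc m) z w"
proof -
  have pos: "kappa \<alpha> j > 0" if "j \<le> m" for j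
    using that assms by (intro kappa_pos) auto
  have split: "(\<Prod>i\<in>{j..<m}. 1 - (cmod (\<alpha> i))\<^sup>2) = kappa \<alpha> m / kappa \<alpha> j" if "j \<le> m" for j
  proof -
    have "kappa \<alpha> m = kappa \<alpha> j * (\<Prod>i\<in>{j..<m}. 1 - (cmod (\<alpha> i))\<^sup>2)"
      unfolding kappa_def using that prod.atLeastLessThan_concat[of 0 j m "\<lambda>i. 1 - (cmod (\<alpha> i))\<^sup>2"]
      by (simp add: atLeast0LessThan)
    then show ?thesis using pos[OF that] by simp
  qed
  define S where "S = (\<Sum>j<m. of_real (\<Prod>i\<in>{j..<m}. 1 - (cmod (\<alpha> i))\<^sup>2)
        * (poly (opuc \<alpha> j) z * cnj (poly (opuc \<alpha> j) w)))"
  have "S = of_real (kappa \<alpha> m) * CD_kernel \<alpha> m z w"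
    unfolding S_def CD_kernel_def sum_distrib_left
    by (intro sum.cong) (auto simp: split)
  then have K: "of_real (kappa \<alpha> m) * CD_kernel \<alpha> (Suc m) z w
      = S + poly (opuc \<alpha> m) z * cnj (poly (opuc \<alpha> m) w)"
    using pos[of m] by (simp add: CD_kernel_def distrib_left)
  show ?thesis
    unfolding mult.assoc K using christoffel_darboux[of \<alpha> m z w]
    by (simp add: S_def algebra_simps)
qed

lemma CD_kernel_self:
  assumes "\<And>i. i < m \<Longrightarrow> cmod (\<alpha> i) < 1"
  obtains r where "r > 0" "CD_kernel \<alpha> (Suc m) z z = of_real r"
proof
  define r where "r = (\<Sum>j<Suc m. (cmod (poly (opuc \<alpha> j) z))\<^sup>2 / kappa \<alpha> j)"
  show "CD_kernel \<alpha> (Suc m) z z = of_real r"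
    unfolding CD_kernel_def r_def of_real_sum
    by (intro sum.cong) (auto simp only: of_real_divide complex_norm_square)
  have pos: "kappa \<alpha> j > 0" if "j \<le> m" for j
    using that assms by (intro kappa_pos) auto
  have "r \<ge> (\<Sum>j\<in>{0}. (cmod (poly (opuc \<alpha> j) z))\<^sup>2 / kappa \<alpha> j)"
    unfolding r_def using pos by (intro sum_mono2) (auto intro!: divide_nonneg_pos)
  then show "r > 0" by simp
qed

text \<open>
  The range of the Verblunsky map on \<open>n\<close>-point measures. Only the first \<open>n\<close> entries of the sequence
  are constrained.
\<close>
definition verb_dom :: "nat \<Rightarrow> (nat \<Rightarrow> complex) set" where
  "verb_dom n = {\<alpha>. (\<forall>k. Suc k < n \<longrightarrow> cmod (\<alpha> k) < 1) \<and> cmod (\<alpha> (n - 1)) = 1}"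

lemma para_zero_iff:
  assumes "\<alpha> \<in> verb_dom (Suc m)" "poly (opuc \<alpha> (Suc m)) z = 0"
  shows "poly (ropuc \<alpha> m) z = \<alpha> m * (z * poly (opuc \<alpha> m) z)"
proof -
  have "\<alpha> m * cnj (\<alpha> m) = 1"
    using assms by (intro unimodular_mult_cnj) (simp add: verb_dom_def)
  then show ?thesis using assms(2) unfolding poly_opuc_Suc
    by (metis (no_types, lifting) eq_iff_diff_eq_0 mult.assoc mult_1)
qed

text \<open>
  At a zero of \<open>\<Phi>\<^sub>n\<close> the two terms on the left of the Christoffel-Darboux formula have equal modulus,
  because the last coefficient is unimodular; the kernel on the right is positive, so the factor
  \<open>1 - \<bar>z\<bar>\<^sup>2\<close> vanishes.
\<close>
lemma para_zero_cmod:
  assumes \<alpha>: "\<alpha> \<in> verb_dom (Suc m)" and z: "poly (opuc \<alpha> (Suc m)) z = 0"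
  shows "cmod z = 1"
proof -
  have a: "\<And>i. i < m \<Longrightarrow> cmod (\<alpha> i) < 1" using \<alpha> by (auto simp: verb_dom_def)
  have 1: "\<alpha> m * cnj (\<alpha> m) = 1"
    using \<alpha> by (intro unimodular_mult_cnj) (simp add: verb_dom_def)
  obtain r where r: "r > 0" "CD_kernel \<alpha> (Suc m) z z = of_real r"
    using CD_kernel_self[of m \<alpha> z, OF a] by blast
  have "poly (ropuc \<alpha> m) z * cnj (poly (ropuc \<alpha> m) z)
       - (z * poly (opuc \<alpha> m) z) * cnj (z * poly (opuc \<alpha> m) z) = 0"
    unfolding para_zero_iff[OF assms] using 1 by (simp add: algebra_simps)
  then have "(1 - z * cnj z) * of_real (kappa \<alpha> m) * of_real r = 0"
    using CD_kernel_eq[of m \<alpha> z z, OF a] r by simp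
  moreover have "kappa \<alpha> m > 0" by (rule kappa_pos[of m \<alpha>, OF a])
  ultimately have "z * cnj z = 1" using r by simp
  then have "complex_of_real ((cmod z)\<^sup>2) = of_real 1" unfolding complex_norm_square by simp
  then have "(cmod z)\<^sup>2 = 1\<^sup>2" unfolding of_real_eq_iff by simp
  then show ?thesis by (rule power2_eq_imp_eq) auto
qed

lemma para_kernel_factor:
  assumes \<alpha>: "\<alpha> \<in> verb_dom (Suc m)" and w: "poly (opuc \<alpha> (Suc m)) w = 0"
  shows "(1 - z * cnj w) * of_real (kappa \<alpha> m) * CD_kernel \<alpha> (Suc m) z w
       = - \<alpha> m * cnj (poly (ropuc \<alpha> m) w) * poly (opuc \<alpha> (Suc m)) z"
proof -
  have a: "\<And>i. i < m \<Longrightarrow> cmod (\<alpha> i) < 1" using \<alpha> by (auto simp: verb_dom_def)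
  have 1: "\<alpha> m * cnj (\<alpha> m) = 1"
    using \<alpha> by (intro unimodular_mult_cnj) (simp add: verb_dom_def)
  have "cnj (w * poly (opuc \<alpha> m) w) = \<alpha> m * cnj (poly (ropuc \<alpha> m) w)"
    unfolding para_zero_iff[OF assms] using 1
    by (metis complex_cnj_mult mult.assoc mult_1)
  note s = this
  have "(1 - z * cnj w) * of_real (kappa \<alpha> m) * CD_kernel \<alpha> (Suc m) z w
      = poly (ropuc \<alpha> m) z * cnj (poly (ropuc \<alpha> m) w)
        - (z * poly (opuc \<alpha> m) z) * cnj (w * poly (opuc \<alpha> m) w)"
    by (rule CD_kernel_eq[of m \<alpha> z w, OF a, symmetric])
  also have "\<dots> = (\<alpha> m * cnj (\<alpha> m)) * (poly (ropuc \<alpha> m) z * cnj (poly (ropuc \<alpha> m) w))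
        - (z * poly (opuc \<alpha> m) z) * (\<alpha> m * cnj (poly (ropuc \<alpha> m) w))"
    unfolding s 1 by simp
  also have "\<dots> = - \<alpha> m * cnj (poly (ropuc \<alpha> m) w) * poly (opuc \<alpha> (Suc m)) z"
    unfolding poly_opuc_Suc by (simp add: algebra_simps)
  finally show ?thesis .
qed

lemma para_kernel_orthogonal:
  assumes \<alpha>: "\<alpha> \<in> verb_dom (Suc m)" and z: "poly (opuc \<alpha> (Suc m)) z = 0"
    and w: "poly (opuc \<alpha> (Suc m)) w = 0" and "z \<noteq> w"
  shows "CD_kernel \<alpha> (Suc m) z w = 0"
proof -
  have "kappa \<alpha> m > 0" using \<alpha> by (intro kappa_pos) (auto simp: verb_dom_def)
  moreover have "1 - z * cnj w \<noteq> 0"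
  proof
    assume "1 - z * cnj w = 0"
    then have "w = (z * cnj w) * w" by (metis eq_iff_diff_eq_0 mult_1)
    also have "\<dots> = z * (w * cnj w)" by simp
    also have "\<dots> = z" using unimodular_mult_cnj[OF para_zero_cmod[OF \<alpha> w]] by simp
    finally show False using \<open>z \<noteq> w\<close> by simp
  qed
  moreover have "(1 - z * cnj w) * of_real (kappa \<alpha> m) * CD_kernel \<alpha> (Suc m) z w = 0"
    unfolding para_kernel_factor[OF \<alpha> w] z by simp
  ultimately show ?thesis by simp
qed

text \<open>
  A double zero \<open>w\<close> would make the derivative of \<open>(1 - z cnj w) K(z, w)\<close> vanish at \<open>w\<close>, hence
  \<open>K(w, w) = 0\<close>.
\<close>
lemma para_rsquarefree:
  assumes \<alpha>: "\<alpha> \<in> verb_dom (Suc m)"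
  shows "rsquarefree (opuc \<alpha> (Suc m))"
  unfolding rsquarefree_roots
proof (intro allI notI)
  fix w assume "poly (opuc \<alpha> (Suc m)) w = 0 \<and> poly (pderiv (opuc \<alpha> (Suc m))) w = 0"
  then have w: "poly (opuc \<alpha> (Suc m)) w = 0" and w': "poly (pderiv (opuc \<alpha> (Suc m))) w = 0" by auto
  have a: "\<And>i. i < m \<Longrightarrow> cmod (\<alpha> i) < 1" using \<alpha> by (auto simp: verb_dom_def)
  have ww: "w * cnj w = 1" by (rule unimodular_mult_cnj[OF para_zero_cmod[OF \<alpha> w]])
  \<comment> \<open>the kernel as a polynomial in its first argument\<close>
  define K where "K = (\<Sum>j<Suc m. Polynomial.smult (cnj (poly (opuc \<alpha> j) w) / of_real (kappa \<alpha> j)) (opuc \<alpha> j))"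
  have K: "poly K z = CD_kernel \<alpha> (Suc m) z w" for z
    by (simp add: K_def CD_kernel_def poly_sum mult.commute)
  define c where "c = - \<alpha> m * cnj (poly (ropuc \<alpha> m) w)"
  have eq: "Polynomial.smult (of_real (kappa \<alpha> m)) ([:1, - cnj w:] * K) = Polynomial.smult c (opuc \<alpha> (Suc m))"
    by (rule poly_ext)
       (use para_kernel_factor[OF \<alpha> w] in \<open>simp add: K c_def algebra_simps\<close>)
  have "poly (pderiv (Polynomial.smult (of_real (kappa \<alpha> m)) ([:1, - cnj w:] * K))) w = 0"
    unfolding eq pderiv_smult using w' by simp
  then have "of_real (kappa \<alpha> m) * (- cnj w * poly K w + (1 - w * cnj w) * poly (pderiv K) w) = 0"
    unfolding pderiv_smult pderiv_mult poly_smult poly_mult poly_add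
    by (simp add: pderiv_pCons mult.commute add.commute)
  moreover have "kappa \<alpha> m > 0" by (rule kappa_pos[of m \<alpha>, OF a])
  moreover have "cnj w \<noteq> 0" using ww by auto
  ultimately have "CD_kernel \<alpha> (Suc m) w w = 0" unfolding ww K by simp
  moreover obtain r where "r > 0" "CD_kernel \<alpha> (Suc m) w w = of_real r"
    using CD_kernel_self[of m \<alpha> w, OF a] by blast
  ultimately show False by simp
qed

definition para_zeros :: "(nat \<Rightarrow> complex) \<Rightarrow> nat \<Rightarrow> complex set" where
  "para_zeros \<alpha> n = {z. poly (opuc \<alpha> n) z = 0}"

lemma finite_para_zeros [simp]: "finite (para_zeros \<alpha> n)"
  unfolding para_zeros_def by (rule poly_roots_finite) simp

lemma opuc_eq_prod_para_zeros:
  assumes "\<alpha> \<in> verb_dom (Suc m)"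
  shows "opuc \<alpha> (Suc m) = (\<Prod>z\<in>para_zeros \<alpha> (Suc m). [:-z, 1:])"
  using complex_poly_decompose_rsquarefree[OF para_rsquarefree[OF assms]]
  by (simp add: para_zeros_def coeff_opuc_self)

lemma card_para_zeros:
  assumes "\<alpha> \<in> verb_dom (Suc m)"
  shows "card (para_zeros \<alpha> (Suc m)) = Suc m"
proof -
  have "Suc m = degree (\<Prod>z\<in>para_zeros \<alpha> (Suc m). [:-z, 1:])"
    using opuc_eq_prod_para_zeros[OF assms] degree_opuc[of \<alpha> "Suc m"] by simp
  also have "\<dots> = card (para_zeros \<alpha> (Suc m))"
    by (subst degree_prod_sum_eq) auto
  finally show ?thesis by simp
qed

text \<open>
  A one-sided inverse of a square matrix is two-sided. This turns the orthogonality of the kernel at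
  the zeros of \<open>\<Phi>\<^sub>n\<close> into orthogonality of the polynomials.
\<close>
lemma orthonormal_transpose:
  fixes A :: "nat \<Rightarrow> nat \<Rightarrow> complex"
  assumes "\<And>p q. p < n \<Longrightarrow> q < n \<Longrightarrow> (\<Sum>j<n. A p j * cnj (A q j)) = (if p = q then 1 else 0)"
    and "i < n" "j < n"
  shows "(\<Sum>p<n. cnj (A p i) * A p j) = (if i = j then 1 else 0)"
proof -
  define M where "M = mat n n (\<lambda>(p, j). A p j)"
  define N where "N = mat n n (\<lambda>(j, p). cnj (A p j))"
  have [simp]: "M \<in> carrier_mat n n" "N \<in> carrier_mat n n" by (auto simp: M_def N_def)
  have "M * N = 1\<^sub>m n"
    by (rule eq_matI) (auto simp: M_def N_def scalar_prod_def assms(1) atLeast0LessThan)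
  then have "N * M = 1\<^sub>m n"
    by (intro mat_mult_left_right_inverse[of M n N]) auto
  then have "(N * M) $$ (i, j) = (if i = j then 1 else 0)" using assms by simp
  then show ?thesis using assms(2,3) by (simp add: M_def N_def scalar_prod_def atLeast0LessThan)
qed

text \<open>
  The Christoffel numbers: the masses of the measure whose orthogonal polynomials are the \<open>\<Phi>\<^sub>k\<close>.
\<close>
definition para_weight :: "(nat \<Rightarrow> complex) \<Rightarrow> nat \<Rightarrow> complex \<Rightarrow> real" where
  "para_weight \<alpha> n z = 1 / Re (CD_kernel \<alpha> n z z)"

lemma para_weight_pos:
  assumes "\<alpha> \<in> verb_dom (Suc m)"
  shows "para_weight \<alpha> (Suc m) z > 0"
proof -
  have a: "\<And>i. i < m \<Longrightarrow> cmod (\<alpha> i) < 1" using assms by (auto simp: verb_dom_def)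
  obtain r where "r > 0" "CD_kernel \<alpha> (Suc m) z z = of_real r"
    using CD_kernel_self[of m \<alpha> z, OF a] by blast
  then show ?thesis by (simp add: para_weight_def)
qed

lemma para_orthogonality:
  assumes \<alpha>: "\<alpha> \<in> verb_dom (Suc m)" and ij: "i \<le> m" "j \<le> m"
  shows "(\<Sum>z\<in>para_zeros \<alpha> (Suc m). of_real (para_weight \<alpha> (Suc m) z)
            * (cnj (poly (opuc \<alpha> i) z) * poly (opuc \<alpha> j) z))
         = (if i = j then of_real (kappa \<alpha> i) else 0)"
proof -
  define n where "n = Suc m"
  define Z where "Z = para_zeros \<alpha> n"
  have a: "\<And>i. i < m \<Longrightarrow> cmod (\<alpha> i) < 1" using assms by (auto simp: verb_dom_def)
  have \<kappa>: "kappa \<alpha> j > 0" if "j < n" for j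
    using that a by (intro kappa_pos) (auto simp: n_def)
  have "finite Z" "card Z = n" using card_para_zeros[OF \<alpha>] by (simp_all add: Z_def n_def)
  then obtain \<zeta> where \<zeta>: "bij_betw \<zeta> {..<n} Z"
    using ex_bij_betw_nat_finite[of Z] by (auto simp: atLeast0LessThan)
  define w where "w = para_weight \<alpha> n"
  have w: "w z > 0" for z using para_weight_pos[OF \<alpha>] by (simp add: w_def n_def)
  have K1: "CD_kernel \<alpha> n z z = of_real (1 / w z)" for z
  proof -
    obtain r where "r > 0" "CD_kernel \<alpha> (Suc m) z z = of_real r"
      using CD_kernel_self[of m \<alpha> z, OF a] by blast
    then show ?thesis by (simp add: w_def para_weight_def n_def)
  qed
  define A where "A p j = of_real (sqrt (w (\<zeta> p))) * poly (opuc \<alpha> j) (\<zeta> p) / of_real (sqrt (kappa \<alpha> j))"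
    for p j
  have "(\<Sum>j<n. A p j * cnj (A q j)) = (if p = q then 1 else 0)" if pq: "p < n" "q < n" for p q
  proof -
    have "(\<Sum>j<n. A p j * cnj (A q j))
        = of_real (sqrt (w (\<zeta> p)) * sqrt (w (\<zeta> q))) * CD_kernel \<alpha> n (\<zeta> p) (\<zeta> q)"
      unfolding CD_kernel_def sum_distrib_left
    proof (intro sum.cong refl)
      fix j assume "j \<in> {..<n}"
      then have "complex_of_real (kappa \<alpha> j) = of_real (sqrt (kappa \<alpha> j)) * of_real (sqrt (kappa \<alpha> j))"
        using \<kappa>[of j] by (simp flip: of_real_mult)
      then show "A p j * cnj (A q j) = of_real (sqrt (w (\<zeta> p)) * sqrt (w (\<zeta> q)))
          * (poly (opuc \<alpha> j) (\<zeta> p) * cnj (poly (opuc \<alpha> j) (\<zeta> q)) / of_real (kappa \<alpha> j))"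
        by (simp add: A_def)
    qed
    also have "\<dots> = (if p = q then 1 else 0)"
    proof (cases "p = q")
      case True
      then show ?thesis
        using w[of "\<zeta> p"] by (simp add: K1 flip: of_real_mult)
    next
      case False
      then have "\<zeta> p \<noteq> \<zeta> q" using \<zeta> pq by (auto simp: bij_betw_def inj_on_def)
      moreover have "\<zeta> p \<in> Z" "\<zeta> q \<in> Z" using \<zeta> pq by (auto simp: bij_betw_def)
      ultimately have "CD_kernel \<alpha> n (\<zeta> p) (\<zeta> q) = 0"
        using para_kernel_orthogonal[OF \<alpha>] by (simp add: Z_def para_zeros_def n_def)
      then show ?thesis using False by simp
    qed
    finally show ?thesis .
  qed
  then have *: "(\<Sum>p<n. cnj (A p i) * A p j) = (if i = j then 1 else 0)"
    using ij by (intro orthonormal_transpose) (auto simp: n_def)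
  define s where "s = complex_of_real (sqrt (kappa \<alpha> i) * sqrt (kappa \<alpha> j))"
  have k: "kappa \<alpha> i > 0" "kappa \<alpha> j > 0" using ij \<kappa> by (auto simp: n_def)
  have "(\<Sum>z\<in>Z. of_real (w z) * (cnj (poly (opuc \<alpha> i) z) * poly (opuc \<alpha> j) z))
      = (\<Sum>p<n. of_real (w (\<zeta> p)) * (cnj (poly (opuc \<alpha> i) (\<zeta> p)) * poly (opuc \<alpha> j) (\<zeta> p)))"
    by (rule sum.reindex_bij_betw[OF \<zeta>, symmetric])
  also have "\<dots> = (\<Sum>p<n. s * (cnj (A p i) * A p j))"
  proof (intro sum.cong refl)
    fix p
    have "complex_of_real (w (\<zeta> p)) = of_real (sqrt (w (\<zeta> p))) * of_real (sqrt (w (\<zeta> p)))"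
      using w[of "\<zeta> p"] by (simp flip: of_real_mult)
    then show "of_real (w (\<zeta> p)) * (cnj (poly (opuc \<alpha> i) (\<zeta> p)) * poly (opuc \<alpha> j) (\<zeta> p))
        = s * (cnj (A p i) * A p j)"
      using k by (simp add: A_def s_def)
  qed
  also have "\<dots> = s * (if i = j then 1 else 0)"
    by (simp only: * flip: sum_distrib_left)
  also have "\<dots> = (if i = j then of_real (kappa \<alpha> i) else 0)"
    using k by (auto simp: s_def simp flip: of_real_mult)
  finally show ?thesis by (simp add: Z_def w_def n_def)
qed


section \<open>Measures with finitely many atoms\<close>

lemma space_circle [simp]: "space circle = sphere 0 1"
  by (simp add: space_restrict_space)

lemma singleton_sets_circle: "z \<in> sphere 0 1 \<Longrightarrow> {z} \<in> sets circle"
  by (auto simp: sets_restrict_space intro!: image_eqI[of _ _ "{z}"])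

lemma finite_sets_circle: "finite A \<Longrightarrow> A \<subseteq> sphere 0 1 \<Longrightarrow> A \<in> sets circle"
proof (induction A rule: finite_induct)
  case (insert a A)
  then show ?case
    using sets.Un[OF singleton_sets_circle[of a], of A] by simp
qed simp

lemma borel_measurable_circle_continuous:
  fixes f :: "complex \<Rightarrow> 'b :: topological_space"
  shows "continuous_on (sphere 0 1) f \<Longrightarrow> f \<in> borel_measurable circle"
  by (rule borel_measurable_continuous_on_restrict)

text \<open>
  Passing through \<open>distr\<close> places the atomic measure on the sigma algebra of the circle.
\<close>
definition fin_meas :: "complex set \<Rightarrow> (complex \<Rightarrow> real) \<Rightarrow> complex measure" where
  "fin_meas Z w = distr (point_measure Z (\<lambda>z. ennreal (w z))) circle (\<lambda>z. z)"

lemma fin_meas_cong: "(\<And>z. z \<in> Z \<Longrightarrow> w z = w' z) \<Longrightarrow> fin_meas Z w = fin_meas Z w'"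
proof -
  assume "\<And>z. z \<in> Z \<Longrightarrow> w z = w' z"
  then have "point_measure Z (\<lambda>z. ennreal (w z)) = point_measure Z (\<lambda>z. ennreal (w' z))"
    by (intro measure_eqI) (auto simp: point_measure_def emeasure_density intro!: nn_integral_cong)
  then show ?thesis by (simp add: fin_meas_def)
qed

locale weighted_points =
  fixes Z :: "complex set" and w :: "complex \<Rightarrow> real"
  assumes finZ: "finite Z" and ZT: "Z \<subseteq> sphere 0 1" and wpos: "\<And>z. z \<in> Z \<Longrightarrow> w z \<ge> 0"
begin

lemma meas_id: "(\<lambda>z. z) \<in> measurable (point_measure Z (\<lambda>z. ennreal (w z))) circle"
  using ZT by auto

lemma integral_fin_meas:
  fixes f :: "complex \<Rightarrow> 'b :: {banach, second_countable_topology}"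
  assumes "f \<in> borel_measurable circle"
  shows "integral\<^sup>L (fin_meas Z w) f = (\<Sum>z\<in>Z. w z *\<^sub>R f z)"
  unfolding fin_meas_def
  by (subst integral_distr[OF meas_id assms])
     (simp add: lebesgue_integral_point_measure_finite finZ wpos)

lemma emeasure_fin_meas:
  assumes "A \<in> sets circle"
  shows "emeasure (fin_meas Z w) A = ennreal (\<Sum>z\<in>Z \<inter> A. w z)"
proof -
  have "emeasure (fin_meas Z w) A = emeasure (point_measure Z (\<lambda>z. ennreal (w z))) (Z \<inter> A)"
    unfolding fin_meas_def using assms
    by (subst emeasure_distr[OF meas_id]) (auto simp: space_point_measure Int_commute)
  also have "\<dots> = (\<Sum>z\<in>Z \<inter> A. ennreal (w z))"
    by (subst emeasure_point_measure_finite) (auto simp: finZ)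
  also have "\<dots> = ennreal (\<Sum>z\<in>Z \<inter> A. w z)"
    using wpos by (intro sum_ennreal) auto
  finally show ?thesis .
qed

lemma measure_fin_meas:
  assumes "A \<in> sets circle"
  shows "measure (fin_meas Z w) A = (\<Sum>z\<in>Z \<inter> A. w z)"
  using emeasure_fin_meas[OF assms] wpos by (auto simp: measure_def intro!: sum_nonneg enn2real_ennreal)

lemma fin_meas_prob:
  assumes "(\<Sum>z\<in>Z. w z) = 1"
  shows "fin_meas Z w \<in> space (prob_algebra circle)"
proof -
  have "prob_space (fin_meas Z w)"
  proof
    have "emeasure (fin_meas Z w) (space circle) = ennreal (\<Sum>z\<in>Z \<inter> space circle. w z)"
      by (rule emeasure_fin_meas[OF sets.top])
    moreover have "Z \<inter> space circle = Z" using ZT by auto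
    ultimately have "emeasure (fin_meas Z w) (space circle) = 1" using assms by (simp only: ennreal_1)
    then show "emeasure (fin_meas Z w) (space (fin_meas Z w)) = 1"
      by (simp add: fin_meas_def)
  qed
  then show ?thesis by (simp add: space_prob_algebra fin_meas_def)
qed

end

lemma prob_algebra_circleD:
  assumes "\<nu> \<in> space (prob_algebra circle)"
  shows "sets \<nu> = sets circle" "space \<nu> = sphere 0 1" "prob_space \<nu>"
  using assms sets_eq_imp_space_eq[of \<nu> circle] by (auto simp: space_prob_algebra)

lemma eq_fin_meas:
  assumes \<nu>: "\<nu> \<in> space (prob_algebra circle)" and S: "finite S" "S \<subseteq> sphere 0 1" "measure \<nu> S = 1"
  shows "\<nu> = fin_meas S (\<lambda>z. measure \<nu> {z})"
proof (rule measure_eqI)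
  interpret prob_space \<nu> using prob_algebra_circleD[OF \<nu>] by simp
  interpret W: weighted_points S "\<lambda>z. measure \<nu> {z}"
    using S by unfold_locales auto
  note s = prob_algebra_circleD(1)[OF \<nu>]
  show "sets \<nu> = sets (fin_meas S (\<lambda>z. measure \<nu> {z}))" by (simp add: s fin_meas_def)
  fix A assume A: "A \<in> sets \<nu>"
  have Sset: "S \<in> sets \<nu>" using finite_sets_circle[OF S(1,2)] s by simp
  have sing: "{z} \<in> sets \<nu>" if "z \<in> S" for z using singleton_sets_circle[of z] S(2) that s by auto
  have "AE x in \<nu>. x \<in> S" using S(3) by (rule AE_prob_1)
  then have "emeasure \<nu> A = emeasure \<nu> (S \<inter> A)"
    using A Sset by (intro emeasure_eq_AE) auto
  also have "\<dots> = (\<Sum>z\<in>S \<inter> A. emeasure \<nu> {z})"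
    using S(1) sing by (intro emeasure_eq_sum_singleton) auto
  also have "\<dots> = ennreal (\<Sum>z\<in>S \<inter> A. measure \<nu> {z})"
    by (simp add: emeasure_eq_measure sum_ennreal)
  also have "\<dots> = emeasure (fin_meas S (\<lambda>z. measure \<nu> {z})) A"
    using W.emeasure_fin_meas[of A] A s by simp
  finally show "emeasure \<nu> A = emeasure (fin_meas S (\<lambda>z. measure \<nu> {z})) A" .
qed

lemma n_point_measuresD:
  assumes "\<nu> \<in> n_point_measures n"
  shows "\<nu> \<in> space (prob_algebra circle)" "finite (atoms \<nu>)" "card (atoms \<nu>) = n"
    "atoms \<nu> \<subseteq> sphere 0 1" "\<nu> = fin_meas (atoms \<nu>) (\<lambda>z. measure \<nu> {z})"
    "weighted_points (atoms \<nu>) (\<lambda>z. measure \<nu> {z})" "\<And>z. z \<in> atoms \<nu> \<Longrightarrow> measure \<nu> {z} > 0"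
proof -
  show *: "\<nu> \<in> space (prob_algebra circle)" "finite (atoms \<nu>)" "card (atoms \<nu>) = n"
    "atoms \<nu> \<subseteq> sphere 0 1" "\<And>z. z \<in> atoms \<nu> \<Longrightarrow> measure \<nu> {z} > 0"
    using assms by (auto simp: n_point_measures_def atoms_def)
  show "\<nu> = fin_meas (atoms \<nu>) (\<lambda>z. measure \<nu> {z})"
    using * assms by (intro eq_fin_meas) (auto simp: n_point_measures_def)
  show "weighted_points (atoms \<nu>) (\<lambda>z. measure \<nu> {z})"
    using * by unfold_locales auto
qed

lemma integral_n_point:
  fixes f :: "complex \<Rightarrow> 'b :: {banach, second_countable_topology}"
  assumes "\<nu> \<in> n_point_measures n" "f \<in> borel_measurable circle"
  shows "integral\<^sup>L \<nu> f = (\<Sum>z\<in>atoms \<nu>. measure \<nu> {z} *\<^sub>R f z)"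
proof -
  have "integral\<^sup>L \<nu> f = integral\<^sup>L (fin_meas (atoms \<nu>) (\<lambda>z. measure \<nu> {z})) f"
    by (rule arg_cong[OF n_point_measuresD(5)[OF assms(1)]])
  also have "\<dots> = (\<Sum>z\<in>atoms \<nu>. measure \<nu> {z} *\<^sub>R f z)"
    by (rule weighted_points.integral_fin_meas[OF n_point_measuresD(6)[OF assms(1)] assms(2)])
  finally show ?thesis .
qed

lemma poly_meas [simp]:
  "(\<lambda>z. cnj (poly q z) * poly p z) \<in> borel_measurable circle"
  "(\<lambda>z. poly p z) \<in> borel_measurable circle" "poly p \<in> borel_measurable circle"
  by (intro borel_measurable_circle_continuous continuous_intros)+

section \<open>Orthogonal polynomials of an atomic measure\<close>

definition lagrange :: "complex set \<Rightarrow> complex \<Rightarrow> complex poly" where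
  "lagrange Z z = (\<Prod>y\<in>Z-{z}. Polynomial.smult (1 / (z - y)) [:-y, 1:])"

lemma degree_lagrange:
  assumes "finite Z" "z \<in> Z"
  shows "degree (lagrange Z z) < card Z"
proof -
  have "degree (lagrange Z z) \<le> (\<Sum>y\<in>Z-{z}. degree (Polynomial.smult (1 / (z - y)) [:-y, 1:]))"
    unfolding lagrange_def
    using degree_prod_sum_le[of "Z - {z}" "\<lambda>y. Polynomial.smult (1 / (z - y)) [:-y, 1:]"] assms(1)
    unfolding o_def by blast
  also have "\<dots> \<le> (\<Sum>y\<in>Z-{z}. 1)"
    by (intro sum_mono) auto
  also have "\<dots> < card Z" using assms by (auto simp: card_gt_0_iff intro!: diff_less)
  finally show ?thesis .
qed

lemma poly_lagrange:
  assumes "finite Z" "z \<in> Z" "y \<in> Z"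
  shows "poly (lagrange Z z) y = (if y = z then 1 else 0)"
proof (cases "y = z")
  case True
  then show ?thesis unfolding lagrange_def poly_prod
    by (auto intro!: prod.neutral simp: diff_divide_distrib[symmetric] split: if_splits)
next
  case False
  then show ?thesis unfolding lagrange_def poly_prod using assms by (auto intro!: bexI[of _ y])
qed

lemma sum_lagrange:
  assumes "finite Z" "Z \<noteq> {}"
  shows "(\<Sum>z\<in>Z. lagrange Z z) = 1"
proof (rule poly_eqI_degree)
  fix y assume "y \<in> Z"
  then show "poly (\<Sum>z\<in>Z. lagrange Z z) y = poly 1 y"
    using assms by (simp add: poly_sum poly_lagrange)
next
  have "degree (\<Sum>z\<in>Z. lagrange Z z) \<le> card Z - 1"
  proof (intro degree_sum_le)
    fix z assume "z \<in> Z"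
    then show "degree (lagrange Z z) \<le> card Z - 1" using degree_lagrange[OF assms(1), of z] by linarith
  qed (rule assms(1))
  moreover have "card Z > 0" using assms by (simp add: card_gt_0_iff)
  ultimately show "degree (\<Sum>z\<in>Z. lagrange Z z) < card Z" by linarith
  show "degree (1 :: complex poly) < card Z" using \<open>card Z > 0\<close> by simp
qed

lemma monic_span:
  fixes P :: "nat \<Rightarrow> complex poly"
  assumes "\<And>i. i < j \<Longrightarrow> degree (P i) = i \<and> coeff (P i) i = 1" and "\<And>i. i \<ge> j \<Longrightarrow> coeff q i = 0"
  shows "\<exists>c. q = (\<Sum>i<j. Polynomial.smult (c i) (P i))"
  using assms
proof (induction j arbitrary: q)
  case 0
  then show ?case by (auto simp: poly_eq_iff)
next
  case (Suc j)
  define q' where "q' = q - Polynomial.smult (coeff q j) (P j)"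
  have "coeff q' i = 0" if "i \<ge> j" for i
  proof (cases "i = j")
    case True
    then show ?thesis using Suc.prems(1)[of j] by (auto simp: q'_def)
  next
    case False
    then have "coeff (P j) i = 0" using Suc.prems(1)[of j] that by (intro coeff_eq_0) auto
    then show ?thesis using Suc.prems(2)[of i] False that by (simp add: q'_def)
  qed
  moreover have "degree (P i) = i \<and> coeff (P i) i = 1" if "i < j" for i
    using Suc.prems(1)[of i] that by simp
  ultimately have "\<exists>c. q' = (\<Sum>i<j. Polynomial.smult (c i) (P i))"
    by (intro Suc.IH) blast+
  then obtain c where c: "q' = (\<Sum>i<j. Polynomial.smult (c i) (P i))" by blast
  have "q = (\<Sum>i<Suc j. Polynomial.smult ((c(j := coeff q j)) i) (P i))"
    using c by (simp add: q'_def algebra_simps)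
  then show ?case by blast
qed

lemma coeff_above_degree: "degree q < j \<Longrightarrow> i \<ge> j \<Longrightarrow> coeff q i = 0"
  by (simp add: coeff_eq_0)

locale positive_points = weighted_points +
  assumes wpos': "\<And>z. z \<in> Z \<Longrightarrow> w z > 0"
begin

definition ip :: "complex poly \<Rightarrow> complex poly \<Rightarrow> complex" where
  "ip q p = (\<Sum>z\<in>Z. w z *\<^sub>R (cnj (poly q z) * poly p z))"

lemma ip_add: "ip q (p + p') = ip q p + ip q p'" "ip (q + q') p = ip q p + ip q' p"
  by (simp_all add: ip_def algebra_simps sum.distrib)

lemma ip_diff: "ip q (p - p') = ip q p - ip q p'"
  by (simp add: ip_def algebra_simps sum_subtractf)

lemma ip_smult: "ip q (Polynomial.smult c p) = c * ip q p" "ip (Polynomial.smult c q) p = cnj c * ip q p"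
  by (simp_all add: ip_def sum_distrib_left algebra_simps)

lemma ip_0: "ip q 0 = 0" "ip 0 q = 0"
  by (simp_all add: ip_def)

lemma ip_sum: "ip q (\<Sum>i\<in>I. f i) = (\<Sum>i\<in>I. ip q (f i))" "ip (\<Sum>i\<in>I. f i) p = (\<Sum>i\<in>I. ip (f i) p)"
  by (induction I rule: infinite_finite_induct; simp add: ip_add ip_0)+

lemma ip_self: "ip p p = of_real (\<Sum>z\<in>Z. w z * (cmod (poly p z))\<^sup>2)"
  unfolding ip_def of_real_sum
  by (intro sum.cong refl) (simp only: of_real_mult complex_norm_square scaleR_conv_of_real mult_ac)

lemma norm_pos:
  assumes "p \<noteq> 0" "degree p < card Z"
  shows "(\<Sum>z\<in>Z. w z * (cmod (poly p z))\<^sup>2) > 0"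
proof -
  have "\<exists>z\<in>Z. poly p z \<noteq> 0"
  proof (rule ccontr)
    assume "\<not> (\<exists>z\<in>Z. poly p z \<noteq> 0)"
    then have "p = 0"
      using assms(2) by (intro poly_eqI_degree[of Z p 0]) auto
    with assms show False by simp
  qed
  then obtain z where "z \<in> Z" "poly p z \<noteq> 0" by blast
  then show ?thesis
    using finZ wpos wpos'[of z] by (intro sum_pos2[of Z z]) auto
qed

lemma ip_self_nonzero: "p \<noteq> 0 \<Longrightarrow> degree p < card Z \<Longrightarrow> ip p p \<noteq> 0"
  using norm_pos[of p] unfolding ip_self by (metis less_irrefl of_real_eq_0_iff)

text \<open>
  The defining property of \<open>monic_OP\<close> at a degree below the number of atoms.
\<close>
definition is_mop :: "nat \<Rightarrow> complex poly \<Rightarrow> bool" where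
  "is_mop j p \<longleftrightarrow> degree p = j \<and> lead_coeff p = 1 \<and> (\<forall>q. degree q < j \<longrightarrow> ip q p = 0)"

lemma mop_unique:
  assumes "j < card Z" "is_mop j p" "is_mop j p'"
  shows "p = p'"
proof (rule ccontr)
  assume ne: "p \<noteq> p'"
  have c: "coeff (p - p') i = 0" if "i \<ge> j" for i
    using that assms unfolding is_mop_def
    by (cases "i = j") (auto simp: coeff_eq_0)
  have "degree (p - p') < j"
  proof (rule ccontr)
    assume "\<not> degree (p - p') < j"
    then have "lead_coeff (p - p') = 0" by (intro c) auto
    then have "p - p' = 0" by (simp only: leading_coeff_0_iff)
    then show False using ne by simp
  qed
  then have "ip (p - p') (p - p') = 0"
    using assms by (simp add: is_mop_def ip_diff)
  moreover have "ip (p - p') (p - p') \<noteq> 0"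
    using ne \<open>degree (p - p') < j\<close> assms by (intro ip_self_nonzero) auto
  ultimately show False by simp
qed

lemma orth_span:
  assumes "\<And>i. i < j \<Longrightarrow> degree (P i) = i \<and> coeff (P i) i = 1" "\<And>i. i < j \<Longrightarrow> ip (P i) p = 0"
    and "degree q < j"
  shows "ip q p = 0"
proof -
  obtain c where "q = (\<Sum>i<j. Polynomial.smult (c i) (P i))"
    using monic_span[of j P q] assms(1) coeff_above_degree[OF assms(3)] by blast
  then show ?thesis using assms(2) by (simp add: ip_sum ip_smult)
qed

text \<open>
  Gram-Schmidt.
\<close>
lemma mop_exists: "j < card Z \<Longrightarrow> \<exists>p. is_mop j p"
proof (induction j rule: less_induct)
  case (less j)
  then have "\<forall>i\<in>{..<j}. \<exists>p. is_mop i p" by auto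
  then obtain P where P: "\<forall>i\<in>{..<j}. is_mop i (P i)" by (rule bchoice[THEN exE])
  then have dP: "degree (P i) = i \<and> coeff (P i) i = 1" if "i < j" for i
    using P that unfolding is_mop_def by (metis lessThan_iff)
  have orth: "ip (P i) (P k) = 0" if "i < j" "k < j" "i \<noteq> k" for i k
  proof (cases "i < k")
    case True
    then show ?thesis using P that dP[of i] by (auto simp: is_mop_def)
  next
    case False
    then have "ip (P k) (P i) = 0" using P that dP[of k] by (auto simp: is_mop_def)
    moreover have "ip (P i) (P k) = cnj (ip (P k) (P i))"
      by (simp add: ip_def mult.commute)
    ultimately show ?thesis by simp
  qed
  define M where "M = monom (1::complex) j"
  define R where "R = (\<Sum>i<j. Polynomial.smult (ip (P i) M / ip (P i) (P i)) (P i))"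
  have nz: "ip (P i) (P i) \<noteq> 0" if "i < j" for i
    using dP[OF that] that less.prems by (intro ip_self_nonzero) auto
  have RM: "ip (P i) R = ip (P i) M" if "i < j" for i
  proof -
    have "ip (P i) R = (\<Sum>k<j. (ip (P k) M / ip (P k) (P k)) * ip (P i) (P k))"
      by (simp add: R_def ip_sum ip_smult)
    also have "\<dots> = (\<Sum>k<j. if k = i then ip (P i) M else 0)"
      using nz orth that by (intro sum.cong) auto
    also have "\<dots> = ip (P i) M" using that by simp
    finally show ?thesis .
  qed
  have cR: "coeff R i = 0" if "i \<ge> j" for i
    unfolding R_def coeff_sum using that dP by (intro sum.neutral) (auto simp: coeff_eq_0)
  have cj: "coeff (M - R) j = 1" using cR[of j] by (simp add: M_def)
  moreover have "degree (M - R) \<le> j"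
    by (rule degree_le) (use cR in \<open>auto simp: M_def\<close>)
  ultimately have d: "degree (M - R) = j" by (metis le_antisym le_degree zero_neq_one)
  have "ip q (M - R) = 0" if "degree q < j" for q
    by (rule orth_span[of j P]) (use dP RM that in \<open>auto simp: ip_diff\<close>)
  then have "is_mop j (M - R)" using d cj by (simp add: is_mop_def)
  then show ?case by blast
qed

end

lemma positive_points_n_point:
  "\<nu> \<in> n_point_measures n \<Longrightarrow> positive_points (atoms \<nu>) (\<lambda>z. measure \<nu> {z})"
  using n_point_measuresD(6,7)[of \<nu> n]
  by (auto simp: positive_points_def positive_points_axioms_def)

lemma monic_OP_mop:
  assumes \<nu>: "\<nu> \<in> n_point_measures n" and j: "j < n"
  shows "positive_points.is_mop (atoms \<nu>) (\<lambda>z. measure \<nu> {z}) j (monic_OP \<nu> j)"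
    and "positive_points.is_mop (atoms \<nu>) (\<lambda>z. measure \<nu> {z}) j p \<Longrightarrow> monic_OP \<nu> j = p"
proof -
  interpret positive_points "atoms \<nu>" "\<lambda>z. measure \<nu> {z}" by (rule positive_points_n_point[OF \<nu>])
  have c: "card (atoms \<nu>) = n" by (rule n_point_measuresD(3)[OF \<nu>])
  have "is_mop j p \<longleftrightarrow> (degree p = j \<and> lead_coeff p = 1 \<and>
              (\<forall>q. degree q < j \<longrightarrow> (\<integral>z. cnj (poly q z) * poly p z \<partial>\<nu>) = 0))" for p
    unfolding is_mop_def ip_def by (subst integral_n_point[OF \<nu>]) auto
  then have eq: "monic_OP \<nu> j = (THE p. is_mop j p)"
    using j c by (simp add: monic_OP_def)
  have ex: "\<exists>!p. is_mop j p"
    using mop_exists[of j] mop_unique[of j] j c by blast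
  show "is_mop j (monic_OP \<nu> j)" unfolding eq by (rule theI'[OF ex])
  show "is_mop j p \<Longrightarrow> monic_OP \<nu> j = p" unfolding eq using ex by (rule the1_equality)
qed

lemma poly_ext_nonzero:
  fixes p q :: "complex poly"
  assumes "\<And>z. z \<noteq> 0 \<Longrightarrow> poly p z = poly q z"
  shows "p = q"
proof (rule ccontr)
  assume "p \<noteq> q"
  then have "finite {z. poly (p - q) z = 0}" by (intro poly_roots_finite) simp
  moreover have "UNIV - {0} \<subseteq> {z. poly (p - q) z = 0}" using assms by auto
  ultimately have "finite (UNIV - {0 :: complex})" by (rule rev_finite_subset)
  then show False by (simp add: infinite_UNIV_char_0)
qed

text \<open>
  The recursion in \<open>has_verblunsky\<close> is stated off the origin and with values of \<open>1 / cnj z\<close>; it is the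
  Szego recursion because both sides are polynomials.
\<close>
lemma has_verblunsky_iff:
  assumes "\<nu> \<in> n_point_measures n" "n > 0"
  shows "has_verblunsky \<nu> n \<alpha> \<longleftrightarrow> (\<forall>k\<le>n. monic_OP \<nu> k = opuc \<alpha> k)"
proof
  assume h: "has_verblunsky \<nu> n \<alpha>"
  interpret positive_points "atoms \<nu>" "\<lambda>z. measure \<nu> {z}" by (rule positive_points_n_point[OF assms(1)])
  have "monic_OP \<nu> k = opuc \<alpha> k" if "k \<le> n" for k
    using that
  proof (induction k)
    case 0
    have "is_mop 0 1" by (simp add: is_mop_def)
    then show ?case using monic_OP_mop(2)[OF assms(1), of 0 1] assms by simp
  next
    case (Suc k)
    show ?case
    proof (rule poly_ext_nonzero)
      fix z :: complex assume z: "z \<noteq> 0"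
      have "poly (monic_OP \<nu> (Suc k)) z =
          z * poly (monic_OP \<nu> k) z
          - cnj (\<alpha> k) * (z ^ k * cnj (poly (monic_OP \<nu> k) (1 / cnj z)))"
        using h z Suc.prems by (simp add: has_verblunsky_def)
      also have "\<dots> = z * poly (opuc \<alpha> k) z - cnj (\<alpha> k) * poly (ropuc \<alpha> k) z"
        using Suc szego_reversal[OF z, of \<alpha> k] by simp
      finally show "poly (monic_OP \<nu> (Suc k)) z = poly (opuc \<alpha> (Suc k)) z"
        by (simp only: poly_opuc_Suc)
    qed
  qed
  then show "\<forall>k\<le>n. monic_OP \<nu> k = opuc \<alpha> k" by blast
next
  assume h: "\<forall>k\<le>n. monic_OP \<nu> k = opuc \<alpha> k"
  show "has_verblunsky \<nu> n \<alpha>"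
    unfolding has_verblunsky_def
  proof (intro allI impI)
    fix k and z :: complex assume "k < n" "z \<noteq> 0"
    then show "poly (monic_OP \<nu> (Suc k)) z =
          z * poly (monic_OP \<nu> k) z
          - cnj (\<alpha> k) * (z ^ k * cnj (poly (monic_OP \<nu> k) (1 / cnj z)))"
      using h szego_reversal[of z \<alpha> k] by (simp add: poly_opuc_Suc)
  qed
qed

lemma atoms_verblunsky:
  assumes "\<nu> \<in> n_point_measures n" "n > 0" "has_verblunsky \<nu> n \<alpha>"
  shows "atoms \<nu> = para_zeros \<alpha> n"
proof -
  have "opuc \<alpha> n = monic_OP \<nu> n" using assms has_verblunsky_iff by auto
  also have "\<dots> = (\<Prod>\<zeta>\<in>atoms \<nu>. [:- \<zeta>, 1:])"
    using n_point_measuresD(3)[OF assms(1)] by (simp add: monic_OP_def)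
  finally show ?thesis
    using n_point_measuresD(2)[OF assms(1)] by (auto simp: para_zeros_def poly_prod)
qed

text \<open>
  The recursion is an orthogonal decomposition \<open>z \<Phi>\<^sub>k = \<Phi>\<^sub>k\<^sub>+\<^sub>1 + cnj (\<alpha> k) \<Phi>\<^sub>k\<^sup>*\<close> with
  \<open>\<parallel>\<Phi>\<^sub>k\<^sup>*\<parallel> = \<parallel>\<Phi>\<^sub>k\<parallel>\<close>, so \<open>\<bar>\<alpha> k\<bar>\<^sup>2 = 1 - \<parallel>\<Phi>\<^sub>k\<^sub>+\<^sub>1\<parallel>\<^sup>2 / \<parallel>\<Phi>\<^sub>k\<parallel>\<^sup>2\<close>. The norm is positive below degree \<open>n\<close>,
  and \<open>\<Phi>\<^sub>n\<close> vanishes on the support.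
\<close>
lemma verblunsky_in_dom:
  assumes \<nu>: "\<nu> \<in> n_point_measures n" and n: "n > 0" and h: "has_verblunsky \<nu> n \<alpha>"
  shows "\<alpha> \<in> verb_dom n"
proof -
  interpret positive_points "atoms \<nu>" "\<lambda>z. measure \<nu> {z}" by (rule positive_points_n_point[OF \<nu>])
  have op: "monic_OP \<nu> k = opuc \<alpha> k" if "k \<le> n" for k
    using that has_verblunsky_iff[OF \<nu> n] h by blast
  have card: "card (atoms \<nu>) = n" by (rule n_point_measuresD(3)[OF \<nu>])
  define N where "N k = (\<Sum>z\<in>atoms \<nu>. measure \<nu> {z} * (cmod (poly (opuc \<alpha> k) z))\<^sup>2)" for k
  have Npos: "N k > 0" if "k < n" for k
    unfolding N_def using that card by (intro norm_pos) auto
  have Nn: "N n = 0"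
    unfolding N_def using atoms_verblunsky[OF assms] by (auto simp: para_zeros_def)
  have rec: "N k = N (Suc k) + (cmod (\<alpha> k))\<^sup>2 * N k" if k: "k < n" for k
  proof -
    have orth: "ip (ropuc \<alpha> k) (opuc \<alpha> (Suc k)) = 0"
    proof (cases "Suc k = n")
      case True
      then show ?thesis unfolding ip_def using atoms_verblunsky[OF assms] by (auto simp: para_zeros_def)
    next
      case False
      then have "is_mop (Suc k) (opuc \<alpha> (Suc k))"
        using monic_OP_mop(1)[OF \<nu>, of "Suc k"] op[of "Suc k"] k by simp
      moreover have "degree (ropuc \<alpha> k) < Suc k" using degree_opuc_le[of \<alpha> k] by simp
      ultimately show ?thesis unfolding is_mop_def by blast
    qed
    have pt: "(cmod (poly (opuc \<alpha> k) z))\<^sup>2 = (cmod (poly (opuc \<alpha> (Suc k)) z))\<^sup>2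
        + (cmod (\<alpha> k))\<^sup>2 * (cmod (poly (opuc \<alpha> k) z))\<^sup>2
        + 2 * Re (\<alpha> k * (cnj (poly (ropuc \<alpha> k) z) * poly (opuc \<alpha> (Suc k)) z))"
      if "z \<in> atoms \<nu>" for z
    proof -
      have z: "cmod z = 1" using that by (auto simp: atoms_def)
      have "(cmod (poly (opuc \<alpha> k) z))\<^sup>2 = (cmod (z * poly (opuc \<alpha> k) z))\<^sup>2"
        using z by (simp add: norm_mult)
      also have "z * poly (opuc \<alpha> k) z
          = poly (opuc \<alpha> (Suc k)) z + cnj (\<alpha> k) * poly (ropuc \<alpha> k) z"
        by (simp add: poly_opuc_Suc)
      also have "(cmod \<dots>)\<^sup>2 = (cmod (poly (opuc \<alpha> (Suc k)) z))\<^sup>2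
          + (cmod (cnj (\<alpha> k) * poly (ropuc \<alpha> k) z))\<^sup>2
          + 2 * Re (poly (opuc \<alpha> (Suc k)) z * cnj (cnj (\<alpha> k) * poly (ropuc \<alpha> k) z))"
        by (simp only: cmod_power2 plus_complex.sel Re_complex_of_real complex_cnj times_complex.sel cnj.sel)
           (simp add: power2_eq_square algebra_simps)
      also have "(cmod (cnj (\<alpha> k) * poly (ropuc \<alpha> k) z))\<^sup>2
          = (cmod (\<alpha> k))\<^sup>2 * (cmod (poly (opuc \<alpha> k) z))\<^sup>2"
        by (simp add: norm_mult power_mult_distrib cmod_ropuc_circle[OF z])
      also have "poly (opuc \<alpha> (Suc k)) z * cnj (cnj (\<alpha> k) * poly (ropuc \<alpha> k) z)
          = \<alpha> k * (cnj (poly (ropuc \<alpha> k) z) * poly (opuc \<alpha> (Suc k)) z)"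
        by (simp add: mult_ac)
      finally show ?thesis .
    qed
    have "N k = (\<Sum>z\<in>atoms \<nu>. measure \<nu> {z} * (cmod (poly (opuc \<alpha> (Suc k)) z))\<^sup>2
        + (cmod (\<alpha> k))\<^sup>2 * (measure \<nu> {z} * (cmod (poly (opuc \<alpha> k) z))\<^sup>2)
        + 2 * Re (\<alpha> k * (measure \<nu> {z} *\<^sub>R (cnj (poly (ropuc \<alpha> k) z) * poly (opuc \<alpha> (Suc k)) z))))"
      unfolding N_def by (intro sum.cong refl, subst pt) (simp_all add: algebra_simps)
    also have "\<dots> = N (Suc k) + (cmod (\<alpha> k))\<^sup>2 * N k
        + 2 * Re (\<alpha> k * ip (ropuc \<alpha> k) (opuc \<alpha> (Suc k)))"
      unfolding N_def ip_def sum.distrib sum_distrib_left Re_sum by simp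
    finally show ?thesis by (simp add: orth)
  qed
  have sq: "(cmod (\<alpha> k))\<^sup>2 = 1 - N (Suc k) / N k" if "k < n" for k
    using rec[OF that] Npos[OF that] by (simp add: field_simps)
  have "cmod (\<alpha> k) < 1" if "Suc k < n" for k
  proof -
    have "(cmod (\<alpha> k))\<^sup>2 < 1\<^sup>2" using sq[of k] Npos[of k] Npos[of "Suc k"] that by simp
    then show ?thesis by (rule power2_less_imp_less) simp
  qed
  moreover have "cmod (\<alpha> (n - 1)) = 1"
  proof -
    have "(cmod (\<alpha> (n - 1)))\<^sup>2 = 1\<^sup>2" using sq[of "n - 1"] Nn n by simp
    then show ?thesis by (rule power2_eq_imp_eq) auto
  qed
  ultimately show ?thesis by (simp add: verb_dom_def)
qed

lemma para_measure:
  assumes \<alpha>: "\<alpha> \<in> verb_dom (Suc m)"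
  defines "\<mu> \<equiv> fin_meas (para_zeros \<alpha> (Suc m)) (para_weight \<alpha> (Suc m))"
  shows "\<mu> \<in> n_point_measures (Suc m)" "has_verblunsky \<mu> (Suc m) \<alpha>"
    and "\<And>i j. i \<le> m \<Longrightarrow> j \<le> m \<Longrightarrow> (\<integral>z. cnj (poly (opuc \<alpha> i) z) * poly (opuc \<alpha> j) z \<partial>\<mu>)
            = (if i = j then of_real (kappa \<alpha> i) else 0)"
proof -
  define Z where "Z = para_zeros \<alpha> (Suc m)"
  define w where "w = para_weight \<alpha> (Suc m)"
  have \<mu>: "\<mu> = fin_meas Z w" by (simp add: \<mu>_def Z_def w_def)
  have ZT: "Z \<subseteq> sphere 0 1" using para_zero_cmod[OF \<alpha>] by (auto simp: Z_def para_zeros_def)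
  have finZ: "finite Z" and card: "card Z = Suc m"
    using card_para_zeros[OF \<alpha>] by (simp_all add: Z_def)
  have w: "w z > 0" for z using para_weight_pos[OF \<alpha>] by (simp add: w_def)
  interpret positive_points Z w
    using ZT finZ w by unfold_locales (auto intro: less_imp_le)
  have orth: "ip (opuc \<alpha> i) (opuc \<alpha> j) = (if i = j then of_real (kappa \<alpha> i) else 0)"
    if "i \<le> m" "j \<le> m" for i j
    using para_orthogonality[OF \<alpha> that] unfolding ip_def by (simp add: Z_def w_def scaleR_conv_of_real)
  show "(\<integral>z. cnj (poly (opuc \<alpha> i) z) * poly (opuc \<alpha> j) z \<partial>\<mu>)
            = (if i = j then of_real (kappa \<alpha> i) else 0)" if "i \<le> m" "j \<le> m" for i j
    unfolding \<mu> orth[OF that, symmetric] ip_def by (rule integral_fin_meas) simp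
  have "complex_of_real (\<Sum>z\<in>Z. w z) = 1"
    using orth[of 0 0] by (simp add: ip_def scaleR_conv_of_real)
  then have sum1: "(\<Sum>z\<in>Z. w z) = 1" by (simp only: of_real_eq_1_iff)
  have \<mu>P: "\<mu> \<in> space (prob_algebra circle)" unfolding \<mu> by (rule fin_meas_prob[OF sum1])
  have meas: "measure \<mu> {z} = (if z \<in> Z then w z else 0)" if "z \<in> sphere 0 1" for z
    unfolding \<mu> measure_fin_meas[OF singleton_sets_circle[OF that]] by (simp add: Int_insert_right)
  have atoms: "atoms \<mu> = Z"
    using ZT w meas by (auto simp: atoms_def split: if_splits)
  show np: "\<mu> \<in> n_point_measures (Suc m)"
  proof -
    have "measure \<mu> Z = 1"
      unfolding \<mu> using measure_fin_meas[OF finite_sets_circle[OF finZ ZT]] sum1 by simp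
    then show ?thesis
      unfolding n_point_measures_def using \<mu>P finZ card atoms by simp
  qed
  interpret N: positive_points "atoms \<mu>" "\<lambda>z. measure \<mu> {z}" by (rule positive_points_n_point[OF np])
  have ipeq: "N.ip q p = ip q p" for q p
    unfolding N.ip_def ip_def unfolding atoms using ZT by (intro sum.cong refl) (auto simp: meas)
  have "monic_OP \<mu> k = opuc \<alpha> k" if "k \<le> Suc m" for k
  proof (cases "k = Suc m")
    case True
    then show ?thesis
      using opuc_eq_prod_para_zeros[OF \<alpha>] card by (simp add: monic_OP_def atoms Z_def)
  next
    case False
    have "ip q (opuc \<alpha> k) = 0" if "degree q < k" for q
      by (rule orth_span[of k "opuc \<alpha>"]) (use \<open>k \<le> Suc m\<close> False orth that in \<open>auto simp: coeff_opuc_self\<close>)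
    then have "N.is_mop k (opuc \<alpha> k)"
      by (simp add: N.is_mop_def ipeq coeff_opuc_self)
    then show ?thesis using False that by (intro monic_OP_mop(2)[OF np]) auto
  qed
  then show "has_verblunsky \<mu> (Suc m) \<alpha>"
    using has_verblunsky_iff[OF np] by simp
qed

text \<open>
  The atoms are the zeros of \<open>\<Phi>\<^sub>n\<close>. The mass of an atom is the integral of a Lagrange polynomial, that
  is, the constant coefficient of its expansion in the \<open>\<Phi>\<^sub>i\<close>, which depends only on \<open>\<alpha>\<close>.
\<close>
lemma verblunsky_unique:
  assumes \<nu>: "\<nu> \<in> n_point_measures n" "has_verblunsky \<nu> n \<alpha>"
    and \<nu>': "\<nu>' \<in> n_point_measures n" "has_verblunsky \<nu>' n \<alpha>" and n: "n > 0"
  shows "\<nu> = \<nu>'"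
proof -
  define Z where "Z = para_zeros \<alpha> n"
  have at: "atoms \<nu> = Z" "atoms \<nu>' = Z"
    using atoms_verblunsky[OF \<nu>(1) n \<nu>(2)] atoms_verblunsky[OF \<nu>'(1) n \<nu>'(2)] by (simp_all add: Z_def)
  have fin: "finite Z" "card Z = n" using n_point_measuresD[OF \<nu>(1)] at by simp_all
  have key: "(\<Sum>z\<in>Z. measure \<tau> {z} *\<^sub>R poly (\<Sum>i<n. Polynomial.smult (c i) (opuc \<alpha> i)) z) = c 0"
    if \<tau>: "\<tau> \<in> n_point_measures n" "has_verblunsky \<tau> n \<alpha>" for \<tau> c
  proof -
    interpret positive_points "atoms \<tau>" "\<lambda>z. measure \<tau> {z}" by (rule positive_points_n_point[OF \<tau>(1)])
    have at: "atoms \<tau> = Z" using atoms_verblunsky[OF \<tau>(1) n \<tau>(2)] by (simp add: Z_def)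
    have prob: "ip 1 1 = 1"
    proof -
      have "prob_space \<tau>" using n_point_measuresD(1)[OF \<tau>(1)] prob_algebra_circleD(3) by blast
      then have "1 = (\<integral>z. (1::complex) \<partial>\<tau>)" by (simp add: prob_space.prob_space)
      also have "\<dots> = ip 1 1" unfolding ip_def by (subst integral_n_point[OF \<tau>(1)]) auto
      finally show ?thesis by simp
    qed
    have z: "ip 1 (opuc \<alpha> i) = 0" if "0 < i" "i < n" for i
    proof -
      have "is_mop i (opuc \<alpha> i)"
        using monic_OP_mop(1)[OF \<tau>(1), of i] has_verblunsky_iff[OF \<tau>(1) n] \<tau>(2) that by simp
      then show ?thesis unfolding is_mop_def using that by simp
    qed
    have "(\<Sum>z\<in>Z. measure \<tau> {z} *\<^sub>R poly (\<Sum>i<n. Polynomial.smult (c i) (opuc \<alpha> i)) z)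
        = ip 1 (\<Sum>i<n. Polynomial.smult (c i) (opuc \<alpha> i))"
      unfolding ip_def unfolding at by simp
    also have "\<dots> = (\<Sum>i<n. c i * ip 1 (opuc \<alpha> i))"
      by (simp add: ip_sum ip_smult)
    also have "\<dots> = (\<Sum>i<n. if i = 0 then c 0 else 0)"
      using z prob by (intro sum.cong) auto
    also have "\<dots> = c 0" using n by simp
    finally show ?thesis .
  qed
  have w: "measure \<nu> {y} = measure \<nu>' {y}" if y: "y \<in> Z" for y
  proof -
    obtain c where c: "lagrange Z y = (\<Sum>i<n. Polynomial.smult (c i) (opuc \<alpha> i))"
      using monic_span[of n "opuc \<alpha>" "lagrange Z y"] degree_lagrange[OF fin(1) y] fin
      by (auto simp: coeff_opuc_self coeff_above_degree)
    have val: "(\<Sum>z\<in>Z. measure \<tau> {z} *\<^sub>R poly (lagrange Z y) z) = of_real (measure \<tau> {y})" for \<tau>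
    proof -
      have "(\<Sum>z\<in>Z. measure \<tau> {z} *\<^sub>R poly (lagrange Z y) z)
          = (\<Sum>z\<in>Z. if z = y then of_real (measure \<tau> {y}) else 0)"
        using y fin by (intro sum.cong) (auto simp: poly_lagrange scaleR_conv_of_real)
      then show ?thesis using y fin by simp
    qed
    have "complex_of_real (measure \<nu> {y}) = of_real (measure \<nu>' {y})"
      using key[OF \<nu>, of c] key[OF \<nu>', of c] val[of \<nu>] val[of \<nu>'] unfolding c by metis
    then show ?thesis by simp
  qed
  have "\<nu> = fin_meas Z (\<lambda>z. measure \<nu> {z})" using n_point_measuresD(5)[OF \<nu>(1)] by (simp add: at)
  also have "\<dots> = fin_meas Z (\<lambda>z. measure \<nu>' {z})" by (rule fin_meas_cong[OF w])
  also have "\<dots> = \<nu>'" using n_point_measuresD(5)[OF \<nu>'(1)] by (simp add: at)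
  finally show ?thesis .
qed

lemma measure_of_verblunsky_eq:
  assumes \<alpha>: "\<alpha> \<in> verb_dom (Suc m)"
  shows "measure_of_verblunsky (Suc m) \<alpha> = fin_meas (para_zeros \<alpha> (Suc m)) (para_weight \<alpha> (Suc m))"
  unfolding measure_of_verblunsky_def
proof (rule the_equality)
  show "fin_meas (para_zeros \<alpha> (Suc m)) (para_weight \<alpha> (Suc m)) \<in> n_point_measures (Suc m)
      \<and> has_verblunsky (fin_meas (para_zeros \<alpha> (Suc m)) (para_weight \<alpha> (Suc m))) (Suc m) \<alpha>"
    using para_measure(1,2)[OF \<alpha>] by blast
  then show "\<And>\<mu>. \<mu> \<in> n_point_measures (Suc m) \<and> has_verblunsky \<mu> (Suc m) \<alpha> \<Longrightarrow>
      \<mu> = fin_meas (para_zeros \<alpha> (Suc m)) (para_weight \<alpha> (Suc m))"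
    using verblunsky_unique by blast
qed

text \<open>
  Outside \<open>verb_dom\<close> the definite description has no witness, so its value is one and the same
  unspecified measure, which the sequence \<open>0\<close> represents. Measurability on the whole space needs
  this.
\<close>
lemma measure_of_verblunsky_outside:
  assumes "\<alpha> \<notin> verb_dom (Suc m)"
  shows "measure_of_verblunsky (Suc m) \<alpha> = measure_of_verblunsky (Suc m) (\<lambda>_. 0)"
proof -
  have "(\<lambda>_. 0) \<notin> verb_dom (Suc m)" by (simp add: verb_dom_def)
  then have "(\<mu> \<in> n_point_measures (Suc m) \<and> has_verblunsky \<mu> (Suc m) \<alpha>)
      = (\<mu> \<in> n_point_measures (Suc m) \<and> has_verblunsky \<mu> (Suc m) (\<lambda>_. 0))" for \<mu>
    using verblunsky_in_dom[of \<mu> "Suc m"] assms by blast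
  then show ?thesis by (simp add: measure_of_verblunsky_def)
qed

lemma measure_of_verblunsky_props:
  assumes \<alpha>: "\<alpha> \<in> verb_dom (Suc m)"
  defines "\<mu> \<equiv> measure_of_verblunsky (Suc m) \<alpha>"
  shows "\<mu> \<in> n_point_measures (Suc m)" "atoms \<mu> = para_zeros \<alpha> (Suc m)"
    "\<And>k. k \<le> Suc m \<Longrightarrow> monic_OP \<mu> k = opuc \<alpha> k"
    "\<And>i j. i \<le> m \<Longrightarrow> j \<le> m \<Longrightarrow> (\<integral>z. cnj (poly (opuc \<alpha> i) z) * poly (opuc \<alpha> j) z \<partial>\<mu>)
            = (if i = j then of_real (kappa \<alpha> i) else 0)"
  using para_measure[OF \<alpha>] atoms_verblunsky[of \<mu> "Suc m" \<alpha>] has_verblunsky_iff[of \<mu> "Suc m" \<alpha>]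
  unfolding \<mu>_def measure_of_verblunsky_eq[OF \<alpha>] by auto

section \<open>Moments as functions of the Verblunsky coefficients\<close>

text \<open>
  The value that \<open>\<integral> z\<^sup>k\<close> must take if \<open>\<integral> \<Phi>\<^sub>j = 0\<close> for \<open>0 < j \<le> k\<close>. Being explicit in \<open>\<alpha>\<close>, it is
  visibly measurable and continuous in \<open>\<alpha>\<close>.
\<close>
fun mom :: "(nat \<Rightarrow> complex) \<Rightarrow> nat \<Rightarrow> complex" where
  "mom \<alpha> 0 = 1"
| "mom \<alpha> (Suc k) = - (\<Sum>j\<le>k. coeff (opuc \<alpha> (Suc k)) j * mom \<alpha> j)"

declare mom.simps(2) [simp del]

lemma integrable_circle_complex:
  fixes f :: "complex \<Rightarrow> 'b :: {banach, second_countable_topology}"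
  assumes "\<mu> \<in> space (prob_algebra circle)" "continuous_on (sphere 0 1) f"
  shows "integrable \<mu> f"
proof -
  have "f \<in> borel_measurable \<mu>"
    using borel_measurable_circle_continuous[OF assms(2)] prob_algebra_circleD(1)[OF assms(1)]
    by (simp cong: measurable_cong_sets)
  moreover have "integrable \<mu> (\<lambda>z. norm (f z))"
    using assms by (intro integrable_circle continuous_intros)
  ultimately show ?thesis by (simp add: integrable_norm_iff)
qed

lemma integral_poly:
  assumes "\<mu> \<in> space (prob_algebra circle)" "degree p \<le> N"
  shows "(\<integral>z. poly p z \<partial>\<mu>) = (\<Sum>j\<le>N. coeff p j * (\<integral>z. z ^ j \<partial>\<mu>))"
proof -
  have "(\<integral>z. poly p z \<partial>\<mu>) = (\<integral>z. (\<Sum>j\<le>N. coeff p j * z ^ j) \<partial>\<mu>)"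
  proof (rule Bochner_Integration.integral_cong[OF refl])
    fix z show "poly p z = (\<Sum>j\<le>N. coeff p j * z ^ j)"
      unfolding poly_altdef by (rule sum.mono_neutral_left) (use assms(2) in \<open>auto simp: coeff_eq_0\<close>)
  qed
  also have "\<dots> = (\<Sum>j\<le>N. \<integral>z. coeff p j * z ^ j \<partial>\<mu>)"
    by (intro Bochner_Integration.integral_sum integrable_circle_complex[OF assms(1)] continuous_intros)
  finally show ?thesis by simp
qed

lemma moment_eq_mom:
  assumes \<mu>: "\<mu> \<in> space (prob_algebra circle)"
    and orth: "\<And>k. 0 < k \<Longrightarrow> k \<le> N \<Longrightarrow> (\<integral>z. poly (opuc \<alpha> k) z \<partial>\<mu>) = 0"
  shows "k \<le> N \<Longrightarrow> (\<integral>z. z ^ k \<partial>\<mu>) = mom \<alpha> k"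
proof (induction k rule: less_induct)
  case (less k)
  show ?case
  proof (cases k)
    case 0
    then show ?thesis using prob_algebra_circleD(3)[OF \<mu>] by (simp add: prob_space.prob_space)
  next
    case (Suc l)
    have "0 = (\<Sum>j\<le>Suc l. coeff (opuc \<alpha> (Suc l)) j * (\<integral>z. z ^ j \<partial>\<mu>))"
      using orth[of "Suc l"] less.prems Suc integral_poly[OF \<mu>, of "opuc \<alpha> (Suc l)" "Suc l"] by simp
    also have "\<dots> = (\<Sum>j\<le>l. coeff (opuc \<alpha> (Suc l)) j * mom \<alpha> j) + (\<integral>z. z ^ Suc l \<partial>\<mu>)"
      unfolding sum.atMost_Suc coeff_opuc_self using less Suc by (auto intro!: sum.cong)
    finally have "- (\<Sum>j\<le>l. coeff (opuc \<alpha> (Suc l)) j * mom \<alpha> j) = (\<integral>z. z ^ Suc l \<partial>\<mu>)"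
      by (intro minus_unique) (rule sym)
    then show ?thesis unfolding Suc mom.simps by (rule sym)
  qed
qed

lemma moments_measure_of_verblunsky:
  assumes \<alpha>: "\<alpha> \<in> verb_dom (Suc m)" and k: "k \<le> Suc m"
  shows "(\<integral>z. z ^ k \<partial>measure_of_verblunsky (Suc m) \<alpha>) = mom \<alpha> k"
proof (rule moment_eq_mom[OF _ _ k])
  note P = measure_of_verblunsky_props[OF \<alpha>]
  show "measure_of_verblunsky (Suc m) \<alpha> \<in> space (prob_algebra circle)"
    by (rule n_point_measuresD(1)[OF P(1)])
  fix k assume k: "0 < k" "k \<le> Suc m"
  show "(\<integral>z. poly (opuc \<alpha> k) z \<partial>measure_of_verblunsky (Suc m) \<alpha>) = 0"
  proof (cases "k = Suc m")
    case True
    show ?thesis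
      by (subst integral_n_point[OF P(1)]) (auto simp: P(2) para_zeros_def True)
  next
    case False
    then show ?thesis using P(4)[of 0 k] k by simp
  qed
qed


section \<open>Weak convergence through power moments\<close>

lemma laurent_moment:
  assumes m: "m \<in> space (prob_algebra circle)"
  shows "(\<integral>z. z ^ p * cnj z ^ q \<partial>m)
      = (if q \<le> p then (\<integral>z. z ^ (p - q) \<partial>m) else cnj (\<integral>z. z ^ (q - p) \<partial>m))"
proof -
  have sp: "cmod z = 1" if "z \<in> space m" for z
    using that prob_algebra_circleD(2)[OF m] by simp
  have pw: "z ^ i * cnj z ^ i = 1" if "cmod z = 1" for z i
    using unimodular_mult_cnj[OF that] by (metis power_mult_distrib power_one)
  show ?thesis
  proof (cases "q \<le> p")
    case True
    have "z ^ p * cnj z ^ q = z ^ (p - q)" if "z \<in> space m" for z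
      using pw[OF sp[OF that], of q] True
      by (metis (no_types, opaque_lifting) le_add_diff_inverse2 mult.assoc mult.right_neutral power_add)
    then show ?thesis using True by (simp cong: Bochner_Integration.integral_cong)
  next
    case False
    have "z ^ p * cnj z ^ q = cnj (z ^ (q - p))" if "z \<in> space m" for z
    proof -
      have "cnj z ^ q = cnj z ^ p * cnj z ^ (q - p)"
        using False by (simp flip: power_add)
      then show ?thesis using pw[OF sp[OF that], of p] by (simp flip: mult.assoc)
    qed
    then have "(\<integral>z. z ^ p * cnj z ^ q \<partial>m) = (\<integral>z. cnj (z ^ (q - p)) \<partial>m)"
      by (rule Bochner_Integration.integral_cong[OF refl])
    then show ?thesis using False
      by (simp only: Bochner_Integration.integral_cnj[of _ "\<lambda>z. z ^ (q - p)"] if_False)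
  qed
qed

text \<open>
  Moments of negative order are conjugates of those of positive order, so all integrals of Laurent
  polynomials converge; polynomials in \<open>Re z\<close> and \<open>Im z\<close> are of this form, and they are uniformly
  dense by the theorem of Stone and Weierstrass.
\<close>
lemma weak_conv_circle_if_power_moments:
  assumes \<nu>s: "\<And>j. \<nu>s j \<in> space (prob_algebra circle)" and \<nu>: "\<nu> \<in> space (prob_algebra circle)"
    and mom: "\<And>k. (\<lambda>j. \<integral>z. z ^ k \<partial>\<nu>s j) \<longlonglongrightarrow> (\<integral>z. z ^ k \<partial>\<nu>)"
  shows "weak_conv_circle \<nu>s \<nu>"
proof -
  define S where "S = sphere (0::complex) 1"
  define L where "L f \<longleftrightarrow> continuous_on S f \<and> (\<lambda>j. integral\<^sup>L (\<nu>s j) f) \<longlonglongrightarrow> integral\<^sup>L \<nu> f"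
    for f :: "complex \<Rightarrow> complex"
  define G where "G f \<longleftrightarrow> (\<forall>p q. L (\<lambda>z. f z * (z ^ p * cnj z ^ q)))" for f
  have int: "integrable (\<nu>s j) f" "integrable \<nu> f" if "continuous_on S f"
    for f :: "complex \<Rightarrow> complex" and j
    using integrable_circle_complex[OF \<nu>s, of f j] integrable_circle_complex[OF \<nu>, of f] that
    by (auto simp: S_def)
  have L_add: "L (\<lambda>z. f z + g z)" if "L f" "L g" for f g
    using that int[of f] int[of g]
    by (auto simp: L_def intro!: continuous_intros tendsto_intros)
  have L_cmult: "L (\<lambda>z. c * f z)" if "L f" for f c
    using that by (auto simp: L_def intro!: continuous_intros tendsto_intros)
  have G1: "G (\<lambda>_. 1)"
    unfolding G_def L_def
  proof (intro allI conjI)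
    fix p q
    show "continuous_on S (\<lambda>z. 1 * (z ^ p * cnj z ^ q))" by (intro continuous_intros)
    show "(\<lambda>j. \<integral>z. 1 * (z ^ p * cnj z ^ q) \<partial>\<nu>s j) \<longlonglongrightarrow> (\<integral>z. 1 * (z ^ p * cnj z ^ q) \<partial>\<nu>)"
      unfolding mult_1 laurent_moment[OF \<nu>s] laurent_moment[OF \<nu>]
      using mom by (auto intro!: tendsto_cnj)
  qed
  have GRe: "G (\<lambda>z. f z * of_real (Re z))" if "G f" for f
    unfolding G_def
  proof (intro allI)
    fix p q
    have "L (\<lambda>z. (1/2) * (f z * (z ^ Suc p * cnj z ^ q)) + (1/2) * (f z * (z ^ p * cnj z ^ Suc q)))"
      using that unfolding G_def by (intro L_add L_cmult) blast+
    moreover have "(1/2) * (f z * (z ^ Suc p * cnj z ^ q)) + (1/2) * (f z * (z ^ p * cnj z ^ Suc q))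
        = f z * of_real (Re z) * (z ^ p * cnj z ^ q)" for z
    proof -
      have e: "of_real (Re z) = (1/2) * (z + cnj z)" by (simp add: complex_eq_iff)
      show ?thesis unfolding e by (simp only: power_Suc algebra_simps)
    qed
    ultimately show "L (\<lambda>z. f z * of_real (Re z) * (z ^ p * cnj z ^ q))" by simp
  qed
  have GIm: "G (\<lambda>z. f z * of_real (Im z))" if "G f" for f
    unfolding G_def
  proof (intro allI)
    fix p q
    have "L (\<lambda>z. (-\<i>/2) * (f z * (z ^ Suc p * cnj z ^ q)) + (\<i>/2) * (f z * (z ^ p * cnj z ^ Suc q)))"
      using that unfolding G_def by (intro L_add L_cmult) blast+
    moreover have "(-\<i>/2) * (f z * (z ^ Suc p * cnj z ^ q)) + (\<i>/2) * (f z * (z ^ p * cnj z ^ Suc q))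
        = f z * of_real (Im z) * (z ^ p * cnj z ^ q)" for z
    proof -
      have e: "of_real (Im z) = (-\<i>/2) * z + (\<i>/2) * cnj z" by (simp add: complex_eq_iff)
      show ?thesis unfolding e by (simp only: power_Suc algebra_simps)
    qed
    ultimately show "L (\<lambda>z. f z * of_real (Im z) * (z ^ p * cnj z ^ q))" by simp
  qed
  have Ga: "G (\<lambda>z. of_real (Re z) ^ a)" for a
  proof (induction a)
    case (Suc a)
    then show ?case using GRe[OF Suc] by (simp add: mult.commute)
  qed (use G1 in simp)
  have Gab: "G (\<lambda>z. of_real (Re z) ^ a * of_real (Im z) ^ b)" for a b
  proof (induction b)
    case (Suc b)
    have "G (\<lambda>z. of_real (Re z) ^ a * of_real (Im z) ^ b * of_real (Im z))" by (rule GIm[OF Suc])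
    then show ?case by (simp add: mult_ac)
  qed (use Ga in simp)
  show ?thesis
  proof (rule weak_conv_circle_if_moments[OF \<nu>s \<nu>])
    fix a b
    have "L (\<lambda>z. of_real (Re z) ^ a * of_real (Im z) ^ b * (z ^ 0 * cnj z ^ 0))"
      using Gab[of a b] unfolding G_def by blast
    then have "(\<lambda>j. (\<integral>z. complex_of_real (Re z ^ a * Im z ^ b) \<partial>\<nu>s j))
        \<longlonglongrightarrow> (\<integral>z. complex_of_real (Re z ^ a * Im z ^ b) \<partial>\<nu>)"
      by (simp add: L_def)
    then show "(\<lambda>j. \<integral>z. Re z ^ a * Im z ^ b \<partial>\<nu>s j) \<longlonglongrightarrow> (\<integral>z. Re z ^ a * Im z ^ b \<partial>\<nu>)"
      unfolding integral_complex_of_real tendsto_of_real_iff .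
  qed
qed

lemma circle_measure_eqI_power_moments:
  assumes "\<mu> \<in> space (prob_algebra circle)" "\<nu> \<in> space (prob_algebra circle)"
    and "\<And>k. (\<integral>z. z ^ k \<partial>\<mu>) = (\<integral>z. z ^ k \<partial>\<nu>)"
  shows "\<mu> = \<nu>"
proof (rule circle_measure_eqI[OF assms(1,2)])
  fix f :: "complex \<Rightarrow> real" assume "continuous_on (sphere 0 1) f"
  moreover have "weak_conv_circle (\<lambda>_. \<mu>) \<nu>"
    using assms by (intro weak_conv_circle_if_power_moments) auto
  ultimately have "(\<lambda>_::nat. integral\<^sup>L \<mu> f) \<longlonglongrightarrow> integral\<^sup>L \<nu> f"
    unfolding weak_conv_circle_def by blast
  then show "integral\<^sup>L \<mu> f = integral\<^sup>L \<nu> f" by (simp add: LIMSEQ_const_iff)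
qed

section \<open>Spectral measures of unitary matrices\<close>

definition unitary_mat :: "nat \<Rightarrow> complex mat \<Rightarrow> bool" where
  "unitary_mat n A \<longleftrightarrow> A \<in> carrier_mat n n \<and> mat_adjoint A * A = 1\<^sub>m n \<and> A * mat_adjoint A = 1\<^sub>m n"

lemma mat_adjoint_dim [simp]: "dim_row (mat_adjoint A) = dim_col A" "dim_col (mat_adjoint A) = dim_row A"
  by (simp_all add: mat_adjoint_def)

lemma mat_adjoint_carrier [simp]: "A \<in> carrier_mat n n \<Longrightarrow> mat_adjoint A \<in> carrier_mat n n"
  by (intro carrier_matI) simp_all

lemma mat_adjoint_index [simp]:
  fixes A :: "complex mat"
  shows "i < dim_col A \<Longrightarrow> j < dim_row A \<Longrightarrow> mat_adjoint A $$ (i, j) = cnj (A $$ (j, i))"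
  by (simp add: mat_adjoint_def mat_of_rows_index)

lemma mat_adjoint_mult:
  fixes A B :: "complex mat"
  assumes "A \<in> carrier_mat n n" "B \<in> carrier_mat n n"
  shows "mat_adjoint (A * B) = mat_adjoint B * mat_adjoint A"
  using assms by (intro eq_matI) (auto simp: scalar_prod_def mult.commute intro!: sum.cong)

lemma pow_mat_commute:
  fixes A :: "'a :: semiring_1 mat"
  assumes "A \<in> carrier_mat n n"
  shows "A ^\<^sub>m k * A = A * A ^\<^sub>m k"
proof (induction k)
  case 0 then show ?case using assms by simp
next
  case (Suc k)
  have "A ^\<^sub>m Suc k * A = (A * A ^\<^sub>m k) * A" using Suc by simp
  also have "\<dots> = A * (A ^\<^sub>m k * A)" using assms by (intro assoc_mult_mat) auto
  finally show ?case by simp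
qed

lemma mat_adjoint_pow:
  fixes A :: "complex mat"
  assumes A: "A \<in> carrier_mat n n"
  shows "mat_adjoint (A ^\<^sub>m k) = mat_adjoint A ^\<^sub>m k"
proof (induction k)
  case 0
  then show ?case using A by (intro eq_matI) auto
next
  case (Suc k)
  have "mat_adjoint (A ^\<^sub>m Suc k) = mat_adjoint A * mat_adjoint A ^\<^sub>m k"
    using A Suc by (simp add: mat_adjoint_mult[of _ n])
  then show ?case using pow_mat_commute[of "mat_adjoint A" n k] A by simp
qed

lemma unit_vec_entry:
  fixes A :: "complex mat"
  assumes "A \<in> carrier_mat n n" "n > 0"
  shows "(A *\<^sub>v unit_vec n 0) \<bullet>c unit_vec n 0 = A $$ (0, 0)"
proof -
  have c: "conjugate (unit_vec n 0 :: complex vec) = unit_vec n 0"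
    by (rule eq_vecI) (auto simp: unit_vec_def)
  show ?thesis unfolding c using assms by simp
qed

text \<open>
  Negative powers add nothing: both sides become complex conjugates.
\<close>
lemma spectral_measure_iff:
  assumes A: "A \<in> carrier_mat n n" and n: "n > 0" and \<mu>: "\<mu> \<in> space (prob_algebra circle)"
  shows "(\<forall>k::int. (\<integral>z. z powi k \<partial>\<mu>) =
              (((if k \<ge> 0 then A ^\<^sub>m nat k else mat_adjoint A ^\<^sub>m nat (- k)) *\<^sub>v unit_vec n 0) \<bullet>c unit_vec n 0))
     \<longleftrightarrow> (\<forall>k::nat. (\<integral>z. z ^ k \<partial>\<mu>) = (A ^\<^sub>m k) $$ (0, 0))" (is "?L \<longleftrightarrow> ?R")
proof
  assume L: ?L
  show ?R
  proof
    fix k :: nat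
    show "(\<integral>z. z ^ k \<partial>\<mu>) = (A ^\<^sub>m k) $$ (0, 0)"
      using spec[OF L, of "int k"] unit_vec_entry[of "A ^\<^sub>m k" n] A n by simp
  qed
next
  assume R: ?R
  show ?L
  proof
    fix k :: int
    show "(\<integral>z. z powi k \<partial>\<mu>) =
              (((if k \<ge> 0 then A ^\<^sub>m nat k else mat_adjoint A ^\<^sub>m nat (- k)) *\<^sub>v unit_vec n 0) \<bullet>c unit_vec n 0)"
    proof (cases "k \<ge> 0")
      case True
      then have "z powi k = z ^ nat k" for z :: complex by (simp add: power_int_def)
      then show ?thesis using R True unit_vec_entry[of "A ^\<^sub>m nat k" n] A n by simp
    next
      case False
      define l where "l = nat (- k)"
      have "z powi k = cnj (z ^ l)" if "z \<in> space \<mu>" for z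
      proof -
        have "cmod z = 1" using that prob_algebra_circleD(2)[OF \<mu>] by simp
        then have "inverse z = cnj z"
          using unimodular_mult_cnj[of z] by (metis inverse_unique)
        then show ?thesis using False by (simp add: power_int_def l_def)
      qed
      then have "(\<integral>z. z powi k \<partial>\<mu>) = (\<integral>z. cnj (z ^ l) \<partial>\<mu>)"
        by (rule Bochner_Integration.integral_cong[OF refl])
      also have "\<dots> = cnj ((A ^\<^sub>m l) $$ (0, 0))"
        using R by (simp only: Bochner_Integration.integral_cnj[of _ "\<lambda>z. z ^ l"])
      also have "\<dots> = mat_adjoint (A ^\<^sub>m l) $$ (0, 0)"
        using A n by (subst mat_adjoint_index) auto
      also have "\<dots> = (mat_adjoint A ^\<^sub>m l *\<^sub>v unit_vec n 0) \<bullet>c unit_vec n 0"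
        using A n by (subst unit_vec_entry) (auto simp: mat_adjoint_pow[OF A])
      finally show ?thesis unfolding l_def using False by (simp only: if_False)
    qed
  qed
qed

lemma spectral_measure_eqI:
  assumes A: "unitary_mat n A" and n: "n > 0" and \<mu>: "\<mu> \<in> space (prob_algebra circle)"
    and m: "\<And>k. (\<integral>z. z ^ k \<partial>\<mu>) = (A ^\<^sub>m k) $$ (0, 0)"
  shows "spectral_measure A (unit_vec n 0) = \<mu>"
proof -
  have c: "A \<in> carrier_mat n n" and u: "mat_adjoint A * A = 1\<^sub>m (dim_row A) \<and> A * mat_adjoint A = 1\<^sub>m (dim_row A)"
    using A by (auto simp: unitary_mat_def)
  note iff = spectral_measure_iff[OF c n]
  have "(THE \<mu>. \<mu> \<in> space (prob_algebra circle) \<and>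
           (\<forall>k::int. (\<integral>z. z powi k \<partial>\<mu>) =
              (((if k \<ge> 0 then A ^\<^sub>m nat k else mat_adjoint A ^\<^sub>m nat (- k)) *\<^sub>v unit_vec n 0) \<bullet>c unit_vec n 0))) = \<mu>"
  proof (rule the_equality)
    show "\<mu> \<in> space (prob_algebra circle) \<and>
           (\<forall>k::int. (\<integral>z. z powi k \<partial>\<mu>) =
              (((if k \<ge> 0 then A ^\<^sub>m nat k else mat_adjoint A ^\<^sub>m nat (- k)) *\<^sub>v unit_vec n 0) \<bullet>c unit_vec n 0))"
      using iff[OF \<mu>] \<mu> m by blast
    fix \<nu> assume h: "\<nu> \<in> space (prob_algebra circle) \<and>
           (\<forall>k::int. (\<integral>z. z powi k \<partial>\<nu>) =
              (((if k \<ge> 0 then A ^\<^sub>m nat k else mat_adjoint A ^\<^sub>m nat (- k)) *\<^sub>v unit_vec n 0) \<bullet>c unit_vec n 0))"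
    then have \<nu>: "\<nu> \<in> space (prob_algebra circle)" by blast
    with h iff[OF \<nu>] have "\<forall>k. (\<integral>z. z ^ k \<partial>\<nu>) = (A ^\<^sub>m k) $$ (0, 0)" by blast
    then show "\<nu> = \<mu>" using m by (intro circle_measure_eqI_power_moments[OF \<nu> \<mu>]) simp
  qed
  then show ?thesis unfolding spectral_measure_def if_P[OF u] .
qed

lemma spectral_measure_not_unitary:
  "A \<in> carrier_mat n n \<Longrightarrow> \<not> unitary_mat n A \<Longrightarrow> spectral_measure A v = undefined"
  by (auto simp: spectral_measure_def unitary_mat_def)

lemma nonzero_kernel_poly:
  fixes x :: "nat \<Rightarrow> nat \<Rightarrow> complex"
  shows "\<exists>p. p \<noteq> 0 \<and> degree p \<le> n \<and> (\<forall>i<n. (\<Sum>k\<le>n. coeff p k * x k i) = 0)"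
proof -
  define M where "M = mat (Suc n) (Suc n) (\<lambda>(i, k). if i < n then x k i else 0)"
  have M: "M \<in> carrier_mat (Suc n) (Suc n)" by (simp add: M_def)
  have "det M = (\<Sum>j<Suc n. M $$ (n, j) * cofactor M n j)"
    by (rule laplace_expansion_row[OF M]) simp
  also have "\<dots> = 0" by (intro sum.neutral) (auto simp: M_def)
  finally obtain v where v: "v \<in> carrier_vec (Suc n)" "v \<noteq> 0\<^sub>v (Suc n)" "M *\<^sub>v v = 0\<^sub>v (Suc n)"
    using det_0_iff_vec_prod_zero_field[OF M] by blast
  define p where "p = (\<Sum>k\<le>n. monom (v $ k) k)"
  have cp: "coeff p k = (if k \<le> n then v $ k else 0)" for k
    by (simp add: p_def coeff_sum)
  have "p \<noteq> 0"
  proof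
    assume "p = 0"
    then have "v $ k = 0" if "k < Suc n" for k using cp[of k] that by simp
    then have "v = 0\<^sub>v (Suc n)" using v(1) by (intro eq_vecI) auto
    with v(2) show False by simp
  qed
  moreover have "degree p \<le> n" by (rule degree_le) (simp add: cp)
  moreover have "(\<Sum>k\<le>n. coeff p k * x k i) = 0" if "i < n" for i
  proof -
    have "(M *\<^sub>v v) $ i = (\<Sum>k\<le>n. x k i * v $ k)"
      using that v(1) by (simp add: M_def scalar_prod_def atLeast0LessThan lessThan_Suc_atMost)
    then show ?thesis using v(3) that by (simp add: cp mult.commute)
  qed
  ultimately show ?thesis by blast
qed

text \<open>
  The spectral theorem in the cyclic subspace of \<open>e\<^sub>1\<close>. For a polynomial \<open>p\<close> let \<open>l i p\<close> be the \<open>i\<close>-th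
  entry of \<open>p(A) e\<^sub>1\<close>. The minimal polynomial \<open>p\<close> of \<open>e\<^sub>1\<close> has simple zeros on the circle, because
  multiplication by \<open>z\<close> preserves the semi-inner product \<open>B\<close> of polynomials. For a zero \<open>z\<close> the
  Lagrange polynomial \<open>L z\<close> gives an eigenvector for the eigenvalue \<open>z\<close>; these vectors are pairwise
  orthogonal and sum to \<open>e\<^sub>1\<close>, and their squared norms are the masses.
\<close>
lemma spectral_measure_exists:
  assumes A: "unitary_mat n A" and n: "n > 0"
  shows "\<exists>\<mu>\<in>space (prob_algebra circle). \<forall>k. (\<integral>z. z ^ k \<partial>\<mu>) = (A ^\<^sub>m k) $$ (0, 0)"
proof -
  have Ac: "A \<in> carrier_mat n n" using A by (simp add: unitary_mat_def)
  define x where "x k i = (A ^\<^sub>m k) $$ (i, 0)" for k i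
  have x0: "x 0 i = (if i = 0 then 1 else 0)" if "i < n" for i
    using that Ac n by (simp add: x_def)
  have xS: "x (Suc k) i = (\<Sum>r<n. A $$ (i, r) * x k r)" if "i < n" for k i
  proof -
    have "x (Suc k) i = (A * A ^\<^sub>m k) $$ (i, 0)" using pow_mat_commute[OF Ac, of k] by (simp add: x_def)
    also have "\<dots> = (\<Sum>r<n. A $$ (i, r) * x k r)"
      using that Ac n by (simp add: scalar_prod_def x_def atLeast0LessThan)
    finally show ?thesis .
  qed
  define l where "l i p = (\<Sum>k\<le>degree p. coeff p k * x k i)" for i p
  have l_eq: "l i p = (\<Sum>k\<le>N. coeff p k * x k i)" if "degree p \<le> N" for i p N
    unfolding l_def by (rule sum.mono_neutral_left) (use that in \<open>auto simp: coeff_eq_0\<close>)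
  have l_add: "l i (p + q) = l i p + l i q" for i p q
  proof -
    define N where "N = max (degree p) (degree q)"
    have "degree (p + q) \<le> N" "degree p \<le> N" "degree q \<le> N"
      using degree_add_le_max[of p q] by (auto simp: N_def)
    then show ?thesis using l_eq by (simp add: sum.distrib algebra_simps)
  qed
  have l_smult: "l i (Polynomial.smult c p) = c * l i p" for i c p
    using l_eq[of "Polynomial.smult c p" "degree p" i] degree_smult_le[of c p]
    by (simp add: l_def sum_distrib_left algebra_simps)
  have l_0: "l i 0 = 0" for i by (simp add: l_def)
  have l_sum: "l i (\<Sum>s\<in>S. f s) = (\<Sum>s\<in>S. l i (f s))" for i S and f :: "complex \<Rightarrow> complex poly"
    by (induction S rule: infinite_finite_induct) (auto simp: l_add l_0)
  have l_shift: "l i (pCons 0 p) = (\<Sum>r<n. A $$ (i, r) * l r p)" if "i < n" for i p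
  proof -
    have "l i (pCons 0 p) = (\<Sum>k\<le>Suc (degree p). coeff (pCons 0 p) k * x k i)"
      by (rule l_eq) (simp add: degree_pCons_le)
    also have "\<dots> = (\<Sum>k\<le>degree p. coeff p k * x (Suc k) i)"
      by (subst sum.atMost_Suc_shift) simp
    also have "\<dots> = (\<Sum>k\<le>degree p. \<Sum>r<n. A $$ (i, r) * (coeff p k * x k r))"
      by (simp add: xS[OF that] sum_distrib_left mult_ac)
    also have "\<dots> = (\<Sum>r<n. A $$ (i, r) * l r p)"
      by (subst sum.swap) (simp add: l_def sum_distrib_left)
    finally show ?thesis .
  qed
  define B where "B p q = (\<Sum>i<n. l i p * cnj (l i q))" for p q
  have uni: "(\<Sum>i<n. A $$ (i, r) * cnj (A $$ (i, s))) = (if r = s then 1 else 0)" if "r < n" "s < n" for r s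
  proof -
    have "(mat_adjoint A * A) $$ (s, r) = (\<Sum>i<n. cnj (A $$ (i, s)) * A $$ (i, r))"
      using that Ac by (simp add: scalar_prod_def atLeast0LessThan)
    then show ?thesis using A that by (auto simp: unitary_mat_def mult.commute)
  qed
  have B_shift: "B (pCons 0 p) (pCons 0 q) = B p q" for p q
  proof -
    have "B (pCons 0 p) (pCons 0 q)
        = (\<Sum>i<n. \<Sum>r<n. \<Sum>s<n. (l r p * cnj (l s q)) * (A $$ (i, r) * cnj (A $$ (i, s))))"
      unfolding B_def by (intro sum.cong refl) (simp add: l_shift sum_product mult_ac)
    also have "\<dots> = (\<Sum>r<n. \<Sum>i<n. \<Sum>s<n. (l r p * cnj (l s q)) * (A $$ (i, r) * cnj (A $$ (i, s))))"
      by (rule sum.swap)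
    also have "\<dots> = (\<Sum>r<n. \<Sum>s<n. \<Sum>i<n. (l r p * cnj (l s q)) * (A $$ (i, r) * cnj (A $$ (i, s))))"
      by (rule sum.cong[OF refl], rule sum.swap)
    also have "\<dots> = (\<Sum>r<n. \<Sum>s<n. if r = s then l r p * cnj (l s q) else 0)"
      by (intro sum.cong refl) (simp add: uni flip: sum_distrib_left)
    also have "\<dots> = B p q" unfolding B_def by (intro sum.cong) auto
    finally show ?thesis .
  qed
  define N where "N p \<longleftrightarrow> (\<forall>i<n. l i p = 0)" for p
  have B_self: "B p p = of_real (\<Sum>i<n. (cmod (l i p))\<^sup>2)" for p
    by (simp only: B_def of_real_sum complex_norm_square)
  have B_0: "N p" if "B p p = 0" for p
  proof -
    have "(\<Sum>i<n. (cmod (l i p))\<^sup>2) = 0" using that unfolding B_self by (simp only: of_real_eq_0_iff)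
    then show ?thesis by (simp add: sum_nonneg_eq_0_iff N_def)
  qed
  have N_shift: "N (pCons 0 p)" if "N p" for p
    using that by (simp add: N_def l_shift)
  \<comment> \<open>\<open>n + 1\<close> vectors in dimension \<open>n\<close> are dependent\<close>
  have "\<exists>p. p \<noteq> 0 \<and> N p"
    using nonzero_kernel_poly[of n x] l_eq[of _ n] unfolding N_def by metis
  then obtain p where p: "p \<noteq> 0" "N p" and min: "\<And>q. q \<noteq> 0 \<Longrightarrow> N q \<Longrightarrow> degree p \<le> degree q"
    using ex_has_least_nat[of "\<lambda>p. p \<noteq> 0 \<and> N p" _ degree] by metis
  have lin: "[:-c, 1:] * q = pCons 0 q + Polynomial.smult (-c) q" for c :: complex and q
    by simp
  have eig: "l i (pCons 0 q) = c * l i q" if "N ([:-c, 1:] * q)" "i < n" for c q i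
    using that unfolding N_def lin l_add l_smult by simp
  have root: "cmod c = 1 \<and> poly (pderiv p) c \<noteq> 0" if pc: "poly p c = 0" for c
  proof -
    obtain q where q: "p = [:-c, 1:] * q"
      using pc unfolding poly_eq_0_iff_dvd by (rule dvdE)
    have q0: "q \<noteq> 0" using p(1) q by auto
    have "degree p = Suc (degree q)" unfolding q using q0 by (subst degree_mult_eq) auto
    then have Bq: "B q q \<noteq> 0" using min[of q] B_0[of q] q0 by auto
    have e: "l i (pCons 0 q) = c * l i q" if "i < n" for i
      using eig[of c q i] p(2) q that by simp
    have "B (pCons 0 q) (pCons 0 q) = (c * cnj c) * B q q"
      unfolding B_def sum_distrib_left by (intro sum.cong refl) (simp add: e)
    then have "c * cnj c = 1" using B_shift[of q q] Bq by simp
    then have "complex_of_real ((cmod c)\<^sup>2) = of_real 1" unfolding complex_norm_square by simp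
    then have "(cmod c)\<^sup>2 = 1\<^sup>2" unfolding of_real_eq_iff by simp
    then have c1: "cmod c = 1" by (rule power2_eq_imp_eq) auto
    have "poly (pderiv p) c \<noteq> 0"
    proof
      assume "poly (pderiv p) c = 0"
      then have "poly q c = 0" unfolding q pderiv_mult by (simp add: pderiv_pCons)
      then obtain r where r: "q = [:-c, 1:] * r"
        unfolding poly_eq_0_iff_dvd by (rule dvdE)
      have "B q (pCons 0 r) = (c * cnj c) * B q (pCons 0 r)" using \<open>c * cnj c = 1\<close> by simp
      also have "\<dots> = cnj c * B (pCons 0 q) (pCons 0 r)"
        unfolding B_def sum_distrib_left by (intro sum.cong refl) (simp add: e)
      also have "\<dots> = cnj c * B q r" by (simp only: B_shift)
      finally have "B q (pCons 0 r) - cnj c * B q r = 0" by simp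
      moreover have "B q q = B q (pCons 0 r) - cnj c * B q r"
      proof -
        have "l i q = l i (pCons 0 r) - c * l i r" for i
          by (subst r, unfold lin l_add l_smult) simp
        then have "B q q = (\<Sum>i<n. l i q * cnj (l i (pCons 0 r) - c * l i r))"
          unfolding B_def by simp
        then show ?thesis
          unfolding B_def by (simp add: algebra_simps sum_subtractf sum_distrib_left)
      qed
      ultimately show False using Bq by simp
    qed
    then show ?thesis using c1 by blast
  qed
  define Z where "Z = {z. poly p z = 0}"
  have rs: "rsquarefree p" unfolding rsquarefree_roots using root by blast
  have finZ: "finite Z" unfolding Z_def by (rule poly_roots_finite[OF p(1)])
  have ZT: "Z \<subseteq> sphere 0 1" using root by (auto simp: Z_def)
  define Q where "Q = (\<Prod>z\<in>Z. [:-z, 1:])"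
  have pQ: "p = Polynomial.smult (lead_coeff p) Q"
    using complex_poly_decompose_rsquarefree[OF rs] by (simp add: Q_def Z_def)
  have NQ: "N Q"
  proof -
    have e: "l i p = lead_coeff p * l i Q" for i by (subst pQ) (simp only: l_smult)
    have "l i Q = 0" if "i < n" for i
    proof -
      have "lead_coeff p * l i Q = 0" using p(2) that unfolding N_def e by blast
      moreover have "lead_coeff p \<noteq> 0" using p(1) by simp
      ultimately show ?thesis by (metis mult_eq_0_iff)
    qed
    then show ?thesis by (simp add: N_def)
  qed
  have Zne: "Z \<noteq> {}"
  proof
    assume "Z = {}"
    then have "N 1" using NQ by (simp add: Q_def)
    then have "x 0 0 = 0" using n by (auto simp: N_def l_def)
    then show False using x0[of 0] n by simp
  qed
  define L where "L z = lagrange Z z" for z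
  have NL: "N ([:-z, 1:] * L z)" if "z \<in> Z" for z
  proof -
    define c where "c = (\<Prod>y\<in>Z-{z}. 1 / (z - y))"
    have "L z = Polynomial.smult c (\<Prod>y\<in>Z-{z}. [:-y, 1:])"
      unfolding L_def lagrange_def prod_smult c_def ..
    then have "[:-z, 1:] * L z = Polynomial.smult c ([:-z, 1:] * (\<Prod>y\<in>Z-{z}. [:-y, 1:]))"
      by (simp only: mult_smult_right)
    also have "[:-z, 1:] * (\<Prod>y\<in>Z-{z}. [:-y, 1:]) = Q"
      unfolding Q_def by (rule prod.remove[OF finZ that, symmetric])
    finally have "[:-z, 1:] * L z = Polynomial.smult c Q" .
    then show ?thesis using NQ by (simp only: N_def l_smult) simp
  qed
  have eL: "l i (pCons 0 (L z)) = z * l i (L z)" if "z \<in> Z" "i < n" for z i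
    by (rule eig[OF NL[OF that(1)] that(2)])
  have B_orth: "B (L z) (L y) = 0" if "z \<in> Z" "y \<in> Z" "z \<noteq> y" for z y
  proof -
    have "B (L z) (L y) = B (pCons 0 (L z)) (pCons 0 (L y))" by (simp only: B_shift)
    also have "\<dots> = (z * cnj y) * B (L z) (L y)"
      unfolding B_def sum_distrib_left using that by (intro sum.cong refl) (simp add: eL)
    finally have *: "(1 - z * cnj y) * B (L z) (L y) = 0" by (simp add: algebra_simps)
    have "1 - z * cnj y \<noteq> 0"
    proof
      assume h: "1 - z * cnj y = 0"
      have "y * cnj y = 1" using that ZT by (intro unimodular_mult_cnj) auto
      then have "y = z * cnj y * y" using h by simp
      also have "\<dots> = z * (y * cnj y)" by simp
      finally show False using \<open>y * cnj y = 1\<close> that(3) by simp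
    qed
    with * show ?thesis by simp
  qed
  have xL: "x k i = (\<Sum>z\<in>Z. z ^ k * l i (L z))" if "i < n" for k i
    using that
  proof (induction k arbitrary: i)
    case 0
    have "(\<Sum>z\<in>Z. L z) = 1" unfolding L_def by (rule sum_lagrange[OF finZ Zne])
    then have "l i 1 = (\<Sum>z\<in>Z. l i (L z))" by (metis l_sum)
    then show ?case by (simp add: l_def)
  next
    case (Suc k)
    have "x (Suc k) i = (\<Sum>r<n. A $$ (i, r) * (\<Sum>z\<in>Z. z ^ k * l r (L z)))"
      using Suc by (simp add: xS)
    also have "\<dots> = (\<Sum>z\<in>Z. z ^ k * (\<Sum>r<n. A $$ (i, r) * l r (L z)))"
      unfolding sum_distrib_left by (subst sum.swap) (simp add: mult_ac)
    also have "\<dots> = (\<Sum>z\<in>Z. z ^ Suc k * l i (L z))"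
      using Suc.prems by (intro sum.cong refl) (simp add: eL flip: l_shift)
    finally show ?case .
  qed
  define w where "w z = (\<Sum>i<n. (cmod (l i (L z)))\<^sup>2)" for z
  have wB: "B (L z) (L z) = of_real (w z)" for z by (simp add: B_self w_def)
  have entry: "(A ^\<^sub>m k) $$ (0, 0) = (\<Sum>z\<in>Z. w z *\<^sub>R z ^ k)" for k
  proof -
    have "x k 0 = (\<Sum>i<n. if i = 0 then x k 0 else 0)" using n by simp
    also have "\<dots> = (\<Sum>i<n. x k i * cnj (x 0 i))"
      by (intro sum.cong) (auto simp: x0)
    also have "\<dots> = (\<Sum>i<n. (\<Sum>z\<in>Z. z ^ k * l i (L z)) * cnj (\<Sum>y\<in>Z. l i (L y)))"
      using xL[where k=0] xL[where k=k] by (intro sum.cong) auto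
    also have "\<dots> = (\<Sum>i<n. \<Sum>z\<in>Z. \<Sum>y\<in>Z. z ^ k * (l i (L z) * cnj (l i (L y))))"
      unfolding cnj_sum sum_product by (simp only: mult.assoc)
    also have "\<dots> = (\<Sum>z\<in>Z. \<Sum>i<n. \<Sum>y\<in>Z. z ^ k * (l i (L z) * cnj (l i (L y))))"
      by (rule sum.swap)
    also have "\<dots> = (\<Sum>z\<in>Z. \<Sum>y\<in>Z. \<Sum>i<n. z ^ k * (l i (L z) * cnj (l i (L y))))"
      by (rule sum.cong[OF refl], rule sum.swap)
    also have "\<dots> = (\<Sum>z\<in>Z. \<Sum>y\<in>Z. z ^ k * B (L z) (L y))"
      by (simp add: B_def sum_distrib_left)
    also have "\<dots> = (\<Sum>z\<in>Z. \<Sum>y\<in>Z. if z = y then w z *\<^sub>R z ^ k else 0)"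
      using B_orth by (intro sum.cong refl) (auto simp: wB scaleR_conv_of_real)
    also have "\<dots> = (\<Sum>z\<in>Z. w z *\<^sub>R z ^ k)"
      using finZ by (intro sum.cong) auto
    finally show ?thesis by (simp add: x_def)
  qed
  interpret weighted_points Z w
    using finZ ZT by unfold_locales (auto simp: w_def intro: sum_nonneg)
  have "complex_of_real (\<Sum>z\<in>Z. w z) = 1"
    using entry[of 0] Ac n by (simp add: scaleR_conv_of_real)
  then have "(\<Sum>z\<in>Z. w z) = 1" by (simp only: of_real_eq_1_iff)
  then have "fin_meas Z w \<in> space (prob_algebra circle)" by (rule fin_meas_prob)
  moreover have "(\<integral>z. z ^ k \<partial>fin_meas Z w) = (A ^\<^sub>m k) $$ (0, 0)" for k
    unfolding entry by (rule integral_fin_meas) (intro borel_measurable_circle_continuous continuous_intros)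
  ultimately show ?thesis by blast
qed

lemma spectral_measure_props:
  assumes "unitary_mat n A" "n > 0"
  shows "spectral_measure A (unit_vec n 0) \<in> space (prob_algebra circle)"
    and "(\<integral>z. z ^ k \<partial>spectral_measure A (unit_vec n 0)) = (A ^\<^sub>m k) $$ (0, 0)"
proof -
  obtain \<mu> where "\<mu> \<in> space (prob_algebra circle)" "\<forall>k. (\<integral>z. z ^ k \<partial>\<mu>) = (A ^\<^sub>m k) $$ (0, 0)"
    using spectral_measure_exists[OF assms] by blast
  moreover from this have "spectral_measure A (unit_vec n 0) = \<mu>"
    by (intro spectral_measure_eqI[OF assms]) auto
  ultimately show "spectral_measure A (unit_vec n 0) \<in> space (prob_algebra circle)"
    and "(\<integral>z. z ^ k \<partial>spectral_measure A (unit_vec n 0)) = (A ^\<^sub>m k) $$ (0, 0)" by auto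
qed


section \<open>The GGT matrix\<close>

definition diag_of :: "nat \<Rightarrow> (nat \<Rightarrow> complex) \<Rightarrow> complex mat" where
  "diag_of n \<zeta> = mat n n (\<lambda>(p, q). if p = q then \<zeta> p else 0)"

lemma diag_of_carrier [simp]: "diag_of n \<zeta> \<in> carrier_mat n n"
  by (simp add: diag_of_def)

lemma diag_of_mult: "diag_of n \<zeta> * diag_of n \<eta> = diag_of n (\<lambda>p. \<zeta> p * \<eta> p)"
proof (rule eq_matI)
  fix p q assume "p < dim_row (diag_of n (\<lambda>p. \<zeta> p * \<eta> p))" "q < dim_col (diag_of n (\<lambda>p. \<zeta> p * \<eta> p))"
  then have pq: "p < n" "q < n" by (simp_all add: diag_of_def)
  then have "(diag_of n \<zeta> * diag_of n \<eta>) $$ (p, q)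
      = (\<Sum>r<n. (if p = r then \<zeta> p else 0) * (if r = q then \<eta> r else 0))"
    by (simp add: diag_of_def scalar_prod_def atLeast0LessThan)
  also have "\<dots> = (\<Sum>r<n. if r = p then (if p = q then \<zeta> p * \<eta> p else 0) else 0)"
    by (intro sum.cong) auto
  also have "\<dots> = diag_of n (\<lambda>p. \<zeta> p * \<eta> p) $$ (p, q)"
    using pq by (simp add: diag_of_def)
  finally show "(diag_of n \<zeta> * diag_of n \<eta>) $$ (p, q) = diag_of n (\<lambda>p. \<zeta> p * \<eta> p) $$ (p, q)" .
qed (auto simp: diag_of_def)

lemma diag_of_pow: "diag_of n \<zeta> ^\<^sub>m k = diag_of n (\<lambda>p. \<zeta> p ^ k)"
proof (induction k)
  case 0
  show ?case by (rule eq_matI) (auto simp: diag_of_def)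
next
  case (Suc k)
  then show ?case by (simp add: diag_of_mult mult.commute)
qed

lemma adjoint_diag_mult_entry:
  assumes W: "W \<in> carrier_mat n n" and ij: "i < n" "j < n"
  shows "(mat_adjoint W * diag_of n \<zeta> * W) $$ (i, j) = (\<Sum>p<n. \<zeta> p * (cnj (W $$ (p, i)) * W $$ (p, j)))"
proof -
  have 1: "(mat_adjoint W * diag_of n \<zeta>) $$ (i, p) = cnj (W $$ (p, i)) * \<zeta> p" if "p < n" for p
  proof -
    have "(mat_adjoint W * diag_of n \<zeta>) $$ (i, p)
        = (\<Sum>q<n. cnj (W $$ (q, i)) * (if q = p then \<zeta> q else 0))"
      using W ij that by (simp add: diag_of_def scalar_prod_def atLeast0LessThan)
    also have "\<dots> = (\<Sum>q<n. if q = p then cnj (W $$ (p, i)) * \<zeta> p else 0)"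
      by (intro sum.cong) auto
    also have "\<dots> = cnj (W $$ (p, i)) * \<zeta> p" using that by simp
    finally show ?thesis .
  qed
  have d: "dim_row (mat_adjoint W * diag_of n \<zeta>) = n" "dim_col (mat_adjoint W * diag_of n \<zeta>) = n"
    using W by (auto simp: diag_of_def)
  have "(mat_adjoint W * diag_of n \<zeta> * W) $$ (i, j)
      = (\<Sum>p<n. (mat_adjoint W * diag_of n \<zeta>) $$ (i, p) * W $$ (p, j))"
    using W ij d by (subst index_mult_mat(1)) (auto simp: scalar_prod_def atLeast0LessThan)
  then show ?thesis using 1 by (simp add: mult_ac)
qed

lemma mat_adjoint_adjoint [simp]:
  fixes W :: "complex mat"
  shows "mat_adjoint (mat_adjoint W) = W"
  by (rule eq_matI) auto

lemma unitary_mat_adjoint: "unitary_mat n A \<Longrightarrow> unitary_mat n (mat_adjoint A)"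
  by (auto simp: unitary_mat_def)

lemma unitary_mat_mult:
  assumes "unitary_mat n A" "unitary_mat n B"
  shows "unitary_mat n (A * B)"
proof -
  have c: "A \<in> carrier_mat n n" "B \<in> carrier_mat n n" "mat_adjoint A \<in> carrier_mat n n" "mat_adjoint B \<in> carrier_mat n n"
    using assms by (auto simp: unitary_mat_def)
  have "mat_adjoint A * (A * B) = (mat_adjoint A * A) * B"
    using c by (intro assoc_mult_mat[symmetric]) auto
  also have "\<dots> = B" using assms(1) c by (simp add: unitary_mat_def)
  finally have "mat_adjoint B * mat_adjoint A * (A * B) = mat_adjoint B * B"
    using assoc_mult_mat[of "mat_adjoint B" n n "mat_adjoint A" n "A * B" n] c by simp
  note 1 = this
  have "B * (mat_adjoint B * mat_adjoint A) = (B * mat_adjoint B) * mat_adjoint A"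
    using c by (intro assoc_mult_mat[symmetric]) auto
  also have "\<dots> = mat_adjoint A" using assms(2) c by (simp add: unitary_mat_def)
  finally have "A * B * (mat_adjoint B * mat_adjoint A) = A * mat_adjoint A"
    using assoc_mult_mat[of A n n B n "mat_adjoint B * mat_adjoint A" n] c by simp
  with 1 show ?thesis
    using assms c unfolding unitary_mat_def by (simp add: mat_adjoint_mult[of _ n])
qed

lemma unitary_diag_of:
  assumes "\<And>p. p < n \<Longrightarrow> cmod (\<zeta> p) = 1"
  shows "unitary_mat n (diag_of n \<zeta>)"
proof -
  have a: "mat_adjoint (diag_of n \<zeta>) = diag_of n (\<lambda>p. cnj (\<zeta> p))"
    by (rule eq_matI) (auto simp: diag_of_def)
  have 1: "diag_of n \<xi> = 1\<^sub>m n" if "\<And>p. p < n \<Longrightarrow> \<xi> p = 1" for \<xi>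
    using that by (intro eq_matI) (auto simp: diag_of_def)
  show ?thesis
    unfolding unitary_mat_def a diag_of_mult using assms
    by (auto intro!: 1 simp: unimodular_mult_cnj mult.commute[of "cnj _"])
qed

lemma norm_opuc_measure_of_verblunsky:
  assumes \<alpha>: "\<alpha> \<in> verb_dom (Suc m)" and j: "j \<le> m"
  shows "(\<integral>w. (cmod (poly (monic_OP (measure_of_verblunsky (Suc m) \<alpha>) j) w))\<^sup>2 \<partial>measure_of_verblunsky (Suc m) \<alpha>)
       = kappa \<alpha> j"
proof -
  let ?\<mu> = "measure_of_verblunsky (Suc m) \<alpha>"
  note P = measure_of_verblunsky_props[OF \<alpha>]
  have "(\<integral>w. complex_of_real ((cmod (poly (opuc \<alpha> j) w))\<^sup>2) \<partial>?\<mu>) = of_real (kappa \<alpha> j)"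
    using P(4)[OF j j] by (simp only: complex_norm_square mult.commute if_True simp_thms)
  then have "(\<integral>w. (cmod (poly (opuc \<alpha> j) w))\<^sup>2 \<partial>?\<mu>) = kappa \<alpha> j"
    unfolding integral_complex_of_real of_real_eq_iff .
  then show ?thesis using P(3)[of j] j by simp
qed

lemma kappa_pos_dom: "\<alpha> \<in> verb_dom (Suc m) \<Longrightarrow> j \<le> m \<Longrightarrow> kappa \<alpha> j > 0"
  by (rule kappa_pos) (auto simp: verb_dom_def)

lemma GGT_entry:
  assumes \<alpha>: "\<alpha> \<in> verb_dom (Suc m)" and ij: "i \<le> m" "j \<le> m"
  shows "GGT (Suc m) \<alpha> $$ (i, j)
    = (\<integral>z. cnj (poly (opuc \<alpha> i) z) * (z * poly (opuc \<alpha> j) z) \<partial>measure_of_verblunsky (Suc m) \<alpha>)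
      / of_real (sqrt (kappa \<alpha> i) * sqrt (kappa \<alpha> j))"
proof -
  let ?\<mu> = "measure_of_verblunsky (Suc m) \<alpha>"
  note P = measure_of_verblunsky_props[OF \<alpha>]
  have op: "orthonormal_poly ?\<mu> k z = poly (opuc \<alpha> k) z / of_real (sqrt (kappa \<alpha> k))" if "k \<le> m" for k z
    using that P(3)[of k] norm_opuc_measure_of_verblunsky[OF \<alpha> that] by (simp add: orthonormal_poly_def)
  have "GGT (Suc m) \<alpha> $$ (i, j) = (\<integral>z. cnj (orthonormal_poly ?\<mu> i z) * (z * orthonormal_poly ?\<mu> j z) \<partial>?\<mu>)"
    using ij by (simp add: GGT_def Let_def)
  also have "\<dots> = (\<integral>z. (cnj (poly (opuc \<alpha> i) z) * (z * poly (opuc \<alpha> j) z))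
      / of_real (sqrt (kappa \<alpha> i) * sqrt (kappa \<alpha> j)) \<partial>?\<mu>)"
    using ij by (simp add: op)
  finally show ?thesis by simp
qed

lemma GGT_carrier [simp]: "GGT n \<alpha> \<in> carrier_mat n n"
  by (simp add: GGT_def Let_def)

lemma GGT_dim [simp]: "dim_row (GGT n \<alpha>) = n" "dim_col (GGT n \<alpha>) = n"
  using GGT_carrier[of n \<alpha>] by (auto simp del: GGT_carrier)

text \<open>
  The matrix of multiplication by \<open>z\<close> is diagonal in the basis of normalized indicators of the atoms;
  \<open>W\<close> is the change to the basis of orthonormal polynomials.
\<close>
lemma GGT_diagonalization:
  assumes \<alpha>: "\<alpha> \<in> verb_dom (Suc m)"
  obtains \<zeta> W where "bij_betw \<zeta> {..<Suc m} (para_zeros \<alpha> (Suc m))" "unitary_mat (Suc m) W"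
    "GGT (Suc m) \<alpha> = mat_adjoint W * diag_of (Suc m) \<zeta> * W"
    "\<And>p. p < Suc m \<Longrightarrow> cnj (W $$ (p, 0)) * W $$ (p, 0) = of_real (measure (measure_of_verblunsky (Suc m) \<alpha>) {\<zeta> p})"
proof -
  define n where "n = Suc m"
  define \<mu> where "\<mu> = measure_of_verblunsky n \<alpha>"
  note P = measure_of_verblunsky_props[OF \<alpha>, folded n_def, folded \<mu>_def]
  define Z where "Z = para_zeros \<alpha> n"
  have Z: "finite Z" "card Z = n" using card_para_zeros[OF \<alpha>] by (simp_all add: Z_def n_def)
  then obtain \<zeta> where \<zeta>: "bij_betw \<zeta> {..<n} Z"
    using ex_bij_betw_nat_finite[of Z] by (auto simp: atLeast0LessThan)
  have \<kappa>: "kappa \<alpha> j > 0" if "j < n" for j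
    using that kappa_pos_dom[OF \<alpha>] by (simp add: n_def)
  define w where "w z = measure \<mu> {z}" for z
  have w0: "w z \<ge> 0" for z by (simp add: w_def)
  define W where "W = mat n n (\<lambda>(p, j). of_real (sqrt (w (\<zeta> p))) * poly (opuc \<alpha> j) (\<zeta> p) / of_real (sqrt (kappa \<alpha> j)))"
  have W: "W \<in> carrier_mat n n" by (simp add: W_def)
  have ent: "cnj (W $$ (p, i)) * W $$ (p, j)
      = of_real (w (\<zeta> p)) * (cnj (poly (opuc \<alpha> i) (\<zeta> p)) * poly (opuc \<alpha> j) (\<zeta> p))
         / of_real (sqrt (kappa \<alpha> i) * sqrt (kappa \<alpha> j))" if "p < n" "i < n" "j < n" for p i j
  proof -
    have "complex_of_real (w (\<zeta> p)) = of_real (sqrt (w (\<zeta> p))) * of_real (sqrt (w (\<zeta> p)))"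
      using w0[of "\<zeta> p"] by (simp flip: of_real_mult)
    then show ?thesis using that by (simp add: W_def)
  qed
  have sums: "(\<Sum>p<n. f (\<zeta> p) * (cnj (W $$ (p, i)) * W $$ (p, j)))
      = (\<integral>z. f z * (cnj (poly (opuc \<alpha> i) z) * poly (opuc \<alpha> j) z) \<partial>\<mu>) / of_real (sqrt (kappa \<alpha> i) * sqrt (kappa \<alpha> j))"
    if ij: "i < n" "j < n" and f: "continuous_on (sphere 0 1) f" for f i j
  proof -
    have "(\<integral>z. f z * (cnj (poly (opuc \<alpha> i) z) * poly (opuc \<alpha> j) z) \<partial>\<mu>)
        = (\<Sum>z\<in>Z. w z *\<^sub>R (f z * (cnj (poly (opuc \<alpha> i) z) * poly (opuc \<alpha> j) z)))"
      unfolding w_def Z_def P(2)[symmetric]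
      by (intro integral_n_point[OF P(1)] borel_measurable_circle_continuous continuous_intros f)
    also have "\<dots> = (\<Sum>p<n. w (\<zeta> p) *\<^sub>R (f (\<zeta> p) * (cnj (poly (opuc \<alpha> i) (\<zeta> p)) * poly (opuc \<alpha> j) (\<zeta> p))))"
      by (rule sum.reindex_bij_betw[OF \<zeta>, symmetric])
    finally have e: "(\<integral>z. f z * (cnj (poly (opuc \<alpha> i) z) * poly (opuc \<alpha> j) z) \<partial>\<mu>)
        = (\<Sum>p<n. w (\<zeta> p) *\<^sub>R (f (\<zeta> p) * (cnj (poly (opuc \<alpha> i) (\<zeta> p)) * poly (opuc \<alpha> j) (\<zeta> p))))" .
    show ?thesis
      unfolding e sum_divide_distrib
    proof (intro sum.cong refl)
      fix p assume "p \<in> {..<n}"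
      then show "f (\<zeta> p) * (cnj (W $$ (p, i)) * W $$ (p, j))
          = w (\<zeta> p) *\<^sub>R (f (\<zeta> p) * (cnj (poly (opuc \<alpha> i) (\<zeta> p)) * poly (opuc \<alpha> j) (\<zeta> p)))
            / of_real (sqrt (kappa \<alpha> i) * sqrt (kappa \<alpha> j))"
        using ent[of p i j] ij by (simp only: lessThan_iff scaleR_conv_of_real times_divide_eq_right mult.left_commute)
    qed
  qed
  have "mat_adjoint W * W = 1\<^sub>m n"
  proof (rule eq_matI)
    fix i j assume "i < dim_row (1\<^sub>m n :: complex mat)" "j < dim_col (1\<^sub>m n :: complex mat)"
    then have ij: "i < n" "j < n" by simp_all
    have "(mat_adjoint W * W) $$ (i, j) = (\<Sum>p<n. 1 * (cnj (W $$ (p, i)) * W $$ (p, j)))"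
      using ij W by (simp add: scalar_prod_def atLeast0LessThan)
    also have "\<dots> = (if i = j then of_real (kappa \<alpha> i) else 0) / of_real (sqrt (kappa \<alpha> i) * sqrt (kappa \<alpha> j))"
      using P(4)[of i j] ij by (subst sums) (auto simp: n_def)
    also have "\<dots> = 1\<^sub>m n $$ (i, j)"
      using \<kappa>[of i] ij by (auto simp flip: of_real_mult)
    finally show "(mat_adjoint W * W) $$ (i, j) = 1\<^sub>m n $$ (i, j)" .
  qed (use W in auto)
  moreover from this have "W * mat_adjoint W = 1\<^sub>m n"
    using W by (intro mat_mult_left_right_inverse[of "mat_adjoint W" n W]) auto
  ultimately have U: "unitary_mat n W" using W by (simp add: unitary_mat_def)
  have G: "GGT n \<alpha> = mat_adjoint W * diag_of n \<zeta> * W"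
  proof (rule eq_matI)
    fix i j assume "i < dim_row (mat_adjoint W * diag_of n \<zeta> * W)" "j < dim_col (mat_adjoint W * diag_of n \<zeta> * W)"
    then have ij: "i < n" "j < n" using W by auto
    have "(mat_adjoint W * diag_of n \<zeta> * W) $$ (i, j) = (\<Sum>p<n. \<zeta> p * (cnj (W $$ (p, i)) * W $$ (p, j)))"
      by (rule adjoint_diag_mult_entry[OF W ij])
    also have "\<dots> = (\<integral>z. z * (cnj (poly (opuc \<alpha> i) z) * poly (opuc \<alpha> j) z) \<partial>\<mu>) / of_real (sqrt (kappa \<alpha> i) * sqrt (kappa \<alpha> j))"
      by (rule sums[OF ij]) (intro continuous_intros)
    also have "\<dots> = GGT n \<alpha> $$ (i, j)"
      using GGT_entry[OF \<alpha>, of i j] ij by (simp add: n_def \<mu>_def mult_ac)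
    finally show "GGT n \<alpha> $$ (i, j) = (mat_adjoint W * diag_of n \<zeta> * W) $$ (i, j)" by simp
  qed (use W GGT_carrier[of n \<alpha>] in auto)
  have "cnj (W $$ (p, 0)) * W $$ (p, 0) = of_real (measure \<mu> {\<zeta> p})" if "p < n" for p
    using ent[of p 0 0] that by (simp add: n_def w_def)
  then show ?thesis
    using that[of \<zeta> W] \<zeta> U G by (simp add: n_def Z_def \<mu>_def)
qed

lemma GGT_unitary:
  assumes \<alpha>: "\<alpha> \<in> verb_dom (Suc m)"
  shows "unitary_mat (Suc m) (GGT (Suc m) \<alpha>)"
proof -
  obtain \<zeta> W where W: "bij_betw \<zeta> {..<Suc m} (para_zeros \<alpha> (Suc m))" "unitary_mat (Suc m) W"
    "GGT (Suc m) \<alpha> = mat_adjoint W * diag_of (Suc m) \<zeta> * W"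
    using GGT_diagonalization[OF \<alpha>] by blast
  have "cmod (\<zeta> p) = 1" if "p < Suc m" for p
    using W(1) that para_zero_cmod[OF \<alpha>] by (auto simp: bij_betw_def para_zeros_def)
  then show ?thesis unfolding W(3)
    using W(2) by (intro unitary_mat_mult unitary_mat_adjoint unitary_diag_of) auto
qed

lemma GGT_similar:
  assumes W: "unitary_mat n W" "G = mat_adjoint W * diag_of n \<zeta> * W"
  shows "similar_mat_wit G (diag_of n \<zeta>) (mat_adjoint W) W"
  by (rule similar_mat_witI[of _ _ n]) (use W in \<open>auto simp: unitary_mat_def\<close>)

lemma spectral_measure_GGT:
  assumes \<alpha>: "\<alpha> \<in> verb_dom (Suc m)"
  shows "spectral_measure (GGT (Suc m) \<alpha>) (unit_vec (Suc m) 0) = measure_of_verblunsky (Suc m) \<alpha>"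
proof (rule spectral_measure_eqI[OF GGT_unitary[OF \<alpha>]])
  note P = measure_of_verblunsky_props[OF \<alpha>]
  show "measure_of_verblunsky (Suc m) \<alpha> \<in> space (prob_algebra circle)"
    by (rule n_point_measuresD(1)[OF P(1)])
  fix k
  obtain \<zeta> W where W: "bij_betw \<zeta> {..<Suc m} (para_zeros \<alpha> (Suc m))" "unitary_mat (Suc m) W"
    "GGT (Suc m) \<alpha> = mat_adjoint W * diag_of (Suc m) \<zeta> * W"
    "\<And>p. p < Suc m \<Longrightarrow> cnj (W $$ (p, 0)) * W $$ (p, 0) = of_real (measure (measure_of_verblunsky (Suc m) \<alpha>) {\<zeta> p})"
    using GGT_diagonalization[OF \<alpha>] by blast
  have Wc: "W \<in> carrier_mat (Suc m) (Suc m)" using W(2) by (simp add: unitary_mat_def)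
  have "GGT (Suc m) \<alpha> ^\<^sub>m k = mat_adjoint W * diag_of (Suc m) \<zeta> ^\<^sub>m k * W"
    by (rule similar_mat_wit_pow_id[OF GGT_similar[OF W(2,3)]])
  then have "(GGT (Suc m) \<alpha> ^\<^sub>m k) $$ (0, 0) = (\<Sum>p<Suc m. \<zeta> p ^ k * (cnj (W $$ (p, 0)) * W $$ (p, 0)))"
    using adjoint_diag_mult_entry[OF Wc, of 0 0 "\<lambda>p. \<zeta> p ^ k"] by (simp only: diag_of_pow zero_less_Suc)
  also have "\<dots> = (\<Sum>p<Suc m. measure (measure_of_verblunsky (Suc m) \<alpha>) {\<zeta> p} *\<^sub>R \<zeta> p ^ k)"
    by (intro sum.cong refl) (simp add: W(4) scaleR_conv_of_real)
  also have "\<dots> = (\<Sum>z\<in>para_zeros \<alpha> (Suc m). measure (measure_of_verblunsky (Suc m) \<alpha>) {z} *\<^sub>R z ^ k)"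
    by (rule sum.reindex_bij_betw[OF W(1)])
  also have "\<dots> = (\<integral>z. z ^ k \<partial>measure_of_verblunsky (Suc m) \<alpha>)"
    unfolding P(2)[symmetric]
    by (intro integral_n_point[OF P(1), symmetric] borel_measurable_circle_continuous continuous_intros)
  finally show "(\<integral>z. z ^ k \<partial>measure_of_verblunsky (Suc m) \<alpha>) = (GGT (Suc m) \<alpha> ^\<^sub>m k) $$ (0, 0)" by simp
qed simp

lemma proots_char_poly_GGT:
  assumes \<alpha>: "\<alpha> \<in> verb_dom (Suc m)"
  shows "proots (char_poly (GGT (Suc m) \<alpha>)) = mset_set (para_zeros \<alpha> (Suc m))"
proof -
  obtain \<zeta> W where W: "bij_betw \<zeta> {..<Suc m} (para_zeros \<alpha> (Suc m))" "unitary_mat (Suc m) W"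
    "GGT (Suc m) \<alpha> = mat_adjoint W * diag_of (Suc m) \<zeta> * W"
    using GGT_diagonalization[OF \<alpha>] by blast
  have "char_poly (GGT (Suc m) \<alpha>) = char_poly (diag_of (Suc m) \<zeta>)"
    using GGT_similar[OF W(2,3)] by (intro char_poly_similar) (auto simp: similar_mat_def)
  also have "\<dots> = (\<Prod>a\<leftarrow>diag_mat (diag_of (Suc m) \<zeta>). [:- a, 1:])"
    by (rule char_poly_upper_triangular) (auto simp: diag_of_def)
  also have "diag_mat (diag_of (Suc m) \<zeta>) = map \<zeta> [0..<Suc m]"
    by (rule nth_equalityI) (auto simp: diag_mat_def diag_of_def simp del: upt_Suc)
  also have "(\<Prod>a\<leftarrow>map \<zeta> [0..<Suc m]. [:- a, 1:]) = (\<Prod>p<Suc m. [:- \<zeta> p, 1:])"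
    by (simp only: map_map o_def interv_sum_list_conv_sum_set_nat prod.list_conv_set_nth length_map length_upt)
       (auto intro!: prod.cong simp: atLeast0LessThan simp del: upt_Suc)
  also have "\<dots> = (\<Prod>z\<in>para_zeros \<alpha> (Suc m). [:- z, 1:])"
    by (rule prod.reindex_bij_betw[OF W(1)])
  finally show ?thesis by (simp add: proots_prod sum_unfold_sum_mset)
qed

text \<open>
  Both integrals come from one induction along the Szego recursion: \<open>\<integral> \<Phi>\<^sub>j\<^sub>+\<^sub>1 = 0\<close> relates them
  within a step, and the recursion for \<open>\<Phi>\<^sub>j\<^sup>*\<close> moves to the next degree.
\<close>
lemma integral_rev_opuc:
  assumes \<alpha>: "\<alpha> \<in> verb_dom (Suc m)" and j: "j \<le> m"
  shows "(\<integral>z. poly (ropuc \<alpha> j) z \<partial>measure_of_verblunsky (Suc m) \<alpha>) = of_real (kappa \<alpha> j)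
     \<and> (\<integral>z. z * poly (opuc \<alpha> j) z \<partial>measure_of_verblunsky (Suc m) \<alpha>) = cnj (\<alpha> j) * of_real (kappa \<alpha> j)"
proof -
  let ?\<mu> = "measure_of_verblunsky (Suc m) \<alpha>"
  note P = measure_of_verblunsky_props[OF \<alpha>]
  have \<mu>: "?\<mu> \<in> space (prob_algebra circle)" by (rule n_point_measuresD(1)[OF P(1)])
  have int: "integrable ?\<mu> f" if "continuous_on (sphere 0 1) f" for f :: "complex \<Rightarrow> complex"
    by (rule integrable_circle_complex[OF \<mu> that])
  have z: "(\<integral>z. poly (opuc \<alpha> (Suc j)) z \<partial>?\<mu>) = 0" if "j \<le> m" for j
  proof (cases "j = m")
    case True
    show ?thesis
      by (subst integral_n_point[OF P(1)]) (auto simp: P(2) para_zeros_def True)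
  next
    case False
    then show ?thesis using P(4)[of 0 "Suc j"] that by simp
  qed
  have zz: "(\<integral>z. z * poly (opuc \<alpha> j) z \<partial>?\<mu>) = cnj (\<alpha> j) * (\<integral>z. poly (ropuc \<alpha> j) z \<partial>?\<mu>)" if "j \<le> m" for j
  proof -
    have "0 = (\<integral>z. z * poly (opuc \<alpha> j) z - cnj (\<alpha> j) * poly (ropuc \<alpha> j) z \<partial>?\<mu>)"
      using z[OF that] by (simp only: poly_opuc_Suc)
    also have "\<dots> = (\<integral>z. z * poly (opuc \<alpha> j) z \<partial>?\<mu>) - cnj (\<alpha> j) * (\<integral>z. poly (ropuc \<alpha> j) z \<partial>?\<mu>)"
      by (subst Bochner_Integration.integral_diff) (auto intro!: int continuous_intros)
    finally show ?thesis by simp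
  qed
  have r: "(\<integral>z. poly (ropuc \<alpha> j) z \<partial>?\<mu>) = of_real (kappa \<alpha> j)"
    using j
  proof (induction j)
    case 0
    then show ?case using prob_algebra_circleD(3)[OF \<mu>] by (simp add: prob_space.prob_space)
  next
    case (Suc j)
    have "(\<integral>z. poly (ropuc \<alpha> (Suc j)) z \<partial>?\<mu>) = (\<integral>z. poly (ropuc \<alpha> j) z - \<alpha> j * (z * poly (opuc \<alpha> j) z) \<partial>?\<mu>)"
      by (simp only: poly_opuc_Suc mult.assoc)
    also have "\<dots> = (\<integral>z. poly (ropuc \<alpha> j) z \<partial>?\<mu>) - \<alpha> j * (\<integral>z. z * poly (opuc \<alpha> j) z \<partial>?\<mu>)"
      by (subst Bochner_Integration.integral_diff) (auto intro!: int continuous_intros)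
    also have "\<dots> = of_real (kappa \<alpha> j) * (1 - \<alpha> j * cnj (\<alpha> j))"
      using Suc zz[of j] by (simp add: algebra_simps)
    also have "1 - \<alpha> j * cnj (\<alpha> j) = of_real (1 - (cmod (\<alpha> j))\<^sup>2)"
      by (simp only: of_real_diff complex_norm_square of_real_1)
    finally show ?case by (simp only: kappa_Suc of_real_mult)
  qed
  show ?thesis using r zz[OF j] by simp
qed

lemma GGT_first_row:
  assumes \<alpha>: "\<alpha> \<in> verb_dom (Suc m)" and j: "j \<le> m"
  shows "GGT (Suc m) \<alpha> $$ (0, j) = cnj (\<alpha> j) * of_real (sqrt (kappa \<alpha> j))"
proof -
  have "complex_of_real (kappa \<alpha> j) = of_real (sqrt (kappa \<alpha> j)) * of_real (sqrt (kappa \<alpha> j))"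
    using kappa_pos_dom[OF \<alpha> j] by (simp flip: of_real_mult)
  then show ?thesis
    using GGT_entry[OF \<alpha>, of 0 j] integral_rev_opuc[OF \<alpha> j] j kappa_pos_dom[OF \<alpha> j] by simp
qed

text \<open>
  Inverts \<open>GGT_first_row\<close>: by unitarity the squared moduli of the first \<open>j\<close> entries of the first row
  sum to \<open>1 - kappa \<alpha> j\<close>. Thus the coefficients are measurable functions of the matrix.
\<close>
definition verblunsky_of_mat :: "complex mat \<Rightarrow> nat \<Rightarrow> complex" where
  "verblunsky_of_mat A j = cnj (A $$ (0, j)) / of_real (sqrt (1 - (\<Sum>i<j. (cmod (A $$ (0, i)))\<^sup>2)))"

lemma verblunsky_of_GGT:
  assumes \<alpha>: "\<alpha> \<in> verb_dom (Suc m)" and j: "j \<le> m"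
  shows "verblunsky_of_mat (GGT (Suc m) \<alpha>) j = \<alpha> j"
proof -
  have "(\<Sum>i<l. (cmod (GGT (Suc m) \<alpha> $$ (0, i)))\<^sup>2) = 1 - kappa \<alpha> l" if "l \<le> m" for l
    using that
  proof (induction l)
    case (Suc l)
    have "(cmod (GGT (Suc m) \<alpha> $$ (0, l)))\<^sup>2 = (cmod (\<alpha> l))\<^sup>2 * kappa \<alpha> l"
      using kappa_pos_dom[OF \<alpha>, of l] Suc.prems
      by (simp add: GGT_first_row[OF \<alpha>] norm_mult power_mult_distrib)
    then show ?case using Suc by (simp add: kappa_Suc algebra_simps)
  qed simp
  then have "1 - (\<Sum>i<j. (cmod (GGT (Suc m) \<alpha> $$ (0, i)))\<^sup>2) = kappa \<alpha> j" using j by simp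
  then show ?thesis
    unfolding verblunsky_of_mat_def using kappa_pos_dom[OF \<alpha> j]
    by (simp add: GGT_first_row[OF \<alpha> j])
qed

section \<open>Measurability of the GGT matrix\<close>

lemma szego_measurable:
  assumes X: "\<And>k. k < K \<Longrightarrow> (\<lambda>x. X x k) \<in> borel_measurable N"
  shows "k \<le> K \<Longrightarrow> (\<lambda>x. coeff (opuc (X x) k) a) \<in> borel_measurable N
        \<and> (\<lambda>x. coeff (ropuc (X x) k) a) \<in> borel_measurable N"
proof (induction k arbitrary: a)
  case (Suc k)
  have [measurable]: "(\<lambda>x. X x k) \<in> borel_measurable N" using X[of k] Suc.prems by simp
  have [measurable]: "\<And>a. (\<lambda>x. coeff (opuc (X x) k) a) \<in> borel_measurable N"
    "\<And>a. (\<lambda>x. coeff (ropuc (X x) k) a) \<in> borel_measurable N"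
    using Suc by auto
  have cnj_meas: "(\<lambda>x. cnj (X x k)) \<in> borel_measurable N"
    by (rule measurable_compose[OF _ borel_measurable_continuous_onI]) (auto intro!: continuous_intros)
  have p: "(\<lambda>x. coeff (pCons 0 (opuc (X x) k)) a) \<in> borel_measurable N"
    by (cases a) auto
  show ?case
    unfolding opuc_Suc ropuc_Suc coeff_diff coeff_smult
    using p cnj_meas by (auto intro!: borel_measurable_diff borel_measurable_times)
qed simp

lemma cnj_measurable [measurable]: "f \<in> borel_measurable N \<Longrightarrow> (\<lambda>x. cnj (f x)) \<in> borel_measurable N"
  by (rule measurable_compose[OF _ borel_measurable_continuous_onI]) (auto intro!: continuous_intros)

lemma kappa_measurable:
  assumes X: "\<And>k. k < K \<Longrightarrow> (\<lambda>x. X x k) \<in> borel_measurable N" and "k \<le> K"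
  shows "(\<lambda>x. kappa (X x) k) \<in> borel_measurable N"
proof -
  have [measurable]: "(\<lambda>x. X x i) \<in> borel_measurable N" if "i \<in> {..<k}" for i using X[of i] that assms(2) by simp
  show ?thesis unfolding kappa_def by measurable
qed

lemma mom_measurable:
  assumes X: "\<And>k. k < K \<Longrightarrow> (\<lambda>x. X x k) \<in> borel_measurable N"
  shows "k \<le> K \<Longrightarrow> (\<lambda>x. mom (X x) k) \<in> borel_measurable N"
proof (induction k rule: less_induct)
  case (less k)
  show ?case
  proof (cases k)
    case (Suc l)
    show ?thesis unfolding Suc mom.simps
      using less szego_measurable[of K X N "Suc l", OF X] Suc
      by (intro borel_measurable_uminus borel_measurable_sum borel_measurable_times) auto
  qed simp
qed

lemma verb_dom_measurable:
  assumes X: "\<And>k. k < Suc m \<Longrightarrow> (\<lambda>x. X x k) \<in> borel_measurable N"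
  shows "{x \<in> space N. X x \<in> verb_dom (Suc m)} \<in> sets N"
proof -
  have [measurable]: "(\<lambda>x. X x k) \<in> borel_measurable N" if "k \<in> {..<Suc m}" for k using X[of k] that by simp
  have "{x \<in> space N. X x \<in> verb_dom (Suc m)}
      = {x \<in> space N. (\<forall>k\<in>{..<m}. cmod (X x k) < 1) \<and> cmod (X x m) = 1}"
    by (auto simp: verb_dom_def)
  also have "\<dots> \<in> sets N"
    by (intro sets.sets_Collect_conj sets.sets_Collect_finite_All) (measurable; simp)+
  finally show ?thesis .
qed

text \<open>
  An expression of the entries through finitely many coefficients, from which measurability can be
  read off although \<open>measure_of_verblunsky\<close> is a definite description.
\<close>
lemma GGT_entry_moments:
  assumes \<alpha>: "\<alpha> \<in> verb_dom (Suc m)" and ij: "i \<le> m" "j \<le> m"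
  shows "GGT (Suc m) \<alpha> $$ (i, j)
    = (\<Sum>a\<le>i. \<Sum>b\<le>j. cnj (coeff (opuc \<alpha> i) a) * coeff (opuc \<alpha> j) b
         * (if a \<le> Suc b then mom \<alpha> (Suc b - a) else cnj (mom \<alpha> (a - Suc b))))
      / of_real (sqrt (kappa \<alpha> i) * sqrt (kappa \<alpha> j))"
proof -
  let ?\<mu> = "measure_of_verblunsky (Suc m) \<alpha>"
  note P = measure_of_verblunsky_props[OF \<alpha>]
  have \<mu>: "?\<mu> \<in> space (prob_algebra circle)" by (rule n_point_measuresD(1)[OF P(1)])
  have pp: "cnj (poly (opuc \<alpha> i) z) * (z * poly (opuc \<alpha> j) z)
      = (\<Sum>a\<le>i. \<Sum>b\<le>j. cnj (coeff (opuc \<alpha> i) a) * coeff (opuc \<alpha> j) b * (z ^ Suc b * cnj z ^ a))" for z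
    unfolding poly_altdef by (simp add: sum_distrib_left sum_product mult_ac)
  have "(\<integral>z. cnj (poly (opuc \<alpha> i) z) * (z * poly (opuc \<alpha> j) z) \<partial>?\<mu>)
      = (\<Sum>a\<le>i. \<Sum>b\<le>j. \<integral>z. cnj (coeff (opuc \<alpha> i) a) * coeff (opuc \<alpha> j) b * (z ^ Suc b * cnj z ^ a) \<partial>?\<mu>)"
    unfolding pp
    by (subst Bochner_Integration.integral_sum;
        (intro sum.cong refl Bochner_Integration.integral_sum | intro Bochner_Integration.integrable_sum)?)
       (intro integrable_circle_complex[OF \<mu>] continuous_intros)+
  also have "\<dots> = (\<Sum>a\<le>i. \<Sum>b\<le>j. cnj (coeff (opuc \<alpha> i) a) * coeff (opuc \<alpha> j) b
         * (if a \<le> Suc b then mom \<alpha> (Suc b - a) else cnj (mom \<alpha> (a - Suc b))))"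
  proof (intro sum.cong refl)
    fix a b assume ab: "a \<in> {..i}" "b \<in> {..j}"
    have "(\<integral>z. z ^ Suc b * cnj z ^ a \<partial>?\<mu>)
        = (if a \<le> Suc b then mom \<alpha> (Suc b - a) else cnj (mom \<alpha> (a - Suc b)))"
      unfolding laurent_moment[OF \<mu>]
      using moments_measure_of_verblunsky[OF \<alpha>, of "Suc b - a"] moments_measure_of_verblunsky[OF \<alpha>, of "a - Suc b"] ab ij
      by auto
    then show "(\<integral>z. cnj (coeff (opuc \<alpha> i) a) * coeff (opuc \<alpha> j) b * (z ^ Suc b * cnj z ^ a) \<partial>?\<mu>)
       = cnj (coeff (opuc \<alpha> i) a) * coeff (opuc \<alpha> j) b
         * (if a \<le> Suc b then mom \<alpha> (Suc b - a) else cnj (mom \<alpha> (a - Suc b)))"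
      by (simp only: integral_mult_right_zero)
  qed
  finally show ?thesis unfolding GGT_entry[OF \<alpha> ij] by simp
qed

lemma GGT_outside:
  "\<alpha> \<notin> verb_dom (Suc m) \<Longrightarrow> GGT (Suc m) \<alpha> = GGT (Suc m) (\<lambda>_. 0)"
  using measure_of_verblunsky_outside[of \<alpha> m] by (simp add: GGT_def)

lemma space_mat_borel [simp]: "space (mat_borel n) = carrier_mat n n"
  by (simp add: mat_borel_def)

lemma mat_borel_entry:
  assumes "i < n" "j < n"
  shows "(\<lambda>A. A $$ (i, j)) \<in> borel_measurable (mat_borel n)"
proof -
  have "(\<lambda>A. \<lambda>ij\<in>{..<n} \<times> {..<n}. A $$ ij) \<in> measurable (mat_borel n) (Pi\<^sub>M ({..<n} \<times> {..<n}) (\<lambda>_. borel :: complex measure))"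
    unfolding mat_borel_def by (rule measurable_vimage_algebra1) (auto simp: space_PiM)
  from measurable_compose[OF this measurable_component_singleton[of "(i, j)"]]
  show ?thesis using assms by simp
qed

lemma measurable_mat_borelI:
  assumes "\<And>x. x \<in> space N \<Longrightarrow> f x \<in> carrier_mat n n"
    and "\<And>i j. i < n \<Longrightarrow> j < n \<Longrightarrow> (\<lambda>x. f x $$ (i, j)) \<in> borel_measurable N"
  shows "f \<in> measurable N (mat_borel n)"
  unfolding mat_borel_def
proof (rule measurable_vimage_algebra2)
  show "(\<lambda>x. \<lambda>ij\<in>{..<n} \<times> {..<n}. f x $$ ij) \<in> measurable N (Pi\<^sub>M ({..<n} \<times> {..<n}) (\<lambda>_. borel))"
    by (rule measurable_restrict) (use assms(2) in auto)
qed (use assms(1) in auto)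

lemma GGT_measurable:
  assumes X: "\<And>k. k < Suc m \<Longrightarrow> (\<lambda>x. X x k) \<in> borel_measurable N"
  shows "(\<lambda>x. GGT (Suc m) (X x)) \<in> measurable N (mat_borel (Suc m))"
proof (rule measurable_mat_borelI)
  fix i j assume "i < Suc m" "j < Suc m"
  then have ij: "i \<le> m" "j \<le> m" by auto
  have eq: "(\<lambda>x. GGT (Suc m) (X x) $$ (i, j)) = (\<lambda>x. if X x \<in> verb_dom (Suc m) then
      (\<Sum>a\<le>i. \<Sum>b\<le>j. cnj (coeff (opuc (X x) i) a) * coeff (opuc (X x) j) b
         * (if a \<le> Suc b then mom (X x) (Suc b - a) else cnj (mom (X x) (a - Suc b))))
      / of_real (sqrt (kappa (X x) i) * sqrt (kappa (X x) j)) else GGT (Suc m) (\<lambda>_. 0) $$ (i, j))"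
  proof
    fix x
    show "GGT (Suc m) (X x) $$ (i, j) = (if X x \<in> verb_dom (Suc m) then
      (\<Sum>a\<le>i. \<Sum>b\<le>j. cnj (coeff (opuc (X x) i) a) * coeff (opuc (X x) j) b
         * (if a \<le> Suc b then mom (X x) (Suc b - a) else cnj (mom (X x) (a - Suc b))))
      / of_real (sqrt (kappa (X x) i) * sqrt (kappa (X x) j)) else GGT (Suc m) (\<lambda>_. 0) $$ (i, j))"
      using GGT_entry_moments[of "X x" m, OF _ ij] GGT_outside[of "X x" m] by auto
  qed
  have c: "(\<lambda>x. coeff (opuc (X x) k) a) \<in> borel_measurable N" if "k \<le> m" for k a
    using szego_measurable[of "Suc m" X N k a, OF X] that by simp
  have mo: "(\<lambda>x. mom (X x) k) \<in> borel_measurable N" if "k \<le> Suc m" for k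
    using mom_measurable[of "Suc m" X N k, OF X] that by simp
  have ka: "(\<lambda>x. kappa (X x) k) \<in> borel_measurable N" if "k \<le> m" for k
    using kappa_measurable[of "Suc m" X N k, OF X] that by simp
  have trm: "(\<lambda>x. cnj (coeff (opuc (X x) i) a) * coeff (opuc (X x) j) b
         * (if a \<le> Suc b then mom (X x) (Suc b - a) else cnj (mom (X x) (a - Suc b)))) \<in> borel_measurable N"
    if "a \<le> i" "b \<le> j" for a b
    using that ij by (cases "a \<le> Suc b")
      (auto intro!: borel_measurable_times cnj_measurable c mo)
  have k2: "(\<lambda>x. complex_of_real (sqrt (kappa (X x) i) * sqrt (kappa (X x) j))) \<in> borel_measurable N"
    using ka[OF ij(1)] ka[OF ij(2)] by measurable
  show "(\<lambda>x. GGT (Suc m) (X x) $$ (i, j)) \<in> borel_measurable N"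
    unfolding eq
    by (intro measurable_If borel_measurable_divide k2 borel_measurable_sum trm verb_dom_measurable[of m X N, OF X] measurable_const)
       auto
qed simp


section \<open>The characteristic polynomial at one\<close>

text \<open>
  The deformed Verblunsky coefficients of Bourgade, Nikeghbali and Rouault:
  \<open>\<Phi>\<^sub>k\<^sub>+\<^sub>1(1) = (1 - gam \<alpha> k) * \<Phi>\<^sub>k(1)\<close>.
\<close>
definition gam :: "(nat \<Rightarrow> complex) \<Rightarrow> nat \<Rightarrow> complex" where
  "gam \<alpha> k = cnj (\<alpha> k) * poly (ropuc \<alpha> k) 1 / poly (opuc \<alpha> k) 1"

lemma gam_cong: "(\<And>i. i \<le> k \<Longrightarrow> \<alpha> i = \<alpha>' i) \<Longrightarrow> gam \<alpha> k = gam \<alpha>' k"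
  using opuc_cong[of k \<alpha> \<alpha>'] ropuc_cong[of k \<alpha> \<alpha>'] by (simp add: gam_def)

lemma Re_one_minus_pos:
  assumes "cmod g \<le> 1" "g \<noteq> 1"
  shows "Re (1 - g) > 0"
proof -
  have "Re g \<le> cmod g" by (rule complex_Re_le_cmod)
  moreover have "Re g \<noteq> 1"
  proof
    assume r: "Re g = 1"
    have "(Re g)\<^sup>2 + (Im g)\<^sup>2 \<le> 1\<^sup>2" using assms(1) unfolding cmod_power2[symmetric] by (intro power_mono) auto
    then have "Im g = 0" using r by simp
    then have "g = 1" using r by (simp add: complex_eq_iff)
    with assms(2) show False by simp
  qed
  ultimately show ?thesis using assms(1) by simp
qed

lemma Re_pos_notin_nonpos: "Re z > 0 \<Longrightarrow> z \<notin> \<real>\<^sub>\<le>\<^sub>0"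
  by (auto simp: complex_nonpos_Reals_iff)

lemma Re_pos_nonzero: "Re z > 0 \<Longrightarrow> z \<noteq> 0"
  by auto

lemma szego_cmod_diff:
  "(cmod (poly (ropuc \<alpha> k) z))\<^sup>2 - (cmod (poly (opuc \<alpha> k) z))\<^sup>2
   = (1 - (cmod z)\<^sup>2) * (\<Sum>j<k. (\<Prod>i\<in>{j..<k}. 1 - (cmod (\<alpha> i))\<^sup>2) * (cmod (poly (opuc \<alpha> j) z))\<^sup>2)"
proof -
  have "complex_of_real ((cmod (poly (ropuc \<alpha> k) z))\<^sup>2 - (cmod (poly (opuc \<alpha> k) z))\<^sup>2)
    = of_real ((1 - (cmod z)\<^sup>2) * (\<Sum>j<k. (\<Prod>i\<in>{j..<k}. 1 - (cmod (\<alpha> i))\<^sup>2) * (cmod (poly (opuc \<alpha> j) z))\<^sup>2))"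
    using christoffel_darboux[of \<alpha> k z z]
    by (simp only: of_real_diff of_real_mult of_real_sum complex_norm_square of_real_1)
  then show ?thesis by (simp only: of_real_eq_iff)
qed

lemma szego_disk:
  assumes a: "\<And>i. i < k \<Longrightarrow> cmod (\<alpha> i) < 1" and z: "cmod z < 1"
  shows "cmod (poly (opuc \<alpha> k) z) \<le> cmod (poly (ropuc \<alpha> k) z)" "poly (ropuc \<alpha> k) z \<noteq> 0"
proof -
  define S where "S = (\<Sum>j<k. (\<Prod>i\<in>{j..<k}. 1 - (cmod (\<alpha> i))\<^sup>2) * (cmod (poly (opuc \<alpha> j) z))\<^sup>2)"
  have pr: "(\<Prod>i\<in>{j..<k}. 1 - (cmod (\<alpha> i))\<^sup>2) > 0" for j
    using a by (intro prod_pos) (auto simp: abs_square_less_1)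
  have S0: "S \<ge> 0" unfolding S_def using pr by (intro sum_nonneg mult_nonneg_nonneg) (auto intro: less_imp_le)
  have z2: "1 - (cmod z)\<^sup>2 > 0" using z by (simp add: abs_square_less_1)
  have eq: "(cmod (poly (ropuc \<alpha> k) z))\<^sup>2 - (cmod (poly (opuc \<alpha> k) z))\<^sup>2 = (1 - (cmod z)\<^sup>2) * S"
    unfolding S_def by (rule szego_cmod_diff)
  have "(1 - (cmod z)\<^sup>2) * S \<ge> 0" using z2 S0 by simp
  then have "(cmod (poly (opuc \<alpha> k) z))\<^sup>2 \<le> (cmod (poly (ropuc \<alpha> k) z))\<^sup>2" using eq by linarith
  then show "cmod (poly (opuc \<alpha> k) z) \<le> cmod (poly (ropuc \<alpha> k) z)"
    by (rule power2_le_imp_le) simp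
  show "poly (ropuc \<alpha> k) z \<noteq> 0"
  proof (cases k)
    case (Suc l)
    then have "k > 0" by simp
    then have "S > 0"
      unfolding S_def using pr by (intro sum_pos2[of _ 0]) (auto intro!: mult_nonneg_nonneg less_imp_le[OF pr])
    then have "(1 - (cmod z)\<^sup>2) * S > 0" using z2 by simp
    then have "(cmod (poly (ropuc \<alpha> k) z))\<^sup>2 > 0" using eq by (smt (verit) zero_le_power2)
    then show ?thesis by auto
  qed simp
qed

text \<open>
  The continuous function \<open>h\<close> takes values in the discrete set \<open>2\<pi>i\<int>\<close>.
\<close>
lemma exp_one_continuous_const:
  fixes h :: "real \<Rightarrow> complex"
  assumes "continuous_on {0..1} h" "\<And>r. r \<in> {0..1} \<Longrightarrow> exp (h r) = 1" "h 0 = 0"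
  shows "h 1 = 0"
proof -
  have "h constant_on {0..1}"
  proof (rule continuous_discrete_range_constant[OF _ assms(1)])
    show "connected {0..1::real}" by simp
    fix x :: real assume x: "x \<in> {0..1}"
    show "\<exists>e>0. \<forall>y. y \<in> {0..1} \<and> h y \<noteq> h x \<longrightarrow> e \<le> norm (h y - h x)"
    proof (intro exI[of _ "2*pi"] conjI allI impI)
      fix y assume y: "y \<in> {0..1} \<and> h y \<noteq> h x"
      obtain i j :: int where i: "Re (h x) = 0" "Im (h x) = of_int (2 * i) * pi"
        and j: "Re (h y) = 0" "Im (h y) = of_int (2 * j) * pi"
        using assms(2)[OF x] assms(2)[of y] y unfolding exp_eq_1 by blast
      have "i \<noteq> j" using i j y by (auto simp: complex_eq_iff)
      then have "\<bar>real_of_int (j - i)\<bar> \<ge> 1" by linarith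
      then have "2 * pi * 1 \<le> 2 * pi * \<bar>real_of_int (j - i)\<bar>" by (intro mult_left_mono) auto
      also have "\<dots> = \<bar>2 * pi * real_of_int (j - i)\<bar>" by (simp only: abs_mult) simp
      also have "2 * pi * real_of_int (j - i) = Im (h y - h x)"
        using i j by (simp add: algebra_simps)
      also have "\<bar>Im (h y - h x)\<bar> \<le> norm (h y - h x)" by (rule abs_Im_le_cmod)
      finally show "2 * pi \<le> norm (h y - h x)" by simp
    qed simp
  qed
  then obtain c where "\<And>r. r \<in> {0..1} \<Longrightarrow> h r = c" by (auto simp: constant_on_def)
  then show ?thesis using assms(3) by (metis atLeastAtMost_iff order_refl zero_le_one)
qed

lemma para_nonzero_at_one:
  assumes "\<alpha> \<in> verb_dom (Suc m)" "poly (opuc \<alpha> (Suc m)) 1 \<noteq> 0" "k \<le> Suc m"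
  shows "poly (opuc \<alpha> k) 1 \<noteq> 0" "poly (ropuc \<alpha> k) 1 = cnj (poly (opuc \<alpha> k) 1)"
proof -
  show r: "poly (ropuc \<alpha> k) 1 = cnj (poly (opuc \<alpha> k) 1)" for k using ropuc_circle[of 1 \<alpha> k] by simp
  have "poly (opuc \<alpha> (Suc k)) 1 = 0" if "poly (opuc \<alpha> k) 1 = 0" for k
    using that r[of k] by (simp add: poly_opuc_Suc)
  then have "poly (opuc \<alpha> (k + l)) 1 = 0" if "poly (opuc \<alpha> k) 1 = 0" for l
    using that by (induction l) auto
  moreover obtain l where "Suc m = k + l" using le_Suc_ex[OF assms(3)] by blast
  ultimately show "poly (opuc \<alpha> k) 1 \<noteq> 0" using assms(2) by metis
qed

lemma ropuc_eq_prod: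
  assumes \<alpha>: "\<alpha> \<in> verb_dom (Suc m)"
  shows "poly (ropuc \<alpha> (Suc m)) z = (\<Prod>\<zeta>\<in>para_zeros \<alpha> (Suc m). 1 - z * cnj \<zeta>)"
proof -
  define Z where "Z = para_zeros \<alpha> (Suc m)"
  have "ropuc \<alpha> (Suc m) = (\<Prod>\<zeta>\<in>Z. [:1, - cnj \<zeta>:])"
  proof (rule poly_ext_nonzero)
    fix z :: complex assume z: "z \<noteq> 0"
    have "poly (ropuc \<alpha> (Suc m)) z = z ^ Suc m * cnj (\<Prod>\<zeta>\<in>Z. (1 / cnj z - \<zeta>))"
      using szego_reversal[OF z, of \<alpha> "Suc m"] unfolding opuc_eq_prod_para_zeros[OF \<alpha>]
      by (simp add: poly_prod Z_def)
    also have "z ^ Suc m = (\<Prod>\<zeta>\<in>Z. z)" using card_para_zeros[OF \<alpha>] by (simp add: Z_def)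
    also have "(\<Prod>\<zeta>\<in>Z. z) * cnj (\<Prod>\<zeta>\<in>Z. (1 / cnj z - \<zeta>)) = (\<Prod>\<zeta>\<in>Z. z * (1 / z - cnj \<zeta>))"
      by (simp add: prod.distrib)
    also have "\<dots> = (\<Prod>\<zeta>\<in>Z. 1 - z * cnj \<zeta>)"
      using z by (intro prod.cong refl) (simp add: right_diff_distrib)
    finally show "poly (ropuc \<alpha> (Suc m)) z = poly (\<Prod>\<zeta>\<in>Z. [:1, - cnj \<zeta>:]) z"
      by (simp add: poly_prod)
  qed
  then show ?thesis by (simp add: poly_prod Z_def)
qed

text \<open>
  The exponentials of the two sides agree, as both are \<open>\<Phi>\<^sub>n(1)\<close>. To see that the principal branches
  add up correctly, follow \<open>\<Phi>\<^sub>n\<^sup>*\<close> along the segment from \<open>0\<close> to \<open>1\<close>: it is the product of the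
  \<open>1 - r cnj \<zeta>\<close> and, telescoping, of the quotients \<open>\<Phi>\<^sub>k\<^sub>+\<^sub>1\<^sup>*(r) / \<Phi>\<^sub>k\<^sup>*(r) = 1 - R k r\<close>. All these
  factors have positive real part on the whole segment, so the logarithms are continuous there, and
  they vanish at \<open>0\<close>.
\<close>
lemma sum_Ln_zeros:
  assumes \<alpha>: "\<alpha> \<in> verb_dom (Suc m)" and nz: "poly (opuc \<alpha> (Suc m)) 1 \<noteq> 0"
  shows "(\<Sum>\<zeta>\<in>para_zeros \<alpha> (Suc m). Ln (1 - \<zeta>)) = (\<Sum>k<Suc m. Ln (1 - gam \<alpha> k))"
proof -
  define Z where "Z = para_zeros \<alpha> (Suc m)"
  have finZ: "finite Z" by (simp add: Z_def)
  have Z1: "cmod \<zeta> = 1" "\<zeta> \<noteq> 1" if "\<zeta> \<in> Z" for \<zeta>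
    using para_zero_cmod[OF \<alpha>, of \<zeta>] that nz by (auto simp: Z_def para_zeros_def)
  have a: "cmod (\<alpha> i) < 1" if "i < m" for i using \<alpha> that by (auto simp: verb_dom_def)
  have a1: "cmod (\<alpha> k) \<le> 1" if "k < Suc m" for k
  proof (cases "k = m")
    case True then show ?thesis using \<alpha> by (simp add: verb_dom_def)
  next
    case False then show ?thesis using a[of k] that by simp
  qed
  note one = para_nonzero_at_one[OF \<alpha> nz]
  define P Q where "P k r = poly (opuc \<alpha> k) (of_real r)" and "Q k r = poly (ropuc \<alpha> k) (of_real r)" for k and r :: real
  have disk: "cmod (P k r) \<le> cmod (Q k r)" "Q k r \<noteq> 0" if "k < Suc m" "0 \<le> r" "r < 1" for k r
    unfolding P_def Q_def using szego_disk[of k \<alpha> "of_real r"] a that by auto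
  have Qn: "Q k r \<noteq> 0" if "k \<le> Suc m" "r \<in> {0..1}" for k r
  proof (cases "r = 1")
    case True
    then show ?thesis using one[OF that(1)] by (simp add: Q_def)
  next
    case False
    show ?thesis
    proof (cases "k = Suc m")
      case True
      have "1 - of_real r * cnj \<zeta> \<noteq> 0" if "\<zeta> \<in> Z" for \<zeta>
      proof
        assume "1 - of_real r * cnj \<zeta> = 0"
        then have "cmod (of_real r * cnj \<zeta>) = 1" by simp
        then show False using Z1[OF that] \<open>r \<in> {0..1}\<close> False by (simp add: norm_mult)
      qed
      then show ?thesis unfolding Q_def True ropuc_eq_prod[OF \<alpha>] by (simp add: Z_def)
    next
      case False
      then show ?thesis using disk(2)[of k r] that \<open>r \<noteq> 1\<close> by auto
    qed
  qed
  \<comment> \<open>the conjugate of \<open>gam \<alpha> k\<close> at \<open>r = 1\<close>; of modulus less than \<open>1\<close> inside, by the maximum principle \<open>szego_disk\<close>\<close>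
  define R where "R k r = \<alpha> k * (of_real r * P k r / Q k r)" for k r
  have ratio: "1 - R k r = Q (Suc k) r / Q k r" if "k < Suc m" "r \<in> {0..1}" for k r
    using Qn[of k r] that by (simp add: R_def P_def Q_def poly_opuc_Suc diff_divide_distrib mult_ac)
  have Rle: "cmod (R k r) \<le> 1" if "k < Suc m" "r \<in> {0..1}" for k r
  proof -
    have "cmod (P k r) \<le> cmod (Q k r)"
    proof (cases "r = 1")
      case True
      then show ?thesis using cmod_ropuc_circle[of 1 \<alpha> k] by (simp add: P_def Q_def)
    qed (use disk(1)[of k r] that in auto)
    then have "cmod (P k r / Q k r) \<le> 1" using Qn[of k r] that by (simp add: norm_divide)
    then have "cmod (\<alpha> k) * (\<bar>r\<bar> * cmod (P k r / Q k r)) \<le> 1 * (1 * 1)"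
      using a1[OF that(1)] that(2) by (intro mult_mono) auto
    then show ?thesis by (simp add: R_def norm_mult norm_divide)
  qed
  have Rpos: "Re (1 - R k r) > 0" if "k < Suc m" "r \<in> {0..1}" for k r
  proof (rule Re_one_minus_pos[OF Rle[OF that]])
    have "1 - R k r \<noteq> 0" unfolding ratio[OF that] using Qn[of k r] Qn[of "Suc k" r] that by simp
    then show "R k r \<noteq> 1" by auto
  qed
  define L where "L \<zeta> r = 1 - of_real r * cnj \<zeta>" for \<zeta> and r :: real
  have Lpos: "Re (L \<zeta> r) > 0" if "\<zeta> \<in> Z" "r \<in> {0..1}" for \<zeta> r
    unfolding L_def
  proof (rule Re_one_minus_pos)
    show "cmod (of_real r * cnj \<zeta>) \<le> 1" using Z1[OF that(1)] that(2) by (simp add: norm_mult)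
    show "of_real r * cnj \<zeta> \<noteq> 1"
    proof
      assume h: "of_real r * cnj \<zeta> = 1"
      then have "cmod (of_real r * cnj \<zeta>) = 1" by simp
      then have "r = 1" using Z1[OF that(1)] that(2) by (simp add: norm_mult)
      then have "cnj \<zeta> = cnj 1" using h by simp
      then show False using Z1(2)[OF that(1)] by (simp only: complex_cnj_cancel_iff)
    qed
  qed
  define h where "h r = (\<Sum>\<zeta>\<in>Z. Ln (L \<zeta> r)) - (\<Sum>k<Suc m. Ln (1 - R k r))" for r
  have "h 1 = 0"
  proof (rule exp_one_continuous_const)
    have cQ: "continuous_on {0..1} (\<lambda>r. Q k r)" "continuous_on {0..1} (\<lambda>r. P k r)" for k
      unfolding Q_def P_def by (intro continuous_intros)+
    have cR: "continuous_on {0..1} (\<lambda>r. 1 - R k r)" if "k < Suc m" for k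
      unfolding R_def using Qn[of k] that by (intro continuous_intros cQ) auto
    show "continuous_on {0..1} h"
      unfolding h_def
    proof (intro continuous_on_diff continuous_on_sum)
      fix \<zeta> assume "\<zeta> \<in> Z"
      then show "continuous_on {0..1} (\<lambda>r. Ln (L \<zeta> r))"
        using Lpos[of \<zeta>] by (intro continuous_on_Ln') (auto simp: L_def intro!: continuous_intros Re_pos_notin_nonpos)
    next
      fix k assume "k \<in> {..<Suc m}"
      then show "continuous_on {0..1} (\<lambda>r. Ln (1 - R k r))"
        using Rpos[of k] cR[of k] by (intro continuous_on_Ln') (auto intro!: Re_pos_notin_nonpos)
    qed
    show "h 0 = 0" by (simp add: h_def L_def R_def)
    fix r :: real assume r: "r \<in> {0..1}"
    have "exp (\<Sum>\<zeta>\<in>Z. Ln (L \<zeta> r)) = (\<Prod>\<zeta>\<in>Z. L \<zeta> r)"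
      unfolding exp_sum[OF finZ] using Re_pos_nonzero[OF Lpos[OF _ r]] by (intro prod.cong refl exp_Ln)
    also have "\<dots> = Q (Suc m) r" by (simp add: Q_def ropuc_eq_prod[OF \<alpha>] L_def Z_def)
    finally have 1: "exp (\<Sum>\<zeta>\<in>Z. Ln (L \<zeta> r)) = Q (Suc m) r" .
    have "exp (\<Sum>k<Suc m. Ln (1 - R k r)) = (\<Prod>k<Suc m. 1 - R k r)"
      unfolding exp_sum[OF finite_lessThan] using Re_pos_nonzero[OF Rpos[OF _ r]]
      by (intro prod.cong refl exp_Ln) simp
    also have "\<dots> = (\<Prod>k<Suc m. Q (Suc k) r / Q k r)" using ratio[OF _ r] by (intro prod.cong) auto
    also have "\<dots> = Q (Suc m) r / Q 0 r"
      using Qn[OF _ r] by (intro prod_lessThan_telescope) auto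
    also have "\<dots> = Q (Suc m) r" by (simp add: Q_def)
    finally have 2: "exp (\<Sum>k<Suc m. Ln (1 - R k r)) = Q (Suc m) r" .
    show "exp (h r) = 1" unfolding h_def exp_diff 1 2 using Qn[OF _ r] by simp
  qed
  then have "(\<Sum>\<zeta>\<in>Z. Ln (L \<zeta> 1)) = (\<Sum>k<Suc m. Ln (1 - R k 1))" by (simp add: h_def)
  then have "(\<Sum>\<zeta>\<in>Z. cnj (Ln (L \<zeta> 1))) = (\<Sum>k<Suc m. cnj (Ln (1 - R k 1)))"
    by (metis cnj_sum)
  moreover have "cnj (Ln (L \<zeta> 1)) = Ln (1 - \<zeta>)" if "\<zeta> \<in> Z" for \<zeta>
    using Lpos[OF that, of 1] by (subst cnj_Ln) (auto intro!: Re_pos_notin_nonpos simp: L_def)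
  moreover have "cnj (Ln (1 - R k 1)) = Ln (1 - gam \<alpha> k)" if "k < Suc m" for k
  proof -
    have "cnj (R k 1) = gam \<alpha> k"
      using one[of k] that by (simp add: R_def gam_def P_def Q_def)
    then show ?thesis
      using Rpos[OF that, of 1] by (subst cnj_Ln) (auto intro!: Re_pos_notin_nonpos)
  qed
  ultimately show ?thesis by (simp add: Z_def)
qed

text \<open>
  The contribution to \<open>det_delta \<delta>\<close> of an eigenvalue \<open>x\<close>, and likewise of a deformed coefficient \<open>x\<close>.
\<close>
definition hw :: "complex \<Rightarrow> complex \<Rightarrow> real" where
  "hw \<delta> x = exp (2 * Re (cnj \<delta> * Ln (1 - x)))"

lemma hw_pos [simp]: "hw \<delta> x > 0" "hw \<delta> x \<ge> 0"
  by (simp_all add: hw_def)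

lemma hw_measurable [measurable]: "hw \<delta> \<in> borel_measurable borel"
  unfolding hw_def[abs_def] by measurable

lemma det_delta_GGT:
  assumes \<alpha>: "\<alpha> \<in> verb_dom (Suc m)" and nz: "poly (opuc \<alpha> (Suc m)) 1 \<noteq> 0"
  shows "Re (det_delta \<delta> (GGT (Suc m) \<alpha>)) = (\<Prod>k<Suc m. hw \<delta> (gam \<alpha> k))"
proof -
  define Z where "Z = para_zeros \<alpha> (Suc m)"
  have Z1: "cmod \<zeta> = 1" "\<zeta> \<noteq> 1" if "\<zeta> \<in> Z" for \<zeta>
    using para_zero_cmod[OF \<alpha>, of \<zeta>] that nz by (auto simp: Z_def para_zeros_def)
  have finZ: "finite Z" by (simp add: Z_def)
  have trm: "(1 - \<zeta>) powr cnj \<delta> * (1 - cnj \<zeta>) powr \<delta> = of_real (exp (2 * Re (cnj \<delta> * Ln (1 - \<zeta>))))"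
    if "\<zeta> \<in> Z" for \<zeta>
  proof -
    have pos: "Re (1 - \<zeta>) > 0" using Z1[OF that] by (intro Re_one_minus_pos) auto
    then have "cnj (Ln (1 - \<zeta>)) = Ln (1 - cnj \<zeta>)"
      by (subst cnj_Ln) (auto intro!: Re_pos_notin_nonpos)
    moreover have "1 - \<zeta> \<noteq> 0" "1 - cnj \<zeta> \<noteq> 0" using pos by (auto simp: complex_eq_iff)
    ultimately have "(1 - \<zeta>) powr cnj \<delta> * (1 - cnj \<zeta>) powr \<delta>
        = exp (cnj \<delta> * Ln (1 - \<zeta>) + cnj (cnj \<delta> * Ln (1 - \<zeta>)))"
      by (simp add: powr_def exp_add)
    also have "\<dots> = exp (of_real (2 * Re (cnj \<delta> * Ln (1 - \<zeta>))))"
      by (simp only: complex_add_cnj)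
    finally show ?thesis by (simp only: exp_of_real)
  qed
  have "det_delta \<delta> (GGT (Suc m) \<alpha>) = (\<Prod>\<zeta>\<in>Z. (1 - \<zeta>) powr cnj \<delta> * (1 - cnj \<zeta>) powr \<delta>)"
    unfolding det_delta_def proots_char_poly_GGT[OF \<alpha>] Z_def
    by (rule prod_unfold_prod_mset[symmetric])
  also have "\<dots> = of_real (\<Prod>\<zeta>\<in>Z. exp (2 * Re (cnj \<delta> * Ln (1 - \<zeta>))))"
    unfolding of_real_prod by (intro prod.cong refl trm)
  finally have "Re (det_delta \<delta> (GGT (Suc m) \<alpha>)) = (\<Prod>\<zeta>\<in>Z. exp (2 * Re (cnj \<delta> * Ln (1 - \<zeta>))))"
    by (simp only: Re_complex_of_real)
  also have "\<dots> = exp (\<Sum>\<zeta>\<in>Z. 2 * Re (cnj \<delta> * Ln (1 - \<zeta>)))"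
    by (rule exp_sum[OF finZ, symmetric])
  also have "(\<Sum>\<zeta>\<in>Z. 2 * Re (cnj \<delta> * Ln (1 - \<zeta>))) = 2 * Re (cnj \<delta> * (\<Sum>\<zeta>\<in>Z. Ln (1 - \<zeta>)))"
    by (simp only: sum_distrib_left Re_sum)
  also have "\<dots> = (\<Sum>k<Suc m. 2 * Re (cnj \<delta> * Ln (1 - gam \<alpha> k)))"
    unfolding Z_def sum_Ln_zeros[OF \<alpha> nz] by (simp only: sum_distrib_left Re_sum)
  also have "exp \<dots> = (\<Prod>k<Suc m. hw \<delta> (gam \<alpha> k))"
    unfolding hw_def by (rule exp_sum) simp
  finally show ?thesis .
qed

section \<open>Deformed Verblunsky coefficients\<close>

text \<open>
  The phase by which a deformed coefficient turns all later Verblunsky coefficients; the value at \<open>1\<close> keeps it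
  unimodular everywhere.
\<close>
definition ph :: "complex \<Rightarrow> complex" where
  "ph x = (if x = 1 then 1 else (1 - cnj x) / (1 - x))"

lemma cmod_ph [simp]: "cmod (ph x) = 1"
proof (cases "x = 1")
  case False
  have "cmod (1 - cnj x) = cmod (1 - x)" using complex_mod_cnj[of "1 - x"] by simp
  then show ?thesis using False by (simp add: ph_def norm_divide)
qed (simp add: ph_def)

lemma ph_measurable [measurable]: "ph \<in> borel_measurable borel"
  unfolding ph_def[abs_def] by measurable

text \<open>
  The Verblunsky coefficients as functions of the deformed ones; \<open>gam_verb_of_def\<close> shows that it
  inverts \<open>gam\<close>.
\<close>
definition verb_of_def :: "(nat \<Rightarrow> complex) \<Rightarrow> nat \<Rightarrow> complex" where
  "verb_of_def \<gamma> k = cnj (\<gamma> k) * (\<Prod>j<k. ph (\<gamma> j))"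

lemma cmod_verb_of_def [simp]: "cmod (verb_of_def \<gamma> k) = cmod (\<gamma> k)"
  by (simp add: verb_of_def_def norm_mult prod_norm[symmetric])

lemma verb_of_def_cong: "(\<And>i. i \<le> k \<Longrightarrow> \<gamma> i = \<gamma>' i) \<Longrightarrow> verb_of_def \<gamma> k = verb_of_def \<gamma>' k"
  by (simp add: verb_of_def_def)

lemma opuc_verb_of_def_at_one:
  assumes "\<And>j. j < k \<Longrightarrow> \<gamma> j \<noteq> 1"
  shows "poly (opuc (verb_of_def \<gamma>) k) 1 = (\<Prod>j<k. 1 - \<gamma> j)"
  using assms
proof (induction k)
  case (Suc k)
  define p where "p = (\<Prod>j<k. 1 - \<gamma> j)"
  have p: "poly (opuc (verb_of_def \<gamma>) k) 1 = p" using Suc by (simp add: p_def)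
  have p0: "p \<noteq> 0" using Suc.prems by (simp add: p_def)
  have "(\<Prod>j<k. ph (\<gamma> j)) = cnj p / p"
    unfolding p_def using Suc.prems by (simp add: ph_def prod_dividef[symmetric])
  then have "cnj (verb_of_def \<gamma> k) = \<gamma> k * (p / cnj p)" by (simp add: verb_of_def_def)
  then have "cnj (verb_of_def \<gamma> k) * cnj p = \<gamma> k * p" using p0 by simp
  then have "poly (opuc (verb_of_def \<gamma>) (Suc k)) 1 = p - \<gamma> k * p"
    using ropuc_circle[of 1 "verb_of_def \<gamma>" k] p by (simp add: poly_opuc_Suc)
  then show ?case by (simp add: p_def algebra_simps)
qed simp

lemma gam_verb_of_def:
  assumes "\<And>j. j < k \<Longrightarrow> \<gamma> j \<noteq> 1"
  shows "gam (verb_of_def \<gamma>) k = \<gamma> k"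
proof -
  define p where "p = (\<Prod>j<k. 1 - \<gamma> j)"
  have p: "poly (opuc (verb_of_def \<gamma>) k) 1 = p"
    unfolding p_def by (rule opuc_verb_of_def_at_one[OF assms])
  have p0: "p \<noteq> 0" using assms by (simp add: p_def)
  have "(\<Prod>j<k. ph (\<gamma> j)) = cnj p / p"
    unfolding p_def using assms by (simp add: ph_def prod_dividef[symmetric])
  then have v: "cnj (verb_of_def \<gamma> k) = \<gamma> k * (p / cnj p)" by (simp add: verb_of_def_def)
  have r: "poly (ropuc (verb_of_def \<gamma>) k) 1 = cnj p"
    using ropuc_circle[of 1 "verb_of_def \<gamma>" k] p by simp
  show ?thesis unfolding gam_def r p v using p0 by simp
qed

lemma verb_of_def_dom: "\<gamma> \<in> verb_dom n \<Longrightarrow> verb_of_def \<gamma> \<in> verb_dom n"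
  by (simp add: verb_dom_def)


section \<open>Invariance under rotations and reflections\<close>

lemma measurable_Complex [measurable (raw)]:
  assumes "f \<in> borel_measurable N" "g \<in> borel_measurable N"
  shows "(\<lambda>x. Complex (f x) (g x)) \<in> borel_measurable N"
  using assms by (simp add: borel_measurable_complex_iff)

lemma lborel_complex_eq:
  "(lborel :: complex measure) = distr (lborel \<Otimes>\<^sub>M lborel) borel (\<lambda>p. Complex (fst p) (snd p))"
proof (rule lborel_eqI)
  fix l u :: complex assume lu: "\<And>b. b \<in> Basis \<Longrightarrow> l \<bullet> b \<le> u \<bullet> b"
  have le: "Re l \<le> Re u" "Im l \<le> Im u" using lu[of 1] lu[of \<i>] by (auto simp: Basis_complex_def)
  have m: "(\<lambda>p. Complex (fst p) (snd p)) \<in> borel_measurable (lborel \<Otimes>\<^sub>M lborel)" by measurable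
  have "(\<lambda>p. Complex (fst p) (snd p)) -` box l u \<inter> space (lborel \<Otimes>\<^sub>M lborel)
      = {Re l<..<Re u} \<times> {Im l<..<Im u}"
    by (auto simp: in_box_complex_iff space_pair_measure)
  then have "emeasure (distr (lborel \<Otimes>\<^sub>M lborel) borel (\<lambda>p. Complex (fst p) (snd p))) (box l u)
      = emeasure (lborel \<Otimes>\<^sub>M lborel) ({Re l<..<Re u} \<times> {Im l<..<Im u})"
    using m by (subst emeasure_distr) auto
  also have "\<dots> = ennreal (Re u - Re l) * ennreal (Im u - Im l)"
    using le by (subst lborel.emeasure_pair_measure_Times) auto
  also have "\<dots> = ennreal ((Re u - Re l) * (Im u - Im l))"
    by (rule ennreal_mult[symmetric]) (use le in auto)
  also have "(Re u - Re l) * (Im u - Im l) = (\<Prod>b\<in>Basis. (u - l) \<bullet> b)"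
    by (simp add: Basis_complex_def)
  finally show "emeasure (distr (lborel \<Otimes>\<^sub>M lborel) borel (\<lambda>p. Complex (fst p) (snd p))) (box l u)
      = ennreal (\<Prod>b\<in>Basis. (u - l) \<bullet> b)" .
qed simp

lemma nn_integral_lborel_complex:
  assumes [measurable]: "f \<in> borel_measurable borel"
  shows "(\<integral>\<^sup>+z. f z \<partial>lborel) = (\<integral>\<^sup>+x. (\<integral>\<^sup>+y. f (Complex x y) \<partial>lborel) \<partial>lborel)"
    and "(\<integral>\<^sup>+z. f z \<partial>lborel) = (\<integral>\<^sup>+y. (\<integral>\<^sup>+x. f (Complex x y) \<partial>lborel) \<partial>lborel)"
proof -
  have "(\<integral>\<^sup>+z. f z \<partial>lborel) = (\<integral>\<^sup>+p. f (Complex (fst p) (snd p)) \<partial>(lborel \<Otimes>\<^sub>M lborel))"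
    by (subst lborel_complex_eq, subst nn_integral_distr) simp_all
  also have "\<dots> = (\<integral>\<^sup>+x. (\<integral>\<^sup>+y. f (Complex x y) \<partial>lborel) \<partial>lborel)"
    by (subst lborel.nn_integral_fst[symmetric]) simp_all
  finally show 1: "(\<integral>\<^sup>+z. f z \<partial>lborel) = (\<integral>\<^sup>+x. (\<integral>\<^sup>+y. f (Complex x y) \<partial>lborel) \<partial>lborel)" .
  show "(\<integral>\<^sup>+z. f z \<partial>lborel) = (\<integral>\<^sup>+y. (\<integral>\<^sup>+x. f (Complex x y) \<partial>lborel) \<partial>lborel)"
    unfolding 1 by (rule lborel_pair.Fubini'[symmetric]) measurable
qed

lemma nn_integral_shift:
  fixes f :: "real \<Rightarrow> ennreal"
  assumes "f \<in> borel_measurable borel"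
  shows "(\<integral>\<^sup>+x. f (x + t) \<partial>lborel) = (\<integral>\<^sup>+x. f x \<partial>lborel)"
    and "(\<integral>\<^sup>+x. f (t - x) \<partial>lborel) = (\<integral>\<^sup>+x. f x \<partial>lborel)"
  using nn_integral_real_affine[OF assms, of 1 t] nn_integral_real_affine[OF assms, of "-1" t]
  by (simp_all add: add.commute)

lemma nn_integral_shear:
  assumes [measurable]: "f \<in> borel_measurable borel"
  shows "(\<integral>\<^sup>+z. f (z + of_real (s * Im z)) \<partial>lborel) = (\<integral>\<^sup>+z. f z \<partial>lborel)"
    and "(\<integral>\<^sup>+z. f (z + \<i> * of_real (s * Re z)) \<partial>lborel) = (\<integral>\<^sup>+z. f z \<partial>lborel)"
proof -
  have "(\<integral>\<^sup>+z. f (z + of_real (s * Im z)) \<partial>lborel)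
      = (\<integral>\<^sup>+y. (\<integral>\<^sup>+x. f (Complex x y + of_real (s * y)) \<partial>lborel) \<partial>lborel)"
    by (subst nn_integral_lborel_complex(2)) simp_all
  also have "\<dots> = (\<integral>\<^sup>+y. (\<integral>\<^sup>+x. f (Complex (x + s * y) y) \<partial>lborel) \<partial>lborel)"
  proof -
    have "Complex x y + of_real (s * y) = Complex (x + s * y) y" for x y
      by (simp add: complex_eq_iff)
    then show ?thesis by (simp only:)
  qed
  also have "\<dots> = (\<integral>\<^sup>+y. (\<integral>\<^sup>+x. f (Complex x y) \<partial>lborel) \<partial>lborel)"
  proof (rule nn_integral_cong)
    fix y :: real
    show "(\<integral>\<^sup>+x. f (Complex (x + s * y) y) \<partial>lborel) = (\<integral>\<^sup>+x. f (Complex x y) \<partial>lborel)"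
      by (rule nn_integral_shift(1)[where f="\<lambda>x. f (Complex x y)"]) measurable
  qed
  finally show "(\<integral>\<^sup>+z. f (z + of_real (s * Im z)) \<partial>lborel) = (\<integral>\<^sup>+z. f z \<partial>lborel)"
    by (subst nn_integral_lborel_complex(2)) simp_all
  have e: "Complex x y + \<i> * of_real (s * x) = Complex x (y + s * x)" for x y
    by (simp add: complex_eq_iff)
  have "(\<integral>\<^sup>+z. f (z + \<i> * of_real (s * Re z)) \<partial>lborel)
      = (\<integral>\<^sup>+x. (\<integral>\<^sup>+y. f (Complex x y + \<i> * of_real (s * x)) \<partial>lborel) \<partial>lborel)"
    by (subst nn_integral_lborel_complex(1)) simp_all
  also have "\<dots> = (\<integral>\<^sup>+x. (\<integral>\<^sup>+y. f (Complex x y) \<partial>lborel) \<partial>lborel)"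
    unfolding e
  proof (rule nn_integral_cong)
    fix x :: real
    show "(\<integral>\<^sup>+y. f (Complex x (y + s * x)) \<partial>lborel) = (\<integral>\<^sup>+y. f (Complex x y) \<partial>lborel)"
      by (rule nn_integral_shift(1)[where f="\<lambda>y. f (Complex x y)"]) measurable
  qed
  finally show "(\<integral>\<^sup>+z. f (z + \<i> * of_real (s * Re z)) \<partial>lborel) = (\<integral>\<^sup>+z. f z \<partial>lborel)"
    by (subst nn_integral_lborel_complex(1)) simp_all
qed

lemma nn_integral_lborel_cnj:
  assumes [measurable]: "f \<in> borel_measurable borel"
  shows "(\<integral>\<^sup>+z. f (cnj z) \<partial>lborel) = (\<integral>\<^sup>+z. f z \<partial>lborel)"
proof -
  have e: "cnj (Complex x y) = Complex x (0 - y)" for x y by (simp add: complex_eq_iff)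
  have "(\<integral>\<^sup>+z. f (cnj z) \<partial>lborel) = (\<integral>\<^sup>+x. (\<integral>\<^sup>+y. f (cnj (Complex x y)) \<partial>lborel) \<partial>lborel)"
    by (subst nn_integral_lborel_complex(1)) simp_all
  also have "\<dots> = (\<integral>\<^sup>+x. (\<integral>\<^sup>+y. f (Complex x y) \<partial>lborel) \<partial>lborel)"
    unfolding e
  proof (rule nn_integral_cong)
    fix x :: real
    show "(\<integral>\<^sup>+y. f (Complex x (0 - y)) \<partial>lborel) = (\<integral>\<^sup>+y. f (Complex x y) \<partial>lborel)"
      by (rule nn_integral_shift(2)[where f="\<lambda>y. f (Complex x y)"]) measurable
  qed
  finally show ?thesis by (subst nn_integral_lborel_complex(1)) simp_all
qed

text \<open>
  A rotation by an angle that is no multiple of \<open>\<pi>\<close> is a product of three shears, and a shear is a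
  family of translations by Fubini.
\<close>
lemma nn_integral_lborel_rotate:
  assumes [measurable]: "f \<in> borel_measurable borel" and u: "cmod u = 1"
  shows "(\<integral>\<^sup>+z. f (u * z) \<partial>lborel) = (\<integral>\<^sup>+z. f z \<partial>lborel)"
proof -
  have gen: "(\<integral>\<^sup>+z. f (u * z) \<partial>lborel) = (\<integral>\<^sup>+z. f z \<partial>lborel)"
    if [measurable]: "f \<in> borel_measurable borel" and u: "cmod u = 1" and Im: "Im u \<noteq> 0"
    for u and f :: "complex \<Rightarrow> ennreal"
  proof -
    define a where "a = (Re u - 1) / Im u"
    define H where "H z = z + of_real (a * Im z)" for z
    define V where "V z = z + \<i> * of_real (Im u * Re z)" for z
    have [measurable]: "H \<in> borel_measurable borel" "V \<in> borel_measurable borel"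
      unfolding H_def[abs_def] V_def[abs_def] by measurable
    have n: "(Re u)\<^sup>2 + (Im u)\<^sup>2 = 1" using u cmod_power2[of u] by simp
    have ab: "a * Im u = Re u - 1" using Im by (simp add: a_def)
    have aa: "a * (Re u + 1) = - Im u"
    proof -
      have "(a * (Re u + 1)) * Im u = (Re u - 1) * (Re u + 1)"
        using ab by (simp add: mult_ac)
      also have "\<dots> = (- Im u) * Im u" using n by (simp add: algebra_simps power2_eq_square)
      finally show ?thesis using Im mult_right_cancel by blast
    qed
    have "u * z = H (V (H z))" for z
    proof (rule complex_eqI)
      have "Re (H (V (H z))) = Re z + a * Im z + a * (Im z + Im u * (Re z + a * Im z))"
        by (simp add: H_def V_def)
      also have "\<dots> = Re z * (1 + a * Im u) + Im z * (a * (1 + (1 + a * Im u)))"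
        by (simp add: algebra_simps)
      also have "\<dots> = Re z * Re u + Im z * (- Im u)" unfolding ab using aa by (simp add: add.commute)
      finally show "Re (u * z) = Re (H (V (H z)))" by (simp add: mult_ac)
      have "Im (H (V (H z))) = Im z + Im u * (Re z + a * Im z)"
        by (simp add: H_def V_def)
      also have "\<dots> = Im z * (1 + a * Im u) + Im u * Re z" by (simp add: algebra_simps)
      finally show "Im (u * z) = Im (H (V (H z)))" unfolding ab by (simp add: mult_ac)
    qed
    then have "(\<integral>\<^sup>+z. f (u * z) \<partial>lborel) = (\<integral>\<^sup>+z. f (H (V (H z))) \<partial>lborel)" by simp
    also have "\<dots> = (\<integral>\<^sup>+z. f (H (V z)) \<partial>lborel)"
      by (rule nn_integral_shear(1)[of "\<lambda>z. f (H (V z))" a, folded H_def]) measurable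
    also have "\<dots> = (\<integral>\<^sup>+z. f (H z) \<partial>lborel)"
      by (rule nn_integral_shear(2)[of "\<lambda>z. f (H z)" "Im u", folded V_def]) measurable
    also have "\<dots> = (\<integral>\<^sup>+z. f z \<partial>lborel)"
      by (rule nn_integral_shear(1)[of "\<lambda>z. f z" a, folded H_def]) measurable
    finally show ?thesis .
  qed
  show ?thesis
  proof (cases "Im u = 0")
    case False
    then show ?thesis using gen[of f u] u by simp
  next
    case True
    \<comment> \<open>half turns and the identity: two rotations with nonvanishing imaginary part\<close>
    define v where "v = - \<i> * u"
    have v: "u * z = \<i> * (v * z)" for z by (simp add: v_def complex_eq_iff)
    have "Re u \<noteq> 0" using True u by (auto simp: cmod_def)
    then have Imv: "Im v \<noteq> 0" by (simp add: v_def)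
    have "(\<integral>\<^sup>+z. f (u * z) \<partial>lborel) = (\<integral>\<^sup>+z. f (\<i> * (v * z)) \<partial>lborel)" by (simp only: v)
    also have "\<dots> = (\<integral>\<^sup>+z. f (\<i> * z) \<partial>lborel)"
      by (rule gen[of "\<lambda>z. f (\<i> * z)" v]) (use u Imv in \<open>auto simp: v_def norm_mult\<close>)
    also have "\<dots> = (\<integral>\<^sup>+z. f z \<partial>lborel)" by (rule gen) auto
    finally show ?thesis .
  qed
qed

text \<open>
  Reflections generate the rotations as well. Reflections are what occurs in \<open>verb_of_def\<close>, which
  conjugates the new coordinate and turns it.
\<close>
definition reflection_invariant :: "complex measure \<Rightarrow> bool" where
  "reflection_invariant N \<longleftrightarrow> sets N = sets borel \<and>
     (\<forall>u f. cmod u = 1 \<longrightarrow> f \<in> borel_measurable borel \<longrightarrow> (\<integral>\<^sup>+z. f (u * cnj z) \<partial>N) = (\<integral>\<^sup>+z. f z \<partial>N))"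

lemma reflection_invariant_density:
  assumes [measurable]: "g \<in> borel_measurable borel"
    and g: "\<And>u z. cmod u = 1 \<Longrightarrow> g (u * cnj z) = g z"
  shows "reflection_invariant (density lborel g)"
  unfolding reflection_invariant_def
proof (intro conjI allI impI)
  fix u :: complex and f :: "complex \<Rightarrow> ennreal"
  assume u: "cmod u = 1" and [measurable]: "f \<in> borel_measurable borel"
  have "(\<integral>\<^sup>+z. f (u * cnj z) \<partial>density lborel g) = (\<integral>\<^sup>+z. g (u * cnj z) * f (u * cnj z) \<partial>lborel)"
    by (subst nn_integral_density) (auto simp: g[OF u])
  also have "\<dots> = (\<integral>\<^sup>+z. g (u * z) * f (u * z) \<partial>lborel)"
    by (rule nn_integral_lborel_cnj[of "\<lambda>z. g (u * z) * f (u * z)"]) measurable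
  also have "\<dots> = (\<integral>\<^sup>+z. g z * f z \<partial>lborel)"
    by (rule nn_integral_lborel_rotate[of "\<lambda>z. g z * f z", OF _ u]) measurable
  also have "\<dots> = (\<integral>\<^sup>+z. f z \<partial>density lborel g)"
    by (subst nn_integral_density) auto
  finally show "(\<integral>\<^sup>+z. f (u * cnj z) \<partial>density lborel g) = (\<integral>\<^sup>+z. f z \<partial>density lborel g)" .
qed simp

lemma cis_measurable [measurable]: "cis \<in> borel_measurable borel"
  by (intro borel_measurable_continuous_onI continuous_intros)

lemma nn_integral_nu_law_1:
  assumes [measurable]: "f \<in> borel_measurable borel"
  shows "(\<integral>\<^sup>+z. f z \<partial>nu_law 1) = (\<integral>\<^sup>+\<theta>. f (cis \<theta>) * indicator {0..<2*pi} \<theta> \<partial>lborel) / ennreal (2*pi)"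
proof -
  have "cis \<in> measurable (uniform_measure lborel {0..<2*pi}) borel"
    by (simp add: measurable_def cis_measurable[unfolded measurable_def, simplified])
  then have "(\<integral>\<^sup>+z. f z \<partial>nu_law 1) = (\<integral>\<^sup>+\<theta>. f (cis \<theta>) \<partial>uniform_measure lborel {0..<2*pi})"
    unfolding nu_law_def by (simp add: nn_integral_distr)
  also have "\<dots> = (\<integral>\<^sup>+\<theta>. f (cis \<theta>) * indicator {0..<2*pi} \<theta> \<partial>lborel) / emeasure lborel {0..<2*pi}"
    by (rule nn_integral_uniform_measure) measurable
  finally show ?thesis by simp
qed

text \<open>
  On the angle this is a reflection of the line followed by a translation; the part of the interval
  that leaves \<open>[0, 2\<pi>)\<close> returns by periodicity.
\<close>
lemma reflection_invariant_nu_law_1: "reflection_invariant (nu_law 1)"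
  unfolding reflection_invariant_def
proof (intro conjI allI impI)
  show "sets (nu_law 1) = sets borel" by (simp add: nu_law_def)
  fix u :: complex and f :: "complex \<Rightarrow> ennreal"
  assume u: "cmod u = 1" and [measurable]: "f \<in> borel_measurable borel"
  define p where "p = Arg2pi u"
  have p: "0 \<le> p" "p < 2 * pi" "u = cis p"
    using Arg2pi[of u] u by (auto simp: p_def cis_conv_exp is_Arg_def)
  define g where "g t = f (cis t)" for t
  have [measurable]: "g \<in> borel_measurable borel" unfolding g_def[abs_def] by measurable
  have per: "g (t + (- (2 * pi))) = g t" for t
    by (simp add: g_def cis.code sin_diff cos_diff)
  have ug: "f (u * cnj (cis t)) = g (p - t)" for t
    by (simp add: p(3) g_def cis_cnj cis_mult)
  have split: "indicator {p - 2*pi<..p} t = indicator {p - 2*pi<..0} t + (indicator {0<..p} t :: ennreal)" for t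
    using p by (auto simp: indicator_def)
  have split2: "indicator {0<..2*pi} t = indicator {p<..2*pi} t + (indicator {0<..p} t :: ennreal)" for t
    using p by (auto simp: indicator_def)
  have "(\<integral>\<^sup>+t. f (u * cnj (cis t)) * indicator {0..<2*pi} t \<partial>lborel)
      = (\<integral>\<^sup>+t. (\<lambda>t. g (p - t) * indicator {0..<2*pi} t) (p - t) \<partial>lborel)"
    unfolding ug by (rule nn_integral_shift(2)[symmetric]) measurable
  also have "\<dots> = (\<integral>\<^sup>+t. g t * indicator {p - 2*pi<..p} t \<partial>lborel)"
    by (intro nn_integral_cong) (auto simp: indicator_def)
  also have "\<dots> = (\<integral>\<^sup>+t. g t * indicator {p - 2*pi<..0} t \<partial>lborel) + (\<integral>\<^sup>+t. g t * indicator {0<..p} t \<partial>lborel)"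
    unfolding split distrib_left by (rule nn_integral_add) measurable
  also have "(\<integral>\<^sup>+t. g t * indicator {p - 2*pi<..0} t \<partial>lborel)
      = (\<integral>\<^sup>+t. (\<lambda>t. g t * indicator {p - 2*pi<..0} t) (t + (- (2*pi))) \<partial>lborel)"
    by (rule nn_integral_shift(1)[symmetric]) measurable
  also have "\<dots> = (\<integral>\<^sup>+t. g t * indicator {p<..2*pi} t \<partial>lborel)"
    using per by (intro nn_integral_cong) (auto simp: indicator_def)
  also have "(\<integral>\<^sup>+t. g t * indicator {p<..2*pi} t \<partial>lborel) + (\<integral>\<^sup>+t. g t * indicator {0<..p} t \<partial>lborel)
      = (\<integral>\<^sup>+t. g t * indicator {0<..2*pi} t \<partial>lborel)"
    unfolding split2 distrib_left by (rule nn_integral_add[symmetric]) measurable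
  also have "\<dots> = (\<integral>\<^sup>+t. g t * indicator {0..<2*pi} t \<partial>lborel)"
  proof (rule nn_integral_cong_AE)
    have "AE t in lborel. t \<noteq> 0" "AE t in lborel. t \<noteq> 2 * pi" by (rule AE_lborel_singleton)+
    then show "AE t in lborel. g t * indicator {0<..2*pi} t = g t * indicator {0..<2*pi} t"
      by eventually_elim (auto simp: indicator_def)
  qed
  finally show "(\<integral>\<^sup>+z. f (u * cnj z) \<partial>nu_law 1) = (\<integral>\<^sup>+z. f z \<partial>nu_law 1)"
    by (subst (1 2) nn_integral_nu_law_1) (measurable, simp add: g_def)
qed

lemma nu_law_density:
  "s \<noteq> 1 \<Longrightarrow> nu_law s = density lborel
        (\<lambda>z. ennreal (indicator (ball 0 1) z * ((s - 1) / (2*pi) * (1 - (cmod z)\<^sup>2) powr ((s - 3) / 2))))"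
  by (simp add: nu_law_def)

lemma nu_law_density_measurable:
  "(\<lambda>z. ennreal (indicator (ball 0 1) z * ((s - 1) / (2*pi) * (1 - (cmod z)\<^sup>2) powr ((s - 3) / 2))))
        \<in> borel_measurable borel"
proof -
  have [measurable]: "ball (0::complex) 1 \<in> sets borel" by simp
  show ?thesis by measurable
qed

lemma reflection_invariant_nu_law: "reflection_invariant (nu_law s)"
proof (cases "s = 1")
  case False
  show ?thesis unfolding nu_law_density[OF False]
  proof (rule reflection_invariant_density)
    show "(\<lambda>z. ennreal (indicator (ball 0 1) z * ((s - 1) / (2*pi) * (1 - (cmod z)\<^sup>2) powr ((s - 3) / 2))))
        \<in> borel_measurable borel"
      by (rule nu_law_density_measurable)
  qed (auto simp: norm_mult indicator_def)
qed (simp add: reflection_invariant_nu_law_1)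

lemma sets_nu_law [simp, measurable_cong]: "sets (nu_law s) = sets borel"
  by (simp add: nu_law_def)

lemma space_nu_law [simp]: "space (nu_law s) = UNIV"
  by (simp add: nu_law_def)

lemma sigma_finite_nu_law: "sigma_finite_measure (nu_law s)"
proof (cases "s = 1")
  case True
  have "emeasure (nu_law 1) UNIV = (\<integral>\<^sup>+z. 1 \<partial>nu_law 1)" by simp
  also have "\<dots> = 1" by (subst nn_integral_nu_law_1) auto
  finally have "prob_space (nu_law 1)" by (intro prob_spaceI) simp
  then interpret prob_space "nu_law 1" .
  show ?thesis unfolding True by (rule sigma_finite_measure_axioms)
next
  case False
  show ?thesis
    unfolding nu_law_density[OF False]
    by (subst sigma_finite_measure.sigma_finite_iff_density_finite[OF lborel.sigma_finite_measure_axioms])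
       (use nu_law_density_measurable[of s] in auto)
qed

lemma AE_nu_law_disk: "s \<noteq> 1 \<Longrightarrow> AE z in nu_law s. cmod z < 1"
  unfolding nu_law_density
  by (subst AE_density) (auto simp: indicator_def)

lemma AE_nu_law_circle: "AE z in nu_law 1. cmod z = 1 \<and> z \<noteq> 1"
proof -
  define B where "B = {z :: complex. \<not> (cmod z = 1 \<and> z \<noteq> 1)}"
  have [measurable]: "B \<in> sets borel" unfolding B_def by measurable
  have "emeasure (nu_law 1) B = (\<integral>\<^sup>+z. indicator B z \<partial>nu_law 1)" by simp
  also have "\<dots> = (\<integral>\<^sup>+\<theta>. indicator B (cis \<theta>) * indicator {0..<2*pi} \<theta> \<partial>lborel) / ennreal (2*pi)"
    by (rule nn_integral_nu_law_1) measurable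
  also have "(\<integral>\<^sup>+\<theta>. indicator B (cis \<theta>) * indicator {0..<2*pi} \<theta> \<partial>lborel) = (\<integral>\<^sup>+\<theta>. 0 \<partial>(lborel :: real measure))"
  proof (rule nn_integral_cong_AE)
    have "AE t in lborel. t \<noteq> (0::real)" by (rule AE_lborel_singleton)
    then show "AE t in lborel. indicator B (cis t) * indicator {0..<2*pi} t = (0::ennreal)"
    proof eventually_elim
      case (elim t)
      have "cis t \<noteq> 1" if "0 < t" "t < 2 * pi"
      proof
        assume "cis t = 1"
        then have "cos t = 1" by (simp add: complex_eq_iff)
        then obtain n :: int where "t = of_int n * 2 * pi" using cos_one_2pi_int by auto
        then have n: "t = of_int n * (2 * pi)" by simp
        have "0 < n" using that(1) unfolding n by (simp add: zero_less_mult_iff)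
        moreover have "real_of_int n * (2 * pi) < 1 * (2 * pi)" using that(2) unfolding n by simp
        then have "real_of_int n < 1" by (rule mult_right_less_imp_less) simp
        ultimately show False by simp
      qed
      then show ?case using elim by (auto simp: B_def indicator_def)
    qed
  qed
  finally have "emeasure (nu_law 1) B = 0" by simp
  then show ?thesis
    by (intro AE_I[of _ _ B]) (auto simp: B_def)
qed


section \<open>The law of the deformed Verblunsky coefficients\<close>

locale refl_inv_product = product_sigma_finite N for N :: "nat \<Rightarrow> complex measure" +
  assumes refl_inv: "\<And>k. reflection_invariant (N k)"
begin

lemma sets_N [simp, measurable_cong]: "sets (N k) = sets borel"
  using refl_inv[of k] by (simp add: reflection_invariant_def)

lemma space_N [simp]: "space (N k) = UNIV"
  using sets_eq_imp_space_eq[OF sets_N[of k]] by simp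

lemma component_meas [measurable]: "k < m \<Longrightarrow> (\<lambda>\<gamma>. \<gamma> k) \<in> borel_measurable (Pi\<^sub>M {..<m} N)"
  using measurable_component_singleton[of k "{..<m}" N] by (simp cong: measurable_cong_sets)

definition verb_restr :: "nat \<Rightarrow> (nat \<Rightarrow> complex) \<Rightarrow> nat \<Rightarrow> complex" where
  "verb_restr m \<gamma> = restrict (verb_of_def \<gamma>) {..<m}"

lemma verb_of_def_meas [measurable]:
  assumes "k < m"
  shows "(\<lambda>\<gamma>. verb_of_def \<gamma> k) \<in> borel_measurable (Pi\<^sub>M {..<m} N)"
proof -
  have [measurable]: "(\<lambda>\<gamma>. \<gamma> j) \<in> borel_measurable (Pi\<^sub>M {..<m} N)" if "j \<in> {..<k}" for j
    using component_meas[of j m] that assms by simp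
  have [measurable]: "(\<lambda>\<gamma>. \<gamma> k) \<in> borel_measurable (Pi\<^sub>M {..<m} N)" using component_meas[of k m] assms by simp
  show ?thesis unfolding verb_of_def_def by measurable
qed

lemma verb_restr_meas [measurable]: "verb_restr m \<in> measurable (Pi\<^sub>M {..<m} N) (Pi\<^sub>M {..<m} N)"
  unfolding verb_restr_def[abs_def]
  by (rule measurable_restrict) (auto cong: measurable_cong_sets)

text \<open>
  Given the earlier coordinates, the last one is conjugated and turned by a fixed phase, which does not
  change its law.
\<close>
lemma nn_integral_verb_restr:
  "F \<in> borel_measurable (Pi\<^sub>M {..<m} N) \<Longrightarrow>
     (\<integral>\<^sup>+\<gamma>. F (verb_restr m \<gamma>) \<partial>Pi\<^sub>M {..<m} N) = (\<integral>\<^sup>+\<gamma>. F \<gamma> \<partial>Pi\<^sub>M {..<m} N)"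
proof (induction m arbitrary: F)
  case 0
  show ?case by (rule nn_integral_cong) (auto simp: verb_restr_def space_PiM)
next
  case (Suc m)
  have I: "{..<Suc m} = insert m {..<m}" by auto
  note F = Suc.prems
  have FI: "F \<in> borel_measurable (Pi\<^sub>M (insert m {..<m}) N)" using F by (simp only: I)
  have FT: "(\<lambda>\<gamma>. F (verb_restr (Suc m) \<gamma>)) \<in> borel_measurable (Pi\<^sub>M (insert m {..<m}) N)"
    using measurable_compose[OF verb_restr_meas[of "Suc m"] F] by (simp only: I)
  define G where "G x = (\<integral>\<^sup>+y. F (x(m := y)) \<partial>N m)" for x
  have G: "G \<in> borel_measurable (Pi\<^sub>M {..<m} N)"
  proof -
    interpret sigma_finite_measure "N m" by (rule sigma_finite_measures)
    have "(\<lambda>(x, y). F (x(m := y))) \<in> borel_measurable (Pi\<^sub>M {..<m} N \<Otimes>\<^sub>M N m)"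
      using measurable_compose[OF measurable_add_dim[of m "{..<m}" N] FI] by (simp add: case_prod_unfold)
    then show ?thesis unfolding G_def[abs_def] by (rule borel_measurable_nn_integral)
  qed
  have inner: "(\<integral>\<^sup>+y. F (verb_restr (Suc m) (x(m := y))) \<partial>N m) = G (verb_restr m x)"
    if x: "x \<in> space (Pi\<^sub>M {..<m} N)" for x
  proof -
    define u where "u = (\<Prod>j<m. ph (x j))"
    have u: "cmod u = 1" by (simp add: u_def prod_norm[symmetric])
    have upd: "verb_restr (Suc m) (x(m := y)) = (verb_restr m x)(m := u * cnj y)" for y
    proof
      fix k
      have "verb_of_def (x(m := y)) k = verb_of_def x k" if "k < m"
        using that by (intro verb_of_def_cong) auto
      moreover have "verb_of_def (x(m := y)) m = u * cnj y"
        unfolding verb_of_def_def u_def by (simp add: mult.commute)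
      ultimately show "verb_restr (Suc m) (x(m := y)) k = ((verb_restr m x)(m := u * cnj y)) k"
        by (auto simp: verb_restr_def)
    qed
    have X: "verb_restr m x \<in> space (Pi\<^sub>M {..<m} N)"
      by (rule measurable_space[OF verb_restr_meas x])
    have "(\<lambda>y. F ((verb_restr m x)(m := y))) \<in> borel_measurable (N m)"
      using measurable_compose[OF measurable_component_update[OF X, of m] FI] by simp
    then have "(\<lambda>y. F ((verb_restr m x)(m := y))) \<in> borel_measurable borel"
      by (simp cong: measurable_cong_sets)
    then show ?thesis
      unfolding upd G_def using refl_inv[of m] u unfolding reflection_invariant_def by blast
  qed
  have "(\<integral>\<^sup>+\<gamma>. F (verb_restr (Suc m) \<gamma>) \<partial>Pi\<^sub>M {..<Suc m} N)
      = (\<integral>\<^sup>+x. (\<integral>\<^sup>+y. F (verb_restr (Suc m) (x(m := y))) \<partial>N m) \<partial>Pi\<^sub>M {..<m} N)"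
    unfolding I by (rule product_nn_integral_insert[OF _ _ FT]) auto
  also have "\<dots> = (\<integral>\<^sup>+x. G (verb_restr m x) \<partial>Pi\<^sub>M {..<m} N)"
    by (rule nn_integral_cong) (rule inner)
  also have "\<dots> = (\<integral>\<^sup>+x. G x \<partial>Pi\<^sub>M {..<m} N)" by (rule Suc.IH[OF G])
  also have "\<dots> = (\<integral>\<^sup>+\<gamma>. F \<gamma> \<partial>Pi\<^sub>M {..<Suc m} N)"
    unfolding I G_def by (rule product_nn_integral_insert[OF _ _ FI, symmetric]) auto
  finally show ?case .
qed

lemma distr_verb_restr: "distr (Pi\<^sub>M {..<m} N) (Pi\<^sub>M {..<m} N) (verb_restr m) = Pi\<^sub>M {..<m} N"
proof (rule measure_eqI)
  fix A assume "A \<in> sets (distr (Pi\<^sub>M {..<m} N) (Pi\<^sub>M {..<m} N) (verb_restr m))"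
  then have A: "A \<in> sets (Pi\<^sub>M {..<m} N)" by simp
  have "emeasure (distr (Pi\<^sub>M {..<m} N) (Pi\<^sub>M {..<m} N) (verb_restr m)) A
      = (\<integral>\<^sup>+\<gamma>. indicator A \<gamma> \<partial>distr (Pi\<^sub>M {..<m} N) (Pi\<^sub>M {..<m} N) (verb_restr m))"
    using A by simp
  also have "\<dots> = (\<integral>\<^sup>+\<gamma>. indicator A (verb_restr m \<gamma>) \<partial>Pi\<^sub>M {..<m} N)"
    using A by (intro nn_integral_distr) auto
  also have "\<dots> = (\<integral>\<^sup>+\<gamma>. indicator A \<gamma> \<partial>Pi\<^sub>M {..<m} N)"
    using A by (intro nn_integral_verb_restr) auto
  finally show "emeasure (distr (Pi\<^sub>M {..<m} N) (Pi\<^sub>M {..<m} N) (verb_restr m)) A = emeasure (Pi\<^sub>M {..<m} N) A"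
    using A by simp
qed simp

lemma AE_component:
  assumes k: "k < m" and AE: "AE z in N k. P z" and P: "Measurable.pred borel P"
  shows "AE \<gamma> in Pi\<^sub>M {..<m} N. P (\<gamma> k)"
proof -
  define B where "B = {z. \<not> P z}"
  have B: "B \<in> sets (N k)" using P unfolding B_def by simp
  have 0: "emeasure (N k) B = 0"
    using AE B by (subst (asm) AE_iff_measurable[of B]) (auto simp: B_def)
  define E where "E = Pi\<^sub>E {..<m} (\<lambda>i. if i = k then B else UNIV)"
  have s: "(if i = k then B else UNIV) \<in> sets (N i)" for i using B by auto
  have E: "E \<in> sets (Pi\<^sub>M {..<m} N)" unfolding E_def by (intro sets_PiM_I_finite s) auto
  have "emeasure (Pi\<^sub>M {..<m} N) E = (\<Prod>i<m. emeasure (N i) (if i = k then B else UNIV))"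
    unfolding E_def by (intro emeasure_PiM s) auto
  also have "\<dots> = 0" using k 0 by (intro prod_zero) (auto intro!: bexI[of _ k])
  finally show ?thesis
    using k by (intro AE_I[of _ _ E] E) (auto simp: E_def B_def space_PiM PiE_iff extensional_def)
qed

end

lemma verb_dom_cong: "(\<And>k. k < Suc m \<Longrightarrow> \<alpha> k = \<alpha>' k) \<Longrightarrow> \<alpha> \<in> verb_dom (Suc m) \<longleftrightarrow> \<alpha>' \<in> verb_dom (Suc m)"
  by (auto simp: verb_dom_def)

lemma GGT_cong:
  assumes "\<And>k. k < n \<Longrightarrow> \<alpha> k = \<alpha>' k"
  shows "GGT n \<alpha> = GGT n \<alpha>'"
proof -
  have "has_verblunsky \<mu> n \<alpha> = has_verblunsky \<mu> n \<alpha>'" for \<mu>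
    using assms unfolding has_verblunsky_def by auto
  then have "measure_of_verblunsky n \<alpha> = measure_of_verblunsky n \<alpha>'"
    unfolding measure_of_verblunsky_def by simp
  then show ?thesis by (simp add: GGT_def)
qed

text \<open>
  For densities that need not be measurable. The density of \<open>CJ\<close> is of this kind a priori:
  \<open>det_delta\<close> is defined through the multiset of eigenvalues.
\<close>
lemma density_cong_AE_any:
  assumes "AE x in M. f x = g x"
  shows "density M f = density M g"
proof -
  have "(\<integral>\<^sup>+x. f x * indicator A x \<partial>M) = (\<integral>\<^sup>+x. g x * indicator A x \<partial>M)" for A
    using assms by (intro nn_integral_cong_AE) auto
  then show ?thesis unfolding density_def by simp
qed

definition CJ_nu :: "nat \<Rightarrow> real \<Rightarrow> nat \<Rightarrow> complex measure" where
  "CJ_nu n \<beta> k = nu_law (\<beta> * real (n - k - 1) + 1)"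

interpretation CJ_nu: refl_inv_product "CJ_nu n \<beta>" for n \<beta>
proof (intro refl_inv_product.intro product_sigma_finite.intro refl_inv_product_axioms.intro)
  fix k
  show "sigma_finite_measure (CJ_nu n \<beta> k)" unfolding CJ_nu_def by (rule sigma_finite_nu_law)
  show "reflection_invariant (CJ_nu n \<beta> k)" unfolding CJ_nu_def by (rule reflection_invariant_nu_law)
qed

text \<open>
  Agrees with \<open>det_delta\<close> on almost all matrices, and is measurable in the entries by construction.
\<close>
definition det_of_row :: "nat \<Rightarrow> complex \<Rightarrow> complex mat \<Rightarrow> real" where
  "det_of_row n \<delta> A = (\<Prod>k<n. hw \<delta> (gam (verblunsky_of_mat A) k))"

text \<open>
  A measurable description of the GGT matrices without the eigenvalue \<open>1\<close>.
\<close>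
definition good_mat :: "nat \<Rightarrow> complex mat \<Rightarrow> bool" where
  "good_mat n A \<longleftrightarrow> verblunsky_of_mat A \<in> verb_dom n \<and>
     (\<forall>i<n. \<forall>j<n. A $$ (i, j) = GGT n (verblunsky_of_mat A) $$ (i, j)) \<and>
     poly (opuc (verblunsky_of_mat A) n) 1 \<noteq> 0"

lemma good_mat_det:
  assumes "A \<in> carrier_mat (Suc m) (Suc m)" "good_mat (Suc m) A"
  shows "Re (det_delta \<delta> A) = det_of_row (Suc m) \<delta> A"
proof -
  have "A = GGT (Suc m) (verblunsky_of_mat A)"
    using assms by (intro eq_matI) (auto simp: good_mat_def)
  then show ?thesis
    using assms(2) det_delta_GGT[of "verblunsky_of_mat A" m \<delta>] by (auto simp: good_mat_def det_of_row_def)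
qed

lemma verblunsky_of_mat_meas:
  assumes "k < n"
  shows "(\<lambda>A. verblunsky_of_mat A k) \<in> borel_measurable (mat_borel n)"
proof -
  have m0: "0 < n" using assms by simp
  have [measurable]: "(\<lambda>A. A $$ (0, i)) \<in> borel_measurable (mat_borel n)" if "i \<in> {..<k}" for i
    using mat_borel_entry[OF m0, of i] that assms by simp
  have [measurable]: "(\<lambda>A. A $$ (0, k)) \<in> borel_measurable (mat_borel n)"
    using mat_borel_entry[OF m0 assms] .
  show ?thesis unfolding verblunsky_of_mat_def by measurable
qed

lemma poly_opuc_meas:
  assumes X: "\<And>k. k < K \<Longrightarrow> (\<lambda>x. X x k) \<in> borel_measurable M" and k: "k \<le> K"
  shows "(\<lambda>x. poly (opuc (X x) k) z) \<in> borel_measurable M" "(\<lambda>x. poly (ropuc (X x) k) z) \<in> borel_measurable M"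
proof -
  have eq: "poly p z = (\<Sum>i\<le>k. coeff p i * z ^ i)" if "degree p \<le> k" for p :: "complex poly"
    unfolding poly_altdef by (rule sum.mono_neutral_left) (use that in \<open>auto simp: coeff_eq_0\<close>)
  have r: "degree (ropuc \<alpha> k) \<le> k" for \<alpha> using degree_opuc_le[of \<alpha> k] by simp
  have o: "degree (opuc \<alpha> k) \<le> k" for \<alpha> by simp
  show "(\<lambda>x. poly (opuc (X x) k) z) \<in> borel_measurable M"
    unfolding eq[OF o]
    by (intro borel_measurable_sum borel_measurable_times measurable_const
        szego_measurable[of K X M k, OF X k, THEN conjunct1]) auto
  show "(\<lambda>x. poly (ropuc (X x) k) z) \<in> borel_measurable M"
    unfolding eq[OF r]
    by (intro borel_measurable_sum borel_measurable_times measurable_const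
        szego_measurable[of K X M k, OF X k, THEN conjunct2]) auto
qed

lemma gam_meas:
  assumes X: "\<And>k. k < K \<Longrightarrow> (\<lambda>x. X x k) \<in> borel_measurable M" and k: "k < K"
  shows "(\<lambda>x. gam (X x) k) \<in> borel_measurable M"
  unfolding gam_def
  using X[OF k] poly_opuc_meas[of K X M k, OF X] k
  by (intro borel_measurable_divide borel_measurable_times cnj_measurable) auto

lemma det_of_row_meas: "det_of_row n \<delta> \<in> borel_measurable (mat_borel n)"
  unfolding det_of_row_def[abs_def]
  by (intro borel_measurable_prod measurable_compose[OF gam_meas[of n verblunsky_of_mat] hw_measurable] verblunsky_of_mat_meas)
     auto

lemma good_mat_meas: "{A \<in> space (mat_borel (Suc m)). good_mat (Suc m) A} \<in> sets (mat_borel (Suc m))"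
proof -
  let ?n = "Suc m"
  note v = verblunsky_of_mat_meas[of _ ?n]
  have 1: "{A \<in> space (mat_borel ?n). verblunsky_of_mat A \<in> verb_dom ?n} \<in> sets (mat_borel ?n)"
    by (rule verb_dom_measurable[of m verblunsky_of_mat, OF v])
  have G: "(\<lambda>A. GGT ?n (verblunsky_of_mat A)) \<in> measurable (mat_borel ?n) (mat_borel ?n)"
    by (rule GGT_measurable[of m verblunsky_of_mat, OF v])
  have 2: "{A \<in> space (mat_borel ?n). A $$ (i, j) = GGT ?n (verblunsky_of_mat A) $$ (i, j)} \<in> sets (mat_borel ?n)"
    if "i < ?n" "j < ?n" for i j
  proof -
    have [measurable]: "(\<lambda>A. A $$ (i, j)) \<in> borel_measurable (mat_borel ?n)"
      "(\<lambda>A. GGT ?n (verblunsky_of_mat A) $$ (i, j)) \<in> borel_measurable (mat_borel ?n)"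
      using mat_borel_entry[OF that] measurable_compose[OF G mat_borel_entry[OF that]] by simp_all
    show ?thesis by measurable
  qed
  have [measurable]: "(\<lambda>A. poly (opuc (verblunsky_of_mat A) ?n) 1) \<in> borel_measurable (mat_borel ?n)"
    by (rule poly_opuc_meas(1)[of ?n verblunsky_of_mat, OF v]) auto
  have 3: "{A \<in> space (mat_borel ?n). poly (opuc (verblunsky_of_mat A) ?n) 1 \<noteq> 0} \<in> sets (mat_borel ?n)"
    by measurable
  have "{A \<in> space (mat_borel ?n). good_mat ?n A}
      = {A \<in> space (mat_borel ?n). verblunsky_of_mat A \<in> verb_dom ?n \<and>
          (\<forall>i\<in>{..<?n}. \<forall>j\<in>{..<?n}. A $$ (i, j) = GGT ?n (verblunsky_of_mat A) $$ (i, j)) \<and>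
          poly (opuc (verblunsky_of_mat A) ?n) 1 \<noteq> 0}"
    by (auto simp: good_mat_def)
  also have "\<dots> \<in> sets (mat_borel ?n)"
    by (intro sets.sets_Collect_conj sets.sets_Collect_finite_All 1 3 2) auto
  finally show ?thesis .
qed

text \<open>
  Almost every sequence of deformed coefficients lies here; a coefficient \<open>1\<close> would produce the
  eigenvalue \<open>1\<close>.
\<close>
definition def_dom :: "nat \<Rightarrow> (nat \<Rightarrow> complex) \<Rightarrow> bool" where
  "def_dom n \<gamma> \<longleftrightarrow> \<gamma> \<in> verb_dom n \<and> (\<forall>k<n. \<gamma> k \<noteq> 1)"

lemma GGT_def_dom:
  assumes \<gamma>: "def_dom (Suc m) \<gamma>"
  defines "A \<equiv> GGT (Suc m) (verb_of_def \<gamma>)"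
  shows "good_mat (Suc m) A" "det_of_row (Suc m) \<delta> A = (\<Prod>k<Suc m. hw \<delta> (\<gamma> k))"
proof -
  have dom: "verb_of_def \<gamma> \<in> verb_dom (Suc m)" using \<gamma> by (intro verb_of_def_dom) (simp add: def_dom_def)
  have v: "verblunsky_of_mat A k = verb_of_def \<gamma> k" if "k < Suc m" for k
    unfolding A_def using that by (intro verblunsky_of_GGT[OF dom]) auto
  have "verblunsky_of_mat A \<in> verb_dom (Suc m)" using dom verb_dom_cong[of m _ "verb_of_def \<gamma>", OF v] by blast
  moreover have "GGT (Suc m) (verblunsky_of_mat A) = A"
    unfolding A_def[symmetric] using GGT_cong[of "Suc m" _ "verb_of_def \<gamma>", OF v] by (simp add: A_def)
  moreover have "opuc (verblunsky_of_mat A) (Suc m) = opuc (verb_of_def \<gamma>) (Suc m)"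
    by (rule opuc_cong[OF v])
  moreover have "poly (opuc (verb_of_def \<gamma>) (Suc m)) 1 \<noteq> 0"
    using \<gamma> by (subst opuc_verb_of_def_at_one) (auto simp: def_dom_def)
  ultimately show "good_mat (Suc m) A" by (simp add: good_mat_def)
  have "gam (verblunsky_of_mat A) k = \<gamma> k" if "k < Suc m" for k
  proof -
    have "gam (verblunsky_of_mat A) k = gam (verb_of_def \<gamma>) k"
      using v that by (intro gam_cong) auto
    also have "\<dots> = \<gamma> k" using \<gamma> that by (intro gam_verb_of_def) (auto simp: def_dom_def)
    finally show ?thesis .
  qed
  then show "det_of_row (Suc m) \<delta> A = (\<Prod>k<Suc m. hw \<delta> (\<gamma> k))"
    unfolding det_of_row_def by (intro prod.cong) auto
qed

context
  fixes m :: nat and \<beta> :: real and \<delta> :: complex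
  assumes \<beta>: "\<beta> > 0"
begin

abbreviation (input) "PN \<equiv> Pi\<^sub>M {..<Suc m} (CJ_nu (Suc m) \<beta>)"

lemma AE_def_dom: "AE \<gamma> in PN. def_dom (Suc m) \<gamma>"
proof -
  have 1: "AE \<gamma> in PN. cmod (\<gamma> k) < 1" if "k < m" for k
  proof (rule CJ_nu.AE_component)
    have "\<beta> * real (Suc m - k - 1) + 1 \<noteq> 1" using \<beta> that by simp
    then show "AE z in CJ_nu (Suc m) \<beta> k. cmod z < 1" unfolding CJ_nu_def by (rule AE_nu_law_disk)
    show "k < Suc m" using that by simp
    show "Measurable.pred borel (\<lambda>z :: complex. cmod z < 1)" by measurable
  qed
  have 2: "AE \<gamma> in PN. cmod (\<gamma> m) = 1 \<and> \<gamma> m \<noteq> 1"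
  proof (rule CJ_nu.AE_component)
    have e: "\<beta> * real (Suc m - m - 1) + 1 = 1" by simp
    show "AE z in CJ_nu (Suc m) \<beta> m. cmod z = 1 \<and> z \<noteq> 1"
      unfolding CJ_nu_def e by (rule AE_nu_law_circle)
    show "m < Suc m" by simp
    show "Measurable.pred borel (\<lambda>z :: complex. cmod z = 1 \<and> z \<noteq> 1)" by measurable
  qed
  have "AE \<gamma> in PN. \<forall>k\<in>{..<m}. cmod (\<gamma> k) < 1" using 1 by (intro AE_finite_allI) auto
  then show ?thesis using 2
  proof eventually_elim
    case (elim \<gamma>)
    have "\<gamma> k \<noteq> 1" if "k < Suc m" for k
    proof (cases "k = m")
      case False
      then have "cmod (\<gamma> k) < 1" using elim(1) that by simp
      then show ?thesis by auto
    qed (use elim in simp)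
    then show ?case using elim by (auto simp: def_dom_def verb_dom_def)
  qed
qed

lemma CJ0_eq: "CJ0 (Suc m) \<beta> = distr PN (mat_borel (Suc m)) (\<lambda>\<gamma>. GGT (Suc m) (verb_of_def \<gamma>))"
proof -
  have G: "GGT (Suc m) \<in> measurable PN (mat_borel (Suc m))"
    using GGT_measurable[of m "\<lambda>\<gamma>. \<gamma>" PN] CJ_nu.component_meas by simp
  have "CJ0 (Suc m) \<beta> = distr (distr PN PN (CJ_nu.verb_restr (Suc m))) (mat_borel (Suc m)) (GGT (Suc m))"
    unfolding CJ_nu.distr_verb_restr unfolding CJ0_def CJ_nu_def[abs_def] ..
  also have "\<dots> = distr PN (mat_borel (Suc m)) (GGT (Suc m) \<circ> CJ_nu.verb_restr (Suc m))"
    by (rule distr_distr[OF G CJ_nu.verb_restr_meas])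
  also have "GGT (Suc m) \<circ> CJ_nu.verb_restr (Suc m) = (\<lambda>\<gamma>. GGT (Suc m) (verb_of_def \<gamma>))"
  proof
    fix \<gamma>
    show "(GGT (Suc m) \<circ> CJ_nu.verb_restr (Suc m)) \<gamma> = GGT (Suc m) (verb_of_def \<gamma>)"
      unfolding o_apply by (rule GGT_cong) (simp add: CJ_nu.verb_restr_def)
  qed
  finally show ?thesis .
qed

lemma GGT_verb_meas: "(\<lambda>\<gamma>. GGT (Suc m) (verb_of_def \<gamma>)) \<in> measurable PN (mat_borel (Suc m))"
  by (rule GGT_measurable[of m verb_of_def]) (rule CJ_nu.verb_of_def_meas)

lemma AE_CJ0_det: "AE A in CJ0 (Suc m) \<beta>. Re (det_delta \<delta> A) = det_of_row (Suc m) \<delta> A"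
proof -
  have "AE A in CJ0 (Suc m) \<beta>. good_mat (Suc m) A"
    unfolding CJ0_eq AE_distr_iff[OF GGT_verb_meas good_mat_meas]
    using AE_def_dom by eventually_elim (rule GGT_def_dom)
  moreover have "AE A in CJ0 (Suc m) \<beta>. A \<in> carrier_mat (Suc m) (Suc m)"
    by (rule AE_I2) (simp add: CJ0_def)
  ultimately show ?thesis by eventually_elim (rule good_mat_det)
qed

text \<open>
  The normalizing constant of \<open>CJ\<close>.
\<close>
definition ZZ :: ennreal where "ZZ = (\<integral>\<^sup>+\<gamma>. (\<Prod>k<Suc m. ennreal (hw \<delta> (\<gamma> k))) \<partial>PN)"

lemma nn_integral_CJ0:
  assumes "g \<in> borel_measurable (mat_borel (Suc m))"
  shows "(\<integral>\<^sup>+A. ennreal (det_of_row (Suc m) \<delta> A) * g A \<partial>CJ0 (Suc m) \<beta>)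
      = (\<integral>\<^sup>+\<gamma>. (\<Prod>k<Suc m. ennreal (hw \<delta> (\<gamma> k))) * g (GGT (Suc m) (verb_of_def \<gamma>)) \<partial>PN)"
proof -
  have "(\<integral>\<^sup>+A. ennreal (det_of_row (Suc m) \<delta> A) * g A \<partial>CJ0 (Suc m) \<beta>)
      = (\<integral>\<^sup>+\<gamma>. ennreal (det_of_row (Suc m) \<delta> (GGT (Suc m) (verb_of_def \<gamma>))) * g (GGT (Suc m) (verb_of_def \<gamma>)) \<partial>PN)"
    unfolding CJ0_eq
    by (rule nn_integral_distr[OF GGT_verb_meas], unfold measurable_distr_eq1)
       (intro borel_measurable_times_ennreal assms measurable_compose[OF det_of_row_meas measurable_ennreal])
  also have "\<dots> = (\<integral>\<^sup>+\<gamma>. (\<Prod>k<Suc m. ennreal (hw \<delta> (\<gamma> k))) * g (GGT (Suc m) (verb_of_def \<gamma>)) \<partial>PN)"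
  proof (rule nn_integral_cong_AE)
    show "AE \<gamma> in PN. ennreal (det_of_row (Suc m) \<delta> (GGT (Suc m) (verb_of_def \<gamma>))) * g (GGT (Suc m) (verb_of_def \<gamma>))
        = (\<Prod>k<Suc m. ennreal (hw \<delta> (\<gamma> k))) * g (GGT (Suc m) (verb_of_def \<gamma>))"
      using AE_def_dom
    proof eventually_elim
      case (elim \<gamma>)
      show ?case unfolding GGT_def_dom(2)[OF elim] by (simp only: prod_ennreal[OF hw_pos(2)])
    qed
  qed
  finally show ?thesis .
qed

text \<open>
  In the deformed coordinates the law \<open>CJ\<close> has a density of product form with respect to a product
  measure.
\<close>
lemma emeasure_CJ:
  assumes A: "A \<in> sets (mat_borel (Suc m))"
  shows "emeasure (CJ (Suc m) \<delta> \<beta>) A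
      = (\<integral>\<^sup>+\<gamma>. (\<Prod>k<Suc m. ennreal (hw \<delta> (\<gamma> k))) * indicator A (GGT (Suc m) (verb_of_def \<gamma>)) \<partial>PN) / ZZ"
proof -
  have [measurable]: "det_of_row (Suc m) \<delta> \<in> borel_measurable (CJ0 (Suc m) \<beta>)"
    using det_of_row_meas[of "Suc m" \<delta>] by (simp add: CJ0_def cong: measurable_cong_sets)
  have A' [measurable]: "A \<in> sets (CJ0 (Suc m) \<beta>)" using A by (simp add: CJ0_def)
  have Z: "(\<integral>\<^sup>+B. ennreal (Re (det_delta \<delta> B)) \<partial>CJ0 (Suc m) \<beta>) = ZZ"
  proof -
    have "(\<integral>\<^sup>+B. ennreal (Re (det_delta \<delta> B)) \<partial>CJ0 (Suc m) \<beta>)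
        = (\<integral>\<^sup>+B. ennreal (det_of_row (Suc m) \<delta> B) * 1 \<partial>CJ0 (Suc m) \<beta>)"
      using AE_CJ0_det by (intro nn_integral_cong_AE) auto
    also have "\<dots> = ZZ" unfolding ZZ_def by (subst nn_integral_CJ0) auto
    finally show ?thesis .
  qed
  have "CJ (Suc m) \<delta> \<beta> = density (CJ0 (Suc m) \<beta>) (\<lambda>A. ennreal (det_of_row (Suc m) \<delta> A) / ZZ)"
    unfolding CJ_def Z using AE_CJ0_det by (intro density_cong_AE_any) auto
  then have "emeasure (CJ (Suc m) \<delta> \<beta>) A = (\<integral>\<^sup>+B. ennreal (det_of_row (Suc m) \<delta> B) / ZZ * indicator A B \<partial>CJ0 (Suc m) \<beta>)"
    using A' by (simp add: emeasure_density)
  also have "\<dots> = (\<integral>\<^sup>+B. ennreal (det_of_row (Suc m) \<delta> B) * indicator A B / ZZ \<partial>CJ0 (Suc m) \<beta>)"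
    by (simp add: divide_ennreal_def mult_ac)
  also have "\<dots> = (\<integral>\<^sup>+B. ennreal (det_of_row (Suc m) \<delta> B) * indicator A B \<partial>CJ0 (Suc m) \<beta>) / ZZ"
    using A' by (intro nn_integral_divide) measurable
  also have "(\<integral>\<^sup>+B. ennreal (det_of_row (Suc m) \<delta> B) * indicator A B \<partial>CJ0 (Suc m) \<beta>)
      = (\<integral>\<^sup>+\<gamma>. (\<Prod>k<Suc m. ennreal (hw \<delta> (\<gamma> k))) * indicator A (GGT (Suc m) (verb_of_def \<gamma>)) \<partial>PN)"
    by (rule nn_integral_CJ0[OF borel_measurable_indicator[OF A]])
  finally show ?thesis .
qed

text \<open>
  By independence the factors of the other coordinates cancel against the normalizing constant. The
  hypothesis on the total mass says that this constant is neither \<open>0\<close> nor \<open>\<infinity>\<close>, so that the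
  cancellation is legitimate.
\<close>
lemma CJ_union_bound:
  assumes prob: "emeasure (CJ (Suc m) \<delta> \<beta>) (carrier_mat (Suc m) (Suc m)) = 1"
    and A: "A \<in> sets (mat_borel (Suc m))" and B: "B \<in> sets borel" and K: "K \<subseteq> {..<Suc m}"
    and imp: "\<And>\<gamma>. def_dom (Suc m) \<gamma> \<Longrightarrow> GGT (Suc m) (verb_of_def \<gamma>) \<in> A \<Longrightarrow> \<exists>k\<in>K. \<gamma> k \<in> B"
  shows "emeasure (CJ (Suc m) \<delta> \<beta>) A
    \<le> (\<Sum>k\<in>K. (\<integral>\<^sup>+z. ennreal (hw \<delta> z) * indicator B z \<partial>CJ_nu (Suc m) \<beta> k)
             / (\<integral>\<^sup>+z. ennreal (hw \<delta> z) \<partial>CJ_nu (Suc m) \<beta> k))"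
proof -
  have finK: "finite K" using K finite_subset by blast
  have hwm: "(\<lambda>z. ennreal (hw \<delta> z)) \<in> borel_measurable (CJ_nu (Suc m) \<beta> k)" for k
    by (simp cong: measurable_cong_sets)
  have hwB: "(\<lambda>z. ennreal (hw \<delta> z) * indicator B z) \<in> borel_measurable (CJ_nu (Suc m) \<beta> k)" for k
    using B by (simp cong: measurable_cong_sets)
  have comp: "(\<lambda>\<gamma>. \<gamma> k) \<in> borel_measurable PN" if "k < Suc m" for k
    using CJ_nu.component_meas[OF that] .
  have prodm: "(\<lambda>\<gamma>. \<Prod>k<Suc m. ennreal (hw \<delta> (\<gamma> k))) \<in> borel_measurable PN"
    by (intro borel_measurable_prod_ennreal measurable_compose[OF comp]) auto
  define I where "I k = (\<integral>\<^sup>+z. ennreal (hw \<delta> z) \<partial>CJ_nu (Suc m) \<beta> k)" for k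
  define J where "J k = (\<integral>\<^sup>+z. ennreal (hw \<delta> z) * indicator B z \<partial>CJ_nu (Suc m) \<beta> k)" for k
  have Zprod: "ZZ = (\<Prod>k<Suc m. I k)"
    unfolding ZZ_def I_def by (rule CJ_nu.product_nn_integral_prod[OF finite_lessThan hwm])
  have sp: "GGT (Suc m) (verb_of_def \<gamma>) \<in> carrier_mat (Suc m) (Suc m)" for \<gamma> by simp
  have "ZZ / ZZ = 1"
    using prob emeasure_CJ[of "carrier_mat (Suc m) (Suc m)"] sets.top[of "mat_borel (Suc m)"]
    by (simp add: sp ZZ_def)
  then have Z: "ZZ \<noteq> 0" "ZZ \<noteq> \<infinity>" by (auto simp: divide_eq_1_ennreal infinity_ennreal_def)
  have I0: "I k \<noteq> 0" if "k < Suc m" for k 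
  proof
    assume "I k = 0"
    then have "ZZ = 0" unfolding Zprod using that by (intro prod_zero) (auto intro!: bexI[of _ k])
    with Z(1) show False by simp
  qed
  have rest: "(\<Prod>j\<in>{..<Suc m} - {k}. I j) \<noteq> 0" "(\<Prod>j\<in>{..<Suc m} - {k}. I j) \<noteq> \<infinity>" if "k < Suc m" for k
  proof -
    have zz: "ZZ = I k * (\<Prod>j\<in>{..<Suc m} - {k}. I j)"
      unfolding Zprod using that by (intro prod.remove) auto
    show "(\<Prod>j\<in>{..<Suc m} - {k}. I j) \<noteq> 0" using Z(1) zz by auto
    show "(\<Prod>j\<in>{..<Suc m} - {k}. I j) \<noteq> \<infinity>"
      using Z(2) zz I0[OF that] by (auto simp: ennreal_mult_top ennreal_top_mult infinity_ennreal_def)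
  qed
  have one: "(\<integral>\<^sup>+\<gamma>. (\<Prod>j<Suc m. ennreal (hw \<delta> (\<gamma> j))) * indicator B (\<gamma> k) \<partial>PN) / ZZ = J k / I k"
    if k: "k < Suc m" for k
  proof -
    define f where "f j z = (if j = k then ennreal (hw \<delta> z) * indicator B z else ennreal (hw \<delta> z))" for j z
    have fm: "f j \<in> borel_measurable (CJ_nu (Suc m) \<beta> j)" for j
      unfolding f_def[abs_def] by (cases "j = k") (simp_all only: if_True if_False simp_thms hwm hwB)
    have "(\<Prod>j<Suc m. ennreal (hw \<delta> (\<gamma> j))) * indicator B (\<gamma> k) = (\<Prod>j<Suc m. f j (\<gamma> j))" for \<gamma>
    proof -
      have "(\<Prod>j<Suc m. f j (\<gamma> j)) = f k (\<gamma> k) * (\<Prod>j\<in>{..<Suc m} - {k}. f j (\<gamma> j))"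
        using k by (intro prod.remove) auto
      also have "\<dots> = (ennreal (hw \<delta> (\<gamma> k)) * (\<Prod>j\<in>{..<Suc m} - {k}. ennreal (hw \<delta> (\<gamma> j)))) * indicator B (\<gamma> k)"
        by (simp add: f_def mult_ac)
      also have "ennreal (hw \<delta> (\<gamma> k)) * (\<Prod>j\<in>{..<Suc m} - {k}. ennreal (hw \<delta> (\<gamma> j))) = (\<Prod>j<Suc m. ennreal (hw \<delta> (\<gamma> j)))"
        using k by (intro prod.remove[symmetric]) auto
      finally show ?thesis by simp
    qed
    then have "(\<integral>\<^sup>+\<gamma>. (\<Prod>j<Suc m. ennreal (hw \<delta> (\<gamma> j))) * indicator B (\<gamma> k) \<partial>PN)
        = (\<Prod>j<Suc m. integral\<^sup>N (CJ_nu (Suc m) \<beta> j) (f j))"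
      by (simp only: CJ_nu.product_nn_integral_prod[OF finite_lessThan fm])
    also have "\<dots> = integral\<^sup>N (CJ_nu (Suc m) \<beta> k) (f k) * (\<Prod>j\<in>{..<Suc m} - {k}. integral\<^sup>N (CJ_nu (Suc m) \<beta> j) (f j))"
      using k by (intro prod.remove) auto
    also have "\<dots> = J k * (\<Prod>j\<in>{..<Suc m} - {k}. I j)"
      by (simp add: f_def[abs_def] J_def I_def)
    finally have "(\<integral>\<^sup>+\<gamma>. (\<Prod>j<Suc m. ennreal (hw \<delta> (\<gamma> j))) * indicator B (\<gamma> k) \<partial>PN)
      = J k * (\<Prod>j\<in>{..<Suc m} - {k}. I j)" .
    moreover have "ZZ = I k * (\<Prod>j\<in>{..<Suc m} - {k}. I j)"
      unfolding Zprod using k by (intro prod.remove) auto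
    ultimately show ?thesis using divide_mult_eq[OF rest(1)[OF k]] rest(2)[OF k] by simp
  qed
  have "emeasure (CJ (Suc m) \<delta> \<beta>) A
      = (\<integral>\<^sup>+\<gamma>. (\<Prod>k<Suc m. ennreal (hw \<delta> (\<gamma> k))) * indicator A (GGT (Suc m) (verb_of_def \<gamma>)) \<partial>PN) / ZZ"
    by (rule emeasure_CJ[OF A])
  also have "\<dots> \<le> (\<integral>\<^sup>+\<gamma>. (\<Sum>k\<in>K. (\<Prod>j<Suc m. ennreal (hw \<delta> (\<gamma> j))) * indicator B (\<gamma> k)) \<partial>PN) / ZZ"
  proof (intro divide_right_mono_ennreal nn_integral_mono_AE)
    show "AE \<gamma> in PN. (\<Prod>k<Suc m. ennreal (hw \<delta> (\<gamma> k))) * indicator A (GGT (Suc m) (verb_of_def \<gamma>))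
        \<le> (\<Sum>k\<in>K. (\<Prod>j<Suc m. ennreal (hw \<delta> (\<gamma> j))) * indicator B (\<gamma> k))"
      using AE_def_dom
    proof eventually_elim
      case (elim \<gamma>)
      have "indicator A (GGT (Suc m) (verb_of_def \<gamma>)) \<le> (\<Sum>k\<in>K. indicator B (\<gamma> k) :: ennreal)"
      proof (cases "GGT (Suc m) (verb_of_def \<gamma>) \<in> A")
        case True
        then obtain k where "k \<in> K" "\<gamma> k \<in> B" using imp[OF elim] by blast
        then have "(\<Sum>k\<in>{k}. indicator B (\<gamma> k) :: ennreal) \<le> (\<Sum>k\<in>K. indicator B (\<gamma> k))"
          using finK by (intro sum_mono2) auto
        then show ?thesis using True \<open>\<gamma> k \<in> B\<close> by simp
      qed simp
      then show ?case by (simp only: sum_distrib_left[symmetric]) (rule mult_left_mono, auto)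
    qed
  qed
  also have "(\<integral>\<^sup>+\<gamma>. (\<Sum>k\<in>K. (\<Prod>j<Suc m. ennreal (hw \<delta> (\<gamma> j))) * indicator B (\<gamma> k)) \<partial>PN)
      = (\<Sum>k\<in>K. (\<integral>\<^sup>+\<gamma>. (\<Prod>j<Suc m. ennreal (hw \<delta> (\<gamma> j))) * indicator B (\<gamma> k) \<partial>PN))"
  proof (rule nn_integral_sum)
    fix k assume "k \<in> K"
    then have "k < Suc m" using K by auto
    from measurable_compose[OF comp[OF this] borel_measurable_indicator[OF B]]
    show "(\<lambda>\<gamma>. (\<Prod>j<Suc m. ennreal (hw \<delta> (\<gamma> j))) * indicator B (\<gamma> k)) \<in> borel_measurable PN"
      by (intro borel_measurable_times_ennreal prodm)
  qed
  also have "\<dots> / ZZ = (\<Sum>k\<in>K. (\<integral>\<^sup>+\<gamma>. (\<Prod>j<Suc m. ennreal (hw \<delta> (\<gamma> j))) * indicator B (\<gamma> k) \<partial>PN) / ZZ)"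
    by (simp add: divide_ennreal_def sum_distrib_right)
  also have "\<dots> = (\<Sum>k\<in>K. J k / I k)" using K by (intro sum.cong refl one) auto
  finally show ?thesis by (simp add: I_def J_def)
qed

end


section \<open>Concentration of a deformed coefficient\<close>

text \<open>
  The point of concentration of the deformed coefficients; \<open>mu_d d\<close> is the measure for which they are
  all equal to it.
\<close>
definition gamma_d :: "complex \<Rightarrow> complex" where
  "gamma_d d = - d / (1 + cnj d)"

text \<open>
  The density of a deformed coefficient is a large power of this function, by \<open>density_hw_eq\<close>.
\<close>
definition rate :: "complex \<Rightarrow> complex \<Rightarrow> real" where
  "rate d z = (1 - (cmod z)\<^sup>2) * exp (2 * Re (cnj d * Ln (1 - z)))"

context
  fixes d :: complex
  assumes d: "Re d \<ge> 0"
begin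

lemma one_plus_d_nz: "1 + d \<noteq> 0" "1 + cnj d \<noteq> 0"
proof -
  have "Re (1 + d) > 0" "Re (1 + cnj d) > 0" using d by auto
  then show "1 + d \<noteq> 0" "1 + cnj d \<noteq> 0" using Re_pos_nonzero by blast+
qed

lemma one_minus_gamma_d: "1 - gamma_d d = of_real (1 + 2 * Re d) / (1 + cnj d)"
proof -
  have "1 - gamma_d d = (1 + cnj d + d) / (1 + cnj d)"
    using one_plus_d_nz by (simp add: gamma_d_def field_simps)
  also have "1 + cnj d + d = of_real (1 + 2 * Re d)" by (simp add: complex_eq_iff)
  finally show ?thesis .
qed

lemma cmod_gamma_d: "cmod (gamma_d d) < 1"
proof -
  have "(cmod d)\<^sup>2 < (cmod (1 + cnj d))\<^sup>2"
    using d unfolding cmod_power2 by (simp add: power2_eq_square algebra_simps)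
  then have "cmod d < cmod (1 + cnj d)" by (rule power2_less_imp_less) simp
  then show ?thesis using one_plus_d_nz by (simp add: gamma_d_def norm_divide)
qed

text \<open>
  In the coordinates \<open>\<theta>\<close>, \<open>x\<close> with \<open>1 - z = x cos \<theta> e\<^bsup>i\<theta>\<^esup>\<close> the logarithm of the rate is a function of
  \<open>x\<close> plus a function of \<open>\<theta>\<close>: a circle through \<open>0\<close> and \<open>x\<close> is traced as \<open>\<theta>\<close> varies, and
  \<open>1 - \<bar>z\<bar>\<^sup>2 = x (2 - x) cos\<^sup>2 \<theta>\<close>.
\<close>
lemma ln_rate:
  assumes z: "cmod z < 1"
  defines "\<theta> \<equiv> Im (Ln (1 - z))" and "x \<equiv> cmod (1 - z) / cos (Im (Ln (1 - z)))"
  shows "\<bar>\<theta>\<bar> < pi / 2" "cos \<theta> > 0" "0 < x" "x < 2" "rate d z > 0"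
    "ln (rate d z) = ((1 + 2 * Re d) * ln x + ln (2 - x)) + ((2 + 2 * Re d) * ln (cos \<theta>) + 2 * Im d * \<theta>)"
    "1 - z = of_real (x * cos \<theta>) * cis \<theta>"
proof -
  have pos: "Re (1 - z) > 0" using z by (intro Re_one_minus_pos) auto
  then have nz: "1 - z \<noteq> 0" by (rule Re_pos_nonzero)
  define r where "r = cmod (1 - z)"
  have r: "r > 0" using nz by (simp add: r_def)
  show th: "\<bar>\<theta>\<bar> < pi / 2" unfolding \<theta>_def using Re_Ln_pos_lt[OF nz] pos by blast
  then show c: "cos \<theta> > 0" by (intro cos_gt_zero_pi) (auto simp: abs_less_iff)
  have "1 - z = exp (Ln (1 - z))" using nz by simp
  also have "\<dots> = of_real (exp (Re (Ln (1 - z)))) * cis \<theta>"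
    unfolding \<theta>_def by (rule exp_eq_polar)
  also have "exp (Re (Ln (1 - z))) = r" using nz by (simp add: r_def)
  finally have polar: "1 - z = of_real r * cis \<theta>" .
  have x: "x = r / cos \<theta>" by (simp add: x_def r_def \<theta>_def)
  show x0: "0 < x" using r c by (simp add: x)
  show "1 - z = of_real (x * cos \<theta>) * cis \<theta>" using polar c by (simp add: x)
  have Re: "Re (1 - z) = r * cos \<theta>" by (subst polar) simp
  have "(cmod z)\<^sup>2 = (cmod (1 - (1 - z)))\<^sup>2" by simp
  also have "\<dots> = 1 - 2 * Re (1 - z) + (cmod (1 - z))\<^sup>2"
    by (simp only: cmod_power2) (simp add: power2_eq_square algebra_simps)
  finally have "1 - (cmod z)\<^sup>2 = 2 * (r * cos \<theta>) - r\<^sup>2" unfolding Re r_def by simp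
  also have "\<dots> = x * (cos \<theta>)\<^sup>2 * (2 - x)" using c by (simp add: x field_simps power2_eq_square)
  finally have w: "1 - (cmod z)\<^sup>2 = x * (cos \<theta>)\<^sup>2 * (2 - x)" .
  have wpos: "1 - (cmod z)\<^sup>2 > 0" using z by (simp add: abs_square_less_1)
  then have "x * (cos \<theta>)\<^sup>2 * (2 - x) > 0" using w by simp
  then have "2 - x > 0" using x0 c by (metis mult_pos_pos zero_less_mult_pos zero_less_power)
  then show x2: "x < 2" by simp
  show "rate d z > 0" using wpos by (simp add: rate_def)
  have "Re (Ln (1 - z)) = ln r" using nz by (simp add: r_def)
  also have "\<dots> = ln (x * cos \<theta>)" using c by (simp add: x)
  also have "\<dots> = ln x + ln (cos \<theta>)" using x0 c by (simp add: ln_mult)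
  finally have "Re (cnj d * Ln (1 - z)) = Re d * (ln x + ln (cos \<theta>)) + Im d * \<theta>"
    by (simp add: \<theta>_def)
  note e = this
  have "ln (rate d z) = ln (1 - (cmod z)\<^sup>2) + ln (exp (2 * Re (cnj d * Ln (1 - z))))"
    unfolding rate_def by (rule ln_mult_pos) (use wpos in auto)
  then have "ln (rate d z) = ln (x * (cos \<theta>)\<^sup>2 * (2 - x)) + 2 * (Re d * (ln x + ln (cos \<theta>)) + Im d * \<theta>)"
    unfolding ln_exp e w .
  also have "ln (x * (cos \<theta>)\<^sup>2 * (2 - x)) = ln x + 2 * ln (cos \<theta>) + ln (2 - x)"
    using x0 x2 c by (simp add: ln_mult ln_realpow)
  finally show "ln (rate d z) = ((1 + 2 * Re d) * ln x + ln (2 - x)) + ((2 + 2 * Re d) * ln (cos \<theta>) + 2 * Im d * \<theta>)"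
    by (simp add: algebra_simps)
qed

lemma x_part_max:
  fixes a x :: real
  assumes "a \<ge> 0" "0 < x" "x < 2"
  defines "x0 \<equiv> (1 + 2 * a) / (1 + a)"
  shows "x \<noteq> x0 \<Longrightarrow> (1 + 2 * a) * ln x + ln (2 - x) < (1 + 2 * a) * ln x0 + ln (2 - x0)"
proof -
  assume ne: "x \<noteq> x0"
  have x0: "0 < x0" using assms by (simp add: x0_def)
  have y: "2 - x0 = 1 / (1 + a)" using assms by (simp add: x0_def field_simps)
  have y0: "2 - x0 > 0" unfolding y using assms by simp
  have l1: "ln (x / x0) < x / x0 - 1"
  proof -
    have "x / x0 > 0" using assms(2) x0 by simp
    moreover have "x / x0 \<noteq> 1" using ne x0 by simp
    ultimately show ?thesis using ln_le_minus_one[of "x/x0"] ln_eq_minus_one[of "x/x0"] by linarith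
  qed
  have l2: "ln ((2 - x) / (2 - x0)) \<le> (2 - x) / (2 - x0) - 1"
    using y0 assms by (intro ln_le_minus_one) auto
  have "(1 + 2 * a) * ln (x / x0) + ln ((2 - x) / (2 - x0))
      < (1 + 2 * a) * (x / x0 - 1) + ((2 - x) / (2 - x0) - 1)"
    using l1 l2 assms by (intro add_less_le_mono mult_strict_left_mono) auto
  also have "\<dots> = 0" unfolding y using assms by (simp add: x0_def field_simps)
  finally have "(1 + 2 * a) * ln (x / x0) + ln ((2 - x) / (2 - x0)) < 0" .
  moreover have "ln (x / x0) = ln x - ln x0" using assms(2) x0 by (simp add: ln_div)
  moreover have "ln ((2 - x) / (2 - x0)) = ln (2 - x) - ln (2 - x0)" using assms(3) y0 by (simp add: ln_div)
  ultimately show ?thesis by (simp add: algebra_simps)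
qed

lemma theta_part_max:
  fixes c b \<theta> \<theta>0 :: real
  assumes "c > 0" "\<bar>\<theta>\<bar> < pi / 2" "\<bar>\<theta>0\<bar> < pi / 2" "c * tan \<theta>0 = b" "\<theta> \<noteq> \<theta>0"
  shows "c * ln (cos \<theta>) + b * \<theta> < c * ln (cos \<theta>0) + b * \<theta>0"
proof -
  define f where "f t = c * ln (cos t) + b * t" for t
  have der: "(f has_real_derivative (b - c * tan t)) (at t)" if "\<bar>t\<bar> < pi / 2" for t
  proof -
    have "cos t > 0" using that by (intro cos_gt_zero_pi) (auto simp: abs_less_iff)
    then show ?thesis unfolding f_def
      by (auto intro!: derivative_eq_intros simp: tan_def)
  qed
  show ?thesis
  proof (cases "\<theta> < \<theta>0")
    case True
    then obtain t where t: "\<theta> < t" "t < \<theta>0" "f \<theta>0 - f \<theta> = (\<theta>0 - \<theta>) * (b - c * tan t)"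
      using MVT2[of \<theta> \<theta>0 f "\<lambda>t. b - c * tan t"] der assms by (auto simp: abs_less_iff)
    have "tan t < tan \<theta>0" using t assms by (intro tan_monotone) (auto simp: abs_less_iff)
    then have "c * tan t < b" using assms by (metis mult_strict_left_mono)
    then have "f \<theta>0 - f \<theta> > 0" using t by simp
    then show ?thesis by (simp add: f_def)
  next
    case False
    then have lt: "\<theta>0 < \<theta>" using assms by simp
    then obtain t where t: "\<theta>0 < t" "t < \<theta>" "f \<theta> - f \<theta>0 = (\<theta> - \<theta>0) * (b - c * tan t)"
      using MVT2[of \<theta>0 \<theta> f "\<lambda>t. b - c * tan t"] der assms by (auto simp: abs_less_iff)
    have "tan \<theta>0 < tan t" using t assms by (intro tan_monotone) (auto simp: abs_less_iff)
    then have "b < c * tan t" using assms by (metis mult_strict_left_mono)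
    then have "f \<theta> - f \<theta>0 < 0" using t by (simp add: mult_pos_neg)
    then show ?thesis by (simp add: f_def)
  qed
qed

text \<open>
  Both summands of \<open>ln_rate\<close> are strictly concave, with critical points \<open>x = (1 + 2 Re d) / (1 + Re d)\<close>
  and \<open>tan \<theta> = Im d / (1 + Re d)\<close>, which are the coordinates of \<open>gamma_d d\<close>.
\<close>
lemma rate_max:
  assumes z: "cmod z < 1" and ne: "z \<noteq> gamma_d d"
  shows "rate d z < rate d (gamma_d d)"
proof -
  define a b where "a = Re d" and "b = Im d"
  define \<theta> where "\<theta> u = Im (Ln (1 - u))" for u :: complex
  define x where "x u = cmod (1 - u) / cos (\<theta> u)" for u
  note L = ln_rate[folded \<theta>_def, folded x_def]
  let ?g = "gamma_d d"
  note g = cmod_gamma_d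
  define f where "f = cmod (1 + cnj d)"
  have f: "f > 0" using one_plus_d_nz by (simp add: f_def)
  have pg: "1 - ?g = of_real ((1 + 2 * a) / f\<^sup>2) * (1 + d)"
  proof -
    have h: "(1 + cnj d) * (1 + d) = of_real (f\<^sup>2)"
      using complex_norm_square[of "1 + cnj d"] unfolding f_def by simp
    have "1 / (1 + cnj d) = (1 + d) / ((1 + cnj d) * (1 + d))"
      using one_plus_d_nz by simp
    then have h2: "1 / (1 + cnj d) = (1 + d) / of_real (f\<^sup>2)" unfolding h .
    have "1 - ?g = of_real (1 + 2 * a) * (1 / (1 + cnj d))" unfolding one_minus_gamma_d a_def by simp
    then show ?thesis unfolding h2 by simp
  qed
  have Rg: "Re (1 - ?g) = (1 + 2 * a) / f\<^sup>2 * (1 + a)" "Im (1 - ?g) = (1 + 2 * a) / f\<^sup>2 * b"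
    unfolding pg a_def b_def by simp_all
  have a0: "a \<ge> 0" using d by (simp add: a_def)
  have cs: "Re (1 - ?g) = x ?g * cos (\<theta> ?g) * cos (\<theta> ?g)" "Im (1 - ?g) = x ?g * cos (\<theta> ?g) * sin (\<theta> ?g)"
    by (subst L(7)[OF g], simp)+
  have tan: "(2 + 2 * a) * tan (\<theta> ?g) = 2 * b"
  proof -
    have "tan (\<theta> ?g) = Im (1 - ?g) / Re (1 - ?g)"
      unfolding cs using L(2,3)[OF g] by (simp add: tan_def)
    also have "\<dots> = b / (1 + a)"
    proof -
      have "(1 + 2 * a) / f\<^sup>2 \<noteq> 0" using f a0 by simp
      then show ?thesis unfolding Rg by (rule mult_divide_mult_cancel_left)
    qed
    finally show ?thesis using a0 by (simp add: field_simps)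
  qed
  have xg: "x ?g = (1 + 2 * a) / (1 + a)"
  proof -
    have "x ?g = (cmod (1 - ?g))\<^sup>2 / Re (1 - ?g)"
      unfolding cs using L(2,3)[OF g] by (simp add: x_def power2_eq_square)
    also have "(cmod (1 - ?g))\<^sup>2 = ((1 + 2 * a) / f)\<^sup>2"
      unfolding one_minus_gamma_d a_def f_def norm_divide norm_of_real using d by simp
    finally have e: "x ?g = ((1 + 2 * a) / f)\<^sup>2 / ((1 + 2 * a) / f\<^sup>2 * (1 + a))" unfolding Rg .
    have "(K / f)\<^sup>2 / (K / f\<^sup>2 * N) = K / N" if "K \<noteq> 0" for K N :: real
      using f that by (cases "N = 0") (auto simp: field_simps power2_eq_square)
    then show ?thesis unfolding e using a0 by simp
  qed
  have "x z \<noteq> x ?g \<or> \<theta> z \<noteq> \<theta> ?g"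
  proof (rule ccontr)
    assume "\<not> ?thesis"
    then have "1 - z = 1 - ?g" using L(7)[OF z] L(7)[OF g] by simp
    then show False using ne by simp
  qed
  have X: "(1 + 2 * a) * ln (x z) + ln (2 - x z) \<le> (1 + 2 * a) * ln (x ?g) + ln (2 - x ?g)"
    and Xs: "x z \<noteq> x ?g \<Longrightarrow> (1 + 2 * a) * ln (x z) + ln (2 - x z) < (1 + 2 * a) * ln (x ?g) + ln (2 - x ?g)"
    using x_part_max[OF a0 L(3,4)[OF z], folded xg] by (cases "x z = x ?g"; force)+
  have T: "(2 + 2 * a) * ln (cos (\<theta> z)) + 2 * b * \<theta> z \<le> (2 + 2 * a) * ln (cos (\<theta> ?g)) + 2 * b * \<theta> ?g"
    and Ts: "\<theta> z \<noteq> \<theta> ?g \<Longrightarrow> (2 + 2 * a) * ln (cos (\<theta> z)) + 2 * b * \<theta> z < (2 + 2 * a) * ln (cos (\<theta> ?g)) + 2 * b * \<theta> ?g"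
    using theta_part_max[OF _ L(1)[OF z] L(1)[OF g] tan] a0 by (cases "\<theta> z = \<theta> ?g"; force)+
  have "ln (rate d z) < ln (rate d ?g)"
    unfolding L(6)[OF z] L(6)[OF g] a_def[symmetric] b_def[symmetric]
    using X Xs T Ts \<open>x z \<noteq> x ?g \<or> \<theta> z \<noteq> \<theta> ?g\<close> by linarith
  then show ?thesis using L(5)[OF z] L(5)[OF g] by simp
qed

lemma rate_continuous: "continuous_on (ball 0 1) (rate d)"
  unfolding rate_def[abs_def]
proof (intro continuous_intros)
  fix z :: complex assume "z \<in> ball 0 1"
  then show "1 - z \<notin> \<real>\<^sub>\<le>\<^sub>0" by (intro Re_pos_notin_nonpos Re_one_minus_pos) auto
qed

lemma rate_bound:
  obtains C where "C > 0" "\<And>z. cmod z < 1 \<Longrightarrow> rate d z \<le> C * (1 - (cmod z)\<^sup>2)"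
proof
  define C where "C = exp (2 * (Re d * ln 2 + \<bar>Im d\<bar> * pi))"
  show "C > 0" by (simp add: C_def)
  fix z :: complex assume z: "cmod z < 1"
  have nz: "1 - z \<noteq> 0" using z by auto
  have "cmod (1 - z) \<le> 2" using norm_triangle_ineq4[of 1 z] z by simp
  then have "ln (cmod (1 - z)) \<le> ln 2" using nz by simp
  then have 1: "Re d * Re (Ln (1 - z)) \<le> Re d * ln 2" using d nz by (intro mult_left_mono) auto
  have "Im d * Im (Ln (1 - z)) \<le> \<bar>Im d\<bar> * \<bar>Im (Ln (1 - z))\<bar>" by (metis abs_ge_self abs_mult)
  also have "\<dots> \<le> \<bar>Im d\<bar> * pi"
    using mpi_less_Im_Ln[OF nz] Im_Ln_le_pi[OF nz] by (intro mult_left_mono) auto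
  finally have "Re (cnj d * Ln (1 - z)) \<le> Re d * ln 2 + \<bar>Im d\<bar> * pi" using 1 by simp
  then have "exp (2 * Re (cnj d * Ln (1 - z))) \<le> C" unfolding C_def by simp
  then show "rate d z \<le> C * (1 - (cmod z)\<^sup>2)"
  proof -
    have "0 \<le> 1 - (cmod z)\<^sup>2" using z by (simp add: abs_square_le_1)
    then have "(1 - (cmod z)\<^sup>2) * exp (2 * Re (cnj d * Ln (1 - z))) \<le> (1 - (cmod z)\<^sup>2) * C"
      using \<open>exp (2 * Re (cnj d * Ln (1 - z))) \<le> C\<close> by (intro mult_left_mono)
    then show ?thesis unfolding rate_def by (simp only: mult.commute)
  qed
qed

text \<open>
  The rate tends to \<open>0\<close> at the circle by \<open>rate_bound\<close>, so its supremum away from the maximum is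
  attained or small.
\<close>
lemma rate_gap:
  assumes "\<eta> > 0"
  obtains M where "0 < M" "M < rate d (gamma_d d)"
    "\<And>z. cmod z < 1 \<Longrightarrow> \<eta> \<le> cmod (z - gamma_d d) \<Longrightarrow> rate d z \<le> M"
proof -
  let ?g = "gamma_d d"
  obtain C where C: "C > 0" "\<And>z. cmod z < 1 \<Longrightarrow> rate d z \<le> C * (1 - (cmod z)\<^sup>2)" using rate_bound by blast
  define R where "R = rate d ?g"
  have R: "R > 0" unfolding R_def by (rule ln_rate(5)[OF cmod_gamma_d])
  \<comment> \<open>the compact part of the region, on which the rate can exceed half of the maximum\<close>
  define K where "K = cball 0 1 \<inter> {z. \<eta> \<le> cmod (z - ?g)} \<inter> {z. R / 2 \<le> C * (1 - (cmod z)\<^sup>2)}"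
  have "compact K" unfolding K_def
    by (intro compact_Int_closed compact_cball closed_Collect_le continuous_intros)
  have KD: "K \<subseteq> ball 0 1"
  proof
    fix z assume z: "z \<in> K"
    have "C * (1 - (cmod z)\<^sup>2) > 0" using z R by (auto simp: K_def)
    then have "(cmod z)\<^sup>2 < 1\<^sup>2" using C(1) by (simp add: zero_less_mult_iff)
    then have "cmod z < 1" by (rule power2_less_imp_less) simp
    then show "z \<in> ball 0 1" by simp
  qed
  have outside: "rate d z \<le> R / 2" if "cmod z < 1" "\<eta> \<le> cmod (z - ?g)" "z \<notin> K" for z
    using C(2)[OF that(1)] that by (auto simp: K_def)
  show ?thesis
  proof (cases "K = {}")
    case True
    then show ?thesis using outside R that[of "R / 2"] by (auto simp: R_def)
  next
    case False
    then obtain y where y: "y \<in> K" "\<And>z. z \<in> K \<Longrightarrow> rate d z \<le> rate d y"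
      using continuous_attains_sup[OF \<open>compact K\<close> False continuous_on_subset[OF rate_continuous KD]] by blast
    have "y \<noteq> ?g" using y(1) assms by (auto simp: K_def)
    then have "rate d y < R" unfolding R_def using y(1) KD by (intro rate_max) auto
    define M where "M = max (R / 2) (rate d y)"
    have "0 < M" "M < R" using R \<open>rate d y < R\<close> by (auto simp: M_def)
    moreover have "rate d z \<le> M" if "cmod z < 1" "\<eta> \<le> cmod (z - ?g)" for z
      using outside[OF that] y(2)[of z] by (cases "z \<in> K") (auto simp: M_def)
    ultimately show ?thesis using that[of M] by (simp add: R_def)
  qed
qed

lemma nn_integral_nu_hw:
  assumes s: "s \<noteq> 1" and h: "h \<in> borel_measurable borel"
  shows "(\<integral>\<^sup>+z. h z \<partial>nu_law s) = (\<integral>\<^sup>+z. ennreal (indicator (ball 0 1) z * ((s - 1) / (2*pi) * (1 - (cmod z)\<^sup>2) powr ((s - 3) / 2))) * h z \<partial>lborel)"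
  unfolding nu_law_density[OF s] using h nu_law_density_measurable[of s] by (intro nn_integral_density) auto

text \<open>
  The exponent \<open>(s - 3) / 2\<close> of the law \<open>nu_law s\<close> is \<open>\<beta>/2 * n\<close> up to the bounded quantity \<open>q\<close>.
\<close>
lemma density_hw_eq:
  assumes z: "cmod z < 1" and k: "k < n" and \<beta>: "\<beta> > 0"
  defines "s \<equiv> \<beta> * real (n - k - 1) + 1" and "l \<equiv> \<beta> / 2 * real n" and "q \<equiv> \<beta> / 2 * real (k + 1) + 1"
  shows "(1 - (cmod z)\<^sup>2) powr ((s - 3) / 2) * hw (of_real (\<beta> / 2) * of_nat n * d) z
       = rate d z powr l * (1 - (cmod z)\<^sup>2) powr (- q)"
proof -
  have w: "1 - (cmod z)\<^sup>2 > 0" using z by (simp add: abs_square_less_1)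
  have e: "(s - 3) / 2 = l + - q"
    unfolding s_def l_def q_def using k by (simp add: of_nat_diff field_simps)
  have "hw (of_real (\<beta> / 2) * of_nat n * d) z = exp (l * (2 * Re (cnj d * Ln (1 - z))))"
    unfolding hw_def l_def by (simp add: algebra_simps)
  also have "\<dots> = exp (2 * Re (cnj d * Ln (1 - z))) powr l" by (simp add: powr_def)
  finally have h: "hw (of_real (\<beta> / 2) * of_nat n * d) z = exp (2 * Re (cnj d * Ln (1 - z))) powr l" .
  show ?thesis unfolding h e powr_add rate_def using w by (simp add: powr_mult)
qed

text \<open>
  Laplace's method. Away from the maximum the integrand is at most \<open>M1 ^ (\<beta>/2 * n)\<close>, on a small ball
  around it at least \<open>M2 ^ (\<beta>/2 * n)\<close> with \<open>M1 < M2\<close>, up to factors that cancel or do not depend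
  on \<open>n\<close>.
\<close>
lemma concentration:
  assumes \<beta>: "\<beta> > 0" and \<eta>: "\<eta> > 0"
  defines "B \<equiv> {z. \<eta> \<le> cmod (z - gamma_d d)}" and "\<delta> \<equiv> \<lambda>n. of_real (\<beta> / 2) * of_nat n * d"
  shows "(\<lambda>n. (\<integral>\<^sup>+z. ennreal (hw (\<delta> n) z) * indicator B z \<partial>CJ_nu n \<beta> k)
             / (\<integral>\<^sup>+z. ennreal (hw (\<delta> n) z) \<partial>CJ_nu n \<beta> k)) \<longlonglongrightarrow> 0"
proof -
  let ?g = "gamma_d d"
  have [measurable]: "B \<in> sets borel" unfolding B_def by measurable
  obtain M1 where M1: "0 < M1" "M1 < rate d ?g" "\<And>z. cmod z < 1 \<Longrightarrow> z \<in> B \<Longrightarrow> rate d z \<le> M1"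
    using rate_gap[OF \<eta>] unfolding B_def by (metis mem_Collect_eq)
  obtain C where C: "C > 0" "\<And>z. cmod z < 1 \<Longrightarrow> rate d z \<le> C * (1 - (cmod z)\<^sup>2)" using rate_bound by blast
  define M2 where "M2 = (M1 + rate d ?g) / 2"
  have M2: "M1 < M2" "M2 < rate d ?g" "0 < M2" using M1 by (auto simp: M2_def)
  have "\<exists>r>0. ball ?g r \<subseteq> {z \<in> ball 0 1. rate d z > M2}"
  proof -
    have "{z \<in> ball 0 1. rate d z > M2} = ball 0 1 \<inter> rate d -` {M2<..}" by auto
    then have "open {z \<in> ball 0 1. rate d z > M2}"
      using continuous_open_preimage[OF rate_continuous open_ball open_greaterThan[of M2]] by simp
    moreover have "?g \<in> {z \<in> ball 0 1. rate d z > M2}" using cmod_gamma_d M2 by simp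
    ultimately show ?thesis by (meson open_contains_ball)
  qed
  then obtain r where r0: "r > 0" and sub: "ball ?g r \<subseteq> {z \<in> ball 0 1. rate d z > M2}" by blast
  have r: "r > 0" "\<And>z. z \<in> ball ?g r \<Longrightarrow> cmod z < 1 \<and> rate d z > M2"
    using r0 subsetD[OF sub] by simp_all
  define q where "q = \<beta> / 2 * real (k + 1) + 1"
  have q: "q > 0" using \<beta> by (simp add: q_def add_pos_pos)
  define V where "V = measure lborel (ball (0::complex) 1)"
  define v where "v = measure lborel (ball ?g r)"
  have Vv: "emeasure lborel (ball (0::complex) 1) = ennreal V" "emeasure lborel (ball ?g r) = ennreal v"
    unfolding V_def v_def
    using emeasure_lborel_ball_finite[of "0::complex" 1] emeasure_lborel_ball_finite[of ?g r]
    by (auto intro!: emeasure_eq_ennreal_measure)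
  have v0: "v > 0" "V \<ge> 0" unfolding v_def V_def using r(1) content_ball_pos[of r ?g] by simp_all
  define A where "A = C powr q * M1 powr (- q) * V"
  have A0: "A \<ge> 0" using v0 by (simp add: A_def)
  have bound: "(\<integral>\<^sup>+z. ennreal (hw (\<delta> n) z) * indicator B z \<partial>CJ_nu n \<beta> k)
             / (\<integral>\<^sup>+z. ennreal (hw (\<delta> n) z) \<partial>CJ_nu n \<beta> k)
        \<le> ennreal (A / v * (M1 / M2) powr (\<beta> / 2 * real n))"
    if n: "n > k + 1" "\<beta> / 2 * real n \<ge> q" for n
  proof -
    define s where "s = \<beta> * real (n - k - 1) + 1"
    define l where "l = \<beta> / 2 * real n"
    have s1: "s > 1" using n \<beta> by (simp add: s_def)
    define c where "c = (s - 1) / (2 * pi)"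
    have c: "c > 0" using s1 by (simp add: c_def)
    define D where "D z = indicator (ball 0 1) z * (c * (1 - (cmod z)\<^sup>2) powr ((s - 3) / 2))" for z :: complex
    have nu: "(\<integral>\<^sup>+z. h z \<partial>CJ_nu n \<beta> k) = (\<integral>\<^sup>+z. ennreal (D z) * h z \<partial>lborel)"
      if "h \<in> borel_measurable borel" for h
      unfolding CJ_nu_def s_def[symmetric] D_def c_def using s1 that by (intro nn_integral_nu_hw) auto
    have D0: "D z \<ge> 0" for z using c by (simp add: D_def)
    have val: "D z * hw (\<delta> n) z = c * (rate d z powr l * (1 - (cmod z)\<^sup>2) powr (- q))" if "cmod z < 1" for z
      using density_hw_eq[OF that, of k n \<beta>] n \<beta> that
      by (simp add: D_def \<delta>_def s_def l_def q_def)
    have up: "D z * hw (\<delta> n) z \<le> c * (M1 powr (l - q) * C powr q)" if z: "cmod z < 1" "z \<in> B" for z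
    proof -
      have w: "1 - (cmod z)\<^sup>2 > 0" using z by (simp add: abs_square_less_1)
      have rp: "rate d z > 0" by (rule ln_rate(5)[OF z(1)])
      have "rate d z powr l * (1 - (cmod z)\<^sup>2) powr (- q) = rate d z powr (l - q) * (rate d z / (1 - (cmod z)\<^sup>2)) powr q"
        using w rp by (simp add: powr_divide powr_minus powr_diff field_simps)
      also have "\<dots> \<le> M1 powr (l - q) * C powr q"
      proof (intro mult_mono powr_mono2)
        show "rate d z / (1 - (cmod z)\<^sup>2) \<le> C" using C(2)[OF z(1)] w by (simp add: field_simps)
        show "rate d z \<le> M1" by (rule M1(3)[OF z])
      qed (use w rp q n in \<open>auto simp: l_def\<close>)
      finally show ?thesis unfolding val[OF z(1)] using c by (intro mult_left_mono) auto
    qed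
    have lo: "D z * hw (\<delta> n) z \<ge> c * M2 powr l" if z: "z \<in> ball ?g r" for z
    proof -
      have z1: "cmod z < 1" and zM: "rate d z > M2" using r(2)[OF z] by auto
      have w: "1 - (cmod z)\<^sup>2 > 0" "1 - (cmod z)\<^sup>2 \<le> 1" using z1 by (auto simp: abs_square_less_1)
      have "(1 - (cmod z)\<^sup>2) powr q \<le> 1 powr q" using w q by (intro powr_mono2) auto
      then have "(1 - (cmod z)\<^sup>2) powr (- q) \<ge> 1" using w by (simp add: powr_minus one_le_inverse_iff)
      moreover have "rate d z powr l \<ge> M2 powr l" using zM M2 \<beta> by (intro powr_mono2) (auto simp: l_def)
      ultimately have "M2 powr l * 1 \<le> rate d z powr l * (1 - (cmod z)\<^sup>2) powr (- q)"
        by (intro mult_mono) auto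
      then show ?thesis unfolding val[OF z1] using c by (intro mult_left_mono) auto
    qed
    have num: "(\<integral>\<^sup>+z. ennreal (hw (\<delta> n) z) * indicator B z \<partial>CJ_nu n \<beta> k)
        \<le> ennreal (c * (M1 powr (l - q) * C powr q)) * ennreal V"
    proof -
      have "(\<integral>\<^sup>+z. ennreal (hw (\<delta> n) z) * indicator B z \<partial>CJ_nu n \<beta> k)
          = (\<integral>\<^sup>+z. ennreal (D z) * (ennreal (hw (\<delta> n) z) * indicator B z) \<partial>lborel)"
        by (rule nu) measurable
      also have "\<dots> \<le> (\<integral>\<^sup>+z. ennreal (c * (M1 powr (l - q) * C powr q)) * indicator (ball (0::complex) 1) z \<partial>lborel)"
      proof (rule nn_integral_mono)
        fix z :: complex
        show "ennreal (D z) * (ennreal (hw (\<delta> n) z) * indicator B z)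
            \<le> ennreal (c * (M1 powr (l - q) * C powr q)) * indicator (ball 0 1) z"
        proof (cases "cmod z < 1 \<and> z \<in> B")
          case True
          then show ?thesis using up[of z] D0[of z] by (simp add: ennreal_mult[symmetric] ennreal_leI)
        next
          case False
          then show ?thesis by (auto simp: D_def)
        qed
      qed
      also have "\<dots> = ennreal (c * (M1 powr (l - q) * C powr q)) * ennreal V"
        unfolding Vv(1)[symmetric] by (rule nn_integral_cmult_indicator) simp
      finally show ?thesis .
    qed
    have den: "(\<integral>\<^sup>+z. ennreal (hw (\<delta> n) z) \<partial>CJ_nu n \<beta> k) \<ge> ennreal (c * M2 powr l) * ennreal v"
    proof -
      have "ennreal (c * M2 powr l) * ennreal v = (\<integral>\<^sup>+z. ennreal (c * M2 powr l) * indicator (ball ?g r) z \<partial>lborel)"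
        unfolding Vv(2)[symmetric] by (rule nn_integral_cmult_indicator[symmetric]) simp
      also have "\<dots> \<le> (\<integral>\<^sup>+z. ennreal (D z) * ennreal (hw (\<delta> n) z) \<partial>lborel)"
      proof (rule nn_integral_mono)
        fix z :: complex
        show "ennreal (c * M2 powr l) * indicator (ball ?g r) z \<le> ennreal (D z) * ennreal (hw (\<delta> n) z)"
          using lo[of z] D0[of z] by (cases "z \<in> ball ?g r") (auto simp: ennreal_mult[symmetric] ennreal_leI simp del: mem_ball)
      qed
      also have "\<dots> = (\<integral>\<^sup>+z. ennreal (hw (\<delta> n) z) \<partial>CJ_nu n \<beta> k)"
        by (rule nu[symmetric]) measurable
      finally show ?thesis .
    qed
    have quot: "(c * M2 powr l * v) * (A / v * (M1 / M2) powr l) = c * (M1 powr (l - q) * C powr q) * V"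
      using c v0 M1 M2 by (simp add: A_def powr_diff powr_divide powr_minus field_simps)
    have em: "ennreal ((x * y) * z) = ennreal z * (ennreal x * ennreal y)" if "x \<ge> 0" "y \<ge> 0" "z \<ge> 0" for x y z
      using that by (simp add: ennreal_mult mult_ac)
    show ?thesis
    proof (rule divide_le_posI_ennreal)
      have "0 < ennreal (c * M2 powr l) * ennreal v" using c v0 M2 by (simp add: ennreal_zero_less_mult_iff)
      then show "0 < (\<integral>\<^sup>+z. ennreal (hw (\<delta> n) z) \<partial>CJ_nu n \<beta> k)" using den by (rule less_le_trans)
      have "(\<integral>\<^sup>+z. ennreal (hw (\<delta> n) z) * indicator B z \<partial>CJ_nu n \<beta> k)
          \<le> ennreal (c * (M1 powr (l - q) * C powr q) * V)"
        using num c v0 by (simp add: ennreal_mult)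
      also have "\<dots> = ennreal (A / v * (M1 / M2) powr l) * (ennreal (c * M2 powr l) * ennreal v)"
        unfolding quot[symmetric] by (rule em) (use c v0 A0 in auto)
      also have "\<dots> \<le> ennreal (A / v * (M1 / M2) powr l) * (\<integral>\<^sup>+z. ennreal (hw (\<delta> n) z) \<partial>CJ_nu n \<beta> k)"
        using den by (intro mult_left_mono) auto
      finally show "(\<integral>\<^sup>+z. ennreal (hw (\<delta> n) z) * indicator B z \<partial>CJ_nu n \<beta> k)
          \<le> (\<integral>\<^sup>+z. ennreal (hw (\<delta> n) z) \<partial>CJ_nu n \<beta> k) * ennreal (A / v * (M1 / M2) powr (\<beta> / 2 * real n))"
        by (simp only: l_def mult.commute)
    qed
  qed
  have lim: "(\<lambda>n. A / v * (M1 / M2) powr (\<beta> / 2 * real n)) \<longlonglongrightarrow> 0"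
  proof -
    have eq: "(M1 / M2) powr (\<beta> / 2 * real n) = ((M1 / M2) powr (\<beta> / 2)) ^ n" for n
    proof -
      have "(M1 / M2) powr (\<beta> / 2) > 0" using M1 M2 by simp
      then have "((M1 / M2) powr (\<beta> / 2)) ^ n = ((M1 / M2) powr (\<beta> / 2)) powr real n"
        by (rule powr_realpow[symmetric])
      then show ?thesis by (simp only: powr_powr)
    qed
    have "(M1 / M2) powr (\<beta> / 2) < 1 powr (\<beta> / 2)"
      using M1 M2 \<beta> by (intro powr_less_mono2) auto
    then have "(\<lambda>n. ((M1 / M2) powr (\<beta> / 2)) ^ n) \<longlonglongrightarrow> 0" by (intro LIMSEQ_power_zero) simp
    from tendsto_mult_right_zero[OF this, of "A / v"] show ?thesis unfolding eq .
  qed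
  show ?thesis
  proof (rule tendsto_sandwich[where f="\<lambda>_. 0"])
    obtain n0 :: nat where n0: "real n0 > q / (\<beta> / 2)" using reals_Archimedean2 by blast
    have "(\<integral>\<^sup>+z. ennreal (hw (\<delta> n) z) * indicator B z \<partial>CJ_nu n \<beta> k)
             / (\<integral>\<^sup>+z. ennreal (hw (\<delta> n) z) \<partial>CJ_nu n \<beta> k)
        \<le> ennreal (A / v * (M1 / M2) powr (\<beta> / 2 * real n))" if "n \<ge> max n0 (k + 2)" for n
    proof (rule bound)
      have "q / (\<beta> / 2) < real n" using n0 that by linarith
      then show "\<beta> / 2 * real n \<ge> q" using \<beta> by (simp add: field_simps)
    qed (use that in auto)
    then show "eventually (\<lambda>n. (\<integral>\<^sup>+z. ennreal (hw (\<delta> n) z) * indicator B z \<partial>CJ_nu n \<beta> k)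
             / (\<integral>\<^sup>+z. ennreal (hw (\<delta> n) z) \<partial>CJ_nu n \<beta> k)
        \<le> ennreal (A / v * (M1 / M2) powr (\<beta> / 2 * real n))) sequentially"
      unfolding eventually_sequentially by blast
    show "(\<lambda>n. ennreal (A / v * (M1 / M2) powr (\<beta> / 2 * real n))) \<longlonglongrightarrow> 0"
      using tendsto_ennrealI[OF lim] by simp
  qed auto
qed

end


section \<open>Integrals over Poisson-type kernels\<close>

text \<open>
  The denominator of the Poisson kernel, with a complex parameter.
\<close>
definition kern :: "complex \<Rightarrow> real \<Rightarrow> complex" where
  "kern w \<psi> = 1 - 2 * w * of_real (cos \<psi>) + w\<^sup>2"

text \<open>
  Having the value as an argument lets integrability be carried along with every evaluation.
\<close>
abbreviation hbi :: "(real \<Rightarrow> complex) \<Rightarrow> complex \<Rightarrow> bool" where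
  "hbi f v \<equiv> has_bochner_integral lborel (\<lambda>x. indicator {0..pi} x *\<^sub>R f x) v"

lemma hbi_continuous: "continuous_on {0..pi} f \<Longrightarrow> \<exists>v. hbi f v"
  using borel_integrable_compact[of "{0..pi}" f] by (auto simp: has_bochner_integral_iff)

lemma hbi_add: "hbi f v \<Longrightarrow> hbi g w \<Longrightarrow> hbi (\<lambda>x. f x + g x) (v + w)"
  using has_bochner_integral_add[of lborel "\<lambda>x. indicator {0..pi} x *\<^sub>R f x" v "\<lambda>x. indicator {0..pi} x *\<^sub>R g x" w]
  by (simp add: scaleR_add_right)

lemma hbi_cmult: "hbi f v \<Longrightarrow> hbi (\<lambda>x. c * f x) (c * v)"
  using has_bochner_integral_mult_right[of c lborel "\<lambda>x. indicator {0..pi} x *\<^sub>R f x" v] by simp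

lemma hbi_sum: "(\<And>n. n \<in> A \<Longrightarrow> hbi (f n) (v n)) \<Longrightarrow> hbi (\<lambda>x. \<Sum>n\<in>A. f n x) (\<Sum>n\<in>A. v n)"
  using has_bochner_integral_sum[of A lborel "\<lambda>n x. indicator {0..pi} x *\<^sub>R f n x" v]
  by (simp add: scaleR_sum_right)

lemma hbi_cong: "hbi f v \<Longrightarrow> (\<And>x. x \<in> {0..pi} \<Longrightarrow> f x = g x) \<Longrightarrow> hbi g v"
  by (erule has_bochner_integral_cong[THEN iffD1, rotated 3]) (auto simp: indicator_def)

lemma hbi_sin_sin:
  "hbi (\<lambda>x. of_real (sin (real (Suc n) * x) * sin x)) (if n = 0 then of_real (pi / 2) else 0)"
proof -
  define F where "F x = (if n = 0 then x / 2 else sin (real n * x) / (2 * real n)) - sin (real (n + 2) * x) / (2 * real (n + 2))" for x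
  have der: "(F has_real_derivative sin (real (Suc n) * x) * sin x) (at x)" for x
  proof -
    have p: "sin (real (Suc n) * x) * sin x = cos (real n * x) / 2 - cos (real (n + 2) * x) / 2"
      by (simp add: sin_times_sin algebra_simps diff_divide_distrib)
    have d1: "((\<lambda>x. if n = 0 then x / 2 else sin (real n * x) / (2 * real n)) has_real_derivative cos (real n * x) / 2) (at x)"
      by (cases "n = 0") (auto intro!: derivative_eq_intros)
    have d2: "((\<lambda>x. sin (c * x) / (2 * c)) has_real_derivative cos (c * x) / 2) (at x)" if "c > 0" for c :: real
      using that by (auto intro!: derivative_eq_intros)
    show ?thesis
      unfolding F_def p by (intro DERIV_diff d1 d2) simp
  qed
  have "((\<lambda>x. complex_of_real (F x)) has_vector_derivative of_real (sin (real (Suc n) * x) * sin x)) (at x within {0..pi})" for x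
    by (rule has_vector_derivative_of_real) (use der[of x] in \<open>auto simp: has_real_derivative_iff_has_vector_derivative[symmetric] intro: DERIV_subset\<close>)
  then have "hbi (\<lambda>x. of_real (sin (real (Suc n) * x) * sin x)) (of_real (F pi) - of_real (F 0))"
    by (intro has_bochner_integral_FTC_Icc) (auto intro!: continuous_intros)
  moreover have "sin (real n * pi) = 0" "sin (real (n + 2) * pi) = 0"
    using sin_npi[of n] sin_npi[of "n + 2"] by simp_all
  then have "complex_of_real (F pi) - of_real (F 0) = (if n = 0 then of_real (pi / 2) else 0)"
    by (simp add: F_def)
  ultimately show ?thesis by simp
qed

text \<open>
  Partial sums of the expansion of \<open>sin \<psi> / kern w \<psi>\<close> into the \<open>w\<^sup>n sin ((n + 1) \<psi>)\<close>.
\<close>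
lemma kern_telescope:
  "kern w \<psi> * (\<Sum>n<N. w ^ n * of_real (sin (real (Suc n) * \<psi>)))
   = of_real (sin \<psi>) - w ^ N * of_real (sin (real (Suc N) * \<psi>)) + w ^ Suc N * of_real (sin (real N * \<psi>))"
proof (induction N)
  case (Suc N)
  have "sin (real (Suc (Suc N)) * \<psi>) = 2 * cos \<psi> * sin (real (Suc N) * \<psi>) - sin (real N * \<psi>)"
  proof -
    have "sin (real (Suc (Suc N)) * \<psi>) = sin (real (Suc N) * \<psi> + \<psi>)"
      "sin (real N * \<psi>) = sin (real (Suc N) * \<psi> - \<psi>)" by (simp_all add: algebra_simps)
    then show ?thesis by (simp only: sin_add sin_diff) simp
  qed
  then have s: "complex_of_real (sin (real (Suc (Suc N)) * \<psi>))
      = 2 * of_real (cos \<psi>) * of_real (sin (real (Suc N) * \<psi>)) - of_real (sin (real N * \<psi>))"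
    by (simp only: of_real_diff of_real_mult) simp
  show ?case
    unfolding sum.lessThan_Suc distrib_left Suc.IH s unfolding kern_def
    by (simp add: algebra_simps power2_eq_square)
qed simp

lemma kern_lower:
  assumes "cmod w < 1"
  shows "cmod (kern w \<psi>) \<ge> (1 - cmod w)\<^sup>2"
proof -
  have c: "2 * of_real (cos \<psi>) = cis \<psi> + cis (- \<psi>)" by (simp add: complex_eq_iff)
  have "kern w \<psi> = (1 - w * cis \<psi>) * (1 - w * cis (- \<psi>))"
  proof -
    have "(1 - w * cis \<psi>) * (1 - w * cis (- \<psi>)) = 1 - w * (cis \<psi> + cis (- \<psi>)) + w\<^sup>2 * (cis \<psi> * cis (- \<psi>))"
      by (simp add: algebra_simps power2_eq_square)
    then show ?thesis unfolding kern_def c[symmetric] cis_mult by (simp add: mult_ac)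
  qed
  moreover have "cmod (1 - w * cis t) \<ge> 1 - cmod w" for t
    using norm_triangle_ineq2[of 1 "w * cis t"] by (simp add: norm_mult)
  ultimately have "cmod (kern w \<psi>) \<ge> (1 - cmod w) * (1 - cmod w)"
    using assms by (simp add: norm_mult mult_mono)
  then show ?thesis by (simp add: power2_eq_square)
qed

text \<open>
  By orthogonality of the sines only the first term of the expansion \<open>kern_telescope\<close> contributes.
\<close>
lemma hbi_kern_disk:
  assumes w: "cmod w < 1"
  shows "hbi (\<lambda>\<psi>. of_real ((sin \<psi>)\<^sup>2) / kern w \<psi>) (of_real (pi / 2))"
proof -
  have nz: "kern w \<psi> \<noteq> 0" for \<psi>
  proof -
    have "(1 - cmod w)\<^sup>2 > 0" using w by simp
    then show ?thesis using kern_lower[OF w, of \<psi>] by auto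
  qed
  have "continuous_on {0..pi} (\<lambda>\<psi>. of_real ((sin \<psi>)\<^sup>2) / kern w \<psi>)"
    using nz unfolding kern_def by (intro continuous_intros) auto
  then obtain v where v: "hbi (\<lambda>\<psi>. of_real ((sin \<psi>)\<^sup>2) / kern w \<psi>) v" using hbi_continuous by blast
  define K where "K = 2 / (1 - cmod w)\<^sup>2 * pi"
  have est: "norm (v - of_real (pi / 2)) \<le> K * cmod w ^ N" if N: "N \<ge> 1" for N
  proof -
    define S where "S \<psi> = (\<Sum>n<N. w ^ n * of_real (sin (real (Suc n) * \<psi>) * sin \<psi>))" for \<psi>
    have "hbi S (\<Sum>n<N. w ^ n * (if n = 0 then of_real (pi / 2) else 0))"
      unfolding S_def[abs_def] by (intro hbi_sum hbi_cmult hbi_sin_sin)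
    also have "(\<Sum>n<N. w ^ n * (if n = 0 then of_real (pi / 2) else 0)) = (\<Sum>n<N. if n = 0 then of_real (pi / 2) else 0)"
      by (intro sum.cong) auto
    also have "\<dots> = of_real (pi / 2)" using N by simp
    finally have S: "hbi S (of_real (pi / 2))" .
    have diff: "hbi (\<lambda>\<psi>. of_real ((sin \<psi>)\<^sup>2) / kern w \<psi> + (-1) * S \<psi>) (v + (-1) * of_real (pi / 2))"
      by (intro hbi_add hbi_cmult v S)
    have bd: "norm (of_real ((sin \<psi>)\<^sup>2) / kern w \<psi> + (-1) * S \<psi>) \<le> 2 / (1 - cmod w)\<^sup>2 * cmod w ^ N" for \<psi>
    proof -
      have kS: "kern w \<psi> * S \<psi> = of_real (sin \<psi>) * (kern w \<psi> * (\<Sum>n<N. w ^ n * of_real (sin (real (Suc n) * \<psi>))))"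
        unfolding S_def sum_distrib_left by (intro sum.cong refl) (simp add: mult_ac)
      define R where "R = of_real (sin \<psi>) * (w ^ N * of_real (sin (real (Suc N) * \<psi>)) - w ^ Suc N * of_real (sin (real N * \<psi>)))"
      have "of_real ((sin \<psi>)\<^sup>2) - kern w \<psi> * S \<psi> = R"
        unfolding kS kern_telescope R_def by (simp add: algebra_simps power2_eq_square)
      then have eq: "of_real ((sin \<psi>)\<^sup>2) / kern w \<psi> + (-1) * S \<psi> = R / kern w \<psi>"
        using nz[of \<psi>] by (simp add: field_simps)
      have "cmod (w ^ N * of_real (sin (real (Suc N) * \<psi>))) \<le> cmod w ^ N * 1"
        unfolding norm_mult norm_power norm_of_real by (intro mult_left_mono abs_sin_le_one) auto
      moreover have "cmod (w ^ Suc N * of_real (sin (real N * \<psi>))) \<le> cmod w ^ N * 1"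
        unfolding norm_mult norm_power norm_of_real using w
        by (intro mult_mono abs_sin_le_one power_decreasing) auto
      ultimately have "cmod (w ^ N * of_real (sin (real (Suc N) * \<psi>)) - w ^ Suc N * of_real (sin (real N * \<psi>)))
          \<le> 2 * cmod w ^ N"
        by (intro order_trans[OF norm_triangle_ineq4]) simp
      then have "cmod R \<le> 1 * (2 * cmod w ^ N)"
        unfolding R_def norm_mult norm_of_real by (intro mult_mono abs_sin_le_one) auto
      then have "cmod R / cmod (kern w \<psi>) \<le> 2 * cmod w ^ N / (1 - cmod w)\<^sup>2"
        using kern_lower[OF w, of \<psi>] w by (intro frac_le) auto
      then show ?thesis unfolding eq norm_divide by simp
    qed
    have "norm (v + (-1) * of_real (pi / 2)) \<le> (\<integral>x. indicator {0..pi} x *\<^sub>R (2 / (1 - cmod w)\<^sup>2 * cmod w ^ N) \<partial>lborel)"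
      unfolding has_bochner_integral_integral_eq[OF diff, symmetric]
    proof (rule Bochner_Integration.integral_norm_bound_integral)
      show "integrable lborel (\<lambda>x. indicator {0..pi} x *\<^sub>R (of_real ((sin x)\<^sup>2) / kern w x + (-1) * S x))"
        using diff by (simp add: has_bochner_integral_iff)
      show "integrable lborel (\<lambda>x. indicator {0..pi} x *\<^sub>R (2 / (1 - cmod w)\<^sup>2 * cmod w ^ N))"
        by (rule borel_integrable_compact) (auto intro!: continuous_intros)
    qed (use bd in \<open>auto simp: indicator_def\<close>)
    also have "\<dots> = K * cmod w ^ N" by (simp add: K_def)
    finally show ?thesis by simp
  qed
  have "(\<lambda>N. K * cmod w ^ N) \<longlonglongrightarrow> K * 0"
    using w by (intro tendsto_mult tendsto_const LIMSEQ_power_zero) simp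
  then have "norm (v - of_real (pi / 2)) \<le> 0"
    by (intro LIMSEQ_le_const[of "\<lambda>N. K * cmod w ^ N"]) (use est in auto)
  then have "v = of_real (pi / 2)" by (simp only: norm_le_zero_iff right_minus_eq)
  then show ?thesis using v by (simp only:)
qed

text \<open>
  The parameters in the closed disk for which \<open>sin\<^sup>2 \<psi> / kern w \<psi>\<close> is bounded on \<open>[0, \<pi>]\<close>. The boundary points \<open>\<plusminus> 1\<close> occur for
  \<open>Re d = 0\<close>, where the arc that carries the limit measure reaches the point \<open>1\<close>.
\<close>
definition adm :: "complex \<Rightarrow> bool" where
  "adm w \<longleftrightarrow> cmod w < 1 \<or> w = 1 \<or> w = -1"

lemma kern_zero_sin:
  assumes "adm w" "kern w \<psi> = 0"
  shows "sin \<psi> = 0"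
proof -
  have "\<not> cmod w < 1"
  proof
    assume w: "cmod w < 1"
    have "(1 - cmod w)\<^sup>2 > 0" using w by simp
    then show False using kern_lower[OF w, of \<psi>] assms(2) by simp
  qed
  then have "(cos \<psi>)\<^sup>2 = 1"
    using assms by (auto simp: adm_def kern_def complex_eq_iff power2_eq_1_iff)
  then show ?thesis using sin_cos_squared_add[of \<psi>] by simp
qed

lemma hbi_kern:
  assumes "adm w"
  shows "hbi (\<lambda>\<psi>. of_real ((sin \<psi>)\<^sup>2) / kern w \<psi>) (of_real (pi / 2))"
proof (cases "cmod w < 1")
  case False
  define s :: real where "s = Re w"
  have s: "w = of_real s" "s = 1 \<or> s = -1" using assms False by (auto simp: adm_def s_def)
  define F where "F x = (x + s * sin x) / 2" for x
  have "((\<lambda>x. complex_of_real (F x)) has_vector_derivative of_real ((1 + s * cos x) / 2)) (at x within {0..pi})" for x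
    by (rule has_vector_derivative_of_real, unfold has_real_derivative_iff_has_vector_derivative[symmetric] F_def)
       (auto intro!: derivative_eq_intros)
  then have h: "hbi (\<lambda>x. of_real ((1 + s * cos x) / 2)) (of_real (F pi) - of_real (F 0))"
    by (intro has_bochner_integral_FTC_Icc) (auto intro!: continuous_intros)
  have v: "complex_of_real (F pi) - of_real (F 0) = of_real (pi / 2)" by (simp add: F_def)
  have eq: "of_real ((1 + s * cos x) / 2) = of_real ((sin x)\<^sup>2) / kern w x" if "x \<in> {0<..<pi}" for x
  proof -
    have sx: "sin x > 0" using that by (intro sin_gt_zero) auto
    have s2: "s * s = 1" using s(2) by auto
    have k: "kern w x = of_real (2 * (1 - s * cos x))"
    proof -
      have "complex_of_real s * of_real s = 1" using s2 by (metis of_real_1 of_real_mult)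
      then show ?thesis unfolding kern_def s(1) power2_eq_square by (simp add: algebra_simps)
    qed
    have "(1 + s * cos x) * (1 - s * cos x) = 1 - (s * s) * (cos x)\<^sup>2" by (simp add: algebra_simps power2_eq_square)
    also have "\<dots> = (sin x)\<^sup>2" unfolding s2 using sin_cos_squared_add[of x] by linarith
    finally have p: "(1 + s * cos x) * (1 - s * cos x) = (sin x)\<^sup>2" .
    then have "1 - s * cos x \<noteq> 0" using sx by auto
    then have "(1 + s * cos x) / 2 = (sin x)\<^sup>2 / (2 * (1 - s * cos x))"
      unfolding p[symmetric] by (rule mult_divide_mult_cancel_right[symmetric])
    then show ?thesis unfolding k by (simp only: of_real_divide)
  qed
  have m: "(\<lambda>x. indicator {0..pi} x *\<^sub>R (of_real ((sin x)\<^sup>2) / kern w x)) \<in> borel_measurable lborel"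
    unfolding kern_def by measurable
  have "AE x in lborel. x \<noteq> (0::real)" "AE x in lborel. x \<noteq> pi" by (rule AE_lborel_singleton)+
  then have "AE x in lborel. indicator {0..pi} x *\<^sub>R of_real ((1 + s * cos x) / 2)
      = indicator {0..pi} x *\<^sub>R (of_real ((sin x)\<^sup>2) / kern w x)"
    by eventually_elim (use eq in \<open>auto simp: indicator_def\<close>)
  then show ?thesis
    using has_bochner_integral_cong_AE[OF borel_measurable_has_bochner_integral[OF h] m] h v by simp
qed (rule hbi_kern_disk)

text \<open>
  Partial fractions in \<open>cos \<psi>\<close>: \<open>w2 * kern w1 \<psi> - w1 * kern w2 \<psi>\<close> does not depend on \<open>\<psi>\<close>.
\<close>
lemma kern_partial_fractions:
  assumes "w1 \<noteq> w2" "w1 * w2 \<noteq> 1" "adm w1" "adm w2"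
    and h1: "hbi (\<lambda>\<psi>. of_real ((sin \<psi>)\<^sup>2) / kern w1 \<psi> * h \<psi>) v1"
    and h2: "hbi (\<lambda>\<psi>. of_real ((sin \<psi>)\<^sup>2) / kern w2 \<psi> * h \<psi>) v2"
  shows "hbi (\<lambda>\<psi>. of_real ((sin \<psi>)\<^sup>2) / (kern w1 \<psi> * kern w2 \<psi>) * h \<psi>)
     ((w2 * v2 - w1 * v1) / ((w2 - w1) * (1 - w1 * w2)))"
proof -
  define c where "c = (w2 - w1) * (1 - w1 * w2)"
  have c: "c \<noteq> 0" using assms by (simp add: c_def)
  have "hbi (\<lambda>\<psi>. (w2 / c) * (of_real ((sin \<psi>)\<^sup>2) / kern w2 \<psi> * h \<psi>) + (- w1 / c) * (of_real ((sin \<psi>)\<^sup>2) / kern w1 \<psi> * h \<psi>))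
      ((w2 / c) * v2 + (- w1 / c) * v1)"
    by (intro hbi_add hbi_cmult h1 h2)
  then have "hbi (\<lambda>\<psi>. of_real ((sin \<psi>)\<^sup>2) / (kern w1 \<psi> * kern w2 \<psi>) * h \<psi>) ((w2 / c) * v2 + (- w1 / c) * v1)"
  proof (rule hbi_cong)
    fix \<psi>
    show "(w2 / c) * (of_real ((sin \<psi>)\<^sup>2) / kern w2 \<psi> * h \<psi>) + (- w1 / c) * (of_real ((sin \<psi>)\<^sup>2) / kern w1 \<psi> * h \<psi>)
        = of_real ((sin \<psi>)\<^sup>2) / (kern w1 \<psi> * kern w2 \<psi>) * h \<psi>"
    proof (cases "kern w1 \<psi> = 0 \<or> kern w2 \<psi> = 0")
      case True
      then have "sin \<psi> = 0" using kern_zero_sin assms by blast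
      then show ?thesis by simp
    next
      case False
      have id: "w2 * kern w1 \<psi> - w1 * kern w2 \<psi> = c"
        unfolding kern_def c_def by (simp add: algebra_simps power2_eq_square)
      have "(w2 / c) * (of_real ((sin \<psi>)\<^sup>2) / kern w2 \<psi> * h \<psi>) + (- w1 / c) * (of_real ((sin \<psi>)\<^sup>2) / kern w1 \<psi> * h \<psi>)
          = of_real ((sin \<psi>)\<^sup>2) * h \<psi> * ((w2 * kern w1 \<psi> - w1 * kern w2 \<psi>) / (c * kern w1 \<psi> * kern w2 \<psi>))"
        using False c by (simp add: field_simps)
      then show ?thesis unfolding id using c by simp
    qed
  qed
  moreover have "(w2 / c) * v2 + (- w1 / c) * v1 = (w2 * v2 - w1 * v1) / c"
    by (simp add: diff_divide_distrib)
  ultimately show ?thesis by (simp add: c_def)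
qed

lemma adm_mult:
  assumes "adm w1" "adm w2" "cmod w1 < 1 \<or> cmod w2 < 1"
  shows "w1 * w2 \<noteq> 1"
proof
  assume "w1 * w2 = 1"
  then have c: "cmod w1 * cmod w2 = 1" by (metis norm_mult norm_one)
  have le: "cmod w1 \<le> 1" "cmod w2 \<le> 1" using assms by (auto simp: adm_def)
  from assms(3) show False
  proof
    assume w: "cmod w1 < 1"
    have "cmod w1 * cmod w2 \<le> cmod w1 * 1" by (intro mult_left_mono le norm_ge_zero)
    then show False using w c by simp
  next
    assume w: "cmod w2 < 1"
    have "cmod w1 * cmod w2 \<le> 1 * cmod w2" by (intro mult_right_mono le norm_ge_zero)
    then show False using w c by simp
  qed
qed

lemma hbi_kern2:
  assumes "w1 \<noteq> w2" "adm w1" "adm w2" "cmod w1 < 1 \<or> cmod w2 < 1"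
  shows "hbi (\<lambda>\<psi>. of_real ((sin \<psi>)\<^sup>2) / (kern w1 \<psi> * kern w2 \<psi>)) (of_real (pi / 2) / (1 - w1 * w2))"
proof -
  have ne: "w1 * w2 \<noteq> 1" using assms by (intro adm_mult)
  have "hbi (\<lambda>\<psi>. of_real ((sin \<psi>)\<^sup>2) / (kern w1 \<psi> * kern w2 \<psi>) * 1)
      ((w2 * of_real (pi / 2) - w1 * of_real (pi / 2)) / ((w2 - w1) * (1 - w1 * w2)))"
    using assms ne hbi_kern by (intro kern_partial_fractions) auto
  moreover have "(w2 * of_real (pi / 2) - w1 * of_real (pi / 2)) / ((w2 - w1) * (1 - w1 * w2)) = of_real (pi / 2) / (1 - w1 * w2)"
    using assms(1) by (simp add: left_diff_distrib[symmetric] del: of_real_divide)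
  ultimately show ?thesis by simp
qed

lemma hbi_kern3:
  assumes "w1 \<noteq> w2" "w1 \<noteq> w3" "w2 \<noteq> w3" "adm w1" "cmod w2 < 1" "cmod w3 < 1"
  shows "hbi (\<lambda>\<psi>. of_real ((sin \<psi>)\<^sup>2) / (kern w1 \<psi> * kern w2 \<psi> * kern w3 \<psi>))
     (of_real (pi / 2) / ((1 - w1 * w2) * (1 - w1 * w3) * (1 - w2 * w3)))"
proof -
  have a: "adm w2" "adm w3" using assms by (auto simp: adm_def)
  have n12: "1 - w1 * w2 \<noteq> 0" and n13: "1 - w1 * w3 \<noteq> 0" and n23: "1 - w2 * w3 \<noteq> 0"
    using adm_mult[of w1 w2] adm_mult[of w1 w3] adm_mult[of w2 w3] assms a by auto
  define p where "p = complex_of_real (pi / 2)"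
  have "hbi (\<lambda>\<psi>. of_real ((sin \<psi>)\<^sup>2) / (kern w1 \<psi> * kern w2 \<psi>) * (1 / kern w3 \<psi>))
      ((w2 * (p / (1 - w2 * w3)) - w1 * (p / (1 - w1 * w3))) / ((w2 - w1) * (1 - w1 * w2)))"
    using hbi_kern2[of w1 w3] hbi_kern2[of w2 w3] assms a n12
    by (intro kern_partial_fractions) (auto simp: p_def)
  moreover have "(w2 * (p / (1 - w2 * w3)) - w1 * (p / (1 - w1 * w3))) / ((w2 - w1) * (1 - w1 * w2))
      = p / ((1 - w1 * w2) * (1 - w1 * w3) * (1 - w2 * w3))"
  proof -
    have "w2 * (p / (1 - w2 * w3)) - w1 * (p / (1 - w1 * w3))
        = (w2 * p * (1 - w1 * w3) - w1 * p * (1 - w2 * w3)) / ((1 - w2 * w3) * (1 - w1 * w3))"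
      using n13 n23 by (simp add: diff_frac_eq)
    also have "w2 * p * (1 - w1 * w3) - w1 * p * (1 - w2 * w3) = (w2 - w1) * p"
      by (simp add: algebra_simps)
    finally show ?thesis using assms(1) n12 n13 n23 by (simp add: mult_ac)
  qed
  ultimately show ?thesis unfolding p_def[symmetric] by simp
qed


section \<open>The limit measure in a rational parametrization\<close>

lemma cis_double_real:
  fixes x y r :: real
  assumes "cos A = x / r" "sin A = y / r" "r \<noteq> 0"
  shows "cis (2 * A) = (Complex x y)\<^sup>2 / of_real (r\<^sup>2)"
proof -
  have "cis (2 * A) = (cis A)\<^sup>2" by (simp add: power2_eq_square cis_mult)
  moreover have "cis A = Complex x y / of_real r" using assms by (simp add: complex_eq_iff)
  ultimately show ?thesis by (simp add: power_divide)
qed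

text \<open>
  The density of \<open>mu_d d\<close> becomes rational in the lengths \<open>e = \<bar>d\<bar>\<close>, \<open>f = \<bar>1 + d\<bar>\<close> and
  \<open>g = sqrt (1 + 2 Re d)\<close>, which satisfy \<open>f\<^sup>2 = e\<^sup>2 + g\<^sup>2\<close>; the angle \<open>\<phi>0\<close> of this right triangle is half
  of \<open>theta_d d\<close>, and \<open>A0\<close>, the argument of \<open>1 + d\<close>, is half of \<open>xi_d d\<close>.
\<close>
locale limit_param =
  fixes d :: complex
  assumes Re_d: "Re d \<ge> 0" and d_nz: "d \<noteq> 0"
begin

definition a where "a = Re d"
definition b where "b = Im d"
definition e where "e = cmod d"
definition f where "f = cmod (1 + d)"
definition g where "g = sqrt (1 + 2 * a)"
definition \<phi>0 where "\<phi>0 = arcsin (e / f)"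
definition A0 where "A0 = arcsin (b / f)"

lemma a_nonneg: "0 \<le> a" using Re_d by (simp add: a_def)
lemma e_pos: "0 < e" using d_nz by (simp add: e_def)
lemma g_ge: "1 \<le> g" using a_nonneg by (simp add: g_def)
lemma g_pos: "0 < g" using g_ge by simp
lemma e2: "e\<^sup>2 = a\<^sup>2 + b\<^sup>2" by (simp add: e_def cmod_power2 a_def b_def)
lemma f2: "f\<^sup>2 = (1 + a)\<^sup>2 + b\<^sup>2" by (simp add: f_def cmod_power2 a_def b_def)
lemma g2: "g\<^sup>2 = 1 + 2 * a" using a_nonneg by (simp add: g_def)
lemma f2': "f\<^sup>2 = e\<^sup>2 + g\<^sup>2" unfolding e2 f2 g2 by (simp add: power2_eq_square algebra_simps)
lemma f_pos: "0 < f"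
proof -
  have "f\<^sup>2 > 0" unfolding f2' using e_pos by (simp add: add_pos_nonneg)
  then show ?thesis by (simp add: f_def)
qed
lemma e_less_f: "e < f"
  by (rule power2_less_imp_less) (use f2' g_pos f_pos in auto)
lemma g_less_f: "g < f"
  by (rule power2_less_imp_less) (use f2' e_pos f_pos in auto)
lemma b_le_e: "\<bar>b\<bar> \<le> e" by (simp add: b_def e_def abs_Im_le_cmod)

lemma d_eq: "1 + d = Complex (1 + a) b" "1 + cnj d = Complex (1 + a) (- b)"
  by (simp_all add: complex_eq_iff a_def b_def)

lemma quot: "0 < e / f" "e / f < 1" "-1 \<le> b / f" "b / f \<le> 1" "\<bar>b / f\<bar> \<le> e / f"
proof -
  have "\<bar>b\<bar> \<le> f" using b_le_e e_less_f by simp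
  then show "-1 \<le> b / f" "b / f \<le> 1" using f_pos by (auto simp: field_simps)
  show "\<bar>b / f\<bar> \<le> e / f" using b_le_e f_pos by (simp add: divide_right_mono)
qed (use e_pos e_less_f f_pos in auto)

lemma \<phi>0_bounds: "0 < \<phi>0" "\<phi>0 < pi / 2" "sin \<phi>0 = e / f" "cos \<phi>0 = g / f"
proof -
  show "0 < \<phi>0" unfolding \<phi>0_def using quot arcsin_less_arcsin[of 0 "e / f"] by simp
  show "\<phi>0 < pi / 2" unfolding \<phi>0_def using quot arcsin_less_arcsin[of "e / f" 1] by simp
  show "sin \<phi>0 = e / f" unfolding \<phi>0_def using quot by (intro sin_arcsin) auto
  have "cos \<phi>0 = sqrt (1 - (e / f)\<^sup>2)" unfolding \<phi>0_def using quot by (intro cos_arcsin) auto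
  also have "1 - (e / f)\<^sup>2 = (f\<^sup>2 - e\<^sup>2) / f\<^sup>2"
    using f_pos by (simp add: power_divide diff_divide_distrib)
  also have "\<dots> = (g / f)\<^sup>2" by (simp add: power_divide f2')
  finally show "cos \<phi>0 = g / f" using g_pos f_pos by simp
qed

lemma A0_bounds: "- \<phi>0 \<le> A0" "A0 \<le> \<phi>0" "sin A0 = b / f" "cos A0 = (1 + a) / f"
proof -
  have "- (e / f) \<le> b / f" "b / f \<le> e / f" using quot(5) unfolding abs_le_iff by linarith+
  then have "arcsin (- (e / f)) \<le> arcsin (b / f)" "arcsin (b / f) \<le> arcsin (e / f)"
    using quot(1-4) by (auto intro!: arcsin_le_arcsin)
  moreover have "arcsin (- (e / f)) = - arcsin (e / f)" using quot by (intro arcsin_minus) auto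
  ultimately show "- \<phi>0 \<le> A0" "A0 \<le> \<phi>0" by (simp_all add: A0_def \<phi>0_def)
  show "sin A0 = b / f" unfolding A0_def using quot by (intro sin_arcsin) auto
  have "cos A0 = sqrt (1 - (b / f)\<^sup>2)" unfolding A0_def using quot by (intro cos_arcsin) auto
  also have "1 - (b / f)\<^sup>2 = (f\<^sup>2 - b\<^sup>2) / f\<^sup>2"
    using f_pos by (simp add: power_divide diff_divide_distrib)
  also have "\<dots> = ((1 + a) / f)\<^sup>2" by (simp add: power_divide f2)
  finally show "cos A0 = (1 + a) / f" using a_nonneg f_pos by simp
qed

lemma theta_d_eq: "theta_d d = 2 * \<phi>0"
  unfolding theta_d_def
proof (rule the_equality)
  have s: "cmod (d / (1 + d)) = e / f" by (simp add: norm_divide e_def f_def)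
  show "0 \<le> 2 * \<phi>0 \<and> 2 * \<phi>0 < pi \<and> sin (2 * \<phi>0 / 2) = cmod (d / (1 + d))"
    unfolding s using \<phi>0_bounds by simp
  fix \<theta> assume t: "0 \<le> \<theta> \<and> \<theta> < pi \<and> sin (\<theta> / 2) = cmod (d / (1 + d))"
  then have "arcsin (sin (\<theta> / 2)) = \<theta> / 2" by (intro arcsin_sin) auto
  then show "\<theta> = 2 * \<phi>0" using t unfolding s \<phi>0_def by simp
qed

lemma cis_2A0: "cis (2 * A0) = (1 + d) / (1 + cnj d)"
proof -
  have nz: "1 + cnj d \<noteq> 0" using a_nonneg unfolding d_eq by (simp add: complex_eq_iff)
  have "(1 + d) * (1 + cnj d) = of_real (f\<^sup>2)"
    unfolding d_eq f2 by (simp add: complex_eq_iff power2_eq_square)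
  then have f: "of_real (f\<^sup>2) = (1 + d) * (1 + cnj d)" by simp
  have "cis (2 * A0) = (1 + d)\<^sup>2 / of_real (f\<^sup>2)"
    unfolding d_eq by (rule cis_double_real) (use A0_bounds f_pos in auto)
  moreover have "(1 + d) \<noteq> 0" using f_pos by (auto simp: f_def)
  ultimately show ?thesis unfolding f using nz by (simp add: power2_eq_square)
qed

lemma xi_d_eq: "xi_d d = 2 * A0"
  unfolding xi_d_def
proof (rule the_equality)
  show "- theta_d d \<le> 2 * A0 \<and> 2 * A0 \<le> theta_d d \<and> cis (2 * A0) = (1 + d) / (1 + cnj d)"
    unfolding theta_d_eq cis_2A0 using A0_bounds by simp
  fix \<xi> assume x: "- theta_d d \<le> \<xi> \<and> \<xi> \<le> theta_d d \<and> cis \<xi> = (1 + d) / (1 + cnj d)"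
  then have "cis \<xi> = cis (2 * A0)" by (simp add: cis_2A0)
  moreover have r: "\<xi> \<in> {-pi<..pi}" "2 * A0 \<in> {-pi<..pi}"
    using x A0_bounds(1,2) \<phi>0_bounds(1,2) unfolding theta_d_eq by auto
  have "Arg (cis \<xi>) = \<xi>" "Arg (cis (2 * A0)) = 2 * A0"
    by (rule Arg_cis[OF r(1)], rule Arg_cis[OF r(2)])
  ultimately show "\<xi> = 2 * A0" by metis
qed

text \<open>
  The substitution \<open>cot ((\<theta> - xi_d d) / 2) = cot (theta_d d / 2) * cos \<psi>\<close> with \<open>\<psi>\<close> from \<open>0\<close> to \<open>\<pi>\<close>,
  solved for \<open>\<theta>\<close>. It maps onto the closure of the arc that carries \<open>mu_d d\<close>.
\<close>
definition \<Theta> where "\<Theta> \<psi> = 2 * A0 + pi - 2 * arctan (g / e * cos \<psi>)"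
text \<open>
  The derivative of the substitution.
\<close>
definition \<Theta>' where "\<Theta>' \<psi> = 2 * (g / e * sin \<psi>) / (1 + (g / e * cos \<psi>)\<^sup>2)"
definition den where "den \<psi> = (1 + a) * e + g * b * cos \<psi>"
text \<open>
  The density of \<open>mu_d d\<close> in the new variable. The square root in \<open>w_d\<close> disappears, and the factor
  \<open>den\<close> comes from \<open>sin (\<theta> / 2)\<close>.
\<close>
definition v where "v \<psi> = g\<^sup>2 * f * e\<^sup>2 / pi * (sin \<psi>)\<^sup>2 / (den \<psi> * (e\<^sup>2 + g\<^sup>2 * (cos \<psi>)\<^sup>2))"

lemma arctan_ge: "arctan (g / e) = pi / 2 - \<phi>0"
proof (rule arctan_unique)
  have "tan (pi / 2 - \<phi>0) = inverse (tan \<phi>0)" by (rule tan_cot)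
  also have "\<dots> = g / e" using \<phi>0_bounds(3,4) f_pos e_pos g_pos by (simp add: tan_def)
  finally show "tan (pi / 2 - \<phi>0) = g / e" .
qed (use \<phi>0_bounds in auto)

lemma \<Theta>_ends: "\<Theta> 0 = xi_d d + theta_d d" "\<Theta> pi = 2 * pi - theta_d d + xi_d d"
proof -
  show "\<Theta> 0 = xi_d d + theta_d d" by (simp add: \<Theta>_def arctan_ge xi_d_eq theta_d_eq)
  show "\<Theta> pi = 2 * pi - theta_d d + xi_d d" by (simp add: \<Theta>_def arctan_ge arctan_minus xi_d_eq theta_d_eq)
qed

lemma \<Theta>_range: "0 \<le> \<Theta> 0" "\<Theta> pi \<le> 2 * pi"
  unfolding \<Theta>_ends xi_d_eq theta_d_eq using A0_bounds by auto

lemma \<Theta>_deriv: "(\<Theta> has_real_derivative \<Theta>' \<psi>) (at \<psi>)"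
proof -
  have "((\<lambda>\<psi>. 2 * A0 + pi - 2 * arctan (g / e * cos \<psi>)) has_real_derivative
      (0 - 2 * (inverse (1 + (g / e * cos \<psi>)\<^sup>2) * (g / e * (- sin \<psi>))))) (at \<psi>)"
    using e_pos by (auto intro!: derivative_eq_intros)
  moreover have "0 - 2 * (inverse (1 + (g / e * cos \<psi>)\<^sup>2) * (g / e * (- sin \<psi>))) = \<Theta>' \<psi>"
    by (simp add: \<Theta>'_def divide_inverse)
  ultimately show ?thesis unfolding \<Theta>_def[abs_def] by simp
qed

lemma one_plus_sq: "0 < 1 + (x::real)\<^sup>2" by (simp add: add_pos_nonneg)

lemma \<Theta>'_cont: "continuous_on S \<Theta>'"
  unfolding \<Theta>'_def[abs_def] using one_plus_sq by (intro continuous_intros) (auto simp: less_imp_neq[symmetric])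

lemma \<Theta>'_nonneg: "\<psi> \<in> {0..pi} \<Longrightarrow> 0 \<le> \<Theta>' \<psi>"
  unfolding \<Theta>'_def using e_pos g_pos by (auto intro!: divide_nonneg_nonneg mult_nonneg_nonneg sin_ge_zero)

lemma ge_sq: "((1 + a) * e)\<^sup>2 = (a * f)\<^sup>2 + (g * b)\<^sup>2"
  unfolding power_mult_distrib e2 f2 g2 by (simp add: power2_eq_square algebra_simps)

lemma den_bound: "\<bar>g * b\<bar> \<le> (1 + a) * e"
  by (rule power2_le_imp_le) (use ge_sq e_pos a_nonneg in auto)

lemma den_nonneg: "0 \<le> den \<psi>"
proof -
  have "\<bar>g * b * cos \<psi>\<bar> \<le> \<bar>g * b\<bar> * 1" unfolding abs_mult[of "g * b"] by (intro mult_left_mono) auto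
  then show ?thesis using den_bound by (simp add: den_def)
qed

lemma den_pos:
  assumes "\<psi> \<in> {0<..<pi}"
  shows "0 < den \<psi>"
proof (cases "b = 0")
  case False
  have "sin \<psi> > 0" using assms by (intro sin_gt_zero) auto
  then have "0 < (sin \<psi>)\<^sup>2" by simp
  then have "(cos \<psi>)\<^sup>2 < 1" using sin_cos_squared_add[of \<psi>] by linarith
  then have "\<bar>cos \<psi>\<bar> < 1" by (simp add: abs_square_less_1)
  then have "\<bar>g * b\<bar> * \<bar>cos \<psi>\<bar> < \<bar>g * b\<bar> * 1" using False g_pos by (intro mult_strict_left_mono) auto
  then have "\<bar>g * b * cos \<psi>\<bar> < \<bar>g * b\<bar>" by (simp add: abs_mult)
  then show ?thesis using den_bound by (simp add: den_def)
qed (use a_nonneg e_pos in \<open>simp add: den_def\<close>)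

lemma eg_pos: "0 < e\<^sup>2 + g\<^sup>2 * (cos \<psi>)\<^sup>2"
  using e_pos by (simp add: add_pos_nonneg)

lemma \<Theta>_strict:
  assumes "\<psi> \<in> {0<..<pi}"
  shows "\<Theta> 0 < \<Theta> \<psi>" "\<Theta> \<psi> < \<Theta> pi"
proof -
  have "cos \<psi> < 1" "- 1 < cos \<psi>"
    using cos_monotone_0_pi[of 0 \<psi>] cos_monotone_0_pi[of \<psi> pi] assms by auto
  moreover have q: "0 < g / e" using e_pos g_pos by simp
  ultimately have "g / e * cos \<psi> < g / e * 1" "g / e * (-1) < g / e * cos \<psi>"
    using mult_strict_left_mono[OF _ q] by blast+
  then show "\<Theta> 0 < \<Theta> \<psi>" "\<Theta> \<psi> < \<Theta> pi" by (auto simp: \<Theta>_def arctan_less_iff)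
qed

lemma w_d_\<Theta>:
  assumes "\<psi> \<in> {0<..<pi}"
  shows "w_d d (\<Theta> \<psi>) = e * f * g * sin \<psi> / den \<psi>"
proof -
  define x where "x = g / e * cos \<psi>"
  define u where "u = arctan x"
  define r where "r = sqrt (1 + x\<^sup>2)"
  have r: "r > 0" "r\<^sup>2 = 1 + x\<^sup>2" using one_plus_sq[of x] by (auto simp: r_def)
  have cu: "cos u = 1 / r" "sin u = x / r" by (simp_all add: u_def r_def cos_arctan sin_arctan)
  have sp: "sin \<psi> > 0" using assms by (intro sin_gt_zero) auto
  have fz: "f \<noteq> 0" "e \<noteq> 0" "f > 0" "e > 0" using f_pos e_pos by auto
  have c2: "(cos \<psi>)\<^sup>2 = 1 - (sin \<psi>)\<^sup>2" by (rule cos_squared_eq)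
  have s1: "sin ((\<Theta> \<psi> - xi_d d) / 2) = 1 / r"
  proof -
    have E: "(\<Theta> \<psi> - xi_d d) / 2 = pi / 2 - u" by (simp add: \<Theta>_def xi_d_eq u_def x_def field_simps)
    show ?thesis unfolding E using cu by (simp add: sin_diff)
  qed
  have s2: "sin (\<Theta> \<psi> / 2) = den \<psi> / (r * e * f)"
  proof -
    have E: "\<Theta> \<psi> / 2 = pi / 2 - (u - A0)" by (simp add: \<Theta>_def u_def x_def field_simps)
    have "sin (\<Theta> \<psi> / 2) = cos (u - A0)" unfolding E by (simp add: sin_diff)
    also have "\<dots> = 1 / r * ((1 + a) / f) + x / r * (b / f)" unfolding cos_diff cu A0_bounds by simp
    also have "\<dots> = den \<psi> / (r * e * f)" using fz r by (simp add: den_def x_def field_simps)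
    finally show ?thesis .
  qed
  have s3: "(1 / r)\<^sup>2 - (e / f)\<^sup>2 = (g * sin \<psi> / (f * r))\<^sup>2"
  proof -
    have re: "r\<^sup>2 * e\<^sup>2 = f\<^sup>2 - g\<^sup>2 * (sin \<psi>)\<^sup>2"
      unfolding r(2) x_def f2' using fz by (simp add: power_mult_distrib power_divide c2 field_simps)
    have "(1 / r)\<^sup>2 - (e / f)\<^sup>2 = (f\<^sup>2 - r\<^sup>2 * e\<^sup>2) / (f\<^sup>2 * r\<^sup>2)"
      using fz r(1) by (simp add: power_divide field_simps)
    then show ?thesis unfolding re by (simp add: power_divide power_mult_distrib)
  qed
  have al: "cmod (1 + alpha_d d) = 1 / f"
  proof -
    have nz: "1 + cnj d \<noteq> 0" using a_nonneg unfolding d_eq by (simp add: complex_eq_iff)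
    have "1 + alpha_d d = 1 / (1 + cnj d)" using nz by (simp add: alpha_d_def field_simps)
    moreover have "cmod (1 + cnj d) = f" using complex_mod_cnj[of "1 + d"] by (simp add: f_def)
    ultimately show ?thesis by (simp add: norm_divide)
  qed
  have "w_d d (\<Theta> \<psi>) = sqrt ((g * sin \<psi> / (f * r))\<^sup>2) / (1 / f * (den \<psi> / (r * e * f)))"
    unfolding w_d_def s1[unfolded xi_d_eq] s2 al theta_d_eq xi_d_eq using \<Theta>_strict[OF assms] \<phi>0_bounds(3) s3
    unfolding \<Theta>_ends theta_d_eq xi_d_eq by (simp add: add.commute)
  also have "sqrt ((g * sin \<psi> / (f * r))\<^sup>2) = g * sin \<psi> / (f * r)"
    using fz r sp g_pos by simp
  also have "g * sin \<psi> / (f * r) / (1 / f * (den \<psi> / (r * e * f))) = e * f * g * sin \<psi> / den \<psi>"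
    using fz r den_pos[OF assms] by (simp add: field_simps)
  finally show ?thesis .
qed

lemma w_d_ends: "w_d d (\<Theta> 0) = 0" "w_d d (\<Theta> pi) = 0"
  unfolding \<Theta>_ends by (auto simp: w_d_def)

lemma v_eq:
  assumes "\<psi> \<in> {0..pi}"
  shows "w_d d (\<Theta> \<psi>) / (2 * pi) * \<Theta>' \<psi> = v \<psi>"
proof (cases "\<psi> = 0 \<or> \<psi> = pi")
  case True
  then show ?thesis using w_d_ends by (auto simp: v_def)
next
  case False
  then have i: "\<psi> \<in> {0<..<pi}" using assms by auto
  have e: "1 + (g / e * cos \<psi>)\<^sup>2 = (e\<^sup>2 + g\<^sup>2 * (cos \<psi>)\<^sup>2) / e\<^sup>2"
    using e_pos by (simp add: power_mult_distrib power_divide field_simps)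
  define R where "R = e\<^sup>2 + g\<^sup>2 * (cos \<psi>)\<^sup>2"
  have R: "R > 0" unfolding R_def by (rule eg_pos)
  have "\<Theta>' \<psi> = 2 * (g / e * sin \<psi>) / (R / e\<^sup>2)" unfolding \<Theta>'_def e R_def ..
  also have "\<dots> = 2 * g * e * sin \<psi> / R" using e_pos by (simp add: power2_eq_square)
  finally have t: "\<Theta>' \<psi> = 2 * g * e * sin \<psi> / R" .
  show ?thesis unfolding w_d_\<Theta>[OF i] t v_def R_def[symmetric] using R den_pos[OF i]
    by (simp add: power2_eq_square mult_ac)
qed

lemma v_nonneg: "0 \<le> v \<psi>"
  unfolding v_def using den_nonneg[of \<psi>] eg_pos[of \<psi>] f_pos
  by (intro divide_nonneg_nonneg mult_nonneg_nonneg) auto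

lemma v_meas [measurable]: "v \<in> borel_measurable borel"
  unfolding v_def[abs_def] den_def by measurable

lemma \<Theta>_meas [measurable]: "\<Theta> \<in> borel_measurable borel"
  unfolding \<Theta>_def[abs_def] by (intro borel_measurable_continuous_onI continuous_intros)

lemma w_d_meas [measurable]: "w_d d \<in> borel_measurable borel"
  unfolding w_d_def[abs_def] by measurable

lemma cis_circle_meas [measurable]: "cis \<in> borel \<rightarrow>\<^sub>M circle"
  by (intro measurable_restrict_space2) auto

lemma cis_\<Theta>_meas [measurable]: "(\<lambda>\<psi>. cis (\<Theta> \<psi>)) \<in> borel \<rightarrow>\<^sub>M circle"
  by measurable

lemma mu_d_eq:
  "mu_d d = distr (density lborel (\<lambda>\<psi>. ennreal (indicator {0..pi} \<psi> * v \<psi>))) circle (\<lambda>\<psi>. cis (\<Theta> \<psi>))"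
proof (rule measure_eqI)
  fix A assume "A \<in> sets (mu_d d)"
  then have A: "A \<in> sets circle" by (simp add: mu_d_def d_nz)
  then have Ab: "A \<in> sets borel" by (auto simp: sets_restrict_space)
  have v1: "cis -` A \<in> sets borel" using measurable_sets[OF cis_circle_meas A] by simp
  have v2: "(\<lambda>\<psi>. cis (\<Theta> \<psi>)) -` A \<in> sets borel" using measurable_sets[OF cis_\<Theta>_meas A] by simp
  define F where "F \<theta> = ennreal (w_d d \<theta> / (2 * pi)) * indicator A (cis \<theta>)" for \<theta>
  have Fm: "F \<in> borel_measurable borel" unfolding F_def[abs_def] using Ab by measurable
  have "emeasure (mu_d d) A = (\<integral>\<^sup>+\<theta>. indicator {0..<2*pi} \<theta> * ennreal (w_d d \<theta> / (2*pi)) * indicator (cis -` A) \<theta> \<partial>lborel)"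
    unfolding mu_d_def using d_nz A v1 by (simp add: emeasure_distr emeasure_density)
  also have "\<dots> = (\<integral>\<^sup>+\<theta>. F \<theta> * indicator {\<Theta> 0..\<Theta> pi} \<theta> \<partial>lborel)"
  proof (rule nn_integral_cong)
    fix \<theta>
    show "indicator {0..<2*pi} \<theta> * ennreal (w_d d \<theta> / (2*pi)) * indicator (cis -` A) \<theta> = F \<theta> * indicator {\<Theta> 0..\<Theta> pi} \<theta>"
    proof (cases "\<Theta> 0 < \<theta> \<and> \<theta> < \<Theta> pi")
      case True
      then show ?thesis using \<Theta>_range by (auto simp: F_def indicator_def)
    next
      case False
      then have "w_d d \<theta> = 0" unfolding \<Theta>_ends w_d_def by (auto simp: add.commute)
      then show ?thesis by (simp add: F_def)
    qed
  qed
  also have "\<dots> = (\<integral>\<^sup>+\<psi>. F (\<Theta> \<psi>) * \<Theta>' \<psi> * indicator {0..pi} \<psi> \<partial>lborel)"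
    by (rule nn_integral_substitution_aux[OF Fm]) (use \<Theta>_deriv \<Theta>'_cont \<Theta>'_nonneg in auto)
  also have "\<dots> = (\<integral>\<^sup>+\<psi>. ennreal (indicator {0..pi} \<psi> * v \<psi>) * indicator ((\<lambda>\<psi>. cis (\<Theta> \<psi>)) -` A) \<psi> \<partial>lborel)"
  proof (rule nn_integral_cong)
    fix \<psi>
    show "F (\<Theta> \<psi>) * \<Theta>' \<psi> * indicator {0..pi} \<psi> = ennreal (indicator {0..pi} \<psi> * v \<psi>) * indicator ((\<lambda>\<psi>. cis (\<Theta> \<psi>)) -` A) \<psi>"
    proof (cases "\<psi> \<in> {0..pi}")
      case True
      have "ennreal (w_d d (\<Theta> \<psi>) / (2 * pi)) * ennreal (\<Theta>' \<psi>) = ennreal (v \<psi>)"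
        unfolding v_eq[OF True, symmetric] by (rule ennreal_mult''[OF \<Theta>'_nonneg[OF True], symmetric])
      then show ?thesis using True by (auto simp: F_def indicator_def mult_ac)
    qed simp
  qed
  also have "\<dots> = emeasure (distr (density lborel (\<lambda>\<psi>. ennreal (indicator {0..pi} \<psi> * v \<psi>))) circle (\<lambda>\<psi>. cis (\<Theta> \<psi>))) A"
    using A v2 by (simp add: emeasure_distr emeasure_density)
  finally show "emeasure (mu_d d) A = \<dots>" .
qed (simp add: mu_d_def d_nz)

lemma has_bochner_integral_mu_d:
  fixes F :: "complex \<Rightarrow> complex"
  assumes "F \<in> borel_measurable circle" "hbi (\<lambda>\<psi>. of_real (v \<psi>) * F (cis (\<Theta> \<psi>))) J"
  shows "has_bochner_integral (mu_d d) F J"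
proof -
  have [measurable]: "(\<lambda>\<psi>. F (cis (\<Theta> \<psi>))) \<in> borel_measurable borel"
    using measurable_compose[OF cis_\<Theta>_meas assms(1)] .
  have "has_bochner_integral (density lborel (\<lambda>\<psi>. ennreal (indicator {0..pi} \<psi> * v \<psi>))) (\<lambda>\<psi>. F (cis (\<Theta> \<psi>))) J"
  proof (rule has_bochner_integral_density)
    show "has_bochner_integral lborel (\<lambda>\<psi>. (indicator {0..pi} \<psi> * v \<psi>) *\<^sub>R F (cis (\<Theta> \<psi>))) J"
      using assms(2) by (simp add: scaleR_conv_of_real mult_ac indicator_def if_distrib cong: if_cong)
  qed (use v_nonneg in \<open>auto\<close>)
  then show ?thesis unfolding mu_d_eq
    by (intro has_bochner_integral_distr assms) auto
qed

text \<open>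
  The point on the circle is a Moebius function of \<open>cos \<psi>\<close>.
\<close>
lemma cis_\<Theta>: "cis (\<Theta> \<psi>) = (1 + d) / (1 + cnj d) * (Complex (g * cos \<psi>) e / Complex (g * cos \<psi>) (- e))"
proof -
  define x where "x = g / e * cos \<psi>"
  define u where "u = arctan x"
  define r where "r = sqrt (1 + x\<^sup>2)"
  have r: "r > 0" "r\<^sup>2 = 1 + x\<^sup>2" using one_plus_sq[of x] by (auto simp: r_def)
  have ez: "e \<noteq> 0" using e_pos by simp
  have gx: "g * cos \<psi> = e * x" using ez by (simp add: x_def)
  have h1: "cis (\<Theta> \<psi>) = cis (2 * A0) * (- cis (2 * (- u)))"
  proof -
    have "\<Theta> \<psi> = 2 * A0 + (pi + 2 * (- u))" by (simp add: \<Theta>_def u_def x_def)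
    then show ?thesis by (simp only: cis_mult[symmetric] cis_pi mult_minus1)
  qed
  have h2: "cis (2 * (- u)) = (Complex 1 (- x))\<^sup>2 / of_real (r\<^sup>2)"
    by (rule cis_double_real) (use r in \<open>simp_all add: u_def r_def cos_arctan sin_arctan\<close>)
  have h3: "- ((Complex 1 (- x))\<^sup>2 / of_real (r\<^sup>2)) = Complex (e * x) e / Complex (e * x) (- e)"
  proof -
    have n: "Complex (e * x) (- e) \<noteq> 0" using ez by (simp add: complex_eq_iff)
    have m: "complex_of_real (r\<^sup>2) \<noteq> 0" using r(1) by simp
    have "- ((Complex 1 (- x))\<^sup>2) * Complex (e * x) (- e) = Complex (e * x) e * of_real (r\<^sup>2)"
      unfolding r(2) by (simp add: complex_eq_iff power2_eq_square algebra_simps)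
    then show ?thesis unfolding minus_divide_left by (subst frac_eq_eq) (use n m in auto)
  qed
  show ?thesis unfolding gx h1 h2 h3 cis_2A0 ..
qed

end


section \<open>A generating integral of the limit measure\<close>

lemma kern_imaginary: "kern (\<i> * of_real s) \<psi> = Complex (1 - s\<^sup>2) (- 2 * s * cos \<psi>)"
  by (simp add: kern_def complex_eq_iff power2_eq_square)

context limit_param
begin

text \<open>
  Parameters that bring the factors of the integrand into the form \<open>kern\<close>: \<open>w1\<close> for \<open>den\<close>, and \<open>\<i> t\<close>
  for \<open>g cos \<psi> + \<i> e\<close>.
\<close>
definition S where "S = a * f + (1 + a) * e"
definition t where "t = (f - e) / g"
definition w1 where "w1 = - (b * g) / S"
definition \<rho> where "\<rho> = g / f"

lemma S_pos: "0 < S" using a_nonneg e_pos f_pos by (simp add: S_def add_nonneg_pos)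
lemma f_ge_1: "1 < f" using g_ge g_less_f by simp
lemma \<rho>: "0 < \<rho>" "\<rho> < 1" "\<rho> * f = g" using g_pos g_less_f f_pos by (auto simp: \<rho>_def)

lemma fe: "(f - e) * (f + e) = g\<^sup>2"
  using f2' by (simp add: algebra_simps power2_eq_square)

lemma t_g: "t * (f + e) = g"
proof -
  have "t * (f + e) = (f - e) * (f + e) / g" by (simp add: t_def)
  then show ?thesis unfolding fe using g_pos by (simp add: power2_eq_square)
qed

lemma t_sq: "t\<^sup>2 * (f + e) = f - e"
proof -
  have "t\<^sup>2 * (f + e) = t * (t * (f + e))" by (simp add: power2_eq_square)
  also have "\<dots> = f - e" unfolding t_g using g_pos by (simp add: t_def)
  finally show ?thesis .
qed

lemma t_bounds: "0 < t" "t < 1"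
proof -
  show "0 < t" using e_less_f g_pos by (simp add: t_def)
  have "t\<^sup>2 * (f + e) < 1 * (f + e)" unfolding t_sq using e_pos by simp
  then have "t\<^sup>2 < 1" using e_pos f_pos by (simp add: mult_less_cancel_right)
  then show "t < 1" using power_less_one_iff[of t 2] \<open>0 < t\<close> by (simp add: power2_less_imp_less)
qed

lemma w1_S: "w1 * S = - (b * g)" using S_pos by (simp add: w1_def)

lemma w1_sq: "w1\<^sup>2 * S = (1 + a) * e - a * f"
proof -
  have "(w1\<^sup>2 * S) * S = (w1 * S)\<^sup>2" by (simp add: power2_eq_square)
  also have "\<dots> = ((1 + a) * e)\<^sup>2 - (a * f)\<^sup>2" unfolding w1_S ge_sq by (simp add: mult.commute)
  also have "\<dots> = ((1 + a) * e - a * f) * S" by (simp add: S_def power2_eq_square algebra_simps)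
  finally show ?thesis using S_pos by simp
qed

lemma adm_w1: "adm (of_real w1)"
proof -
  have "w1\<^sup>2 * S \<le> 1 * S" unfolding w1_sq using a_nonneg f_pos by (simp add: S_def)
  then have "w1\<^sup>2 \<le> 1" using S_pos by simp
  then have "\<bar>w1\<bar> \<le> 1" by (simp add: abs_square_le_1)
  then have "\<bar>w1\<bar> < 1 \<or> w1 = 1 \<or> w1 = - 1" by linarith
  then show ?thesis unfolding adm_def by auto
qed

lemma den_kern: "of_real (den \<psi>) = of_real (S / 2) * kern (of_real w1) \<psi>"
proof -
  have "S / 2 * (1 - 2 * w1 * cos \<psi> + w1\<^sup>2) = S / 2 - (w1 * S) * cos \<psi> + (w1\<^sup>2 * S) / 2"
    by (simp add: algebra_simps)
  also have "\<dots> = den \<psi>" unfolding w1_S w1_sq by (simp add: den_def S_def field_simps)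
  finally have "den \<psi> = S / 2 * (1 - 2 * w1 * cos \<psi> + w1\<^sup>2)" by simp
  then have "complex_of_real (den \<psi>) = of_real (S / 2 * (1 - 2 * w1 * cos \<psi> + w1\<^sup>2))" by (rule arg_cong)
  then show ?thesis by (simp add: kern_def)
qed

lemma cp_kern: "Complex (g * cos \<psi>) e = \<i> * of_real ((f + e) / 2) * kern (\<i> * of_real t) \<psi>"
proof -
  have "(f + e) / 2 * (2 * t * cos \<psi>) = t * (f + e) * cos \<psi>" by (simp add: algebra_simps)
  then have 1: "(f + e) / 2 * (2 * t * cos \<psi>) = g * cos \<psi>" unfolding t_g .
  have 2: "(f + e) / 2 * (1 - t\<^sup>2) = e" using t_sq by (simp add: algebra_simps)
  have "\<i> * of_real ((f + e) / 2) * kern (\<i> * of_real t) \<psi>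
      = Complex ((f + e) / 2 * (2 * t * cos \<psi>)) ((f + e) / 2 * (1 - t\<^sup>2))"
    unfolding kern_imaginary by (simp add: complex_eq_iff)
  then show ?thesis unfolding 1 2 by simp
qed

text \<open>
  Up to the factor \<open>- cnj \<omega>\<close> the coefficient of \<open>z\<close> in the denominator of the generating function at \<open>x = X cnj \<omega>\<close>, where \<open>\<omega>\<close> is
  \<open>(1 + d) / (1 + cnj d)\<close>. With \<open>\<rho>\<^sup>2 = 1 - \<bar>gamma_d d\<bar>\<^sup>2\<close> the parameter \<open>t\<close> moves by a Moebius
  transformation to \<open>\<tau> X\<close> when the denominator is written as a \<open>kern\<close>.
\<close>
definition y1 where "y1 X = X * (1 - \<rho>\<^sup>2 * X)"
definition M where "M X = 1 - \<rho> * t * X"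
definition N where "N X = t - \<rho> * X"
definition \<tau> where "\<tau> X = N X / M X"

lemma MN:
  "(f + e) * (M X * N X) = g * (1 - X - y1 X)"
  "(f + e) * ((M X)\<^sup>2 - (N X)\<^sup>2) = 2 * e * (1 - X + y1 X)"
  "M X - t * N X = 1 - t\<^sup>2"
proof -
  have "(f + e) * (M X * N X) = t * (f + e) - \<rho> * X * ((f + e) + t\<^sup>2 * (f + e)) + \<rho>\<^sup>2 * X\<^sup>2 * (t * (f + e))"
    by (simp add: M_def N_def power2_eq_square algebra_simps)
  also have "\<dots> = g - 2 * X * (\<rho> * f) + \<rho>\<^sup>2 * X\<^sup>2 * g" unfolding t_g t_sq by (simp add: algebra_simps)
  also have "\<dots> = g * (1 - X - y1 X)" unfolding \<rho>(3) by (simp add: y1_def power2_eq_square algebra_simps)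
  finally show "(f + e) * (M X * N X) = g * (1 - X - y1 X)" .
  have "(f + e) * ((M X)\<^sup>2 - (N X)\<^sup>2) = ((f + e) - t\<^sup>2 * (f + e)) * (1 - \<rho>\<^sup>2 * X\<^sup>2)"
    by (simp add: M_def N_def power2_eq_square algebra_simps)
  also have "\<dots> = 2 * e * (1 - X + y1 X)" unfolding t_sq by (simp add: y1_def power2_eq_square algebra_simps)
  finally show "(f + e) * ((M X)\<^sup>2 - (N X)\<^sup>2) = 2 * e * (1 - X + y1 X)" .
  show "M X - t * N X = 1 - t\<^sup>2" by (simp add: M_def N_def power2_eq_square algebra_simps)
qed

lemma \<tau>_bounds:
  assumes "\<bar>X\<bar> < t"
  shows "0 < M X" "0 < \<tau> X" "\<tau> X < 1"
proof -
  have "\<bar>\<rho> * X\<bar> \<le> 1 * \<bar>X\<bar>" unfolding abs_mult using \<rho> by (intro mult_right_mono) auto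
  then have r: "\<bar>\<rho> * X\<bar> < t" "\<bar>\<rho> * X\<bar> < 1" using assms t_bounds by auto
  have "\<bar>t * (\<rho> * X)\<bar> \<le> 1 * \<bar>\<rho> * X\<bar>" unfolding abs_mult[of t] using t_bounds by (intro mult_right_mono) auto
  then have "\<bar>\<rho> * t * X\<bar> < 1" using r by (simp add: mult_ac)
  then show m: "0 < M X" unfolding M_def by linarith
  have n: "0 < N X" unfolding N_def using r by linarith
  show "0 < \<tau> X" using m n by (simp add: \<tau>_def)
  have "0 < (1 - t) * (1 + \<rho> * X)" using t_bounds r by (intro mult_pos_pos) linarith+
  also have "\<dots> = M X - N X" by (simp add: M_def N_def algebra_simps)
  finally show "\<tau> X < 1" using m by (simp add: \<tau>_def)
qed

text \<open>
  The denominator of the generating function at the point \<open>cis (\<Theta> \<psi>)\<close>, cleared of fractions.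
\<close>
lemma cm_kern:
  assumes "M X \<noteq> 0"
  shows "of_real (1 - X) * Complex (g * cos \<psi>) (- e) - of_real (y1 X) * Complex (g * cos \<psi>) e
    = - \<i> * of_real ((f + e) / 2 * (M X)\<^sup>2) * kern (\<i> * of_real (- \<tau> X)) \<psi>"
proof -
  have 1: "(f + e) / 2 * (M X)\<^sup>2 * (2 * \<tau> X * cos \<psi>) = (f + e) * (M X * N X) * cos \<psi>"
    using assms by (simp add: \<tau>_def power2_eq_square)
  have "(M X)\<^sup>2 * (1 - (\<tau> X)\<^sup>2) = (M X)\<^sup>2 - (N X)\<^sup>2"
    using assms by (simp add: \<tau>_def power_divide right_diff_distrib)
  then have 2: "(f + e) / 2 * (M X)\<^sup>2 * (1 - (\<tau> X)\<^sup>2) = (f + e) * ((M X)\<^sup>2 - (N X)\<^sup>2) / 2"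
    by (simp add: mult.assoc)
  have "- \<i> * of_real ((f + e) / 2 * (M X)\<^sup>2) * kern (\<i> * of_real (- \<tau> X)) \<psi>
      = Complex ((f + e) / 2 * (M X)\<^sup>2 * (2 * \<tau> X * cos \<psi>)) (- ((f + e) / 2 * (M X)\<^sup>2 * (1 - (\<tau> X)\<^sup>2)))"
    unfolding kern_imaginary by (simp only: complex_eq_iff) simp
  also have "\<dots> = Complex (g * (1 - X - y1 X) * cos \<psi>) (- (e * (1 - X + y1 X)))"
    unfolding 1 2 MN by simp
  also have "\<dots> = of_real (1 - X) * Complex (g * cos \<psi>) (- e) - of_real (y1 X) * Complex (g * cos \<psi>) e"
    by (simp add: complex_eq_iff algebra_simps)
  finally show ?thesis by simp
qed

text \<open>
  With \<open>p_norm\<close> the arithmetic on which the closed form of the final integral rests.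
\<close>
lemma p_quot: "of_real \<rho> * (of_real t + \<i> * of_real w1) * (1 + d) = 1 + \<i> * of_real (w1 * t)"
proof -
  have "f * (\<rho> * (t * (1 + a) - w1 * b)) * S = (\<rho> * f) * (t * S * (1 + a) - (w1 * S) * b)"
    by (simp add: algebra_simps)
  also have "\<dots> = (g * t) * S * (1 + a) + (b * g)\<^sup>2" unfolding \<rho>(3) w1_S by (simp add: power2_eq_square algebra_simps)
  also have "g * t = f - e" using g_pos by (simp add: t_def)
  also have "(b * g)\<^sup>2 = (w1 * S)\<^sup>2" by (simp add: w1_S)
  also have "(w1 * S)\<^sup>2 = (w1\<^sup>2 * S) * S" by (simp add: power2_eq_square)
  also have "(f - e) * S * (1 + a) + (w1\<^sup>2 * S) * S = f * 1 * S" unfolding w1_sq by (simp add: algebra_simps)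
  finally have re: "\<rho> * (t * (1 + a) - w1 * b) = 1" using f_pos S_pos by simp
  have "f * (\<rho> * (t * b + w1 * (1 + a))) * S = (\<rho> * f) * (t * b * S + (w1 * S) * (1 + a))"
    by (simp add: algebra_simps)
  also have "\<dots> = (g * t) * b * S - g\<^sup>2 * b * (1 + a)" unfolding \<rho>(3) w1_S by (simp add: power2_eq_square algebra_simps)
  also have "g * t = f - e" using g_pos by (simp add: t_def)
  also have "(f - e) * b * S - g\<^sup>2 * b * (1 + a) = (f - e) * b * (S - (f + e) * (1 + a))"
    unfolding fe[symmetric] by (simp add: algebra_simps)
  also have "S - (f + e) * (1 + a) = - f" by (simp add: S_def algebra_simps)
  also have "(f - e) * b * (- f) = f * ((- (b * g)) * ((f - e) / g))" using g_pos by (simp add: field_simps)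
  also have "\<dots> = f * (w1 * t) * S" unfolding w1_S[symmetric] t_def[symmetric] by simp
  finally have im: "\<rho> * (t * b + w1 * (1 + a)) = w1 * t" using f_pos S_pos by simp
  have "of_real \<rho> * (of_real t + \<i> * of_real w1) * (1 + d) = Complex (\<rho> * (t * (1 + a) - w1 * b)) (\<rho> * (t * b + w1 * (1 + a)))"
    unfolding d_eq by (simp add: complex_eq_iff algebra_simps)
  then show ?thesis unfolding re im by (simp add: complex_eq_iff)
qed

lemma p_norm: "S * (f + e) * (1 + w1\<^sup>2 * t\<^sup>2) = 2 * g\<^sup>2 * f * e"
proof -
  have "S * (f + e) * (1 + w1\<^sup>2 * t\<^sup>2) = S * (f + e) + (w1\<^sup>2 * S) * (t\<^sup>2 * (f + e))" by (simp add: algebra_simps)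
  also have "\<dots> = 2 * g\<^sup>2 * f * e" unfolding w1_sq t_sq unfolding g2 S_def by (simp add: algebra_simps)
  finally show ?thesis .
qed

lemma one_plus_d: "1 + d \<noteq> 0" "1 + cnj d \<noteq> 0"
  using one_plus_d_nz[OF Re_d] by auto

lemma X_quot:
  assumes "\<bar>X\<bar> < 1"
  shows "1 - of_real X / (1 + d) \<noteq> 0"
proof
  assume "1 - of_real X / (1 + d) = 0"
  then have "of_real X = 1 + d" using one_plus_d by (simp add: field_simps)
  then have "cmod (of_real X) = f" by (simp add: f_def)
  then show False using assms f_ge_1 by simp
qed

text \<open>
  The denominator of \<open>hbi_kern3\<close>: multiplying the two factors that contain \<open>\<tau> X\<close> by \<open>M X\<close> clears the
  fractions, and what is left is affine in \<open>X\<close>.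
\<close>
lemma den_product:
  assumes "M X \<noteq> 0"
  defines "W1 \<equiv> complex_of_real w1" and "W2 \<equiv> \<i> * of_real t" and "W3 \<equiv> \<i> * of_real (- \<tau> X)"
  shows "of_real (S * (f + e)\<^sup>2 * (M X)\<^sup>2) * ((1 - W1 * W2) * (1 - W1 * W3) * (1 - W2 * W3))
      = of_real (4 * g\<^sup>2 * f * e\<^sup>2) * (1 - of_real X / (1 + d))"
proof -
  define p where "p = 1 + \<i> * of_real (w1 * t)"
  have m: "M X * \<tau> X = N X" using assms(1) by (simp add: \<tau>_def)
  have r: "of_real \<rho> * (of_real t + \<i> * of_real w1) = p / (1 + d)"
    using p_quot one_plus_d by (simp add: p_def nonzero_eq_divide_eq)
  have "of_real (M X) * (1 - W1 * W3) = of_real (M X) + \<i> * of_real (w1 * (M X * \<tau> X))"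
    by (simp add: W1_def W3_def algebra_simps)
  also have "\<dots> = p - of_real X * (of_real \<rho> * (of_real t + \<i> * of_real w1))"
    unfolding m by (simp add: M_def N_def p_def algebra_simps)
  also have "\<dots> = p * (1 - of_real X / (1 + d))" unfolding r by (simp add: algebra_simps)
  finally have 1: "of_real (M X) * (1 - W1 * W3) = p * (1 - of_real X / (1 + d))" .
  have "W2 * W3 = of_real (t * \<tau> X)" by (simp add: W2_def W3_def complex_eq_iff)
  then have "of_real (M X) * (1 - W2 * W3) = of_real (M X - t * (M X * \<tau> X))" by (simp add: algebra_simps)
  also have "\<dots> = of_real (1 - t\<^sup>2)" unfolding m MN ..
  finally have 2: "of_real (M X) * (1 - W2 * W3) = of_real (1 - t\<^sup>2)" .
  have 3: "(1 - W1 * W2) * p = of_real (1 + w1\<^sup>2 * t\<^sup>2)"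
    by (simp add: W1_def W2_def p_def complex_eq_iff power2_eq_square algebra_simps)
  have "of_real (S * (f + e)\<^sup>2 * (M X)\<^sup>2) * ((1 - W1 * W2) * (1 - W1 * W3) * (1 - W2 * W3))
      = of_real (S * (f + e)\<^sup>2) * (1 - W1 * W2) * (of_real (M X) * (1 - W1 * W3)) * (of_real (M X) * (1 - W2 * W3))"
    by (simp add: power2_eq_square mult_ac)
  also have "\<dots> = of_real (S * (f + e)\<^sup>2) * ((1 - W1 * W2) * p) * of_real (1 - t\<^sup>2) * (1 - of_real X / (1 + d))"
    unfolding 1 2 by (simp only: mult_ac)
  also have "of_real (S * (f + e)\<^sup>2) * ((1 - W1 * W2) * p) * of_real (1 - t\<^sup>2)
      = of_real ((S * (f + e) * (1 + w1\<^sup>2 * t\<^sup>2)) * ((f + e) - t\<^sup>2 * (f + e)))"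
    unfolding 3 of_real_mult[symmetric] by (rule arg_cong[of _ _ of_real]) (simp add: power2_eq_square algebra_simps)
  also have "(S * (f + e) * (1 + w1\<^sup>2 * t\<^sup>2)) * ((f + e) - t\<^sup>2 * (f + e)) = 4 * g\<^sup>2 * f * e\<^sup>2"
    unfolding p_norm t_sq by (simp add: power2_eq_square)
  finally show ?thesis .
qed

lemma hbi_generating:
  assumes X: "\<bar>X\<bar> < t"
  shows "hbi (\<lambda>\<psi>. of_real (v \<psi>) * (1 / (of_real (1 - X) - cis (\<Theta> \<psi>) * ((1 + cnj d) / (1 + d)) * of_real (y1 X))))
    (1 / (1 - of_real X / (1 + d)))"
proof -
  define W1 W2 W3 where "W1 = complex_of_real w1" and "W2 = \<i> * complex_of_real t" and "W3 = \<i> * complex_of_real (- \<tau> X)"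
  note tb = \<tau>_bounds[OF X]
  have X1: "\<bar>X\<bar> < 1" using X t_bounds by simp
  define C where "C = complex_of_real (g\<^sup>2 * f * e\<^sup>2 / pi * 8 / (S * (f + e)\<^sup>2 * (M X)\<^sup>2))"
  have "hbi (\<lambda>\<psi>. C * (of_real ((sin \<psi>)\<^sup>2) / (kern W1 \<psi> * kern W2 \<psi> * kern W3 \<psi>)))
      (C * (of_real (pi / 2) / ((1 - W1 * W2) * (1 - W1 * W3) * (1 - W2 * W3))))"
  proof (intro hbi_cmult hbi_kern3)
    show "W1 \<noteq> W2" "W1 \<noteq> W3" "W2 \<noteq> W3"
      using t_bounds tb by (auto simp: W1_def W2_def W3_def complex_eq_iff)
    show "adm W1" using adm_w1 by (simp add: W1_def)
    show "cmod W2 < 1" "cmod W3 < 1" using t_bounds tb by (auto simp: W2_def W3_def norm_mult)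
  qed
  moreover have "C * (of_real (pi / 2) / ((1 - W1 * W2) * (1 - W1 * W3) * (1 - W2 * W3))) = 1 / (1 - of_real X / (1 + d))"
  proof -
    define D where "D = (1 - W1 * W2) * (1 - W1 * W3) * (1 - W2 * W3)"
    define E where "E = complex_of_real (S * (f + e)\<^sup>2 * (M X)\<^sup>2)"
    define G where "G = complex_of_real (4 * g\<^sup>2 * f * e\<^sup>2)"
    have ED: "E * D = G * (1 - of_real X / (1 + d))"
      using den_product[of X] tb(1) by (simp only: D_def E_def G_def W1_def W2_def W3_def)
    have "S * (f + e)\<^sup>2 * (M X)\<^sup>2 \<noteq> 0" "4 * g\<^sup>2 * f * e\<^sup>2 \<noteq> 0" using S_pos f_pos e_pos g_pos tb(1) by auto
    then have E: "E \<noteq> 0" "G \<noteq> 0" unfolding E_def G_def of_real_eq_0_iff by blast+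
    have "C * of_real (pi / 2) = of_real (g\<^sup>2 * f * e\<^sup>2 / pi * 8 / (S * (f + e)\<^sup>2 * (M X)\<^sup>2) * (pi / 2))"
      unfolding C_def by simp
    also have "g\<^sup>2 * f * e\<^sup>2 / pi * 8 / (S * (f + e)\<^sup>2 * (M X)\<^sup>2) * (pi / 2) = 4 * g\<^sup>2 * f * e\<^sup>2 / (S * (f + e)\<^sup>2 * (M X)\<^sup>2)"
      by (simp add: mult_ac)
    finally have "C * of_real (pi / 2) = G / E" by (simp only: G_def E_def of_real_divide)
    then have "C * (of_real (pi / 2) / D) = G / (E * D)" by (metis divide_divide_eq_left times_divide_eq_right)
    also have "\<dots> = 1 / (1 - of_real X / (1 + d))" unfolding ED using E by simp
    finally show ?thesis by (simp only: D_def)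
  qed
  ultimately have "hbi (\<lambda>\<psi>. C * (of_real ((sin \<psi>)\<^sup>2) / (kern W1 \<psi> * kern W2 \<psi> * kern W3 \<psi>)))
      (1 / (1 - of_real X / (1 + d)))" by (simp only:)
  then show ?thesis
  proof (rule hbi_cong)
    fix \<psi>
    define cp cm where "cp = Complex (g * cos \<psi>) e" and "cm = Complex (g * cos \<psi>) (- e)"
    define R where "R = complex_of_real ((f + e) / 2)"
    have nz: "cp \<noteq> 0" "cm \<noteq> 0" using e_pos by (auto simp: cp_def cm_def complex_eq_iff)
    have prod: "of_real (e\<^sup>2 + g\<^sup>2 * (cos \<psi>)\<^sup>2) = cp * cm"
      by (simp add: cp_def cm_def complex_eq_iff power2_eq_square algebra_simps)
    have E: "cis (\<Theta> \<psi>) * ((1 + cnj d) / (1 + d)) = cp / cm"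
      unfolding cis_\<Theta> cp_def[symmetric] cm_def[symmetric] using one_plus_d by simp
    have Q: "of_real (1 - X) * cm - of_real (y1 X) * cp = - \<i> * R * of_real ((M X)\<^sup>2) * kern W3 \<psi>"
      unfolding cp_def cm_def W3_def R_def using cm_kern[of X \<psi>] tb(1) by (simp only: of_real_mult mult.assoc)
    have cp: "cp = \<i> * R * kern W2 \<psi>" unfolding cp_def cp_kern R_def W2_def ..
    have "(f + e) / 2 \<noteq> 0" using f_pos e_pos by simp
    then have R: "R \<noteq> 0" unfolding R_def of_real_eq_0_iff .
    have ii: "(\<i> * R * x) * (- \<i> * R * m * y) = R * R * m * (x * y)" for x m y by (simp add: algebra_simps)
    have fr: "of_real (1 - X) - cp / cm * of_real (y1 X) = (of_real (1 - X) * cm - of_real (y1 X) * cp) / cm"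
      using nz by (simp add: field_simps)
    have "of_real (v \<psi>) * (1 / (of_real (1 - X) - cis (\<Theta> \<psi>) * ((1 + cnj d) / (1 + d)) * of_real (y1 X)))
        = of_real (g\<^sup>2 * f * e\<^sup>2 / pi) * of_real ((sin \<psi>)\<^sup>2) / (of_real (den \<psi>) * (cp * cm))
          * (cm / (of_real (1 - X) * cm - of_real (y1 X) * cp))"
      unfolding E fr v_def of_real_divide of_real_mult prod by simp
    also have "\<dots> = of_real (g\<^sup>2 * f * e\<^sup>2 / pi) * of_real ((sin \<psi>)\<^sup>2)
          / (of_real (den \<psi>) * (cp * (of_real (1 - X) * cm - of_real (y1 X) * cp)))"
      using nz by (simp add: mult_ac)
    also have "cp * (of_real (1 - X) * cm - of_real (y1 X) * cp) = R * R * of_real ((M X)\<^sup>2) * (kern W2 \<psi> * kern W3 \<psi>)"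
      unfolding Q unfolding cp by (rule ii)
    also have "of_real (den \<psi>) = of_real (S / 2) * kern W1 \<psi>" unfolding W1_def by (rule den_kern)
    also have "of_real (g\<^sup>2 * f * e\<^sup>2 / pi) * of_real ((sin \<psi>)\<^sup>2)
          / (of_real (S / 2) * kern W1 \<psi> * (R * R * of_real ((M X)\<^sup>2) * (kern W2 \<psi> * kern W3 \<psi>)))
        = of_real (g\<^sup>2 * f * e\<^sup>2 / pi) / (of_real (S / 2) * R * R * of_real ((M X)\<^sup>2))
          * (of_real ((sin \<psi>)\<^sup>2) / (kern W1 \<psi> * kern W2 \<psi> * kern W3 \<psi>))"
      by (simp only: times_divide_times_eq mult_ac)
    also have "of_real (g\<^sup>2 * f * e\<^sup>2 / pi) / (of_real (S / 2) * R * R * of_real ((M X)\<^sup>2)) = C"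
      unfolding C_def R_def of_real_mult[symmetric] of_real_divide[symmetric]
      by (rule arg_cong[of _ _ of_real]) (simp add: power2_eq_square)
    finally show "C * (of_real ((sin \<psi>)\<^sup>2) / (kern W1 \<psi> * kern W2 \<psi> * kern W3 \<psi>))
        = of_real (v \<psi>) * (1 / (of_real (1 - X) - cis (\<Theta> \<psi>) * ((1 + cnj d) / (1 + d)) * of_real (y1 X)))"
      by simp
  qed
qed

end


section \<open>The limit measure has constant Verblunsky coefficients\<close>

text \<open>
  Zeros of a nonconstant power series do not accumulate at its centre; it suffices to know the values
  at small positive arguments.
\<close>
lemma power_series_eq_const:
  fixes c :: "nat \<Rightarrow> complex"
  assumes r: "r > 0" and sm: "\<And>x. cmod x < r \<Longrightarrow> summable (\<lambda>n. c n * x ^ n)"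
    and const: "\<And>X. 0 < X \<Longrightarrow> X < r \<Longrightarrow> (\<Sum>n. c n * of_real X ^ n) = c 0"
    and m: "m > 0"
  shows "c m = 0"
proof (rule ccontr)
  assume nz: "c m \<noteq> 0"
  \<comment> \<open>the series minus its constant term, as \<open>powser_0_nonzero\<close> concerns a zero at the centre\<close>
  define h where "h n = (if n = 0 then 0 else c n)" for n
  define H where "H x = (\<Sum>n. h n * x ^ n)" for x
  have hs: "h n * x ^ n = c n * x ^ n - (if n = 0 then c 0 else 0)" for n and x :: complex
    by (simp add: h_def)
  have single: "(\<lambda>n. if n = 0 then c 0 else 0) sums c 0" using sums_single[of 0 "\<lambda>_. c 0"] by simp
  have sums: "(\<lambda>n. h n * x ^ n) sums ((\<Sum>n. c n * x ^ n) - c 0)" if "cmod x < r" for x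
    unfolding hs by (intro sums_diff summable_sums sm single that)
  have H: "H x = (\<Sum>n. c n * x ^ n) - c 0" if "cmod x < r" for x
    unfolding H_def by (rule sums_unique[symmetric, OF sums[OF that]])
  have Hs: "(\<lambda>n. h n * (x - 0) ^ n) sums H x" if "cmod (x - 0) < r" for x
    using sums[of x] H[of x] that by simp
  have "H 0 = 0" unfolding H_def by (simp add: h_def)
  moreover have "h m \<noteq> 0" using nz m by (simp add: h_def)
  ultimately obtain s where s: "0 < s" "\<And>z. z \<in> cball 0 s - {0} \<Longrightarrow> H z \<noteq> 0"
    using powser_0_nonzero[OF r Hs _ _ m] by blast
  define X where "X = min s r / 2"
  have X: "0 < X" "X < r" "X \<le> s" using s(1) r by (auto simp: X_def)
  have "H (of_real X) = 0" using H[of "of_real X"] const[OF X(1,2)] X by simp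
  moreover have "complex_of_real X \<in> cball 0 s - {0}" using X by simp
  ultimately show False using s(2) by blast
qed

context
  fixes d :: complex
  assumes d: "Re d \<ge> 0"
begin

definition const_verb :: "nat \<Rightarrow> complex" where
  "const_verb = verb_of_def (\<lambda>_. gamma_d d)"

definition om :: complex where "om = (1 + d) / (1 + cnj d)"

lemma om: "cmod om = 1" "om * cnj om = 1" "cnj om = (1 + cnj d) / (1 + d)"
proof -
  have "cmod (1 + cnj d) = cmod (1 + d)" using complex_mod_cnj[of "1 + d"] by simp
  then show 1: "cmod om = 1" using one_plus_d_nz[OF d] by (simp add: om_def norm_divide)
  show "om * cnj om = 1" by (rule unimodular_mult_cnj[OF 1])
  show "cnj om = (1 + cnj d) / (1 + d)" by (simp add: om_def)
qed

lemma cnj_const_verb: "cnj (const_verb k) = gamma_d d * om ^ k"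
proof -
  define u where "u = complex_of_real (1 + 2 * Re d)"
  have u: "u \<noteq> 0" "cnj u = u" using d by (auto simp: u_def simp del: of_real_add)
  have g: "1 - gamma_d d = u / (1 + cnj d)" using one_minus_gamma_d[OF d] by (simp add: u_def)
  have "cnj (1 - gamma_d d) = cnj (u / (1 + cnj d))" by (simp only: g)
  then have g': "1 - cnj (gamma_d d) = u / (1 + d)" by (simp add: u)
  have ne: "gamma_d d \<noteq> 1" using cmod_gamma_d[OF d] by auto
  have "cnj (ph (gamma_d d)) = cnj ((1 - cnj (gamma_d d)) / (1 - gamma_d d))" using ne by (simp add: ph_def)
  also have "\<dots> = (1 - gamma_d d) / (1 - cnj (gamma_d d))" by simp
  also have "\<dots> = om" unfolding g g' om_def using u by simp
  finally have "cnj (ph (gamma_d d)) = om" .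
  then show ?thesis by (simp add: const_verb_def verb_of_def_def)
qed

lemma opuc_const_bound:
  assumes z: "cmod z = 1"
  shows "cmod (poly (opuc const_verb k) z) \<le> 2 ^ k"
proof (induction k)
  case (Suc k)
  have "cmod (cnj (const_verb k)) \<le> 1"
    unfolding cnj_const_verb using cmod_gamma_d[OF d] om(1) by (simp add: norm_mult norm_power)
  then have "cmod (cnj (const_verb k) * poly (ropuc const_verb k) z) \<le> 1 * cmod (poly (opuc const_verb k) z)"
    unfolding norm_mult cmod_ropuc_circle[OF z] by (intro mult_right_mono) auto
  then have "cmod (poly (opuc const_verb (Suc k)) z) \<le> cmod (poly (opuc const_verb k) z) + cmod (poly (opuc const_verb k) z)"
    unfolding poly_opuc_Suc using z by (intro order_trans[OF norm_triangle_ineq4]) (simp add: norm_mult)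
  then show ?case using Suc by simp
qed simp

text \<open>
  Eliminating the reversed polynomials from two steps of the Szego recursion, where the ratio of
  consecutive coefficients is the constant \<open>om\<close>.
\<close>
lemma opuc_const_rec:
  "poly (opuc const_verb (Suc (Suc k))) z = (z + om) * poly (opuc const_verb (Suc k)) z
     - om * of_real (1 - (cmod (gamma_d d))\<^sup>2) * z * poly (opuc const_verb k) z"
proof -
  define \<gamma> where "\<gamma> = gamma_d d"
  define P where "P = poly (opuc const_verb k) z"
  define Q where "Q = poly (ropuc const_verb k) z"
  have c: "cnj (const_verb j) = \<gamma> * om ^ j" for j unfolding \<gamma>_def by (rule cnj_const_verb)
  have ck: "const_verb j = cnj \<gamma> * cnj om ^ j" for j
    using arg_cong[OF c[of j], of cnj] by simp
  have o: "om ^ k * cnj om ^ k = 1" unfolding power_mult_distrib[symmetric] om(2) by simp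
  have n: "of_real (1 - (cmod \<gamma>)\<^sup>2) = 1 - \<gamma> * cnj \<gamma>" by (simp add: complex_norm_square del: of_real_power)
  have 1: "poly (opuc const_verb (Suc k)) z = z * P - \<gamma> * om ^ k * Q"
    unfolding poly_opuc_Suc c P_def Q_def ..
  have 2: "poly (ropuc const_verb (Suc k)) z = Q - cnj \<gamma> * cnj om ^ k * z * P"
    unfolding poly_opuc_Suc(2)[of const_verb k z] ck[of k] P_def Q_def ..
  have "poly (opuc const_verb (Suc (Suc k))) z = z * poly (opuc const_verb (Suc k)) z - \<gamma> * om ^ Suc k * poly (ropuc const_verb (Suc k)) z"
    unfolding poly_opuc_Suc(1)[of const_verb "Suc k" z] c ..
  also have "\<dots> = z * (z * P - \<gamma> * om ^ k * Q) - \<gamma> * om * om ^ k * Q + \<gamma> * cnj \<gamma> * om * z * P * (om ^ k * cnj om ^ k)"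
    unfolding 1 2 by (simp add: algebra_simps)
  also have "\<dots> = (z + om) * (z * P - \<gamma> * om ^ k * Q) - om * (1 - \<gamma> * cnj \<gamma>) * z * P"
    unfolding o by (simp add: algebra_simps)
  finally show ?thesis unfolding 1 \<gamma>_def[symmetric] n P_def by simp
qed

lemma opuc_const_generating:
  assumes z: "cmod z = 1" and x: "cmod x < 1 / 2"
  shows "summable (\<lambda>k. x ^ k * poly (opuc const_verb k) z)"
    and "(\<Sum>k. x ^ k * poly (opuc const_verb k) z) * (1 - x * om - z * x * (1 - x * om * of_real (1 - (cmod (gamma_d d))\<^sup>2)))
      = 1 - x * (gamma_d d + om)"
proof -
  define r where "r = complex_of_real (1 - (cmod (gamma_d d))\<^sup>2)"
  define G where "G k = x ^ k * poly (opuc const_verb k) z" for k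
  have "norm (G k) \<le> (cmod x * 2) ^ k" for k
    unfolding G_def norm_mult norm_power power_mult_distrib by (intro mult_left_mono opuc_const_bound z) simp
  then have s: "summable G" using x by (intro summable_comparison_test'[of "\<lambda>k. (cmod x * 2) ^ k" 0 G] summable_geometric) auto
  then show "summable (\<lambda>k. x ^ k * poly (opuc const_verb k) z)" by (simp add: G_def[abs_def])
  have s1: "summable (\<lambda>k. G (Suc k))" by (rule iffD2[OF summable_Suc_iff s])
  have rec: "G (Suc (Suc k)) = x * (z + om) * G (Suc k) - x * x * om * r * z * G k" for k
    unfolding G_def opuc_const_rec r_def by (simp add: algebra_simps)
  have h1: "(\<Sum>k. G (Suc k)) = suminf G - G 0" by (rule suminf_split_head[OF s])
  have h2: "(\<Sum>k. G (Suc (Suc k))) = (\<Sum>k. G (Suc k)) - G 1" using suminf_split_head[OF s1] by simp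
  have "(\<Sum>k. G (Suc (Suc k))) = x * (z + om) * (\<Sum>k. G (Suc k)) - x * x * om * r * z * suminf G"
    unfolding rec by (subst suminf_diff[symmetric]) (auto intro!: summable_mult s s1 simp: suminf_mult s s1)
  then have "suminf G - G 0 - G 1 = x * (z + om) * (suminf G - G 0) - x * x * om * r * z * suminf G"
    unfolding h2 h1 .
  moreover have "G 0 = 1" "G 1 = x * (z - gamma_d d)"
    using cnj_const_verb[of 0] by (simp_all add: G_def poly_opuc_Suc)
  ultimately have "suminf G - 1 - x * (z - gamma_d d) = x * (z + om) * (suminf G - 1) - x * x * om * r * z * suminf G"
    by simp
  then have "suminf G * (1 - x * om - z * x * (1 - x * om * r)) = 1 - x * (gamma_d d + om)"
    by (simp add: algebra_simps)
  then show "(\<Sum>k. x ^ k * poly (opuc const_verb k) z) * (1 - x * om - z * x * (1 - x * om * of_real (1 - (cmod (gamma_d d))\<^sup>2)))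
      = 1 - x * (gamma_d d + om)" by (simp add: G_def[abs_def] r_def)
qed

end

context limit_param
begin

lemma mu_d_prob: "mu_d d \<in> space (prob_algebra circle)"
proof -
  have "hbi (\<lambda>\<psi>. of_real (v \<psi>) * 1) 1"
    using hbi_generating[of 0] t_bounds by (simp add: y1_def)
  then have h: "has_bochner_integral (mu_d d) (\<lambda>_. 1::complex) 1"
    by (intro has_bochner_integral_mu_d) auto
  have "integral\<^sup>L (mu_d d) (\<lambda>_. 1::complex) = 1"
    using h by (auto simp: has_bochner_integral_iff)
  then have m: "measure (mu_d d) (space (mu_d d)) = 1" by (simp add: scaleR_conv_of_real)
  then have "emeasure (mu_d d) (space (mu_d d)) \<noteq> \<infinity>" by (auto simp: measure_def)
  then have "prob_space (mu_d d)"
    using m by (intro prob_spaceI) (simp add: emeasure_eq_ennreal_measure)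
  moreover have "sets (mu_d d) = sets circle" by (simp add: mu_d_def d_nz)
  ultimately show ?thesis by (simp add: space_prob_algebra)
qed

text \<open>
  The numerator of the generating function at \<open>x = X cnj om\<close> is \<open>1 - X / (1 + d)\<close>, which cancels the
  value of the integral \<open>hbi_generating\<close>.
\<close>
lemma gamma_om: "1 + gamma_d d * cnj (om d) = 1 / (1 + d)"
proof -
  have "gamma_d d * cnj (om d) = - d / (1 + d)"
    unfolding om(3)[OF Re_d] gamma_d_def using one_plus_d by simp
  moreover have "1 + - d / (1 + d) = 1 / (1 + d)" using one_plus_d by (simp add: field_simps)
  ultimately show ?thesis by simp
qed

lemma rho_gamma: "1 - (cmod (gamma_d d))\<^sup>2 = \<rho>\<^sup>2"
proof -
  have "cmod (1 + cnj d) = f" using complex_mod_cnj[of "1 + d"] by (simp add: f_def)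
  then have "cmod (gamma_d d) = e / f" by (simp add: gamma_d_def norm_divide e_def)
  then have "1 - (cmod (gamma_d d))\<^sup>2 = (f\<^sup>2 - e\<^sup>2) / f\<^sup>2"
    using f_pos by (simp add: power_divide diff_divide_distrib)
  then show ?thesis by (simp add: \<rho>_def power_divide f2')
qed

text \<open>
  The generating function integrates to \<open>1\<close> for all small positive \<open>X\<close>, so all its coefficients but the
  first vanish.
\<close>
lemma integral_opuc_mu_d:
  assumes m: "m > 0"
  shows "(\<integral>z. poly (opuc (const_verb d) m) z \<partial>mu_d d) = 0"
proof -
  define P where "P k z = poly (opuc (const_verb d) k) z" for k z
  define c where "c k = cnj (om d) ^ k * (\<integral>z. P k z \<partial>mu_d d)" for k
  have sp: "space (mu_d d) = sphere 0 1" "prob_space (mu_d d)" using prob_algebra_circleD[OF mu_d_prob] by auto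
  interpret prob_space "mu_d d" by (rule sp)
  have om1: "cmod (cnj (om d)) = 1" using om(1)[OF Re_d] by simp
  have int: "integrable (mu_d d) (\<lambda>z. y * P k z)" for k y
    unfolding P_def by (intro integrable_circle_complex[OF mu_d_prob] continuous_intros)
  have Pb: "cmod (P k z) \<le> 2 ^ k" if "z \<in> space (mu_d d)" for k z
    unfolding P_def using that by (intro opuc_const_bound[OF Re_d]) (simp add: sp)
  have key: "(\<lambda>k. \<integral>z. x ^ k * P k z \<partial>mu_d d) sums (\<integral>z. (\<Sum>k. x ^ k * P k z) \<partial>mu_d d)" if x: "cmod x < 1 / 2" for x
  proof (rule sums_integral)
    show "integrable (mu_d d) (\<lambda>z. x ^ k * P k z)" for k by (rule int)
    have nb: "norm (x ^ k * P k z) \<le> (cmod x * 2) ^ k" if "z \<in> space (mu_d d)" for k z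
      unfolding norm_mult norm_power power_mult_distrib by (intro mult_left_mono Pb that) simp
    have g: "summable (\<lambda>k. (cmod x * 2) ^ k)" using x by (intro summable_geometric) simp
    show "AE z in mu_d d. summable (\<lambda>k. norm (x ^ k * P k z))"
      by (intro AE_I2 summable_comparison_test'[OF g, of 0]) (use nb in simp)
    show "summable (\<lambda>k. \<integral>z. norm (x ^ k * P k z) \<partial>mu_d d)"
    proof (rule summable_comparison_test'[OF g, of 0])
      fix k
      have "(\<integral>z. norm (x ^ k * P k z) \<partial>mu_d d) \<le> (\<integral>z. (cmod x * 2) ^ k \<partial>mu_d d)"
        by (intro integral_mono integrable_norm int nb) auto
      moreover have "0 \<le> (\<integral>z. norm (x ^ k * P k z) \<partial>mu_d d)" by simp
      ultimately show "norm (\<integral>z. norm (x ^ k * P k z) \<partial>mu_d d) \<le> (cmod x * 2) ^ k" by (simp add: prob_space)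
    qed
  qed
  have "c m = 0"
  proof (rule power_series_eq_const[OF _ _ _ m])
    show "min t (1 / 4) > 0" using t_bounds by simp
    have cx: "c n * x ^ n = (\<integral>z. (cnj (om d) * x) ^ n * P n z \<partial>mu_d d)" for n x
      by (simp add: c_def power_mult_distrib)
    show "summable (\<lambda>n. c n * x ^ n)" if "cmod x < min t (1 / 4)" for x
      unfolding cx by (rule sums_summable[OF key]) (use that om1 in \<open>simp add: norm_mult\<close>)
    fix X :: real assume X: "0 < X" "X < min t (1 / 4)"
    define x where "x = cnj (om d) * of_real X"
    have xs: "cmod x < 1 / 2" using X om1 by (simp add: x_def norm_mult)
    define u where "u = 1 - of_real X / (1 + d)"
    have xo: "x * om d = of_real X" using om(2)[OF Re_d] by (simp add: x_def mult_ac)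
    have num: "1 - x * (gamma_d d + om d) = u"
    proof -
      have "1 - x * (gamma_d d + om d) = 1 - of_real X * (1 + gamma_d d * cnj (om d))"
        using xo by (simp add: x_def algebra_simps)
      then show ?thesis unfolding gamma_om u_def by simp
    qed
    have u: "u \<noteq> 0" unfolding u_def using X by (intro X_quot) simp
    have F: "(\<Sum>k. x ^ k * P k z) = u * (1 / (of_real (1 - X) - z * ((1 + cnj d) / (1 + d)) * of_real (y1 X)))"
      if z: "cmod z = 1" for z
    proof -
      have dd: "1 - x * om d - z * x * (1 - x * om d * of_real (1 - (cmod (gamma_d d))\<^sup>2))
          = of_real (1 - X) - z * ((1 + cnj d) / (1 + d)) * of_real (y1 X)"
        unfolding xo rho_gamma unfolding x_def om(3)[OF Re_d] y1_def by (simp add: mult_ac)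
      have "(\<Sum>k. x ^ k * P k z) * (of_real (1 - X) - z * ((1 + cnj d) / (1 + d)) * of_real (y1 X)) = u"
        using opuc_const_generating(2)[OF Re_d z xs] unfolding dd num P_def .
      moreover from this have "of_real (1 - X) - z * ((1 + cnj d) / (1 + d)) * of_real (y1 X) \<noteq> 0" using u by auto
      ultimately show ?thesis by (simp add: nonzero_eq_divide_eq)
    qed
    have "has_bochner_integral (mu_d d) (\<lambda>z. 1 / (of_real (1 - X) - z * ((1 + cnj d) / (1 + d)) * of_real (y1 X))) (1 / u)"
      unfolding u_def
    proof (rule has_bochner_integral_mu_d)
      show "(\<lambda>z. 1 / (of_real (1 - X) - z * ((1 + cnj d) / (1 + d)) * of_real (y1 X))) \<in> borel_measurable circle"
        by (rule measurable_restrict_space1) measurable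
    qed (rule hbi_generating, use X in simp)
    then have "(\<integral>z. u * (1 / (of_real (1 - X) - z * ((1 + cnj d) / (1 + d)) * of_real (y1 X))) \<partial>mu_d d) = u * (1 / u)"
      by (intro has_bochner_integral_integral_eq has_bochner_integral_mult_right)
    moreover have "(\<integral>z. (\<Sum>k. x ^ k * P k z) \<partial>mu_d d)
        = (\<integral>z. u * (1 / (of_real (1 - X) - z * ((1 + cnj d) / (1 + d)) * of_real (y1 X))) \<partial>mu_d d)"
      by (intro Bochner_Integration.integral_cong refl F) (simp add: sp)
    ultimately have one: "(\<integral>z. (\<Sum>k. x ^ k * P k z) \<partial>mu_d d) = 1" using u by simp
    have "(\<Sum>n. c n * of_real X ^ n) = 1"
      unfolding cx x_def[symmetric] using key[OF xs] unfolding one by (rule sums_unique[symmetric])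
    moreover have "c 0 = 1" by (simp add: c_def P_def prob_space)
    ultimately show "(\<Sum>n. c n * of_real X ^ n) = c 0" by simp
  qed
  moreover have "cnj (om d) \<noteq> 0" using om1 by auto
  ultimately show ?thesis by (simp add: c_def P_def)
qed

end

lemma reflection_invariant_distr:
  assumes N: "reflection_invariant N" and u: "cmod u = 1"
  shows "distr N borel (\<lambda>z. u * cnj z) = N"
proof (rule measure_eqI)
  have s: "sets N = sets borel" using N by (simp add: reflection_invariant_def)
  have m: "(\<lambda>z. u * cnj z) \<in> N \<rightarrow>\<^sub>M borel"
    unfolding measurable_cong_sets[OF s refl] by (intro borel_measurable_continuous_onI continuous_intros)
  show "sets (distr N borel (\<lambda>z. u * cnj z)) = sets N" by (simp add: s)
  fix A assume "A \<in> sets (distr N borel (\<lambda>z. u * cnj z))"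
  then have A: "A \<in> sets borel" by simp
  have "emeasure (distr N borel (\<lambda>z. u * cnj z)) A = (\<integral>\<^sup>+z. indicator A z \<partial>distr N borel (\<lambda>z. u * cnj z))"
    using A by simp
  also have "\<dots> = (\<integral>\<^sup>+z. indicator A (u * cnj z) \<partial>N)" using A by (intro nn_integral_distr m) simp
  also have "\<dots> = (\<integral>\<^sup>+z. indicator A z \<partial>N)" using N u A by (simp add: reflection_invariant_def)
  also have "\<dots> = emeasure N A" using A s by simp
  finally show "emeasure (distr N borel (\<lambda>z. u * cnj z)) A = emeasure N A" .
qed

lemma cis_circle_measurable:
  "cis \<in> uniform_measure lborel {0..<2*pi} \<rightarrow>\<^sub>M circle" "cis \<in> uniform_measure lborel {0..<2*pi} \<rightarrow>\<^sub>M borel"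
proof -
  have "cis \<in> borel \<rightarrow>\<^sub>M circle" by (intro measurable_restrict_space2) auto
  then show "cis \<in> uniform_measure lborel {0..<2*pi} \<rightarrow>\<^sub>M circle" by (simp cong: measurable_cong_sets)
  show "cis \<in> uniform_measure lborel {0..<2*pi} \<rightarrow>\<^sub>M borel" by (simp cong: measurable_cong_sets)
qed

lemma haar_circle_prob: "haar_circle \<in> space (prob_algebra circle)"
proof -
  interpret prob_space "uniform_measure lborel {0..<2*pi}"
    by (rule prob_space_uniform_measure) auto
  have "prob_space haar_circle"
    unfolding haar_circle_def by (rule prob_space_distr[OF cis_circle_measurable(1)])
  then show ?thesis by (simp add: space_prob_algebra haar_circle_def)
qed

text \<open>
  Rotation by a \<open>2k\<close>-th root of unity changes the sign of \<open>z\<^sup>k\<close>.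
\<close>
lemma integral_power_haar:
  assumes k: "k > 0"
  shows "(\<integral>z. z ^ k \<partial>haar_circle) = 0"
proof -
  have pm: "(\<lambda>z::complex. z ^ k) \<in> borel_measurable borel" by measurable
  have "(\<lambda>z::complex. z ^ k) \<in> borel_measurable circle" by (rule measurable_restrict_space1[OF pm])
  then have "(\<integral>z. z ^ k \<partial>haar_circle) = (\<integral>\<theta>. cis \<theta> ^ k \<partial>uniform_measure lborel {0..<2*pi})"
    unfolding haar_circle_def by (intro integral_distr cis_circle_measurable)
  also have "\<dots> = (\<integral>z. z ^ k \<partial>nu_law 1)"
    unfolding nu_law_def using integral_distr[OF cis_circle_measurable(2) pm] by simp
  finally have h: "(\<integral>z. z ^ k \<partial>haar_circle) = (\<integral>z. z ^ k \<partial>nu_law 1)" .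
  define J where "J = (\<integral>z. z ^ k \<partial>nu_law 1)"
  have J: "J = u ^ k * cnj J" if u: "cmod u = 1" for u
  proof -
    have m: "(\<lambda>z. u * cnj z) \<in> nu_law 1 \<rightarrow>\<^sub>M borel"
      unfolding measurable_cong_sets[OF sets_nu_law refl] by (intro borel_measurable_continuous_onI continuous_intros)
    have "J = (\<integral>z. z ^ k \<partial>distr (nu_law 1) borel (\<lambda>z. u * cnj z))"
      unfolding J_def reflection_invariant_distr[OF reflection_invariant_nu_law u] ..
    also have "\<dots> = (\<integral>z. u ^ k * cnj (z ^ k) \<partial>nu_law 1)"
      unfolding integral_distr[OF m pm] by (simp add: power_mult_distrib)
    also have "\<dots> = u ^ k * cnj J"
      unfolding J_def using Bochner_Integration.integral_cnj[of "nu_law 1" "\<lambda>z. z ^ k"] by simp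
    finally show ?thesis .
  qed
  have "cis (pi / real k) ^ k = -1" unfolding Complex.DeMoivre using k by simp
  then have "J = - cnj J" using J[of "cis (pi / real k)"] by simp
  moreover have "J = cnj J" using J[of 1] by simp
  ultimately have "J = 0" by (auto simp: complex_eq_iff)
  then show ?thesis unfolding h J_def .
qed

lemma mu_d_in_prob:
  assumes "Re d \<ge> 0"
  shows "mu_d d \<in> space (prob_algebra circle)"
proof (cases "d = 0")
  case True
  then show ?thesis using haar_circle_prob by (simp add: mu_d_def)
next
  case False
  then interpret limit_param d using assms by unfold_locales
  show ?thesis by (rule mu_d_prob)
qed

theorem moments_mu_d:
  assumes d: "Re d \<ge> 0"
  shows "(\<integral>z. z ^ k \<partial>mu_d d) = mom (verb_of_def (\<lambda>_. gamma_d d)) k"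
proof -
  have "(\<integral>z. poly (opuc (const_verb d) m) z \<partial>mu_d d) = 0" if m: "m > 0" for m
  proof (cases "d = 0")
    case True
    then have c: "cnj (const_verb d j) = 0" for j using cnj_const_verb[OF d, of j] by (simp add: gamma_d_def)
    have "poly (opuc (const_verb d) j) z = z ^ j" for j z
      by (induction j) (simp_all add: poly_opuc_Suc c del: complex_cnj_zero_iff)
    then show ?thesis using integral_power_haar[OF m] True by (simp add: mu_d_def)
  next
    case False
    then interpret limit_param d using d by unfold_locales
    show ?thesis by (rule integral_opuc_mu_d[OF m])
  qed
  then show ?thesis
    using moment_eq_mom[OF mu_d_in_prob[OF d], of k "const_verb d" k] by (simp add: const_verb_def[OF d])
qed


section \<open>Continuity of moments\<close>

lemma coeff_opuc_tendsto:
  assumes "\<And>i. i < k \<Longrightarrow> (\<lambda>j. \<alpha> j i) \<longlonglongrightarrow> \<alpha>' i"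
  shows "(\<lambda>j. coeff (opuc (\<alpha> j) k) n) \<longlonglongrightarrow> coeff (opuc \<alpha>' k) n
    \<and> (\<lambda>j. coeff (ropuc (\<alpha> j) k) n) \<longlonglongrightarrow> coeff (ropuc \<alpha>' k) n"
  using assms
proof (induction k arbitrary: n)
  case (Suc k)
  have IH: "(\<lambda>j. coeff (opuc (\<alpha> j) k) n) \<longlonglongrightarrow> coeff (opuc \<alpha>' k) n"
    "(\<lambda>j. coeff (ropuc (\<alpha> j) k) n) \<longlonglongrightarrow> coeff (ropuc \<alpha>' k) n" for n
    using Suc.IH[of n] Suc.prems by auto
  have pc: "(\<lambda>j. coeff (pCons 0 (opuc (\<alpha> j) k)) n) \<longlonglongrightarrow> coeff (pCons 0 (opuc \<alpha>' k)) n" for n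
    by (cases n) (auto intro: IH)
  have a: "(\<lambda>j. \<alpha> j k) \<longlonglongrightarrow> \<alpha>' k" using Suc.prems by simp
  show ?case
    unfolding opuc_Suc ropuc_Suc coeff_diff coeff_smult
    by (intro conjI tendsto_intros IH pc a)
qed simp

lemma mom_tendsto:
  "(\<And>i. i < k \<Longrightarrow> (\<lambda>j. \<alpha> j i) \<longlonglongrightarrow> \<alpha>' i) \<Longrightarrow> (\<lambda>j. mom (\<alpha> j) k) \<longlonglongrightarrow> mom \<alpha>' k"
proof (induction k rule: less_induct)
  case (less k)
  show ?case
  proof (cases k)
    case (Suc l)
    have "(\<lambda>j. coeff (opuc (\<alpha> j) (Suc l)) i) \<longlonglongrightarrow> coeff (opuc \<alpha>' (Suc l)) i" for i
      using coeff_opuc_tendsto[of "Suc l" \<alpha> \<alpha>' i] less.prems Suc by blast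
    moreover have "(\<lambda>j. mom (\<alpha> j) i) \<longlonglongrightarrow> mom \<alpha>' i" if "i \<in> {..l}" for i
      using less that Suc by simp
    ultimately show ?thesis unfolding Suc mom.simps by (intro tendsto_intros)
  qed simp
qed

lemma verb_of_def_tendsto:
  assumes g: "g \<noteq> 1" and lim: "\<And>i. i \<le> k \<Longrightarrow> (\<lambda>j. \<gamma> j i) \<longlonglongrightarrow> g"
  shows "(\<lambda>j. verb_of_def (\<gamma> j) k) \<longlonglongrightarrow> verb_of_def (\<lambda>_. g) k"
proof -
  have ph: "(\<lambda>j. ph (x j)) \<longlonglongrightarrow> ph g" if x: "x \<longlonglongrightarrow> g" for x
  proof (rule Lim_transform_eventually)
    show "(\<lambda>j. (1 - cnj (x j)) / (1 - x j)) \<longlonglongrightarrow> ph g"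
      using g x unfolding ph_def by (auto intro!: tendsto_eq_intros)
    show "\<forall>\<^sub>F j in sequentially. (1 - cnj (x j)) / (1 - x j) = ph (x j)"
      using tendsto_imp_eventually_ne[OF x g] by eventually_elim (simp add: ph_def)
  qed
  show ?thesis unfolding verb_of_def_def
    by (intro tendsto_intros tendsto_prod ph lim) auto
qed

text \<open>
  Continuity of the moments at a constant sequence, in the first \<open>k\<close> coordinates only.
\<close>
lemma mom_near_constant:
  assumes g: "g \<noteq> 1" and \<epsilon>: "\<epsilon> > 0"
  shows "\<exists>\<eta>>0. \<forall>\<gamma>. (\<forall>i<k. cmod (\<gamma> i - g) < \<eta>) \<longrightarrow>
      cmod (mom (verb_of_def \<gamma>) k - mom (verb_of_def (\<lambda>_. g)) k) < \<epsilon>"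
proof (rule ccontr)
  assume "\<not> ?thesis"
  then have "\<exists>\<gamma>. (\<forall>i<k. cmod (\<gamma> i - g) < inverse (real (Suc j))) \<and>
      \<not> cmod (mom (verb_of_def \<gamma>) k - mom (verb_of_def (\<lambda>_. g)) k) < \<epsilon>" for j
    by (metis inverse_positive_iff_positive of_nat_0_less_iff zero_less_Suc)
  then obtain \<gamma> where \<gamma>: "\<And>j i. i < k \<Longrightarrow> cmod (\<gamma> j i - g) < inverse (real (Suc j))"
    "\<And>j. \<not> cmod (mom (verb_of_def (\<gamma> j)) k - mom (verb_of_def (\<lambda>_. g)) k) < \<epsilon>"
    by metis
  have "(\<lambda>j. \<gamma> j i) \<longlonglongrightarrow> g" if "i < k" for i
  proof (rule LIM_zero_cancel, rule Lim_null_comparison[OF _ LIMSEQ_inverse_real_of_nat])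
    show "\<forall>\<^sub>F j in sequentially. norm (\<gamma> j i - g) \<le> inverse (real (Suc j))"
      using \<gamma>(1)[OF that] by (intro always_eventually allI less_imp_le)
  qed
  then have "(\<lambda>j. mom (verb_of_def (\<gamma> j)) k) \<longlonglongrightarrow> mom (verb_of_def (\<lambda>_. g)) k"
    by (intro mom_tendsto verb_of_def_tendsto g) auto
  then have "\<forall>\<^sub>F j in sequentially. dist (mom (verb_of_def (\<gamma> j)) k) (mom (verb_of_def (\<lambda>_. g)) k) < \<epsilon>"
    using \<epsilon> by (rule tendstoD)
  then show False using \<gamma>(2) by (simp add: dist_norm)
qed

lemma moms_near_constant:
  assumes g: "g \<noteq> 1" and \<epsilon>: "\<epsilon> > 0"
  shows "\<exists>\<eta>>0. \<forall>\<gamma>. (\<forall>i<K. cmod (\<gamma> i - g) < \<eta>) \<longrightarrow>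
      (\<forall>k\<le>K. cmod (mom (verb_of_def \<gamma>) k - mom (verb_of_def (\<lambda>_. g)) k) < \<epsilon>)"
proof -
  obtain h where h: "\<And>k. h k > 0" "\<And>k \<gamma>. (\<forall>i<k. cmod (\<gamma> i - g) < h k) \<Longrightarrow>
      cmod (mom (verb_of_def \<gamma>) k - mom (verb_of_def (\<lambda>_. g)) k) < \<epsilon>"
    using mom_near_constant[OF g \<epsilon>] by metis
  define \<eta> where "\<eta> = Min (h ` {..K})"
  have "\<eta> > 0" using h(1) by (simp add: \<eta>_def)
  moreover have "\<eta> \<le> h k" if "k \<le> K" for k using that by (auto simp: \<eta>_def)
  ultimately show ?thesis
    by (intro exI[of _ \<eta>] conjI allI impI h(2)) (auto intro: less_le_trans)
qed

text \<open>
  If closeness of finitely many moments were never sufficient, a sequence of counterexamples would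
  converge weakly.
\<close>
lemma dist_small_if_moments_close:
  assumes dst: "metrizes_weak dst" and \<nu>: "\<nu> \<in> space (prob_algebra circle)" and \<epsilon>: "\<epsilon> > 0"
  shows "\<exists>K. \<exists>\<eta>>0. \<forall>\<mu>\<in>space (prob_algebra circle).
      (\<forall>k\<le>K. cmod ((\<integral>z. z ^ k \<partial>\<mu>) - (\<integral>z. z ^ k \<partial>\<nu>)) < \<eta>) \<longrightarrow> dst \<mu> \<nu> \<le> \<epsilon>"
proof (rule ccontr)
  assume "\<not> ?thesis"
  then have "\<exists>\<mu>\<in>space (prob_algebra circle).
      (\<forall>k\<le>j. cmod ((\<integral>z. z ^ k \<partial>\<mu>) - (\<integral>z. z ^ k \<partial>\<nu>)) < inverse (real (Suc j))) \<and> \<not> dst \<mu> \<nu> \<le> \<epsilon>" for j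
    by (metis inverse_positive_iff_positive of_nat_0_less_iff zero_less_Suc)
  then obtain \<mu> where \<mu>: "\<And>j. \<mu> j \<in> space (prob_algebra circle)"
    "\<And>j k. k \<le> j \<Longrightarrow> cmod ((\<integral>z. z ^ k \<partial>\<mu> j) - (\<integral>z. z ^ k \<partial>\<nu>)) < inverse (real (Suc j))"
    "\<And>j. \<not> dst (\<mu> j) \<nu> \<le> \<epsilon>"
    by metis
  have "(\<lambda>j. \<integral>z. z ^ k \<partial>\<mu> j) \<longlonglongrightarrow> (\<integral>z. z ^ k \<partial>\<nu>)" for k
  proof (rule LIM_zero_cancel, rule Lim_null_comparison[OF _ LIMSEQ_inverse_real_of_nat])
    show "\<forall>\<^sub>F j in sequentially. norm ((\<integral>z. z ^ k \<partial>\<mu> j) - (\<integral>z. z ^ k \<partial>\<nu>)) \<le> inverse (real (Suc j))"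
      using \<mu>(2)[of k] by (intro eventually_sequentiallyI[of k] less_imp_le)
  qed
  then have "weak_conv_circle \<mu> \<nu>" by (rule weak_conv_circle_if_power_moments[OF \<mu>(1) \<nu>])
  then have "(\<lambda>j. dst (\<mu> j) \<nu>) \<longlonglongrightarrow> 0"
    using dst \<mu>(1) \<nu> unfolding metrizes_weak_def by blast
  then have "\<forall>\<^sub>F j in sequentially. dst (\<mu> j) \<nu> < \<epsilon>" using \<epsilon> by (rule order_tendstoD)
  then obtain j where "dst (\<mu> j) \<nu> < \<epsilon>" using eventually_happens'[OF sequentially_bot] by blast
  then show False using \<mu>(3)[of j] by simp
qed


section \<open>Measurability of the distance to a fixed measure\<close>

lemma mat_mult_entry:
  assumes "A \<in> carrier_mat n n" "B \<in> carrier_mat n n" "i < n" "j < n"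
  shows "(A * B) $$ (i, j) = (\<Sum>l<n. A $$ (i, l) * B $$ (l, j))"
  using assms by (simp add: scalar_prod_def lessThan_atLeast0)

lemma unitary_mat_iff_entries:
  fixes x :: "nat \<times> nat \<Rightarrow> complex"
  shows "unitary_mat n (mat n n x) \<longleftrightarrow>
    (\<forall>i<n. \<forall>j<n. (\<Sum>l<n. cnj (x (l, i)) * x (l, j)) = (if i = j then 1 else 0)
               \<and> (\<Sum>l<n. x (i, l) * cnj (x (j, l))) = (if i = j then 1 else 0))"
proof -
  define A where "A = mat n n x"
  have A: "A \<in> carrier_mat n n" by (simp add: A_def)
  have eq1: "B = 1\<^sub>m n \<longleftrightarrow> (\<forall>i<n. \<forall>j<n. B $$ (i, j) = (if i = j then 1 else 0))" if "B \<in> carrier_mat n n" for B :: "complex mat"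
    using that by (auto simp: mat_eq_iff)
  have c: "mat_adjoint A * A \<in> carrier_mat n n" "A * mat_adjoint A \<in> carrier_mat n n"
    using A by (auto intro!: mult_carrier_mat)
  have "(mat_adjoint A * A) $$ (i, j) = (\<Sum>l<n. cnj (x (l, i)) * x (l, j))"
    "(A * mat_adjoint A) $$ (i, j) = (\<Sum>l<n. x (i, l) * cnj (x (j, l)))" if "i < n" "j < n" for i j
    unfolding mat_mult_entry[OF mat_adjoint_carrier[OF A] A that] mat_mult_entry[OF A mat_adjoint_carrier[OF A] that]
    using that by (auto simp: A_def intro!: sum.cong)
  then show ?thesis
    unfolding unitary_mat_def A_def[symmetric] eq1[OF c(1)] eq1[OF c(2)] using A by auto
qed

lemma coordinate_continuous: "continuous_on S (\<lambda>x :: 'i \<Rightarrow> 'a :: topological_space. x i)"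
  by (rule continuous_on_subset[OF continuous_on_product_coordinates]) simp

lemma closed_unitary: "closed {x :: nat \<times> nat \<Rightarrow> complex. unitary_mat n (mat n n x)}"
proof -
  have "{x :: nat \<times> nat \<Rightarrow> complex. unitary_mat n (mat n n x)} =
    (\<Inter>i\<in>{..<n}. \<Inter>j\<in>{..<n}. {x. (\<Sum>l<n. cnj (x (l, i)) * x (l, j)) = (if i = j then 1 else 0)}
               \<inter> {x. (\<Sum>l<n. x (i, l) * cnj (x (j, l))) = (if i = j then 1 else 0)})"
    unfolding unitary_mat_iff_entries by auto
  also have "closed \<dots>"
    by (intro closed_INT ballI closed_Int closed_Collect_eq continuous_intros coordinate_continuous)
  finally show ?thesis .
qed

lemma pow_entry_tendsto:
  fixes x :: "nat \<Rightarrow> nat \<times> nat \<Rightarrow> complex"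
  assumes x: "\<And>ij. (\<lambda>m. x m ij) \<longlonglongrightarrow> y ij"
  shows "i < n \<Longrightarrow> j < n \<Longrightarrow> (\<lambda>m. (mat n n (x m) ^\<^sub>m k) $$ (i, j)) \<longlonglongrightarrow> (mat n n y ^\<^sub>m k) $$ (i, j)"
proof (induction k arbitrary: i j)
  case (Suc k)
  have e: "(mat n n z ^\<^sub>m Suc k) $$ (i, j) = (\<Sum>l<n. (mat n n z ^\<^sub>m k) $$ (i, l) * z (l, j))" for z :: "nat \<times> nat \<Rightarrow> complex"
    using Suc.prems mat_mult_entry[of "mat n n z ^\<^sub>m k" n "mat n n z" i j] by (simp add: pow_carrier_mat)
  show ?case unfolding e using Suc by (intro tendsto_intros x) auto
qed simp

text \<open>
  The distance is continuous on the closed set of unitary matrices and constant off it, where the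
  spectral measure is undefined.
\<close>
lemma dist_spectral_measure_measurable:
  assumes dst: "metrizes_weak dst" and \<nu>: "\<nu> \<in> space (prob_algebra circle)" and n: "n > 0"
  shows "(\<lambda>A. dst (spectral_measure A (unit_vec n 0)) \<nu>) \<in> borel_measurable (mat_borel n)"
proof -
  interpret Metric_space "space (prob_algebra circle)" dst using dst by (simp add: metrizes_weak_def)
  define C where "C = {x :: nat \<times> nat \<Rightarrow> complex. unitary_mat n (mat n n x)}"
  define h where "h x = dst (spectral_measure (mat n n x) (unit_vec n 0)) \<nu>" for x
  \<comment> \<open>a matrix as a function on all pairs, for which the product topology provides the Borel sets\<close>
  define \<phi> where "\<phi> A = (\<lambda>ij. if ij \<in> {..<n} \<times> {..<n} then A $$ ij else 0)" for A :: "complex mat"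
  have Cb [measurable]: "C \<in> sets borel" unfolding C_def using closed_unitary by (rule borel_closed)
  have cont: "continuous_on C h"
    unfolding continuous_on_sequentially comp_def
  proof (intro allI ballI impI, elim conjE)
    fix x y assume y: "y \<in> C" and x: "\<forall>m. x m \<in> C" and lim: "x \<longlonglongrightarrow> y"
    define \<mu> where "\<mu> z = spectral_measure (mat n n z) (unit_vec n 0)" for z
    have P: "\<mu> z \<in> space (prob_algebra circle)" if "z \<in> C" for z
      unfolding \<mu>_def using spectral_measure_props(1) that n by (simp add: C_def)
    have m: "(\<integral>w. w ^ k \<partial>\<mu> z) = (mat n n z ^\<^sub>m k) $$ (0, 0)" if "z \<in> C" for z k
      unfolding \<mu>_def using spectral_measure_props(2) that n by (simp add: C_def)
    have "(\<lambda>m. x m ij) \<longlonglongrightarrow> y ij" for ij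
      using continuous_on_tendsto_compose[OF coordinate_continuous[of UNIV ij] lim] by simp
    then have "(\<lambda>l. \<integral>w. w ^ k \<partial>\<mu> (x l)) \<longlonglongrightarrow> (\<integral>w. w ^ k \<partial>\<mu> y)" for k
      using pow_entry_tendsto[of x y 0 n 0 k] n x y by (simp add: m)
    then have "weak_conv_circle (\<lambda>l. \<mu> (x l)) (\<mu> y)"
      using P x y by (intro weak_conv_circle_if_power_moments) auto
    moreover have "range (\<lambda>l. \<mu> (x l)) \<subseteq> space (prob_algebra circle)" using P x by auto
    ultimately have z: "(\<lambda>l. dst (\<mu> (x l)) (\<mu> y)) \<longlonglongrightarrow> 0"
      using dst P[OF y] unfolding metrizes_weak_def by blast
    have "\<bar>dst (\<mu> (x l)) \<nu> - dst (\<mu> y) \<nu>\<bar> \<le> dst (\<mu> (x l)) (\<mu> y)" for l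
      using triangle[of "\<mu> (x l)" "\<mu> y" \<nu>] triangle[of "\<mu> y" "\<mu> (x l)" \<nu>] commute[of "\<mu> y" "\<mu> (x l)"] P x y \<nu>
      by (simp add: abs_le_iff)
    then have "(\<lambda>l. dst (\<mu> (x l)) \<nu> - dst (\<mu> y) \<nu>) \<longlonglongrightarrow> 0"
      by (intro Lim_null_comparison[OF _ z] always_eventually allI) simp
    then show "(\<lambda>l. h (x l)) \<longlonglongrightarrow> h y" unfolding h_def \<mu>_def by (rule LIM_zero_cancel)
  qed
  have "(\<lambda>A. \<phi> A ij) \<in> borel_measurable (mat_borel n)" for ij
    unfolding \<phi>_def using mat_borel_entry[of "fst ij" n "snd ij"] by (cases "ij \<in> {..<n} \<times> {..<n}") auto
  then have \<phi>m: "\<phi> \<in> borel_measurable (mat_borel n)"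
    by (rule measurable_coordinatewise_then_product)
  \<comment> \<open>off \<open>C\<close> the value of \<open>spectral_measure\<close> is \<open>undefined\<close>\<close>
  define H where "H x = indicator C x *\<^sub>R h x + (1 - indicator C x) * dst undefined \<nu>" for x
  have "H \<in> borel_measurable borel"
    unfolding H_def[abs_def] using borel_measurable_continuous_on_indicator[OF Cb cont] by measurable
  from measurable_compose[OF \<phi>m this]
  have "(\<lambda>A. H (\<phi> A)) \<in> borel_measurable (mat_borel n)" .
  moreover have "H (\<phi> A) = dst (spectral_measure A (unit_vec n 0)) \<nu>" if "A \<in> space (mat_borel n)" for A
  proof -
    have A: "A \<in> carrier_mat n n" using that by simp
    have "mat n n (\<phi> A) = A" using A by (intro eq_matI) (auto simp: \<phi>_def)
    then show ?thesis
      using spectral_measure_not_unitary[OF A] by (auto simp: H_def C_def h_def indicator_def)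
  qed
  ultimately show ?thesis by (rule measurable_cong[THEN iffD1, rotated])
qed


section \<open>Convergence in probability\<close>

lemma dist_small_if_deformed_near:
  assumes dst: "metrizes_weak dst" and d: "Re d \<ge> 0" and \<epsilon>: "\<epsilon> > 0"
  shows "\<exists>K. \<exists>\<eta>>0. \<forall>m\<ge>K. \<forall>\<gamma>. def_dom (Suc m) \<gamma> \<longrightarrow> (\<forall>i<K. cmod (\<gamma> i - gamma_d d) < \<eta>) \<longrightarrow>
      dst (spectral_measure (GGT (Suc m) (verb_of_def \<gamma>)) (unit_vec (Suc m) 0)) (mu_d d) \<le> \<epsilon>"
proof -
  note P = mu_d_in_prob[OF d]
  have g: "gamma_d d \<noteq> 1" using cmod_gamma_d[OF d] by auto
  obtain K \<eta>1 where K: "\<eta>1 > 0" "\<And>\<mu>. \<mu> \<in> space (prob_algebra circle) \<Longrightarrow>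
      (\<forall>k\<le>K. cmod ((\<integral>z. z ^ k \<partial>\<mu>) - (\<integral>z. z ^ k \<partial>mu_d d)) < \<eta>1) \<Longrightarrow> dst \<mu> (mu_d d) \<le> \<epsilon>"
    using dist_small_if_moments_close[OF dst P \<epsilon>] by metis
  obtain \<eta> where \<eta>: "\<eta> > 0" "\<And>\<gamma> k. (\<forall>i<K. cmod (\<gamma> i - gamma_d d) < \<eta>) \<Longrightarrow> k \<le> K \<Longrightarrow>
      cmod (mom (verb_of_def \<gamma>) k - mom (verb_of_def (\<lambda>_. gamma_d d)) k) < \<eta>1"
    using moms_near_constant[OF g K(1), of K] by metis
  show ?thesis
  proof (intro exI[of _ K] exI[of _ \<eta>] conjI allI impI \<eta>(1))
    fix m \<gamma> assume m: "K \<le> m" and dom: "def_dom (Suc m) \<gamma>" and near: "\<forall>i<K. cmod (\<gamma> i - gamma_d d) < \<eta>"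
    have v: "verb_of_def \<gamma> \<in> verb_dom (Suc m)" using dom by (intro verb_of_def_dom) (simp add: def_dom_def)
    show "dst (spectral_measure (GGT (Suc m) (verb_of_def \<gamma>)) (unit_vec (Suc m) 0)) (mu_d d) \<le> \<epsilon>"
      unfolding spectral_measure_GGT[OF v]
    proof (rule K(2))
      show "measure_of_verblunsky (Suc m) (verb_of_def \<gamma>) \<in> space (prob_algebra circle)"
        by (rule n_point_measuresD(1)[OF measure_of_verblunsky_props(1)[OF v]])
      show "\<forall>k\<le>K. cmod ((\<integral>z. z ^ k \<partial>measure_of_verblunsky (Suc m) (verb_of_def \<gamma>)) - (\<integral>z. z ^ k \<partial>mu_d d)) < \<eta>1"
      proof (intro allI impI)
        fix k assume k: "k \<le> K"
        show "cmod ((\<integral>z. z ^ k \<partial>measure_of_verblunsky (Suc m) (verb_of_def \<gamma>)) - (\<integral>z. z ^ k \<partial>mu_d d)) < \<eta>1"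
          using \<eta>(2)[OF near k] moments_measure_of_verblunsky[OF v, of k] k m by (simp add: moments_mu_d[OF d])
      qed
    qed
  qed
qed

theorem theorem5p1:
  fixes \<beta> \<beta>' :: real and d :: complex and \<delta> :: "nat \<Rightarrow> complex"
    and M :: "nat \<Rightarrow> 'a measure" and U :: "nat \<Rightarrow> 'a \<Rightarrow> complex mat"
  assumes "\<beta> > 0" and "\<beta>' = \<beta> / 2" and "Re d \<ge> 0"
    and "\<And>n. \<delta> n = of_real \<beta>' * of_nat n * d"
    and "\<And>n. n \<ge> 1 \<Longrightarrow> prob_space (M n)"
    and "\<And>n. n \<ge> 1 \<Longrightarrow> U n \<in> measurable (M n) (mat_borel n)"
    and "\<And>n. n \<ge> 1 \<Longrightarrow> distr (M n) (mat_borel n) (U n) = CJ n (\<delta> n) \<beta>"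
  shows "weak_conv_in_prob M (\<lambda>n \<omega>. spectral_measure (U n \<omega>) (unit_vec n 0)) (mu_d d)"
  unfolding weak_conv_in_prob_def
proof (intro allI impI conjI)
  note \<beta> = assms(1) and d = assms(3)
  fix dst :: "complex measure \<Rightarrow> complex measure \<Rightarrow> real" assume dst: "metrizes_weak dst"
  note P = mu_d_in_prob[OF d]
  note dm = dist_spectral_measure_measurable[OF dst P]
  show "(\<lambda>\<omega>. dst (spectral_measure (U n \<omega>) (unit_vec n 0)) (mu_d d)) \<in> borel_measurable (M n)" if "1 \<le> n" for n
    using measurable_compose[OF assms(6)[OF that] dm] that by simp
  fix \<epsilon> :: real assume \<epsilon>: "0 < \<epsilon>"
  obtain K \<eta> where \<eta>: "\<eta> > 0" and close: "\<And>m \<gamma>. m \<ge> K \<Longrightarrow> def_dom (Suc m) \<gamma> \<Longrightarrow>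
      (\<forall>i<K. cmod (\<gamma> i - gamma_d d) < \<eta>) \<Longrightarrow>
      dst (spectral_measure (GGT (Suc m) (verb_of_def \<gamma>)) (unit_vec (Suc m) 0)) (mu_d d) \<le> \<epsilon>"
    using dist_small_if_deformed_near[OF dst d \<epsilon>] by metis
  define B where "B = {z. \<eta> \<le> cmod (z - gamma_d d)}"
  have B: "B \<in> sets borel" unfolding B_def by measurable
  define q where "q n k = (\<integral>\<^sup>+z. ennreal (hw (\<delta> n) z) * indicator B z \<partial>CJ_nu n \<beta> k)
      / (\<integral>\<^sup>+z. ennreal (hw (\<delta> n) z) \<partial>CJ_nu n \<beta> k)" for n k
  have \<delta>: "\<delta> n = of_real (\<beta> / 2) * of_nat n * d" for n by (simp add: assms(2,4))
  have "(\<lambda>n. q n k) \<longlonglongrightarrow> 0" for k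
    unfolding q_def B_def \<delta> by (rule concentration[OF d \<beta> \<eta>])
  then have q: "(\<lambda>n. \<Sum>k<K. q n k) \<longlonglongrightarrow> (\<Sum>k<K. 0)" by (intro tendsto_sum)
  let ?E = "\<lambda>n. {\<omega> \<in> space (M n). \<epsilon> < dst (spectral_measure (U n \<omega>) (unit_vec n 0)) (mu_d d)}"
  have bound: "ennreal (measure (M n) (?E n)) \<le> (\<Sum>k<K. q n k)" if n: "n \<ge> Suc K" for n
  proof -
    obtain m where m: "n = Suc m" "m \<ge> K" using n by (cases n) auto
    have n1: "n \<ge> 1" using n by simp
    interpret prob_space "M n" by (rule assms(5)[OF n1])
    define A where "A = {A \<in> space (mat_borel n). \<epsilon> < dst (spectral_measure A (unit_vec n 0)) (mu_d d)}"
    have "(\<lambda>A. dst (spectral_measure A (unit_vec n 0)) (mu_d d)) \<in> borel_measurable (mat_borel n)"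
      using dm n1 by simp
    then have A: "A \<in> sets (mat_borel n)" unfolding A_def by measurable
    have U: "U n -` space (mat_borel n) \<inter> space (M n) = space (M n)"
      using measurable_space[OF assms(6)[OF n1]] by blast
    have "emeasure (distr (M n) (mat_borel n) (U n)) (space (mat_borel n)) = 1"
      unfolding emeasure_distr[OF assms(6)[OF n1] sets.top] U by (rule emeasure_space_1)
    then have "emeasure (CJ n (\<delta> n) \<beta>) (carrier_mat n n) = 1"
      unfolding assms(7)[OF n1] space_mat_borel .
    then have pr: "emeasure (CJ (Suc m) (\<delta> n) \<beta>) (carrier_mat (Suc m) (Suc m)) = 1" by (simp add: m)
    have "U n -` A \<inter> space (M n) = ?E n"
      using measurable_space[OF assms(6)[OF n1]] by (auto simp: A_def)
    then have "emeasure (M n) (?E n) = emeasure (CJ n (\<delta> n) \<beta>) A"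
      unfolding assms(7)[OF n1, symmetric] by (subst emeasure_distr[OF assms(6)[OF n1] A]) simp
    also have "\<dots> \<le> (\<Sum>k<K. q n k)"
      unfolding q_def m
    proof (rule CJ_union_bound[OF \<beta> pr[unfolded m] A[unfolded m] B])
      show "{..<K} \<subseteq> {..<Suc m}" using m by auto
      fix \<gamma> assume \<gamma>: "def_dom (Suc m) \<gamma>" "GGT (Suc m) (verb_of_def \<gamma>) \<in> A"
      then have "\<not> (\<forall>i<K. cmod (\<gamma> i - gamma_d d) < \<eta>)"
        using close[OF m(2) \<gamma>(1)] by (auto simp: A_def m)
      then show "\<exists>k\<in>{..<K}. \<gamma> k \<in> B" by (auto simp: B_def not_less)
    qed
    finally show ?thesis by (simp add: emeasure_eq_measure)
  qed
  have "(\<lambda>n. ennreal (measure (M n) (?E n))) \<longlonglongrightarrow> ennreal 0"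
  proof (rule tendsto_sandwich[OF _ _ tendsto_const])
    show "\<forall>\<^sub>F n in sequentially. ennreal 0 \<le> ennreal (measure (M n) (?E n))" by simp
    show "\<forall>\<^sub>F n in sequentially. ennreal (measure (M n) (?E n)) \<le> (\<Sum>k<K. q n k)"
      using bound by (intro eventually_sequentiallyI[of "Suc K"])
    show "(\<lambda>n. \<Sum>k<K. q n k) \<longlonglongrightarrow> ennreal 0" using q by simp
  qed
  then show "(\<lambda>n. measure (M n) (?E n)) \<longlonglongrightarrow> 0"
    by (subst (asm) tendsto_ennreal_iff) auto
qed

end
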